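(* Let $N$ be a compact submanifold of a Finsler manifold $(M,F)$ (no completeness is assumed). Then the forward injectivity radius $\mathrm{Inj}^{+}(N)$ is positive, and consequently $d(N,\mathrm{Cu}(N)) > 0$.
   Context: All manifolds are smooth, connected and without boundary. Compact submanifolds are embedded. A Finsler metric on $M$ is a continuous function $F : TM \to \mathbb{R}$, smooth on $TM$ minus the zero section, such that for each $p \in M$ the restriction $F_p = F|_{T_pM}$ satisfies $F_p(\lambda \mathbf{v}) = \lambda F_p(\mathbf{v})$ for all $\lambda > 0$ and $\mathbf{v} \ne 0$, and for each $\mathbf{v} \in T_pM \setminus \{0\}$ the fundamental tensor $g_{\mathbf{v}}(\mathbf{v}_1, \mathbf{v}_2) = \frac12 \frac{\partial^2}{\partial s_1 \partial s_2}\big|_{s_1=s_2=0} F_p(\mathbf{v} + s_1\mathbf{v}_1 + s_2\mathbf{v}_2)^2$ is positive definite. $F$ need not be reversible. The length of a piecewise smooth curve $\gamma:[a,b]\to M$ is $L(\gamma) = \int_a^b F(\dot\gamma)\,dt$, its energy is $E(\gamma) = \frac12 \int_a^b F(\dot\gamma)^2 dt$; $d(N,q)$ is the infimum of lengths of piecewise smooth curves starting at a point of $N$ and ending at $q$, and $d(N,A) = \inf_{q\in A} d(N,q)$ for $A \subset M$ (with $\inf\emptyset = \infty$). Geodesics are critical points of $E$ (with fixed end points). $\exp : \mathcal{O} \subset TM \to M$, $\exp(\mathbf{v}) = \gamma_{\mathbf{v}}(1)$, where $\gamma_{\mathbf{v}}$ is the geodesic with initial velocity $\mathbf{v}$ and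 $\mathcal{O}$ is the maximal open neighborhood of the zero section where this is defined. Geodesics are considered only where they are defined. For $p \in N$ the normal cone is $\nu_p = \{\mathbf{v} \in T_pM \setminus \{0\} : g_{\mathbf{v}}(\mathbf{v},\mathbf{w}) = 0 \ \forall \mathbf{w} \in T_pN\} \cup \{0\}$; $\nu = \nu(N) = \bigcup_{p \in N} \nu_p$, and $S(\nu) = \{\mathbf{v} \in \nu : F(\mathbf{v}) = 1\}$. The normal exponential map $\exp^\nu$ is the restriction of $\exp$ to $\nu$ (where defined). An $N$-geodesic is a critical point of $E$ restricted to curves starting on $N$ (with fixed end point); the unit-speed $N$-geodesics are the curves $\gamma_{\mathbf{v}}(t) = \exp^\nu(t\mathbf{v})$ with $\mathbf{v} \in S(\nu)$. An $N$-segment is a unit-speed $N$-geodesic $\gamma : [a,b] \to M$ with $d(N,\gamma(b)) = b-a = L(\gamma)$; it is said to join $N$ to $\gamma(b)$. The cut locus $\mathrm{Cu}(N)$ is the set of points $q \in M$ such that there is an $N$-segment joining $N$ to $q$, any extension of which fails to be an $N$-segment. For $\mathbf{v} \in S(\nu)$ the cut time is $\rho(\mathbf{v}) = \sup\{t : d(N,\gamma_{\mathbf{v}}(t)) = t\} \in [0,\infty]$. Every $x \in \mathrm{Cu}(N)$ is of the form $x = \exp^\nu(\rho(\mathbf{v})\mathbf{v})$ for some $\mathbf{v} \in S(\nu)$ with $\rho(\mathbf{v}) < \infty$; here $\rho(\mathbf{v}) = 0$ (a degenerate $N$-segment of length $0$) is not excluded a priori. The forward injectivity radius of $N$ is $\mathrm{Inj}^{+}(N)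 = \inf_{\mathbf{v} \in S(\nu)} \rho(\mathbf{v})$.
   Formalization: The Finsler metric is additionally assumed nonnegative (F ≥ 0), since F(v)=v on the circle meets the stated conditions but has d = −∞ and no positive cut time; the manifold M is taken to have dimension at least 1. *)

theory Defs
  imports "HOL-Analysis.Analysis"
begin

section \<open>Smooth maps between normed spaces\<close>

fun Ck_on :: "nat \<Rightarrow> 'a::real_normed_vector set \<Rightarrow> ('a \<Rightarrow> 'b::real_normed_vector) \<Rightarrow> bool" where
  "Ck_on 0 S f \<longleftrightarrow> continuous_on S f"
| "Ck_on (Suc k) S f \<longleftrightarrow>
     (\<forall>x\<in>S. f differentiable (at x)) \<and> (\<forall>v. Ck_on k S (\<lambda>x. frechet_derivative f (at x) v))"

text \<open>Only meant for open sets \<open>S\<close>.\<close>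

definition Cinf_on :: "'a::real_normed_vector set \<Rightarrow> ('a \<Rightarrow> 'b::real_normed_vector) \<Rightarrow> bool" where
  "Cinf_on S f \<longleftrightarrow> (\<forall>k. Ck_on k S f)"


section \<open>Smooth manifolds\<close>

text \<open>
  The points of the manifold are the elements of the type \<open>'m\<close>, whose topology is the manifold
  topology; the model space is a Euclidean space \<open>'e\<close>. A chart is a domain together with a
  coordinate map, whose values outside the domain are irrelevant.
\<close>

type_synonym ('m, 'e) chart = "'m set \<times> ('m \<Rightarrow> 'e)"

definition is_chart :: "('m::topological_space, 'e::euclidean_space) chart \<Rightarrow> bool" where
  "is_chart c \<longleftrightarrow> open (fst c) \<and> open (snd c ` fst c) \<and>
     homeomorphism (fst c) (snd c ` fst c) (snd c) (inv_into (fst c) (snd c))"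

definition smooth_transition ::
    "('m::topological_space, 'e::euclidean_space) chart \<Rightarrow> ('m, 'e) chart \<Rightarrow> bool" where
  "smooth_transition c c' \<longleftrightarrow>
     Cinf_on (snd c ` (fst c \<inter> fst c')) (snd c' \<circ> inv_into (fst c) (snd c))"

definition smooth_atlas :: "('m::topological_space, 'e::euclidean_space) chart set \<Rightarrow> bool" where
  "smooth_atlas A \<longleftrightarrow> (\<forall>c\<in>A. is_chart c) \<and> (\<Union>c\<in>A. fst c) = UNIV \<and>
     (\<forall>c\<in>A. \<forall>c'\<in>A. smooth_transition c c')"

definition maximal_atlas ::
    "('m::topological_space, 'e::euclidean_space) chart set \<Rightarrow> ('m, 'e) chart set" where
  "maximal_atlas A =
     {c. is_chart c \<and> (\<forall>c'\<in>A. smooth_transition c c' \<and> smooth_transition c' c)}"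

definition smooth_manifold ::
    "('m::{t2_space, second_countable_topology}, 'e::euclidean_space) chart set \<Rightarrow> bool" where
  "smooth_manifold A \<longleftrightarrow> smooth_atlas A \<and> connected (UNIV :: 'm set)"

text \<open>
  Smoothness of a map into the manifold on an arbitrary subset \<open>X\<close> of a normed space: locally, the
  map read in a chart is the restriction of a smooth map on an open set.
\<close>

definition smooth_into :: "('m::topological_space, 'e::euclidean_space) chart set \<Rightarrow>
    'a::real_normed_vector set \<Rightarrow> ('a \<Rightarrow> 'm) \<Rightarrow> bool" where
  "smooth_into A X f \<longleftrightarrow> (\<forall>x\<in>X. \<exists>c\<in>A. \<exists>W g. open W \<and> x \<in> W \<and> f ` (X \<inter> W) \<subseteq> fst c \<and>
     Cinf_on W g \<and> (\<forall>y\<in>X \<inter> W. snd c (f y) = g y))"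

text \<open>
  Every point \<open>p\<close> gets a preferred chart, and a tangent vector at \<open>p\<close> is represented by its
  coordinates in that chart. Hence every tangent space is the vector space \<open>'e\<close>, and the tangent
  bundle is \<open>'m \<times> 'e\<close> as a set. Its topology and smooth structure are not the product ones: they
  are given by the bundle charts of the atlas, see \<open>from_chart\<close> and \<open>in_chart\<close>.
\<close>

definition chart_at :: "('m, 'e) chart set \<Rightarrow> 'm \<Rightarrow> ('m, 'e) chart" where
  "chart_at A p = (SOME c. c \<in> A \<and> p \<in> fst c)"

text \<open>The tangent vector at the point \<open>c\<^sup>-\<^sup>1(x)\<close> whose coordinates in the chart \<open>c\<close> are \<open>u\<close>.\<close>

definition from_chart :: "('m::topological_space, 'e::euclidean_space) chart set \<Rightarrow>
    ('m, 'e) chart \<Rightarrow> 'e \<times> 'e \<Rightarrow> 'm \<times> 'e" where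
  "from_chart A c = (\<lambda>(x, u). let p = inv_into (fst c) (snd c) x in
     (p, frechet_derivative (snd (chart_at A p) \<circ> inv_into (fst c) (snd c)) (at x) u))"

definition in_chart :: "('m::topological_space, 'e::euclidean_space) chart set \<Rightarrow>
    ('m \<Rightarrow> 'e \<Rightarrow> real) \<Rightarrow> ('m, 'e) chart \<Rightarrow> 'e \<times> 'e \<Rightarrow> real" where
  "in_chart A F c = (\<lambda>z. case from_chart A c z of (p, v) \<Rightarrow> F p v)"

definition has_velocity :: "('m::topological_space, 'e::euclidean_space) chart set \<Rightarrow>
    (real \<Rightarrow> 'm) \<Rightarrow> real set \<Rightarrow> real \<Rightarrow> 'e \<Rightarrow> bool" where
  "has_velocity A \<gamma> I t v \<longleftrightarrow>
     ((\<lambda>s. snd (chart_at A (\<gamma> t)) (\<gamma> s)) has_vector_derivative v) (at t within I)"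

definition velocity :: "('m::topological_space, 'e::euclidean_space) chart set \<Rightarrow>
    (real \<Rightarrow> 'm) \<Rightarrow> real set \<Rightarrow> real \<Rightarrow> 'e" where
  "velocity A \<gamma> I t = vector_derivative (\<lambda>s. snd (chart_at A (\<gamma> t)) (\<gamma> s)) (at t within I)"


section \<open>Compact embedded submanifolds\<close>

text \<open>Manifolds are nonempty and connected, so this also applies to submanifolds.\<close>

definition compact_submanifold ::
    "('m::{t2_space, second_countable_topology}, 'e::euclidean_space) chart set \<Rightarrow> 'm set \<Rightarrow> bool" where
  "compact_submanifold A N \<longleftrightarrow> compact N \<and> connected N \<and> N \<noteq> {} \<and>
     (\<exists>k. \<forall>p\<in>N. \<exists>c\<in>maximal_atlas A. \<exists>S. subspace S \<and> dim S = k \<and> p \<in> fst c \<and>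
        snd c ` (fst c \<inter> N) = snd c ` fst c \<inter> S)"

definition tangent_space :: "('m::topological_space, 'e::euclidean_space) chart set \<Rightarrow>
    'm set \<Rightarrow> 'm \<Rightarrow> 'e set" where
  "tangent_space A N p = {w. \<exists>e>0. \<exists>\<gamma>. smooth_into A {-e<..<e} \<gamma> \<and> \<gamma> ` {-e<..<e} \<subseteq> N \<and>
     \<gamma> 0 = p \<and> has_velocity A \<gamma> {-e<..<e} 0 w}"


section \<open>Finsler metrics\<close>

definition fundamental_tensor :: "('m \<Rightarrow> 'e::real_vector \<Rightarrow> real) \<Rightarrow> 'm \<Rightarrow> 'e \<Rightarrow> 'e \<Rightarrow> 'e \<Rightarrow> real" where
  "fundamental_tensor F p v v1 v2 =
     deriv (\<lambda>s1. deriv (\<lambda>s2. (F p (v + s1 *\<^sub>R v1 + s2 *\<^sub>R v2))\<^sup>2) 0) 0 / 2"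

text \<open>
  Nonnegativity is part of the usual convention. It follows neither from homogeneity nor from the
  positivity of the fundamental tensor, as both are also satisfied by \<open>F(v) = v\<close> on the circle.
\<close>

definition finsler_metric :: "('m::{t2_space, second_countable_topology}, 'e::euclidean_space) chart set \<Rightarrow>
    ('m \<Rightarrow> 'e \<Rightarrow> real) \<Rightarrow> bool" where
  "finsler_metric A F \<longleftrightarrow>
     (\<forall>c\<in>A. continuous_on (snd c ` fst c \<times> UNIV) (in_chart A F c)) \<and>
     (\<forall>c\<in>A. Cinf_on (snd c ` fst c \<times> (UNIV - {0})) (in_chart A F c)) \<and>
     (\<forall>p v. 0 \<le> F p v) \<and>
     (\<forall>p v r. 0 < r \<longrightarrow> v \<noteq> 0 \<longrightarrow> F p (r *\<^sub>R v) = r * F p v) \<and>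
     (\<forall>p v w. v \<noteq> 0 \<longrightarrow> w \<noteq> 0 \<longrightarrow> 0 < fundamental_tensor F p v w w)"


section \<open>Length, energy and distance\<close>

text \<open>A finite set of break points including the end points; pieces lie between neighbours.\<close>

definition breaks :: "real set \<Rightarrow> real \<Rightarrow> real \<Rightarrow> bool" where
  "breaks P a b \<longleftrightarrow> finite P \<and> {a, b} \<subseteq> P \<and> P \<subseteq> {a..b}"

definition piece :: "real set \<Rightarrow> real \<Rightarrow> real \<Rightarrow> bool" where
  "piece P s t \<longleftrightarrow> s \<in> P \<and> t \<in> P \<and> s < t \<and> P \<inter> {s<..<t} = {}"

definition piecewise_smooth :: "('m::topological_space, 'e::euclidean_space) chart set \<Rightarrow>
    (real \<Rightarrow> 'm) \<Rightarrow> real \<Rightarrow> real \<Rightarrow> bool" where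
  "piecewise_smooth A \<gamma> a b \<longleftrightarrow> a \<le> b \<and>
     (\<exists>P. breaks P a b \<and> (\<forall>s t. piece P s t \<longrightarrow> smooth_into A {s..t} \<gamma>))"

definition curve_length :: "('m::topological_space, 'e::euclidean_space) chart set \<Rightarrow>
    ('m \<Rightarrow> 'e \<Rightarrow> real) \<Rightarrow> (real \<Rightarrow> 'm) \<Rightarrow> real \<Rightarrow> real \<Rightarrow> real" where
  "curve_length A F \<gamma> a b = integral {a..b} (\<lambda>t. F (\<gamma> t) (velocity A \<gamma> {a..b} t))"

definition energy :: "('m::topological_space, 'e::euclidean_space) chart set \<Rightarrow>
    ('m \<Rightarrow> 'e \<Rightarrow> real) \<Rightarrow> (real \<Rightarrow> 'm) \<Rightarrow> real \<Rightarrow> real \<Rightarrow> real" where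
  "energy A F \<gamma> a b = integral {a..b} (\<lambda>t. (F (\<gamma> t) (velocity A \<gamma> {a..b} t))\<^sup>2) / 2"

definition dist_from :: "('m::topological_space, 'e::euclidean_space) chart set \<Rightarrow>
    ('m \<Rightarrow> 'e \<Rightarrow> real) \<Rightarrow> 'm set \<Rightarrow> 'm \<Rightarrow> ereal" where
  "dist_from A F N q = Inf {ereal (curve_length A F \<gamma> a b) | \<gamma> a b.
     piecewise_smooth A \<gamma> a b \<and> \<gamma> a \<in> N \<and> \<gamma> b = q}"

definition dist_from_set :: "('m::topological_space, 'e::euclidean_space) chart set \<Rightarrow>
    ('m \<Rightarrow> 'e \<Rightarrow> real) \<Rightarrow> 'm set \<Rightarrow> 'm set \<Rightarrow> ereal" where
  "dist_from_set A F N B = (INF q\<in>B. dist_from A F N q)"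


section \<open>Geodesics and the exponential map\<close>

text \<open>Piecewise smooth variations \<open>\<Gamma>(s, t)\<close> of the curve \<open>\<gamma>\<close>, with parameter \<open>s \<in> (-e, e)\<close>.\<close>

definition variation :: "('m::topological_space, 'e::euclidean_space) chart set \<Rightarrow>
    (real \<Rightarrow> 'm) \<Rightarrow> real \<Rightarrow> real \<Rightarrow> real \<Rightarrow> (real \<times> real \<Rightarrow> 'm) \<Rightarrow> bool" where
  "variation A \<gamma> a b e \<Gamma> \<longleftrightarrow> 0 < e \<and> (\<forall>t\<in>{a..b}. \<Gamma> (0, t) = \<gamma> t) \<and>
     (\<exists>P. breaks P a b \<and> (\<forall>s t. piece P s t \<longrightarrow> smooth_into A ({-e<..<e} \<times> {s..t}) \<Gamma>))"

definition geodesic :: "('m::topological_space, 'e::euclidean_space) chart set \<Rightarrow>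
    ('m \<Rightarrow> 'e \<Rightarrow> real) \<Rightarrow> (real \<Rightarrow> 'm) \<Rightarrow> real \<Rightarrow> real \<Rightarrow> bool" where
  "geodesic A F \<gamma> a b \<longleftrightarrow> a < b \<and> piecewise_smooth A \<gamma> a b \<and>
     (\<forall>e \<Gamma>. variation A \<gamma> a b e \<Gamma> \<and> (\<forall>s\<in>{-e<..<e}. \<Gamma> (s, a) = \<gamma> a \<and> \<Gamma> (s, b) = \<gamma> b) \<longrightarrow>
        ((\<lambda>s. energy A F (\<lambda>t. \<Gamma> (s, t)) a b) has_real_derivative 0) (at 0))"

definition N_geodesic :: "('m::topological_space, 'e::euclidean_space) chart set \<Rightarrow>
    ('m \<Rightarrow> 'e \<Rightarrow> real) \<Rightarrow> 'm set \<Rightarrow> (real \<Rightarrow> 'm) \<Rightarrow> real \<Rightarrow> real \<Rightarrow> bool" where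
  "N_geodesic A F N \<gamma> a b \<longleftrightarrow> a < b \<and> piecewise_smooth A \<gamma> a b \<and> \<gamma> a \<in> N \<and>
     (\<forall>e \<Gamma>. variation A \<gamma> a b e \<Gamma> \<and> (\<forall>s\<in>{-e<..<e}. \<Gamma> (s, a) \<in> N \<and> \<Gamma> (s, b) = \<gamma> b) \<longrightarrow>
        ((\<lambda>s. energy A F (\<lambda>t. \<Gamma> (s, t)) a b) has_real_derivative 0) (at 0))"

definition geodesic_from :: "('m::topological_space, 'e::euclidean_space) chart set \<Rightarrow>
    ('m \<Rightarrow> 'e \<Rightarrow> real) \<Rightarrow> 'm \<times> 'e \<Rightarrow> (real \<Rightarrow> 'm) \<Rightarrow> bool" where
  "geodesic_from A F = (\<lambda>(p, v) \<gamma>.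
     geodesic A F \<gamma> 0 1 \<and> \<gamma> 0 = p \<and> has_velocity A \<gamma> {0..1} 0 v)"

text \<open>
  The set of all initial velocities whose geodesic is defined on \<open>[0, 1]\<close>; by the dependence of
  geodesics on initial data it is an open neighbourhood of the zero section, and it is the largest
  set on which the exponential map makes sense.
\<close>

definition exp_dom :: "('m::topological_space, 'e::euclidean_space) chart set \<Rightarrow>
    ('m \<Rightarrow> 'e \<Rightarrow> real) \<Rightarrow> ('m \<times> 'e) set" where
  "exp_dom A F = {z. \<exists>\<gamma>. geodesic_from A F z \<gamma>}"

definition exp_map :: "('m::topological_space, 'e::euclidean_space) chart set \<Rightarrow>
    ('m \<Rightarrow> 'e \<Rightarrow> real) \<Rightarrow> 'm \<times> 'e \<Rightarrow> 'm" where
  "exp_map A F z = (THE q. \<exists>\<gamma>. geodesic_from A F z \<gamma> \<and> \<gamma> 1 = q)"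


section \<open>Normal cone, cut locus and injectivity radius\<close>

definition normal_cone :: "('m::topological_space, 'e::euclidean_space) chart set \<Rightarrow>
    ('m \<Rightarrow> 'e \<Rightarrow> real) \<Rightarrow> 'm set \<Rightarrow> ('m \<times> 'e) set" where
  "normal_cone A F N = {(p, v). p \<in> N \<and>
     (v = 0 \<or> (\<forall>w\<in>tangent_space A N p. fundamental_tensor F p v v w = 0))}"

definition unit_normal_cone :: "('m::topological_space, 'e::euclidean_space) chart set \<Rightarrow>
    ('m \<Rightarrow> 'e \<Rightarrow> real) \<Rightarrow> 'm set \<Rightarrow> ('m \<times> 'e) set" where
  "unit_normal_cone A F N = {(p, v) \<in> normal_cone A F N. F p v = 1}"

text \<open>
  A curve on \<open>[a, a]\<close> is a single point and does not determine its velocity. It counts as a unit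
  speed \<open>N\<close>-geodesic if it is the restriction of some \<open>t \<mapsto> exp\<^sup>\<nu>((t - a) v)\<close>, \<open>v\<close> a unit
  normal vector; in particular, there are no such degenerate geodesics if \<open>N\<close> is the whole manifold.
\<close>

definition unit_speed_N_geodesic :: "('m::topological_space, 'e::euclidean_space) chart set \<Rightarrow>
    ('m \<Rightarrow> 'e \<Rightarrow> real) \<Rightarrow> 'm set \<Rightarrow> (real \<Rightarrow> 'm) \<Rightarrow> real \<Rightarrow> real \<Rightarrow> bool" where
  "unit_speed_N_geodesic A F N \<gamma> a b \<longleftrightarrow>
     (N_geodesic A F N \<gamma> a b \<and> (\<forall>t\<in>{a..b}. \<exists>v. has_velocity A \<gamma> {a..b} t v \<and> F (\<gamma> t) v = 1)) \<or>
     (a = b \<and> (\<exists>v. (\<gamma> a, v) \<in> unit_normal_cone A F N))"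

definition N_segment :: "('m::topological_space, 'e::euclidean_space) chart set \<Rightarrow>
    ('m \<Rightarrow> 'e \<Rightarrow> real) \<Rightarrow> 'm set \<Rightarrow> (real \<Rightarrow> 'm) \<Rightarrow> real \<Rightarrow> real \<Rightarrow> bool" where
  "N_segment A F N \<gamma> a b \<longleftrightarrow> unit_speed_N_geodesic A F N \<gamma> a b \<and>
     dist_from A F N (\<gamma> b) = ereal (b - a) \<and> curve_length A F \<gamma> a b = b - a"

definition cut_locus :: "('m::topological_space, 'e::euclidean_space) chart set \<Rightarrow>
    ('m \<Rightarrow> 'e \<Rightarrow> real) \<Rightarrow> 'm set \<Rightarrow> 'm set" where
  "cut_locus A F N = {q. \<exists>\<gamma> a b. N_segment A F N \<gamma> a b \<and> \<gamma> b = q \<and>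
     (\<forall>\<gamma>' a' b'. {a..b} \<subset> {a'..b'} \<and> (\<forall>t\<in>{a..b}. \<gamma>' t = \<gamma> t) \<longrightarrow> \<not> N_segment A F N \<gamma>' a' b')}"

definition cut_time :: "('m::topological_space, 'e::euclidean_space) chart set \<Rightarrow>
    ('m \<Rightarrow> 'e \<Rightarrow> real) \<Rightarrow> 'm set \<Rightarrow> 'm \<times> 'e \<Rightarrow> ereal" where
  "cut_time A F N = (\<lambda>(p, v). Sup {ereal t | t. 0 \<le> t \<and> (p, t *\<^sub>R v) \<in> exp_dom A F \<and>
     dist_from A F N (exp_map A F (p, t *\<^sub>R v)) = ereal t})"

definition forward_inj_radius :: "('m::topological_space, 'e::euclidean_space) chart set \<Rightarrow>
    ('m \<Rightarrow> 'e \<Rightarrow> real) \<Rightarrow> 'm set \<Rightarrow> ereal" where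
  "forward_inj_radius A F N = (INF z\<in>unit_normal_cone A F N. cut_time A F N z)"

end

theory Submission
  imports Defs
begin

text \<open>Work in a chart around a point of \<open>N\<close> in which \<open>N\<close> is a linear subspace, and let
  \<open>L = F\<^sup>2 / 2\<close>. On a compact set of base points \<open>L\<close> is uniformly strongly convex in the velocity and
  Lipschitz together with its momenta. For a short geodesic \<open>x\<close> leaving \<open>N\<close> normally, integrating the
  convexity inequality along a competitor \<open>y\<close> from \<open>N\<close> to the end point of \<open>x\<close>, and integrating
  by parts with the Euler-Lagrange equation, shows that the competitor is at least as long: normality
  kills the boundary term, and the error terms, quadratic in \<open>y - x\<close>, are absorbed for short times.
  No Gauss lemma and no smoothness of the exponential map near the zero section is needed. Compactness of
  \<open>N\<close> makes the length scale \<open>\<epsilon>\<close> uniform, so \<open>\<rho> \<ge> \<epsilon>\<close>; moreover every \<open>N\<close>-segment shorter than \<open>\<epsilon>\<close>,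
  degenerate ones included, extends, so a cut point has distance at least \<open>\<epsilon>\<close> from \<open>N\<close>.\<close>

text \<open>Two obstacles shape the proof. The function \<open>L\<close> is in general only once
  differentiable on the zero section, yet a competitor may stand still, so its velocity can vanish;
  second order Taylor expansion is therefore replaced by estimates that come from homogeneity and
  hold for all velocities, zero included. Moreover a competitor comes with an arbitrary
  parametrization, and one that stands still cannot be parametrized by arc length; so the geodesic
  is adapted to the competitor and not conversely, and the resulting inequality is divided by the
  speed, which turns a comparison of energies into one of lengths. Finally, geodesics are critical
  points among piecewise smooth curves, and \<open>exp_map\<close> is a definite description. Hence
  a solution of the Euler-Lagrange equation counts only once it is shown to be critical and to be
  the only critical curve with its initial velocity. Uniqueness is proved on the level of momenta,
  from the monotonicity of \<open>Lv\<close>, which avoids showing first that critical curves are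
  smooth.\<close>

section \<open>Calculus of C^k and smooth maps\<close>

lemma frechet_derivative_cong_open:
  assumes "open S" "x \<in> S" "\<And>y. y \<in> S \<Longrightarrow> f y = g y"
  shows "frechet_derivative f (at x) = frechet_derivative g (at x)"
proof -
  have "(f has_derivative D) (at x) \<longleftrightarrow> (g has_derivative D) (at x)" for D
    using assms has_derivative_transform_within_open[of _ D x UNIV S] by metis
  then show ?thesis by (simp add: frechet_derivative_def)
qed

lemma Ck_on_imp_continuous_on: "Ck_on k S f \<Longrightarrow> continuous_on S f"
  by (cases k) (auto intro: continuous_at_imp_continuous_on differentiable_imp_continuous_within)

lemma Ck_on_Suc_imp: "Ck_on (Suc k) S f \<Longrightarrow> Ck_on k S f"
proof (induction k arbitrary: f)
  case 0 then show ?case using Ck_on_imp_continuous_on by (metis Ck_on.simps(1))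
next
  case (Suc k) then show ?case by (metis Ck_on.simps(2))
qed

lemma Ck_on_subset: "Ck_on k S f \<Longrightarrow> T \<subseteq> S \<Longrightarrow> Ck_on k T f"
  by (induction k arbitrary: f) (auto intro: continuous_on_subset)

lemma Ck_on_cong:
  assumes "open S" "\<And>x. x \<in> S \<Longrightarrow> f x = g x" "Ck_on k S f"
  shows "Ck_on k S g"
  using assms(2,3)
proof (induction k arbitrary: f g)
  case 0 then show ?case using continuous_on_cong[of S S f g] by simp
next
  case (Suc k)
  have "g differentiable at x" if "x \<in> S" for x
    using Suc.prems that has_derivative_transform_within_open[OF _ assms(1) that, of f]
    by (simp add: differentiable_def) blast
  moreover have "Ck_on k S (\<lambda>x. frechet_derivative g (at x) v)" for v
  proof (rule Suc.IH)
    show "Ck_on k S (\<lambda>x. frechet_derivative f (at x) v)" using Suc.prems by simp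
    show "frechet_derivative f (at x) v = frechet_derivative g (at x) v" if "x \<in> S" for x
      using frechet_derivative_cong_open[OF assms(1) that, of f g] Suc.prems(1) by simp
  qed
  ultimately show ?case by simp
qed

text \<open>Uniqueness of derivatives lets an explicit formula replace the choice made by
  \<open>frechet_derivative\<close>; the closure properties below use this in the inductive step on
  \<open>k\<close>.\<close>

lemma Ck_on_SucI:
  assumes "open S" "\<And>x. x \<in> S \<Longrightarrow> (f has_derivative f' x) (at x)"
    and "\<And>v. Ck_on k S (\<lambda>x. f' x v)"
  shows "Ck_on (Suc k) S f"
proof -
  have "Ck_on k S (\<lambda>x. frechet_derivative f (at x) v)" for v
    by (rule Ck_on_cong[OF assms(1) _ assms(3)[of v]]) (simp add: frechet_derivative_at[OF assms(2), symmetric])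
  then show ?thesis using assms(2) by (auto simp: differentiable_def)
qed

lemma Ck_on_SucD:
  assumes "Ck_on (Suc k) S f" "x \<in> S"
  shows "(f has_derivative frechet_derivative f (at x)) (at x)"
  using assms by (simp add: frechet_derivative_works)

lemma Ck_on_const: "open S \<Longrightarrow> Ck_on k S (\<lambda>x. c)"
proof (induction k arbitrary: c)
  case (Suc k) show ?case
    by (rule Ck_on_SucI[where f' = "\<lambda>x v. 0"]) (use Suc in auto)
qed auto

lemma Ck_on_bounded_linear:
  assumes "bounded_linear T" "open S" "Ck_on k S f"
  shows "Ck_on k S (\<lambda>x. T (f x))"
  using assms(3)
proof (induction k arbitrary: f)
  case 0 then show ?case by (simp add: bounded_linear.continuous_on[OF assms(1)])
next
  case (Suc k)
  show ?case
    by (rule Ck_on_SucI[where f' = "\<lambda>x v. T (frechet_derivative f (at x) v)"])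
      (use Suc assms Ck_on_SucD[OF Suc.prems] in \<open>auto intro!: bounded_linear.has_derivative[OF assms(1)]\<close>)
qed

lemma Ck_on_id: "open S \<Longrightarrow> Ck_on k S (\<lambda>x. x)"
proof (induction k)
  case (Suc k) show ?case
    by (rule Ck_on_SucI[where f' = "\<lambda>x v. v"]) (use Suc Ck_on_const in auto)
qed auto

lemma Ck_on_linear: "bounded_linear T \<Longrightarrow> open S \<Longrightarrow> Ck_on k S T"
  using Ck_on_bounded_linear[OF _ _ Ck_on_id] by blast

lemma Ck_on_add:
  assumes "open S" "Ck_on k S f" "Ck_on k S g"
  shows "Ck_on k S (\<lambda>x. f x + g x)"
  using assms(2,3)
proof (induction k arbitrary: f g)
  case 0 then show ?case by (simp add: continuous_on_add)
next
  case (Suc k)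
  show ?case
    by (rule Ck_on_SucI[where f' = "\<lambda>x v. frechet_derivative f (at x) v + frechet_derivative g (at x) v"])
      (use Suc assms Ck_on_SucD[OF Suc.prems(1)] Ck_on_SucD[OF Suc.prems(2)]
       in \<open>auto intro!: has_derivative_add\<close>)
qed

lemma Ck_on_sum:
  assumes "open S" "\<And>i. i \<in> I \<Longrightarrow> Ck_on k S (f i)"
  shows "Ck_on k S (\<lambda>x. \<Sum>i\<in>I. f i x)"
  using assms(2)
  by (induction I rule: infinite_finite_induct) (auto intro: Ck_on_const Ck_on_add assms(1))

lemma Ck_on_bilinear:
  assumes B: "bounded_bilinear B" and "open S" "Ck_on k S f" "Ck_on k S g"
  shows "Ck_on k S (\<lambda>x. B (f x) (g x))"
  using assms(3,4)
proof (induction k arbitrary: f g)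
  case 0 then show ?case by (simp add: bounded_bilinear.continuous_on[OF B])
next
  case (Suc k)
  show ?case
  proof (rule Ck_on_SucI[where f' = "\<lambda>x v. B (f x) (frechet_derivative g (at x) v) + B (frechet_derivative f (at x) v) (g x)"])
    show "((\<lambda>x. B (f x) (g x)) has_derivative (\<lambda>v. B (f x) (frechet_derivative g (at x) v) +
         B (frechet_derivative f (at x) v) (g x))) (at x)" if "x \<in> S" for x
      by (rule bounded_bilinear.FDERIV[OF B]) (use Ck_on_SucD[OF Suc.prems(1)] Ck_on_SucD[OF Suc.prems(2)] that in auto)
    show "Ck_on k S (\<lambda>x. B (f x) (frechet_derivative g (at x) v) + B (frechet_derivative f (at x) v) (g x))" for v
      using Suc.prems Ck_on_Suc_imp[OF Suc.prems(1)] Ck_on_Suc_imp[OF Suc.prems(2)]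
      by (intro Ck_on_add Suc.IH assms(2)) auto
  qed (rule assms)
qed

text \<open>\<open>Ck_on\<close> speaks of derivatives in fixed directions only. The direction in
  which \<open>g\<close> is differentiated moves with \<open>x\<close>, so the chain rule is
  expanded in a basis of the middle space; the derivative becomes a sum of products to which the
  induction hypothesis applies.\<close>

lemma Ck_on_compose:
  fixes f :: "'a::real_normed_vector \<Rightarrow> 'b::euclidean_space"
  assumes "open S" "open T" "Ck_on k S f" "Ck_on k T g" "f ` S \<subseteq> T"
  shows "Ck_on k S (\<lambda>x. g (f x))"
  using assms(3,4)
proof (induction k arbitrary: g)
  case 0 then show ?case using continuous_on_compose2 assms(5) by simp blast
next
  case (Suc k)
  let ?D = "\<lambda>x v. \<Sum>b\<in>Basis. (frechet_derivative f (at x) v \<bullet> b) *\<^sub>R frechet_derivative g (at (f x)) b"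
  have D: "((\<lambda>x. g (f x)) has_derivative ?D x) (at x)" if "x \<in> S" for x
  proof -
    have g: "(g has_derivative frechet_derivative g (at (f x))) (at (f x))"
      using Ck_on_SucD[OF Suc.prems(2)] that assms(5) by auto
    have l: "linear (frechet_derivative g (at (f x)))" using g has_derivative_linear by blast
    have "?D x v = frechet_derivative g (at (f x)) (frechet_derivative f (at x) v)" for v
    proof -
      have "frechet_derivative g (at (f x)) (frechet_derivative f (at x) v)
        = frechet_derivative g (at (f x)) (\<Sum>b\<in>Basis. (frechet_derivative f (at x) v \<bullet> b) *\<^sub>R b)"
        by (simp add: euclidean_representation)
      also have "\<dots> = ?D x v" by (simp add: linear_sum[OF l] linear_scale[OF l])
      finally show ?thesis by simp
    qed
    then show ?thesis using has_derivative_compose[OF Ck_on_SucD[OF Suc.prems(1) that] g] by simp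
  qed
  show ?case
  proof (rule Ck_on_SucI[OF assms(1) D])
    fix v
    have 1: "Ck_on k S (\<lambda>x. frechet_derivative f (at x) v \<bullet> b)" for b
      by (rule Ck_on_bounded_linear[OF bounded_linear_inner_left assms(1)]) (use Suc.prems in simp)
    have 2: "Ck_on k S (\<lambda>x. frechet_derivative g (at (f x)) b)" for b
      using Suc.IH[OF Ck_on_Suc_imp[OF Suc.prems(1)], of "\<lambda>y. frechet_derivative g (at y) b"] Suc.prems(2) by simp
    show "Ck_on k S (\<lambda>x. ?D x v)"
      by (intro Ck_on_sum Ck_on_bilinear[OF bounded_bilinear_scaleR] 1 2 assms(1))
  qed
qed

lemma Ck_on_local:
  assumes "\<And>x. x \<in> S \<Longrightarrow> \<exists>W. open W \<and> x \<in> W \<and> Ck_on k W f"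
  shows "Ck_on k S f"
  using assms
proof (induction k arbitrary: f)
  case 0
  have "isCont f x" if "x \<in> S" for x
    using 0[OF that] by (auto simp: continuous_on_eq_continuous_at)
  then show ?case by (simp add: continuous_at_imp_continuous_on)
next
  case (Suc k)
  have "f differentiable (at x)" if "x \<in> S" for x using Suc.prems[OF that] by auto
  moreover have "Ck_on k S (\<lambda>x. frechet_derivative f (at x) v)" for v
    using Suc.prems by (intro Suc.IH) (simp, blast)
  ultimately show ?case by simp
qed

lemma Cinf_on_imp_Ck_on: "Cinf_on S f \<Longrightarrow> Ck_on k S f" by (simp add: Cinf_on_def)

lemma Cinf_on_has_derivative:
  "Cinf_on S f \<Longrightarrow> x \<in> S \<Longrightarrow> (f has_derivative frechet_derivative f (at x)) (at x)"
  using Ck_on_SucD[OF Cinf_on_imp_Ck_on] .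

lemma Cinf_on_imp_continuous_on: "Cinf_on S f \<Longrightarrow> continuous_on S f"
  using Ck_on_imp_continuous_on[OF Cinf_on_imp_Ck_on] .

lemma Cinf_on_frechet:
  assumes "Cinf_on S f" shows "Cinf_on S (\<lambda>x. frechet_derivative f (at x) v)"
  unfolding Cinf_on_def
proof
  fix k show "Ck_on k S (\<lambda>x. frechet_derivative f (at x) v)"
    using Cinf_on_imp_Ck_on[OF assms, of "Suc k"] by simp
qed

lemma Cinf_on_subset: "Cinf_on S f \<Longrightarrow> T \<subseteq> S \<Longrightarrow> Cinf_on T f"
  unfolding Cinf_on_def by (blast intro: Ck_on_subset)
lemma Cinf_on_cong: "open S \<Longrightarrow> (\<And>x. x \<in> S \<Longrightarrow> f x = g x) \<Longrightarrow> Cinf_on S f \<Longrightarrow> Cinf_on S g"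
  unfolding Cinf_on_def by (blast intro: Ck_on_cong)
lemma Cinf_on_const: "open S \<Longrightarrow> Cinf_on S (\<lambda>x. c)"
  by (simp add: Cinf_on_def Ck_on_const)
lemma Cinf_on_linear: "bounded_linear T \<Longrightarrow> open S \<Longrightarrow> Cinf_on S T"
  by (simp add: Cinf_on_def Ck_on_linear)
lemma Cinf_on_id: "open S \<Longrightarrow> Cinf_on S (\<lambda>x. x)"
  by (simp add: Cinf_on_def Ck_on_id)
lemma Cinf_on_bounded_linear: "bounded_linear T \<Longrightarrow> open S \<Longrightarrow> Cinf_on S f \<Longrightarrow> Cinf_on S (\<lambda>x. T (f x))"
  by (simp add: Cinf_on_def Ck_on_bounded_linear)
lemma Cinf_on_add: "open S \<Longrightarrow> Cinf_on S f \<Longrightarrow> Cinf_on S g \<Longrightarrow> Cinf_on S (\<lambda>x. f x + g x)"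
  by (simp add: Cinf_on_def Ck_on_add)
lemma Cinf_on_sum: "open S \<Longrightarrow> (\<And>i. i \<in> I \<Longrightarrow> Cinf_on S (f i)) \<Longrightarrow> Cinf_on S (\<lambda>x. \<Sum>i\<in>I. f i x)"
  by (simp add: Cinf_on_def Ck_on_sum)
lemma Cinf_on_bilinear:
  "bounded_bilinear B \<Longrightarrow> open S \<Longrightarrow> Cinf_on S f \<Longrightarrow> Cinf_on S g \<Longrightarrow> Cinf_on S (\<lambda>x. B (f x) (g x))"
  by (simp add: Cinf_on_def Ck_on_bilinear)
lemma Cinf_on_minus: "open S \<Longrightarrow> Cinf_on S f \<Longrightarrow> Cinf_on S g \<Longrightarrow> Cinf_on S (\<lambda>x. f x - g x)"
  using Cinf_on_add[OF _ _ Cinf_on_bounded_linear[OF bounded_linear_minus[OF bounded_linear_ident]], of S f g] by simp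
lemma Cinf_on_compose:
  fixes f :: "'a::real_normed_vector \<Rightarrow> 'b::euclidean_space"
  shows "open S \<Longrightarrow> open T \<Longrightarrow> Cinf_on S f \<Longrightarrow> Cinf_on T g \<Longrightarrow> f ` S \<subseteq> T \<Longrightarrow> Cinf_on S (\<lambda>x. g (f x))"
  unfolding Cinf_on_def by (blast intro: Ck_on_compose)
lemma Cinf_on_local:
  assumes "\<And>x. x \<in> S \<Longrightarrow> \<exists>W. open W \<and> x \<in> W \<and> Cinf_on W f"
  shows "Cinf_on S f"
  unfolding Cinf_on_def
proof
  fix k show "Ck_on k S f" by (rule Ck_on_local) (use assms Cinf_on_imp_Ck_on in blast)
qed
lemma Cinf_on_Pair:
  assumes "open S" "Cinf_on S f" "Cinf_on S g" shows "Cinf_on S (\<lambda>x. (f x, g x))"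
proof -
  have "Cinf_on S (\<lambda>x. (f x, 0) + (0, g x))"
    by (intro Cinf_on_add assms Cinf_on_bounded_linear[of "\<lambda>a. (a, 0)"] Cinf_on_bounded_linear[of "\<lambda>a. (0, a)"]
        bounded_linear_Pair bounded_linear_ident bounded_linear_zero)
  then show ?thesis by simp
qed

text \<open>The inverse of a family of isomorphisms is differentiated by applying the inverse function
  theorem to \<open>(z, w) \<mapsto> (z, M z w)\<close>.\<close>

lemma Ck_on_linear_solve:
  fixes M :: "'z::euclidean_space \<Rightarrow> 'e::euclidean_space \<Rightarrow> 'e"
  assumes S: "open S" and lin: "\<And>z. linear (M z)"
    and M: "\<And>w. Cinf_on S (\<lambda>z. M z w)"
    and inj: "\<And>z w. z \<in> S \<Longrightarrow> M z w = 0 \<Longrightarrow> w = 0"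
    and sol: "\<And>z. z \<in> S \<Longrightarrow> M z (a z) = b z" and b: "Cinf_on S b"
  shows "Ck_on k S a"
proof -
  have rep: "M z w = (\<Sum>i\<in>Basis. (w \<bullet> i) *\<^sub>R M z i)" for z w
  proof -
    have "M z w = M z (\<Sum>i\<in>Basis. (w \<bullet> i) *\<^sub>R i)" by (simp add: euclidean_representation)
    then show ?thesis by (simp add: linear_sum[OF lin] linear_scale[OF lin])
  qed
  have injM: "inj (M z)" if "z \<in> S" for z
    using inj[OF that] lin linear_injective_0 by blast
  have MI: "M z (inv (M z) w) = w" if "z \<in> S" for z w
    using linear_injective_imp_surjective[OF lin injM[OF that]] by (simp add: surj_f_inv_f)
  have IM: "inv (M z) (M z w) = w" if "z \<in> S" for z w
    using injM[OF that] by simp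
  define DM where "DM z v w = (\<Sum>i\<in>Basis. (w \<bullet> i) *\<^sub>R frechet_derivative (\<lambda>z. M z i) (at z) v)" for z v w
  \<comment> \<open>Formal differentiation of \<open>M z (a z) = b z\<close>; the point is that
    \<open>a\<close> is differentiable at all.\<close>
  have solve: "\<exists>a'. \<forall>z\<in>S. (a has_derivative a' z) (at z) \<and>
      (\<forall>v. M z (a' z v) = frechet_derivative b (at z) v - DM z v (a z))"
    if sol: "\<And>z. z \<in> S \<Longrightarrow> M z (a z) = b z" and b: "Ck_on (Suc 0) S b" for a b
  proof -
    define a' where "a' z v = inv (M z) (frechet_derivative b (at z) v - DM z v (a z))" for z v
    have "(a has_derivative a' z) (at z) \<and>
      (\<forall>v. M z (a' z v) = frechet_derivative b (at z) v - DM z v (a z))" if "z \<in> S" for z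
    proof
      let ?f = "\<lambda>(z, w). (z, M z w)" and ?g = "\<lambda>(z, w). (z, inv (M z) w)"
      have MD: "((\<lambda>z. M z i) has_derivative frechet_derivative (\<lambda>z. M z i) (at z)) (at z)" if "z \<in> S" for z i
        using Cinf_on_has_derivative[OF M that] .
      have df2: "((\<lambda>y. M (fst y) (snd y)) has_derivative (\<lambda>(v, w). M (fst y) w + DM (fst y) v (snd y))) (at y)"
        if "fst y \<in> S" for y
      proof -
        have "((\<lambda>y. \<Sum>i\<in>Basis. (snd y \<bullet> i) *\<^sub>R M (fst y) i) has_derivative
           (\<lambda>u. \<Sum>i\<in>Basis. (snd y \<bullet> i) *\<^sub>R frechet_derivative (\<lambda>z. M z i) (at (fst y)) (fst u) + (snd u \<bullet> i) *\<^sub>R M (fst y) i)) (at y)"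
          by (intro has_derivative_sum has_derivative_scaleR has_derivative_inner_left
              has_derivative_snd has_derivative_ident has_derivative_compose[OF has_derivative_fst[OF has_derivative_ident] MD[OF that]])
        moreover have "(\<Sum>i\<in>Basis. (snd y \<bullet> i) *\<^sub>R frechet_derivative (\<lambda>z. M z i) (at (fst y)) (fst u) + (snd u \<bullet> i) *\<^sub>R M (fst y) i)
          = (case u of (v, w) \<Rightarrow> M (fst y) w + DM (fst y) v (snd y))" for u
          by (simp add: split_beta DM_def rep[of _ "snd u"] sum.distrib)
        ultimately show ?thesis by (simp add: rep[symmetric])
      qed
      have df: "(?f has_derivative (\<lambda>(v, w). (v, M (fst y) w + DM (fst y) v (snd y)))) (at y)"
        if "fst y \<in> S" for y
        using has_derivative_Pair[OF has_derivative_fst[OF has_derivative_ident] df2[OF that]]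
        by (simp add: case_prod_unfold)
      \<comment> \<open>\<open>?f\<close> keeps \<open>z\<close> and applies \<open>M z\<close> to
        the second component; its derivative is block triangular with invertible diagonal, so it is
        inverted explicitly.\<close>
      have "(?g has_derivative (\<lambda>(v, w). (v, inv (M z) (w - DM z v (a z))))) (at (?f (z, a z)))"
      proof (rule has_derivative_inverse_strong[where f = ?f and g = ?g and x = "(z, a z)" and S = "S \<times> UNIV"])
        show "open (S \<times> (UNIV::'e set))" using S by (simp add: open_Times)
        show "continuous_on (S \<times> UNIV) ?f"
          using has_derivative_continuous[OF df] by (intro continuous_at_imp_continuous_on) auto
        show "(?f has_derivative (\<lambda>(v, w). (v, M z w + DM z v (a z)))) (at (z, a z))"
          using df[of "(z, a z)"] that by simp
        show "?g (?f y) = y" if "y \<in> S \<times> UNIV" for y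
          using that by (auto simp: IM)
        show "(\<lambda>(v, w). (v, M z w + DM z v (a z))) \<circ> (\<lambda>(v, w). (v, inv (M z) (w - DM z v (a z)))) = id"
          by (simp add: fun_eq_iff MI[OF that])
        show "(z, a z) \<in> S \<times> UNIV" using that by simp
      qed
      then have g: "(?g has_derivative (\<lambda>(v, w). (v, inv (M z) (w - DM z v (a z))))) (at (z, b z))"
        using sol that by simp
      have b': "((\<lambda>z. (z, b z)) has_derivative (\<lambda>v. (v, frechet_derivative b (at z) v))) (at z)"
        by (intro has_derivative_Pair has_derivative_ident Ck_on_SucD[OF b that])
      have "((\<lambda>z. snd (?g (z, b z))) has_derivative (\<lambda>v. a' z v)) (at z)"
        using has_derivative_snd[OF has_derivative_compose[OF b' g]] by (simp add: a'_def)
      then show "(a has_derivative a' z) (at z)"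
        by (rule has_derivative_transform_within_open[OF _ S that]) (simp add: sol[symmetric] IM)
      show "\<forall>v. M z (a' z v) = frechet_derivative b (at z) v - DM z v (a z)"
        by (simp add: a'_def MI[OF that])
    qed
    then show ?thesis by blast
  qed
  \<comment> \<open>The columns of the inverse matrix. Their derivatives solve a system whose
    right-hand side contains only the \<open>N i\<close> and derivatives of \<open>M\<close>, and
    the solution is again a combination of the \<open>N j\<close>; hence class C^k improves to class
    C^(k+1).\<close>
  define N where "N i z = inv (M z) i" for i z
  have "\<exists>a'. \<forall>z\<in>S. (N i has_derivative a' z) (at z) \<and>
      (\<forall>v. M z (a' z v) = frechet_derivative (\<lambda>z. i) (at z) v - DM z v (N i z))" for i
    by (rule solve) (use MI N_def Ck_on_const[OF S] in auto)
  then obtain N' where N': "\<And>i z. z \<in> S \<Longrightarrow> (N i has_derivative N' i z) (at z)"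
      "\<And>i z v. z \<in> S \<Longrightarrow> M z (N' i z v) = - DM z v (N i z)"
    by (simp add: frechet_derivative_const) metis
  have inv: "w = (\<Sum>j\<in>Basis. (c \<bullet> j) *\<^sub>R N j z)" if "z \<in> S" "M z w = c" for z w c
  proof -
    have "M z (\<Sum>j\<in>Basis. (c \<bullet> j) *\<^sub>R N j z) = c"
      by (simp add: linear_sum[OF lin] linear_scale[OF lin] N_def MI that euclidean_representation)
    then show ?thesis using injM[OF that(1)] that(2) by (metis injD)
  qed
  have CN: "Ck_on k S (N i)" for k i
  proof (induction k arbitrary: i)
    case 0 then show ?case using N'(1)
      by (auto intro!: continuous_at_imp_continuous_on dest!: has_derivative_continuous)
  next
    case (Suc k)
    show ?case
    proof (rule Ck_on_SucI[OF S N'(1)])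
      fix v
      have DMk: "Ck_on k S (\<lambda>z. - DM z v (N i z))"
        unfolding DM_def
        by (intro Ck_on_bounded_linear[of uminus] Ck_on_sum S Ck_on_bilinear[OF bounded_bilinear_scaleR]
            Ck_on_bounded_linear[OF bounded_linear_inner_left] bounded_linear_minus[OF bounded_linear_ident]
            Suc.IH Cinf_on_imp_Ck_on[OF Cinf_on_frechet[OF M]])
      have "Ck_on k S (\<lambda>z. \<Sum>j\<in>Basis. (- DM z v (N i z) \<bullet> j) *\<^sub>R N j z)"
        by (intro Ck_on_sum S Ck_on_bilinear[OF bounded_bilinear_scaleR]
            Ck_on_bounded_linear[OF bounded_linear_inner_left] Suc.IH DMk)
      then show "Ck_on k S (\<lambda>z. N' i z v)"
        by (rule Ck_on_cong[OF S, rotated]) (rule inv[OF _ N'(2), symmetric])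
    qed
  qed
  have "Ck_on k S (\<lambda>z. \<Sum>j\<in>Basis. (b z \<bullet> j) *\<^sub>R N j z)"
    by (intro Ck_on_sum S Ck_on_bilinear[OF bounded_bilinear_scaleR]
        Ck_on_bounded_linear[OF bounded_linear_inner_left] CN Cinf_on_imp_Ck_on[OF b])
  then show ?thesis
    by (rule Ck_on_cong[OF S, rotated]) (rule inv[OF _ sol, symmetric])
qed

lemma Cinf_on_linear_solve:
  fixes M :: "'z::euclidean_space \<Rightarrow> 'e::euclidean_space \<Rightarrow> 'e"
  assumes "open S" "\<And>z. linear (M z)" "\<And>w. Cinf_on S (\<lambda>z. M z w)"
    and "\<And>z w. z \<in> S \<Longrightarrow> M z w = 0 \<Longrightarrow> w = 0"
    and "\<And>z. z \<in> S \<Longrightarrow> M z (a z) = b z" "Cinf_on S b"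
  shows "Cinf_on S a"
  unfolding Cinf_on_def
proof
  fix k show "Ck_on k S a"
    by (rule Ck_on_linear_solve[where M = M and b = b]) (fact assms)+
qed

section \<open>Uniform constants and ordinary differential equations\<close>

text \<open>A property inherited by smaller \<open>T\<close> survives the minimum over a finite
  subcover. This serves for existence times, for bounds written as \<open>1 / T\<close>, and for the
  final length scale.\<close>

lemma compact_uniform_pos:
  fixes K :: "'z::topological_space set"
  assumes "compact K"
    and ex: "\<And>z. z \<in> K \<Longrightarrow> \<exists>V T. open V \<and> z \<in> V \<and> 0 < T \<and> (\<forall>y\<in>V \<inter> K. P T y)"
    and mono: "\<And>T T' z. P T z \<Longrightarrow> 0 < T' \<Longrightarrow> T' \<le> T \<Longrightarrow> P T' z"
  shows "\<exists>T>0::real. \<forall>z\<in>K. P T z"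
proof -
  from ex obtain V T where VT: "\<And>z. z \<in> K \<Longrightarrow> open (V z)" "\<And>z. z \<in> K \<Longrightarrow> z \<in> V z"
    "\<And>z. z \<in> K \<Longrightarrow> 0 < T z" "\<And>z y. z \<in> K \<Longrightarrow> y \<in> V z \<inter> K \<Longrightarrow> P (T z) y"
    by metis
  obtain C where C: "C \<subseteq> K" "finite C" "K \<subseteq> (\<Union>z\<in>C. V z)"
    using compactE_image[OF assms(1), of K V] VT by (metis UN_iff subsetI)
  \<comment> \<open>The 1 makes \<open>Min\<close> legitimate for an empty cover.\<close>
  define T0 where "T0 = Min (insert 1 (T ` C))"
  have T0: "0 < T0" using C VT(3) by (auto simp: T0_def subset_iff)
  have "P T0 z" if z: "z \<in> K" for z
  proof -
    obtain c where c: "c \<in> C" "z \<in> V c" using z C by blast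
    have "T0 \<le> T c" using C c by (simp add: T0_def)
    then show ?thesis using mono[OF VT(4)[of c z] T0] c C z by blast
  qed
  then show ?thesis using T0 by blast
qed

text \<open>The integral operator contracts the complete metric space of bounded continuous
  functions. Since the fixed point theorem is applied to a whole type, curves are defined on the
  entire line and time is clamped to \<open>{-T..T}\<close>.\<close>

lemma Picard_global:
  fixes X :: "'a::euclidean_space \<Rightarrow> 'a"
  assumes L: "\<And>x y. norm (X x - X y) \<le> L * norm (x - y)" and T: "0 < T" "T * L \<le> 1/8" and L0: "0 \<le> L"
  shows "\<exists>x. x 0 = z \<and> (\<forall>t\<in>{-T<..<T}. (x has_vector_derivative X (x t)) (at t))"
proof -
  define cl where "cl t = max (-T) (min T t)" for t
  have cl: "cl t \<in> {-T..T}" for t using T by (auto simp: cl_def)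
  have "L-lipschitz_on UNIV X"
    using L L0 by (intro lipschitz_onI) (auto simp: dist_norm)
  then have contX: "continuous_on UNIV X" by (rule lipschitz_on_continuous_on)
  \<comment> \<open>An integral over \<open>{0..t}\<close> vanishes for negative \<open>t\<close>;
    starting at \<open>-T\<close> and subtracting \<open>J \<phi> 0\<close> treats both time
    directions at once.\<close>
  define J where "J \<phi> t = integral {-T..t} (\<lambda>s. X (apply_bcontfun \<phi> s))" for \<phi> :: "real \<Rightarrow>\<^sub>C 'a" and t
  have contX': "continuous_on S (\<lambda>s. X (apply_bcontfun \<phi> s))" for \<phi> :: "real \<Rightarrow>\<^sub>C 'a" and S
    by (rule continuous_on_compose2[OF contX continuous_on_apply_bcontfun]) auto
  define P where "P \<phi> = Bcontfun (\<lambda>t. z + (J \<phi> (cl t) - J \<phi> 0))" for \<phi>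
  have contJ: "continuous_on {-T..T} (J \<phi>)" for \<phi>
    unfolding J_def by (intro indefinite_integral_continuous_1 integrable_continuous_interval contX')
  have P: "apply_bcontfun (P \<phi>) t = z + (J \<phi> (cl t) - J \<phi> 0)" for \<phi> t
  proof -
    have "continuous_on UNIV (\<lambda>t. J \<phi> (cl t))"
      by (rule continuous_on_compose2[OF contJ]) (use T in \<open>auto simp: cl_def[abs_def] intro!: continuous_intros\<close>)
    moreover have "bounded ((\<lambda>t. z + (J \<phi> t - J \<phi> 0)) ` {-T..T})"
      by (intro compact_imp_bounded compact_continuous_image continuous_intros contJ compact_Icc)
    then have "bounded (range (\<lambda>t. z + (J \<phi> (cl t) - J \<phi> 0)))"
      by (rule bounded_subset) (use cl in auto)
    ultimately have "(\<lambda>t. z + (J \<phi> (cl t) - J \<phi> 0)) \<in> bcontfun"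
      by (auto simp: bcontfun_def intro!: continuous_intros)
    then show ?thesis by (simp add: P_def Bcontfun_inverse)
  qed
  \<comment> \<open>The interval has length at most \<open>2 * T\<close>, and
    \<open>T * L \<le> 1/8\<close>. Two such terms enter \<open>P\<close>, hence the contraction
    factor 1/2.\<close>
  have Jd: "norm (J \<phi> t - J \<psi> t) \<le> 1/4 * dist \<phi> \<psi>" if "t \<in> {-T..T}" for \<phi> \<psi> t
  proof -
    have "norm (J \<phi> t - J \<psi> t) = norm (integral {-T..t} (\<lambda>s. X (apply_bcontfun \<phi> s) - X (apply_bcontfun \<psi> s)))"
      unfolding J_def by (intro arg_cong[where f = norm] Henstock_Kurzweil_Integration.integral_diff[symmetric] integrable_continuous_interval contX')
    moreover have "norm (integral {-T..t} (\<lambda>s. X (apply_bcontfun \<phi> s) - X (apply_bcontfun \<psi> s)))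
        \<le> (L * dist \<phi> \<psi>) * (t - -T)"
    proof (rule integral_bound)
      fix s show "norm (X (apply_bcontfun \<phi> s) - X (apply_bcontfun \<psi> s)) \<le> L * dist \<phi> \<psi>"
        using L[of "apply_bcontfun \<phi> s" "apply_bcontfun \<psi> s"] dist_bounded[of \<phi> s \<psi>] L0
        by (smt (verit) dist_norm mult_left_mono)
    qed (use that in \<open>auto intro!: continuous_on_diff contX'\<close>)
    moreover have "(L * dist \<phi> \<psi>) * (t - -T) \<le> (L * dist \<phi> \<psi>) * (2*T)"
      using that L0 by (intro mult_left_mono) auto
    moreover have "(L * dist \<phi> \<psi>) * (2*T) = 2 * (T * L) * dist \<phi> \<psi>" by simp
    moreover have "2 * (T * L) * dist \<phi> \<psi> \<le> 1/4 * dist \<phi> \<psi>"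
      using T by (intro mult_right_mono) auto
    ultimately show ?thesis by linarith
  qed
  have "\<exists>!\<phi>. P \<phi> = \<phi>"
  proof (rule banach_fix_type[where c = "1/2"])
    have "dist (P \<phi>) (P \<psi>) \<le> 1/2 * dist \<phi> \<psi>" for \<phi> \<psi>
    proof (rule dist_bound)
      fix t
      have "norm ((J \<phi> (cl t) - J \<psi> (cl t)) - (J \<phi> 0 - J \<psi> 0)) \<le> 1/4 * dist \<phi> \<psi> + 1/4 * dist \<phi> \<psi>"
        by (rule order_trans[OF norm_triangle_ineq4]) (intro add_mono Jd cl, use T in auto)
      then show "dist (apply_bcontfun (P \<phi>) t) (apply_bcontfun (P \<psi>) t) \<le> 1/2 * dist \<phi> \<psi>"
        by (simp add: P dist_norm algebra_simps)
    qed
    then show "\<forall>x y. dist (P x) (P y) \<le> 1/2 * dist x y" by blast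
  qed auto
  then obtain \<phi> where "P \<phi> = \<phi>" by blast
  then have \<phi>: "apply_bcontfun \<phi> t = z + (J \<phi> (cl t) - J \<phi> 0)" for t using P by metis
  have "cl 0 = 0" using T by (simp add: cl_def)
  then have "apply_bcontfun \<phi> 0 = z" using \<phi> by simp
  moreover have "(apply_bcontfun \<phi> has_vector_derivative X (apply_bcontfun \<phi> t)) (at t)" if t: "t \<in> {-T<..<T}" for t
  proof -
    have "(J \<phi> has_vector_derivative X (apply_bcontfun \<phi> t)) (at t within {-T..T})"
      unfolding J_def[abs_def] by (rule integral_has_vector_derivative[OF contX']) (use t in auto)
    then have "(J \<phi> has_vector_derivative X (apply_bcontfun \<phi> t)) (at t)"
      using t by (simp add: at_within_Icc_at)
    then have "((\<lambda>t. z + (J \<phi> t - J \<phi> 0)) has_vector_derivative X (apply_bcontfun \<phi> t)) (at t)"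
      by (auto intro!: derivative_eq_intros)
    then show ?thesis
      by (rule has_vector_derivative_transform_within_open[where S = "{-T<..<T}"])
        (use t \<phi> in \<open>auto simp: cl_def\<close>)
  qed
  ultimately show ?thesis by blast
qed

text \<open>\<open>Ck_on\<close> controls the derivative along fixed vectors; the sum of the bounds
  along a basis dominates the operator norm.\<close>

lemma C1_bound_on_compact:
  fixes X :: "'a::euclidean_space \<Rightarrow> 'b::real_normed_vector"
  assumes "Ck_on 1 W X" "compact K" "K \<subseteq> W"
  shows "\<exists>B\<ge>0. \<forall>z\<in>K. onorm (frechet_derivative X (at z)) \<le> B"
proof -
  have c: "continuous_on K (\<lambda>z. norm (frechet_derivative X (at z) i))" for i
    using assms by (auto intro!: continuous_on_norm intro: continuous_on_subset)
  have "\<exists>B. \<forall>z\<in>K. norm (frechet_derivative X (at z) i) \<le> B" for i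
    using compact_continuous_image[OF c assms(2), of i, THEN compact_imp_bounded]
    by (auto simp: bounded_iff)
  then obtain B where B: "\<And>i z. z \<in> K \<Longrightarrow> norm (frechet_derivative X (at z) i) \<le> B i" by metis
  define C where "C = (\<Sum>i\<in>Basis. \<bar>B i\<bar>)"
  have "onorm (frechet_derivative X (at z)) \<le> C" if z: "z \<in> K" for z
  proof (rule onorm_bound)
    have l: "linear (frechet_derivative X (at z))"
      using Ck_on_SucD[of 0 W X z] assms z has_derivative_linear by auto
    fix v :: 'a
    have "frechet_derivative X (at z) v = frechet_derivative X (at z) (\<Sum>i\<in>Basis. (v \<bullet> i) *\<^sub>R i)"
      by (simp add: euclidean_representation)
    also have "\<dots> = (\<Sum>i\<in>Basis. (v \<bullet> i) *\<^sub>R frechet_derivative X (at z) i)"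
      by (simp add: linear_sum[OF l] linear_scale[OF l])
    also have "norm \<dots> \<le> (\<Sum>i\<in>Basis. norm v * \<bar>B i\<bar>)"
    proof (rule sum_norm_le)
      fix i :: 'a assume "i \<in> Basis"
      then have "\<bar>v \<bullet> i\<bar> \<le> norm v" by (rule Basis_le_norm)
      moreover have "norm (frechet_derivative X (at z) i) \<le> \<bar>B i\<bar>" using B[OF z, of i] by simp
      ultimately show "norm ((v \<bullet> i) *\<^sub>R frechet_derivative X (at z) i) \<le> norm v * \<bar>B i\<bar>"
        by (simp add: mult_mono)
    qed
    finally show "norm (frechet_derivative X (at z) v) \<le> C * norm v"
      by (simp add: C_def sum_distrib_left mult.commute)
  qed (auto simp: C_def sum_nonneg)
  moreover have "0 \<le> C" by (auto simp: C_def sum_nonneg)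
  ultimately show ?thesis by blast
qed

lemma C1_lipschitz_on_compact_convex:
  fixes X :: "'a::euclidean_space \<Rightarrow> 'b::real_normed_vector"
  assumes "Ck_on 1 W X" "compact K" "convex K" "K \<subseteq> W"
  shows "\<exists>B\<ge>0. \<forall>x\<in>K. \<forall>y\<in>K. norm (X x - X y) \<le> B * norm (x - y)"
proof -
  obtain B where B: "0 \<le> B" "\<And>z. z \<in> K \<Longrightarrow> onorm (frechet_derivative X (at z)) \<le> B"
    using C1_bound_on_compact[OF assms(1,2,4)] by metis
  have "norm (X x - X y) \<le> B * norm (x - y)" if "x \<in> K" "y \<in> K" for x y
  proof (rule differentiable_bound[where f = X and S = K and f' = "\<lambda>z. frechet_derivative X (at z)"])
    fix z assume z: "z \<in> K"
    show "onorm (frechet_derivative X (at z)) \<le> B" by (rule B(2)[OF z])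
    from z show "(X has_derivative frechet_derivative X (at z)) (at z within K)"
      using assms(1,4) by (intro has_derivative_at_withinI[OF Ck_on_SucD[of 0 W X z]]) auto
  qed (fact assms that)+
  then show ?thesis using B(1) by blast
qed

text \<open>Composing \<open>X\<close> with the closest-point projection onto a ball, which is
  1-Lipschitz, makes the vector field globally Lipschitz. For short times a solution from the ball
  of half the radius stays in the ball, where the projection is the identity.\<close>

lemma ODE_local:
  fixes X :: "'a::euclidean_space \<Rightarrow> 'a"
  assumes "open W" "z0 \<in> W" "Ck_on 1 W X"
  shows "\<exists>\<rho>>0. \<exists>T>0. \<forall>z\<in>ball z0 \<rho>. \<exists>x. x 0 = z \<and>
    (\<forall>t\<in>{-T<..<T}. x t \<in> W \<and> (x has_vector_derivative X (x t)) (at t))"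
proof -
  obtain r where r: "0 < r" "cball z0 r \<subseteq> W" using assms open_contains_cball by blast
  define \<rho> where "\<rho> = r / 2"
  let ?K = "cball z0 r"
  obtain L where L: "0 \<le> L" "\<And>x y. x \<in> ?K \<Longrightarrow> y \<in> ?K \<Longrightarrow> norm (X x - X y) \<le> L * norm (x - y)"
    using C1_lipschitz_on_compact_convex[OF assms(3) compact_cball convex_cball r(2)] by metis
  have "continuous_on ?K X" using Ck_on_imp_continuous_on[OF assms(3)] r(2) continuous_on_subset by blast
  then have "bounded (X ` ?K)" using compact_continuous_image compact_cball compact_imp_bounded by blast
  then obtain B where B: "0 < B" "\<And>x. x \<in> ?K \<Longrightarrow> norm (X x) \<le> B"
    by (auto simp: bounded_pos)
  define c where "c = closest_point ?K"
  have c: "c x \<in> ?K" for x unfolding c_def using r by (intro closest_point_in_set) auto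
  have cid: "c x = x" if "x \<in> ?K" for x unfolding c_def using that by (rule closest_point_self)
  have cl: "norm (c x - c y) \<le> norm (x - y)" for x y
    using closest_point_lipschitz[of ?K x y] r by (auto simp: c_def dist_norm)
  \<comment> \<open>The first bound makes the Picard operator contract; the second keeps a solution
    of speed at most \<open>B\<close> within distance \<open>\<rho>\<close> of its initial
    point.\<close>
  define T where "T = min (1 / (8 * (L + 1))) (\<rho> / B)"
  have T: "0 < T" using L B r by (simp add: T_def \<rho>_def)
  have "T * L \<le> 1 / (8 * (L + 1)) * (L + 1)"
    using L T by (intro mult_mono) (auto simp: T_def)
  also have "\<dots> = 1/8" using L(1) by (simp add: field_simps)
  finally have TL: "T * L \<le> 1/8" .
  have TB: "B * T \<le> \<rho>" using B by (auto simp: T_def min_def field_simps)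
  have "\<exists>x. x 0 = z \<and> (\<forall>t\<in>{-T<..<T}. x t \<in> W \<and> (x has_vector_derivative X (x t)) (at t))"
    if z: "z \<in> ball z0 \<rho>" for z
  proof -
    have "norm (X (c x) - X (c y)) \<le> L * norm (x - y)" for x y
      by (rule order_trans[OF L(2)[OF c c]]) (use cl L(1) in \<open>simp add: mult_left_mono\<close>)
    from Picard_global[OF this T TL L(1), of z] obtain x where
      x: "x 0 = z" "\<And>t. t \<in> {-T<..<T} \<Longrightarrow> (x has_vector_derivative X (c (x t))) (at t)" by blast
    have K: "x t \<in> ?K" if t: "t \<in> {-T<..<T}" for t
    proof -
      have "norm (x t - x 0) \<le> B * norm (t - 0)"
      proof (rule differentiable_bound[of "{-T<..<T}"])
        fix s assume "s \<in> {-T<..<T}"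
        then show "(x has_derivative (\<lambda>h. h *\<^sub>R X (c (x s)))) (at s within {-T<..<T})"
          by (intro has_derivative_at_withinI[OF x(2)[unfolded has_vector_derivative_def]])
        show "onorm (\<lambda>h. h *\<^sub>R X (c (x s))) \<le> B"
          using B(2)[OF c, of "x s"] by (simp add: onorm_scaleR_left[OF bounded_linear_ident] onorm_id)
      qed (use t T in auto)
      also have "\<dots> \<le> B * T" using t B by (intro mult_left_mono) auto
      finally have "dist (x t) z \<le> \<rho>" using TB x(1) by (simp add: dist_norm)
      then show ?thesis using z dist_triangle[of z0 "x t" z] by (simp add: \<rho>_def dist_commute)
    qed
    then have "x t \<in> W \<and> (x has_vector_derivative X (x t)) (at t)" if "t \<in> {-T<..<T}" for t
      using x(2)[OF that] K[OF that] cid r(2) by auto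
    then show ?thesis using x(1) by blast
  qed
  moreover have "0 < \<rho>" using r by (simp add: \<rho>_def)
  ultimately show ?thesis using T by blast
qed

text \<open>Bootstrapping: if \<open>x\<close> is of class C^k, then so is its derivative
  \<open>X (x t)\<close>.\<close>

lemma ODE_solution_smooth:
  fixes X :: "'a::euclidean_space \<Rightarrow> 'a"
  assumes "open I" "open W" "Cinf_on W X" "\<And>t. t \<in> I \<Longrightarrow> x t \<in> W"
    and x: "\<And>t. t \<in> I \<Longrightarrow> (x has_vector_derivative X (x t)) (at t)"
  shows "Cinf_on I x"
  unfolding Cinf_on_def
proof
  fix k show "Ck_on k I x"
  proof (induction k)
    case 0
    show ?case using has_vector_derivative_continuous[OF x] continuous_at_imp_continuous_on by auto
  next
    case (Suc k)
    show ?case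
    proof (rule Ck_on_SucI[OF assms(1)])
      show "(x has_derivative (\<lambda>h. h *\<^sub>R X (x t))) (at t)" if "t \<in> I" for t
        using x[OF that] by (simp add: has_vector_derivative_def)
      have "Ck_on k I (\<lambda>t. X (x t))"
        by (rule Ck_on_compose[OF assms(1,2) Suc Cinf_on_imp_Ck_on[OF assms(3)]]) (use assms(4) in auto)
      then show "Ck_on k I (\<lambda>t. h *\<^sub>R X (x t))" for h
        by (rule Ck_on_bounded_linear[OF bounded_linear_scaleR_right assms(1)])
    qed
  qed
qed

section \<open>Finsler functions on open subsets of a Euclidean space\<close>

text \<open>What one chart sees of a Finsler metric. Positivity keeps the iterated derivatives of
  \<open>fundamental_tensor\<close>, so that a linear change of fibre coordinates carries it over
  directly.\<close>

locale local_finsler =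
  fixes U :: "'e::euclidean_space set" and f :: "'e \<times> 'e \<Rightarrow> real"
  assumes open_U: "open U"
    and cont_f: "continuous_on (U \<times> UNIV) f"
    and smooth_f: "Cinf_on (U \<times> (UNIV - {0})) f"
    and nonneg: "0 \<le> f z"
    and homog: "x \<in> U \<Longrightarrow> 0 < r \<Longrightarrow> v \<noteq> 0 \<Longrightarrow> f (x, r *\<^sub>R v) = r * f (x, v)"
    and posdef: "x \<in> U \<Longrightarrow> v \<noteq> 0 \<Longrightarrow> w \<noteq> 0 \<Longrightarrow>
      0 < deriv (\<lambda>s1. deriv (\<lambda>s2. (f (x, v + s1 *\<^sub>R w + s2 *\<^sub>R w))\<^sup>2) 0) 0"
begin

abbreviation W :: "('e \<times> 'e) set" where "W \<equiv> U \<times> (UNIV - {0})"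

definition L :: "'e \<times> 'e \<Rightarrow> real" where "L z = (f z)\<^sup>2 / 2"
definition dL :: "'e \<times> 'e \<Rightarrow> 'e \<times> 'e \<Rightarrow> real" where "dL z = frechet_derivative L (at z)"
text \<open>The base and fibre gradients of the Lagrangian; \<open>Lv\<close> is the momentum, that
  is, the Legendre transform of the velocity.\<close>

definition Lx :: "'e \<times> 'e \<Rightarrow> 'e" where "Lx z = (\<Sum>b\<in>Basis. dL z (b, 0) *\<^sub>R b)"
definition Lv :: "'e \<times> 'e \<Rightarrow> 'e" where "Lv z = (\<Sum>b\<in>Basis. dL z (0, b) *\<^sub>R b)"

lemma open_W: "open W"
  by (intro open_Times open_U open_Diff) auto

lemma L_smooth: "Cinf_on W L"
proof -
  have "Cinf_on W (\<lambda>z. (1/2) * (f z * f z))"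
    by (intro Cinf_on_bounded_linear[of "(*) (1/2)"] Cinf_on_bilinear[OF bounded_bilinear_mult]
        open_W smooth_f bounded_linear_mult_right)
  moreover have "(\<lambda>z. (1/2) * (f z * f z)) = L" by (auto simp: L_def power2_eq_square)
  ultimately show ?thesis by simp
qed

lemma dL_W: "z \<in> W \<Longrightarrow> (L has_derivative dL z) (at z)"
  unfolding dL_def by (rule Cinf_on_has_derivative[OF L_smooth])

text \<open>Homogeneity is available for nonzero vectors only; on the zero section the value is the
  limit along \<open>b\<close> divided by \<open>Suc n\<close>.\<close>

lemma f_zero: assumes "x \<in> U" shows "f (x, 0) = 0"
proof -
  obtain b :: 'e where b: "b \<in> Basis" using nonempty_Basis by blast
  then have b0: "b \<noteq> 0" by auto
  have "isCont f (x, 0)"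
    using cont_f open_U assms by (simp add: continuous_on_eq_continuous_at open_Times)
  moreover have "(\<lambda>n. (x, inverse (real (Suc n)) *\<^sub>R b)) \<longlonglongrightarrow> (x, 0 *\<^sub>R b)"
    by (intro tendsto_intros LIMSEQ_inverse_real_of_nat)
  ultimately have "(\<lambda>n. f (x, inverse (real (Suc n)) *\<^sub>R b)) \<longlonglongrightarrow> f (x, 0)"
    using isCont_tendsto_compose by fastforce
  moreover have "(\<lambda>n. f (x, inverse (real (Suc n)) *\<^sub>R b)) = (\<lambda>n. inverse (real (Suc n)) * f (x, b))"
    using homog[OF assms _ b0] by auto
  moreover have "(\<lambda>n. inverse (real (Suc n)) * f (x, b)) \<longlonglongrightarrow> 0 * f (x, b)"
    by (intro tendsto_intros LIMSEQ_inverse_real_of_nat)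
  ultimately show ?thesis using LIMSEQ_unique by fastforce
qed

lemma f_homog: "x \<in> U \<Longrightarrow> 0 \<le> r \<Longrightarrow> f (x, r *\<^sub>R v) = r * f (x, v)"
  using homog[of x r v] f_zero[of x] by (cases "r = 0 \<or> v = 0") auto

lemma L_homog: "x \<in> U \<Longrightarrow> 0 \<le> r \<Longrightarrow> L (x, r *\<^sub>R v) = r\<^sup>2 * L (x, v)"
  by (simp add: L_def f_homog power_mult_distrib)

text \<open>The derivative of \<open>L (x, r v) = r^2 L (x, v)\<close>. Scaling the fibre increment
  as well yields the homogeneity of both \<open>Lx\<close> and \<open>Lv\<close> from one
  formula.\<close>

lemma dL_homog:
  assumes "x \<in> U" "v \<noteq> 0" "0 < r"
  shows "dL (x, r *\<^sub>R v) (h, r *\<^sub>R k) = r\<^sup>2 * dL (x, v) (h, k)"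
proof -
  have "((\<lambda>z. (fst z, r *\<^sub>R snd z)) has_derivative (\<lambda>u. (fst u, r *\<^sub>R snd u))) (at (x, v))"
    by (auto intro!: derivative_eq_intros)
  moreover have "(L has_derivative dL (x, r *\<^sub>R v)) (at (fst (x, v), r *\<^sub>R snd (x, v)))"
    using dL_W[of "(x, r *\<^sub>R v)"] assms by simp
  ultimately have "((\<lambda>z. L (fst z, r *\<^sub>R snd z)) has_derivative
      (\<lambda>u. dL (x, r *\<^sub>R v) (fst u, r *\<^sub>R snd u))) (at (x, v))"
    by (rule has_derivative_compose)
  moreover have "((\<lambda>z. L (fst z, r *\<^sub>R snd z)) has_derivative (\<lambda>u. r\<^sup>2 * dL (x, v) u)) (at (x, v))"
  proof (rule has_derivative_transform_within_open[OF _ open_W])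
    show "((\<lambda>z. r\<^sup>2 * L z) has_derivative (\<lambda>u. r\<^sup>2 * dL (x, v) u)) (at (x, v))"
      using assms by (intro has_derivative_mult_right dL_W) auto
  qed (use assms L_homog in auto)
  ultimately have "(\<lambda>u. dL (x, r *\<^sub>R v) (fst u, r *\<^sub>R snd u)) = (\<lambda>u. r\<^sup>2 * dL (x, v) u)"
    by (rule has_derivative_unique)
  then show ?thesis by (metis fst_conv snd_conv)
qed

lemma path_derivative:
  assumes "Cinf_on W g" "x \<in> U" "v + s *\<^sub>R w \<noteq> 0"
  shows "((\<lambda>s. g (x, v + s *\<^sub>R w)) has_vector_derivative frechet_derivative g (at (x, v + s *\<^sub>R w)) (0, w)) (at s)"
proof -
  have "((\<lambda>s. (x, v + s *\<^sub>R w)) has_derivative (\<lambda>h. (0, h *\<^sub>R w))) (at s)"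
    by (auto intro!: derivative_eq_intros)
  moreover have g: "(g has_derivative frechet_derivative g (at (x, v + s *\<^sub>R w))) (at (x, v + s *\<^sub>R w))"
    using Cinf_on_has_derivative[OF assms(1)] assms by auto
  ultimately have "((\<lambda>s. g (x, v + s *\<^sub>R w)) has_derivative
      (\<lambda>h. frechet_derivative g (at (x, v + s *\<^sub>R w)) (0, h *\<^sub>R w))) (at s)"
    by (rule has_derivative_compose)
  moreover have "frechet_derivative g (at (x, v + s *\<^sub>R w)) (0, h *\<^sub>R w)
      = h *\<^sub>R frechet_derivative g (at (x, v + s *\<^sub>R w)) (0, w)" for h
    using linear_scale[OF has_derivative_linear[OF g], of h "(0, w)"] by simp
  ultimately show ?thesis by (simp add: has_vector_derivative_def)
qed

lemma dL_inner_W: assumes "z \<in> W" shows "dL z (h, k) = Lx z \<bullet> h + Lv z \<bullet> k"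
proof -
  have l: "linear (dL z)" using dL_W[OF assms] has_derivative_linear by blast
  have "(h, k) = (\<Sum>b\<in>Basis. (h \<bullet> b) *\<^sub>R (b, 0)) + (\<Sum>b\<in>Basis. (k \<bullet> b) *\<^sub>R (0, b))"
    by (simp add: prod_eq_iff fst_sum snd_sum euclidean_representation)
  then have "dL z (h, k) = (\<Sum>b\<in>Basis. (h \<bullet> b) *\<^sub>R dL z (b, 0)) + (\<Sum>b\<in>Basis. (k \<bullet> b) *\<^sub>R dL z (0, b))"
    by (simp add: linear_add[OF l] linear_sum[OF l] linear_scale[OF l] del: scaleR_Pair)
  then show ?thesis by (simp add: Lx_def Lv_def inner_sum_left inner_sum_right inner_commute mult.commute)
qed

lemma Lx_smooth: "Cinf_on W Lx" and Lv_smooth: "Cinf_on W Lv"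
proof -
  have *: "Cinf_on W (\<lambda>z. \<Sum>b\<in>Basis. dL z (j b) *\<^sub>R b)" for j :: "'e \<Rightarrow> 'e \<times> 'e"
    unfolding dL_def
    by (intro Cinf_on_sum open_W Cinf_on_bounded_linear[OF bounded_linear_scaleR_left] Cinf_on_frechet L_smooth)
  show "Cinf_on W Lx" "Cinf_on W Lv"
    using *[of "\<lambda>b. (b, 0)"] *[of "\<lambda>b. (0, b)"] by (simp_all add: Lx_def[abs_def] Lv_def[abs_def])
qed

lemma Lv_homog_pos:
  assumes "x \<in> U" "v \<noteq> 0" "0 < r" shows "Lv (x, r *\<^sub>R v) = r *\<^sub>R Lv (x, v)"
proof -
  have l: "linear (dL (x, r *\<^sub>R v))"
    using dL_W[of "(x, r *\<^sub>R v)"] assms has_derivative_linear by auto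
  have "r * dL (x, r *\<^sub>R v) (0, b) = r\<^sup>2 * dL (x, v) (0, b)" for b
    using dL_homog[OF assms, of 0 b] linear_scale[OF l, of r "(0, b)"] by simp
  then have "dL (x, r *\<^sub>R v) (0, b) = r * dL (x, v) (0, b)" for b
    using assms(3) by (simp add: power2_eq_square)
  then show ?thesis by (simp add: Lv_def scaleR_sum_right)
qed

lemma Lx_homog_pos:
  assumes "x \<in> U" "v \<noteq> 0" "0 < r" shows "Lx (x, r *\<^sub>R v) = r\<^sup>2 *\<^sub>R Lx (x, v)"
  using dL_homog[OF assms, of _ 0] by (simp add: Lx_def scaleR_sum_right)

lemma dL_fibre: "x \<in> U \<Longrightarrow> v \<noteq> 0 \<Longrightarrow> dL (x, v) (0, w) = Lv (x, v) \<bullet> w"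
  using dL_inner_W[of "(x, v)" 0 w] by simp

lemma L_path:
  assumes "x \<in> U" "v + s *\<^sub>R w \<noteq> 0"
  shows "((\<lambda>s. L (x, v + s *\<^sub>R w)) has_real_derivative Lv (x, v + s *\<^sub>R w) \<bullet> w) (at s)"
  using path_derivative[OF L_smooth assms] dL_fibre[OF assms]
  by (simp add: has_real_derivative_iff_has_vector_derivative dL_def)

text \<open>The second fibre derivative of \<open>L\<close> in the direction \<open>w\<close>: the
  fundamental tensor at the vector part of \<open>z\<close>, evaluated on the pair
  \<open>(w, w)\<close>.\<close>

definition Hs :: "'e \<times> 'e \<Rightarrow> 'e \<Rightarrow> real" where
  "Hs z w = frechet_derivative Lv (at z) (0, w) \<bullet> w"

lemma Lv_path:
  assumes "x \<in> U" "v + s *\<^sub>R w \<noteq> 0"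
  shows "((\<lambda>s. Lv (x, v + s *\<^sub>R w) \<bullet> w) has_real_derivative Hs (x, v + s *\<^sub>R w) w) (at s)"
  using bounded_linear.has_vector_derivative[OF bounded_linear_inner_left path_derivative[OF Lv_smooth assms], of w]
  by (simp add: has_real_derivative_iff_has_vector_derivative Hs_def)

lemma nonzero_near:
  fixes v w :: 'e assumes "v \<noteq> 0" shows "\<forall>\<^sub>F s in nhds (0::real). v + s *\<^sub>R w \<noteq> 0"
proof -
  have "isCont (\<lambda>s. v + s *\<^sub>R w) 0" by (intro continuous_intros)
  then have "((\<lambda>s. v + s *\<^sub>R w) \<longlongrightarrow> v + 0 *\<^sub>R w) (nhds 0)"
    using continuous_at_imp_continuous_at_within isCont_def tendsto_at_iff_tendsto_nhds by metis
  then show ?thesis using tendsto_imp_eventually_ne[of _ "v + 0 *\<^sub>R w" _ 0] assms by simp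
qed

lemma Hs_pos: assumes "x \<in> U" "v \<noteq> 0" "w \<noteq> 0" shows "0 < Hs (x, v) w"
proof -
  have 1: "deriv (\<lambda>s2. (f (x, v + s1 *\<^sub>R w + s2 *\<^sub>R w))\<^sup>2) 0 = 2 * (Lv (x, v + s1 *\<^sub>R w) \<bullet> w)"
    if "v + s1 *\<^sub>R w \<noteq> 0" for s1
  proof -
    have "((\<lambda>s2. 2 * L (x, v + s1 *\<^sub>R w + s2 *\<^sub>R w)) has_real_derivative 2 * (Lv (x, v + s1 *\<^sub>R w) \<bullet> w)) (at 0)"
      using L_path[of x "v + s1 *\<^sub>R w" 0 w] assms that by (intro DERIV_cmult) auto
    then show ?thesis by (simp add: L_def DERIV_imp_deriv)
  qed
  \<comment> \<open>The inner derivative is known where \<open>v + s1 w\<close> is nonzero, which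
    holds for all \<open>s1\<close> near 0.\<close>
  have "deriv (\<lambda>s1. deriv (\<lambda>s2. (f (x, v + s1 *\<^sub>R w + s2 *\<^sub>R w))\<^sup>2) 0) 0
      = deriv (\<lambda>s1. 2 * (Lv (x, v + s1 *\<^sub>R w) \<bullet> w)) 0"
    by (rule deriv_cong_ev[OF eventually_mono[OF nonzero_near[OF assms(2), of w] 1]]) auto
  also have "\<dots> = 2 * Hs (x, v) w"
    using Lv_path[of x v 0 w] assms by (intro DERIV_imp_deriv DERIV_cmult) auto
  finally show ?thesis using posdef[OF assms] by simp
qed

lemma euler_pos: assumes "x \<in> U" "v \<noteq> 0" shows "Lv (x, v) \<bullet> v = 2 * L (x, v)"
proof -
  have "((\<lambda>s. L (x, v + s *\<^sub>R v)) has_real_derivative Lv (x, v) \<bullet> v) (at 0)"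
    using L_path[of x v 0 v] assms by simp
  moreover have "((\<lambda>s. L (x, v + s *\<^sub>R v)) has_real_derivative 2 * L (x, v)) (at 0)"
  proof (rule has_field_derivative_transform_within_open[where S = "{-1<..<1}"])
    show "((\<lambda>s. (1 + s)\<^sup>2 * L (x, v)) has_real_derivative 2 * L (x, v)) (at 0)"
      by (auto intro!: derivative_eq_intros)
    fix s :: real assume "s \<in> {-1<..<1}"
    then have "L (x, (1 + s) *\<^sub>R v) = (1 + s)\<^sup>2 * L (x, v)" by (intro L_homog assms) auto
    then show "(1 + s)\<^sup>2 * L (x, v) = L (x, v + s *\<^sub>R v)" by (simp add: algebra_simps)
  qed auto
  ultimately show ?thesis by (rule DERIV_unique)
qed

text \<open>By homogeneity and Euler's identity, \<open>Lv (x, (1 + s) v) \<bullet> v\<close> equals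
  \<open>(1 + s) * 2 * L (x, v)\<close> for small \<open>s\<close>. Its derivative at 0 is therefore
  \<open>2 * L (x, v)\<close>, but it is also the positive number
  \<open>Hs (x, v) v\<close>.\<close>

lemma L_pos: assumes "x \<in> U" "v \<noteq> 0" shows "0 < L (x, v)"
proof -
  have "((\<lambda>s. Lv (x, v + s *\<^sub>R v) \<bullet> v) has_real_derivative Hs (x, v) v) (at 0)"
    using Lv_path[of x v 0 v] assms by simp
  moreover have "((\<lambda>s. Lv (x, v + s *\<^sub>R v) \<bullet> v) has_real_derivative 2 * L (x, v)) (at 0)"
  proof (rule has_field_derivative_transform_within_open[where S = "{-1<..<1}"])
    show "((\<lambda>s. (1 + s) * (2 * L (x, v))) has_real_derivative 2 * L (x, v)) (at 0)"
      by (auto intro!: derivative_eq_intros)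
    fix s :: real assume "s \<in> {-1<..<1}"
    then have "Lv (x, (1 + s) *\<^sub>R v) = (1 + s) *\<^sub>R Lv (x, v)" by (intro Lv_homog_pos assms) auto
    moreover have "v + s *\<^sub>R v = (1 + s) *\<^sub>R v" by (simp add: algebra_simps)
    ultimately show "(1 + s) * (2 * L (x, v)) = Lv (x, v + s *\<^sub>R v) \<bullet> v"
      by (simp add: euler_pos[OF assms])
  qed auto
  ultimately show ?thesis using Hs_pos[OF assms assms(2)] DERIV_unique by fastforce
qed

lemma f_pos: "x \<in> U \<Longrightarrow> v \<noteq> 0 \<Longrightarrow> 0 < f (x, v)"
  using L_pos[of x v] nonneg[of "(x, v)"] by (auto simp: L_def less_le)

lemma normalize: "v \<noteq> 0 \<Longrightarrow> v = norm v *\<^sub>R sgn v" for v :: 'e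
  by (simp add: sgn_div_norm)

lemma f_bounds:
  assumes "compact K" "K \<subseteq> U"
  shows "\<exists>m>0. \<exists>M>0. \<forall>x\<in>K. \<forall>v. m * norm v \<le> f (x, v) \<and> f (x, v) \<le> M * norm v"
proof (cases "K = {}")
  case False
  let ?S = "K \<times> sphere (0::'e) 1"
  have S: "compact ?S" using assms by (intro compact_Times) auto
  have "?S \<noteq> {}" using False by (auto intro: exI[of _ "SOME b. b \<in> Basis"] simp: some_in_eq)
  note ne = this
  have c: "continuous_on ?S f" by (rule continuous_on_subset[OF cont_f]) (use assms in auto)
  obtain a where a: "a \<in> ?S" "\<forall>z\<in>?S. f a \<le> f z"
    using continuous_attains_inf[OF S ne c] by (elim bexE)
  obtain b where b: "b \<in> ?S" "\<forall>z\<in>?S. f z \<le> f b"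
    using continuous_attains_sup[OF S ne c] by (elim bexE)
  note ab = a(1) bspec[OF a(2)] b(1) bspec[OF b(2)]
  have pos: "0 < f z" if "z \<in> ?S" for z
  proof -
    have "fst z \<in> U" "snd z \<noteq> 0" using that assms(2) by auto
    then show ?thesis using f_pos[of "fst z" "snd z"] by simp
  qed
  have "f a * norm v \<le> f (x, v) \<and> f (x, v) \<le> f b * norm v" if "x \<in> K" for x v
  proof (cases "v = 0")
    case True then show ?thesis using f_zero that assms by auto
  next
    case False
    have z: "(x, sgn v) \<in> ?S" using that False by (simp add: norm_sgn)
    have "f (x, norm v *\<^sub>R sgn v) = norm v * f (x, sgn v)" using f_homog that assms by auto
    then have "f (x, v) = norm v * f (x, sgn v)" using normalize[OF False] by simp
    then show ?thesis using ab(2)[OF z] ab(4)[OF z] by (simp add: mult.commute mult_left_mono)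
  qed
  then show ?thesis using pos[OF ab(1)] pos[OF ab(3)] by blast
qed (auto intro: exI[of _ 1])

text \<open>The quadratic bound of \<open>L\<close> by \<open>M^2\<close> times the squared norm
  gives one derivative on the zero section, namely zero. No more can be expected: \<open>L\<close>
  may fail to be twice differentiable at zero vectors.\<close>

lemma dL_zero: assumes "x \<in> U" shows "(L has_derivative (\<lambda>_. 0)) (at (x, 0))"
proof -
  obtain r where r: "0 < r" "cball x r \<subseteq> U" using open_U assms open_contains_cball by blast
  obtain M where M: "M > 0" "\<And>y v. y \<in> cball x r \<Longrightarrow> f (y, v) \<le> M * norm v"
    using f_bounds[OF compact_cball r(2)] by blast
  show ?thesis
  proof (rule has_derivativeI_sandwich[of r])
    show "((\<lambda>z. M\<^sup>2 * norm (z - (x, 0))) \<longlongrightarrow> 0) (at (x, 0))"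
      by (rule tendsto_eq_intros refl | simp)+
    fix z :: "'e \<times> 'e" assume z: "z \<noteq> (x, 0)" "dist z (x, 0) < r"
    have "dist (fst z) x \<le> dist z (x, 0)" using dist_fst_le[of z "(x, 0)"] by simp
    then have "fst z \<in> cball x r" using z by (simp add: dist_commute)
    then have "f z \<le> M * norm (snd z)" using M(2)[of "fst z" "snd z"] by simp
    moreover have "norm (snd z) \<le> norm (z - (x, 0))" by (metis norm_snd_le prod.collapse snd_diff snd_conv diff_zero)
    ultimately have "f z \<le> M * norm (z - (x, 0))" using M(1) by (meson mult_left_mono less_imp_le order_trans)
    then have "(f z)\<^sup>2 \<le> (M * norm (z - (x, 0)))\<^sup>2" using nonneg by (intro power_mono) auto
    moreover have "L z \<le> (f z)\<^sup>2" by (simp add: L_def)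
    ultimately have "L z \<le> M\<^sup>2 * norm (z - (x, 0)) * norm (z - (x, 0))"
      by (simp add: power2_eq_square mult_ac)
    then show "norm (L z - L (x, 0) - 0) / norm (z - (x, 0)) \<le> M\<^sup>2 * norm (z - (x, 0))"
      using z(1) f_zero[OF assms] by (simp add: divide_le_eq L_def)
  qed (use r in auto)
qed

lemma Lx_zero: "x \<in> U \<Longrightarrow> Lx (x, 0) = 0" and Lv_zero: "x \<in> U \<Longrightarrow> Lv (x, 0) = 0"
  using frechet_derivative_at[OF dL_zero, of x] by (simp_all add: Lx_def Lv_def dL_def flip: frechet_derivative_at[OF dL_zero, of x])

lemma L_derivative:
  assumes "x \<in> U" shows "(L has_derivative (\<lambda>(h, k). Lx (x, v) \<bullet> h + Lv (x, v) \<bullet> k)) (at (x, v))"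
proof (cases "v = 0")
  case True then show ?thesis using dL_zero Lx_zero Lv_zero assms by (simp add: case_prod_unfold)
next
  case False
  have "dL (x, v) = (\<lambda>(h, k). Lx (x, v) \<bullet> h + Lv (x, v) \<bullet> k)" using dL_inner_W[of "(x, v)"] assms False by auto
  then show ?thesis using dL_W[of "(x, v)"] assms False by simp
qed

lemma Lx_homog: "x \<in> U \<Longrightarrow> 0 \<le> r \<Longrightarrow> Lx (x, r *\<^sub>R v) = r\<^sup>2 *\<^sub>R Lx (x, v)"
  using Lx_homog_pos[of x v r] Lx_zero[of x] by (cases "r = 0 \<or> v = 0") auto
lemma Lv_homog: "x \<in> U \<Longrightarrow> 0 \<le> r \<Longrightarrow> Lv (x, r *\<^sub>R v) = r *\<^sub>R Lv (x, v)"
  using Lv_homog_pos[of x v r] Lv_zero[of x] by (cases "r = 0 \<or> v = 0") auto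
lemma euler: "x \<in> U \<Longrightarrow> Lv (x, v) \<bullet> v = 2 * L (x, v)"
  using euler_pos[of x v] f_zero[of x] by (cases "v = 0") (auto simp: L_def)

section \<open>Estimates that are uniform over compact sets of base points\<close>

text \<open>By homogeneity the longer of the two vectors may be taken of norm 1. If the other one is
  within distance 1/2 of it, the segment between them stays away from zero and the mean value
  inequality applies; otherwise a bound on \<open>g\<close> is enough. The powers of the norms arise
  from scaling back.\<close>

lemma homog_lipschitz:
  fixes g :: "'e \<times> 'e \<Rightarrow> 'e"
  assumes g: "Cinf_on W g" and K: "compact K" "convex K" "K \<subseteq> U"
    and hom: "\<And>x v r. x \<in> U \<Longrightarrow> 0 \<le> r \<Longrightarrow> g (x, r *\<^sub>R v) = r ^ Suc k *\<^sub>R g (x, v)"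
  shows "\<exists>C\<ge>0. \<forall>x\<in>K. \<forall>x'\<in>K. \<forall>v v'. norm (g (x', v') - g (x, v)) \<le>
     C * (max (norm v) (norm v') ^ Suc k * norm (x' - x) + max (norm v) (norm v') ^ k * norm (v' - v))"
proof -
  let ?sh = "K \<times> (cball (0::'e) 2 - ball 0 (1/2))"
  have sh: "compact ?sh" "?sh \<subseteq> W" using K by (auto intro!: compact_Times compact_diff)
  obtain B where B: "0 \<le> B" "\<And>z. z \<in> ?sh \<Longrightarrow> onorm (frechet_derivative g (at z)) \<le> B"
    using C1_bound_on_compact[OF Cinf_on_imp_Ck_on[OF g] sh] by metis
  have "bounded (g ` ?sh)"
    using compact_continuous_image[OF continuous_on_subset[OF Cinf_on_imp_continuous_on[OF g] sh(2)] sh(1)]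
    by (rule compact_imp_bounded)
  then obtain C0 where C0: "0 < C0" "\<And>z. z \<in> ?sh \<Longrightarrow> norm (g z) \<le> C0" by (auto simp: bounded_pos)
  \<comment> \<open>\<open>4 * C0\<close> is for vectors far apart: there
    \<open>norm (v' - v) > 1/2\<close>, so the crude bound \<open>2 * C0\<close> is at most
    \<open>4 * C0 * norm (v' - v)\<close>.\<close>
  define C where "C = max B (4 * C0)"
  have C: "0 \<le> C" "B \<le> C" "4 * C0 \<le> C" using B(1) by (auto simp: C_def)
  have g0: "g (x, 0) = 0" if "x \<in> U" for x using hom[OF that, of 0 0] by simp
  have bd: "norm (g (x, v)) \<le> C0" if "x \<in> K" "norm v \<le> 1" for x v
  proof (cases "v = 0")
    case True then show ?thesis using g0 that K C0(1) by auto
  next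
    case False
    have "g (x, norm v *\<^sub>R sgn v) = norm v ^ Suc k *\<^sub>R g (x, sgn v)" using hom that K by auto
    then have "norm (g (x, v)) = norm v ^ Suc k * norm (g (x, sgn v))" using normalize[OF False] by simp
    also have "\<dots> \<le> 1 * C0"
      using that False by (intro mult_mono C0 power_le_one) (auto simp: norm_sgn)
    finally show ?thesis by simp
  qed
  have unit: "norm (g (x', v') - g (x, v)) \<le> C * (norm (x' - x) + norm (v' - v))"
    if x: "x \<in> K" "x' \<in> K" and v: "norm v = 1" "norm v' \<le> 1" for x x' v v'
  proof (cases "norm (v' - v) \<le> 1/2")
    case True
    let ?S = "K \<times> cball v (1/2)"
    have S: "?S \<subseteq> ?sh"
    proof
      fix z assume z: "z \<in> ?S"
      then have "norm (v - snd z) \<le> 1/2" by (auto simp: dist_norm)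
      then have "norm (snd z) \<le> 3/2" "norm (snd z) \<ge> 1/2"
        using norm_triangle_ineq2[of v "snd z"] norm_triangle_ineq2[of "snd z" v] v by (auto simp: norm_minus_commute)
      then show "z \<in> ?sh" using z by auto
    qed
    have "norm (g (x', v') - g (x, v)) \<le> B * norm ((x', v') - (x, v))"
    proof (rule differentiable_bound[where f = g and S = ?S and f' = "\<lambda>z. frechet_derivative g (at z)"])
      show "convex ?S" using K by (intro convex_Times) auto
      fix z assume z: "z \<in> ?S"
      show "onorm (frechet_derivative g (at z)) \<le> B" using B(2) S z by blast
      show "(g has_derivative frechet_derivative g (at z)) (at z within ?S)"
        using S sh(2) z by (intro has_derivative_at_withinI[OF Cinf_on_has_derivative[OF g]]) blast
    qed (use x True in \<open>auto simp: dist_norm norm_minus_commute\<close>)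
    also have "\<dots> \<le> C * (norm (x' - x) + norm (v' - v))"
      using norm_Pair_le[of "x' - x" "v' - v"] C B(1) by (intro mult_mono) auto
    finally show ?thesis .
  next
    case False
    have "norm (g (x', v') - g (x, v)) \<le> C0 + C0"
      by (rule order_trans[OF norm_triangle_ineq4]) (intro add_mono bd, use x v in auto)
    also have "\<dots> \<le> (4 * C0) * norm (v' - v)" using False C0(1) by (simp add: field_simps)
    also have "\<dots> \<le> C * (norm (x' - x) + norm (v' - v))" using C by (intro mult_mono) auto
    finally show ?thesis .
  qed
  have ord: "norm (g (x', v') - g (x, v)) \<le> C * (norm v ^ Suc k * norm (x' - x) + norm v ^ k * norm (v' - v))"
    if x: "x \<in> K" "x' \<in> K" and v: "norm v' \<le> norm v" for x x' v v'
  proof (cases "v = 0")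
    case True then show ?thesis using v g0[OF subsetD[OF K(3) x(1)]] g0[OF subsetD[OF K(3) x(2)]] by simp
  next
    case False
    define l where "l = norm v"
    have l: "0 < l" using False by (simp add: l_def)
    define a a' where "a = inverse l *\<^sub>R v" and "a' = inverse l *\<^sub>R v'"
    have e: "v = l *\<^sub>R a" "v' = l *\<^sub>R a'" using l by (auto simp: a_def a'_def)
    have "norm a = 1" "norm a' \<le> 1" using l v by (auto simp: a_def a'_def l_def field_simps)
    from unit[OF x this] have u: "norm (g (x', a') - g (x, a)) \<le> C * (norm (x' - x) + norm (a' - a))" .
    have na: "norm (v' - v) = l * norm (a' - a)" unfolding e using l by (simp flip: scaleR_diff_right)
    have "g (x', v') - g (x, v) = l ^ Suc k *\<^sub>R (g (x', a') - g (x, a))"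
      unfolding e using l by (simp add: hom[OF subsetD[OF K(3) x(1)]] hom[OF subsetD[OF K(3) x(2)]] scaleR_diff_right)
    then have "norm (g (x', v') - g (x, v)) = l ^ Suc k * norm (g (x', a') - g (x, a))" using l by simp
    also have "\<dots> \<le> l ^ Suc k * (C * (norm (x' - x) + norm (a' - a)))"
      using u l by (intro mult_left_mono) auto
    also have "\<dots> = C * (l ^ Suc k * norm (x' - x) + l ^ k * norm (v' - v))"
      by (simp add: na algebra_simps)
    finally show ?thesis by (simp add: l_def)
  qed
  have "norm (g (x', v') - g (x, v)) \<le>
     C * (max (norm v) (norm v') ^ Suc k * norm (x' - x) + max (norm v) (norm v') ^ k * norm (v' - v))"
    if "x \<in> K" "x' \<in> K" for x x' v v'
    using ord[of x x' v' v] ord[of x' x v v'] that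
    by (cases "norm v' \<le> norm v") (auto simp: max_def norm_minus_commute)
  then show ?thesis using C(1) by blast
qed

text \<open>\<open>Hs\<close> is homogeneous of degree 0 in \<open>v\<close> and quadratic in
  \<open>w\<close>, so its minimum over base points in \<open>K\<close> and unit vectors
  \<open>v\<close>, \<open>w\<close> decides.\<close>

lemma Hs_bound:
  assumes "compact K" "K \<subseteq> U"
  shows "\<exists>c>0. \<forall>x\<in>K. \<forall>v w. v \<noteq> 0 \<longrightarrow> c * (norm w)\<^sup>2 \<le> Hs (x, v) w"
proof (cases "K = {}")
  case False
  let ?Sp = "sphere (0::'e) 1"
  let ?S = "(K \<times> ?Sp) \<times> ?Sp"
  have S: "compact ?S" using assms by (intro compact_Times) auto
  have lin: "linear (frechet_derivative Lv (at z))" if "z \<in> W" for z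
    using Cinf_on_has_derivative[OF Lv_smooth that] has_derivative_linear by blast
  have rep: "Hs z w = (\<Sum>b\<in>Basis. (w \<bullet> b) *\<^sub>R frechet_derivative Lv (at z) (0, b)) \<bullet> w" if "z \<in> W" for z w
  proof -
    have "(0, w) = (\<Sum>b\<in>Basis. (w \<bullet> b) *\<^sub>R (0::'e, b))"
      by (simp add: prod_eq_iff fst_sum snd_sum euclidean_representation)
    then have "frechet_derivative Lv (at z) (0, w) = (\<Sum>b\<in>Basis. (w \<bullet> b) *\<^sub>R frechet_derivative Lv (at z) (0, b))"
      by (simp add: linear_sum[OF lin[OF that]] linear_scale[OF lin[OF that]] del: scaleR_Pair)
    then show ?thesis by (simp add: Hs_def)
  qed
  have c: "continuous_on ?S (\<lambda>(z, w). Hs z w)"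
  proof -
    have "continuous_on ?S (\<lambda>y. frechet_derivative Lv (at (fst y)) (0, b))" for b
      by (rule continuous_on_compose2[OF Cinf_on_imp_continuous_on[OF Cinf_on_frechet[OF Lv_smooth]] continuous_on_fst[OF continuous_on_id]])
        (use assms in auto)
    then have "continuous_on ?S (\<lambda>y. (\<Sum>b\<in>Basis. (snd y \<bullet> b) *\<^sub>R frechet_derivative Lv (at (fst y)) (0, b)) \<bullet> snd y)"
      by (intro continuous_intros)
    then show ?thesis
    proof (rule continuous_on_eq)
      fix y assume "y \<in> ?S"
      then have "fst y \<in> W" using assms(2) by (cases y) auto
      then show "(\<Sum>b\<in>Basis. (snd y \<bullet> b) *\<^sub>R frechet_derivative Lv (at (fst y)) (0, b)) \<bullet> snd y = (case y of (z, w) \<Rightarrow> Hs z w)"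
        using rep by (simp add: case_prod_unfold)
    qed
  qed
  have "?S \<noteq> {}" using False by (auto intro: exI[of _ "SOME b. b \<in> Basis"] simp: some_in_eq)
  from continuous_attains_inf[OF S this c]
  obtain a where a: "a \<in> ?S" "\<forall>y\<in>?S. (case a of (z, w) \<Rightarrow> Hs z w) \<le> (case y of (z, w) \<Rightarrow> Hs z w)"
    by (elim bexE)
  define c where "c = (case a of (z, w) \<Rightarrow> Hs z w)"
  have "0 < c"
  proof -
    obtain x v w where e: "a = ((x, v), w)" by (metis surj_pair)
    have "x \<in> U" "v \<noteq> 0" "w \<noteq> 0" using a(1) assms(2) by (auto simp: e)
    then show ?thesis using Hs_pos by (simp add: c_def e)
  qed
  moreover have "c * (norm w)\<^sup>2 \<le> Hs (x, v) w" if x: "x \<in> K" and v: "v \<noteq> 0" for x v w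
  proof (cases "w = 0")
    case True then show ?thesis by (simp add: Hs_def)
  next
    case w: False
    have xU: "x \<in> U" using x assms by auto
    have u: "sgn v \<noteq> 0" using v by (simp add: sgn_zero_iff)
    have hs: "Hs (x, sgn v) w = Hs (x, v) w"
    proof -
      have "((\<lambda>s. norm v * (Lv (x, sgn v + (inverse (norm v) * s) *\<^sub>R w) \<bullet> w)) has_real_derivative
          norm v * (Hs (x, sgn v + (inverse (norm v) * 0) *\<^sub>R w) w * (inverse (norm v) * 1))) (at 0)"
        by (intro DERIV_cmult DERIV_chain2[OF Lv_path[OF xU]] DERIV_ident) (use u in auto)
      moreover have "\<forall>\<^sub>F s in nhds 0. norm v * (Lv (x, sgn v + (inverse (norm v) * s) *\<^sub>R w) \<bullet> w) = Lv (x, v + s *\<^sub>R w) \<bullet> w"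
        using nonzero_near[OF u, of "inverse (norm v) *\<^sub>R w"]
      proof (rule eventually_mono)
        fix s assume s: "sgn v + s *\<^sub>R inverse (norm v) *\<^sub>R w \<noteq> 0"
        have "Lv (x, norm v *\<^sub>R (sgn v + s *\<^sub>R inverse (norm v) *\<^sub>R w)) = norm v *\<^sub>R Lv (x, sgn v + s *\<^sub>R inverse (norm v) *\<^sub>R w)"
          by (rule Lv_homog_pos[OF xU s]) (use v in auto)
        moreover have "norm v *\<^sub>R (sgn v + s *\<^sub>R inverse (norm v) *\<^sub>R w) = v + s *\<^sub>R w"
          using v by (simp add: scaleR_add_right sgn_div_norm)
        ultimately show "norm v * (Lv (x, sgn v + (inverse (norm v) * s) *\<^sub>R w) \<bullet> w) = Lv (x, v + s *\<^sub>R w) \<bullet> w"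
          by (simp add: mult.commute)
      qed
      ultimately have "((\<lambda>s. Lv (x, v + s *\<^sub>R w) \<bullet> w) has_real_derivative Hs (x, sgn v) w) (at 0)"
        using v mult.left_commute[of "norm v"] DERIV_cong_ev[of 0 0 "\<lambda>s. norm v * (Lv (x, sgn v + (inverse (norm v) * s) *\<^sub>R w) \<bullet> w)"
            "\<lambda>s. Lv (x, v + s *\<^sub>R w) \<bullet> w" "Hs (x, sgn v) w" "Hs (x, sgn v) w"] by simp
      then show ?thesis using Lv_path[of x v 0 w] v xU DERIV_unique by fastforce
    qed
    have z: "(x, sgn v) \<in> W" using xU u by simp
    have "Hs (x, sgn v) (norm w *\<^sub>R sgn w) = (norm w)\<^sup>2 * Hs (x, sgn v) (sgn w)"
      using linear_scale[OF lin[OF z], of "norm w" "(0, sgn w)"] by (simp add: Hs_def power2_eq_square)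
    moreover have "c \<le> Hs (x, sgn v) (sgn w)"
      using bspec[OF a(2), of "((x, sgn v), sgn w)"] x v w by (simp add: c_def norm_sgn)
    ultimately show ?thesis
      using hs normalize[OF w] mult_left_mono[of c "Hs (x, sgn v) (sgn w)" "(norm w)\<^sup>2"] by (simp add: mult.commute)
  qed
  ultimately show ?thesis by blast
qed (auto intro: exI[of _ 1])

text \<open>If the segment from \<open>v\<close> to \<open>v'\<close> avoids zero, this is
  \<open>Hs_bound\<close> integrated twice along it. If it meets zero, then \<open>v = 0\<close> or
  \<open>v'\<close> is a nonpositive multiple of \<open>v\<close>, and Euler's identity together
  with the lower bound of \<open>L\<close> settles the claim without second derivatives.\<close>

lemma strong_convexity:
  assumes "compact K" "K \<subseteq> U"
  shows "\<exists>\<mu>>0. \<forall>x\<in>K. \<forall>v v'. L (x, v) + Lv (x, v) \<bullet> (v' - v) + \<mu> * (norm (v' - v))\<^sup>2 \<le> L (x, v')"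
proof -
  obtain c where c: "0 < c" "\<And>x v w. x \<in> K \<Longrightarrow> v \<noteq> 0 \<Longrightarrow> c * (norm w)\<^sup>2 \<le> Hs (x, v) w"
    using Hs_bound[OF assms] by metis
  obtain m where m: "0 < m" "\<And>x v. x \<in> K \<Longrightarrow> m * norm v \<le> f (x, v)"
    using f_bounds[OF assms] by metis
  \<comment> \<open>\<open>c/2\<close> comes from Taylor's formula, \<open>m\<^sup>2/2\<close> from
    squaring \<open>m * norm v \<le> f (x, v)\<close>.\<close>
  define \<mu> where "\<mu> = min (c/2) (m\<^sup>2/2)"
  have Lm: "m\<^sup>2/2 * (norm v)\<^sup>2 \<le> L (x, v)" if "x \<in> K" for x v
  proof -
    have "(m * norm v)\<^sup>2 \<le> (f (x, v))\<^sup>2" using m that by (intro power_mono) auto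
    then show ?thesis by (simp add: L_def power_mult_distrib)
  qed
  have "L (x, v) + Lv (x, v) \<bullet> (v' - v) + \<mu> * (norm (v' - v))\<^sup>2 \<le> L (x, v')" if x: "x \<in> K" for x v v'
  proof -
    have xU: "x \<in> U" using x assms(2) by auto
    define w where "w = v' - v"
    show ?thesis
    proof (cases "\<exists>s\<in>{0..1}. v + s *\<^sub>R w = 0")
      case True
      then obtain s where s: "0 \<le> s" "s \<le> 1" "v + s *\<^sub>R w = 0" by auto
      show ?thesis
      proof (cases "v = 0")
        case True
        have "\<mu> * (norm v')\<^sup>2 \<le> m\<^sup>2/2 * (norm v')\<^sup>2" by (intro mult_right_mono) (auto simp: \<mu>_def)
        then show ?thesis using Lm[OF x, of v'] True Lv_zero[OF xU] f_zero[OF xU] by (simp add: L_def)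
      next
        case False
        then have s0: "0 < s" using s by (cases "s = 0") auto
        \<comment> \<open>From \<open>v + s w = 0\<close> one gets \<open>w = - (1 + l) v\<close>
          and \<open>v' = - l v\<close>.\<close>
        define l where "l = 1 / s - 1"
        have l: "0 \<le> l" using s s0 by (simp add: l_def)
        have w: "w = - ((1 + l) *\<^sub>R v)"
        proof -
          have "s *\<^sub>R w = - v" using s(3) by (simp add: eq_neg_iff_add_eq_0 add.commute)
          then have "(1 / s) *\<^sub>R (s *\<^sub>R w) = (1/s) *\<^sub>R (- v)" by simp
          then show ?thesis using s0 by (simp add: l_def)
        qed
        have v': "v' = - (l *\<^sub>R v)" using w by (simp add: w_def algebra_simps eq_neg_iff_add_eq_0)
        \<comment> \<open>The lower bounds of \<open>L (x, v')\<close> and of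
          \<open>(1 + 2 * l) * L (x, v)\<close> carry the factors \<open>l\<^sup>2\<close> and
          \<open>1 + 2 * l\<close>, which add up to the factor \<open>(1 + l)\<^sup>2\<close> of the
          squared norm of \<open>w\<close>.\<close>
        have "Lv (x, v) \<bullet> w = - ((1 + l) * (2 * L (x, v)))" using euler[OF xU, of v] by (simp add: w)
        moreover have "m\<^sup>2/2 * (l\<^sup>2 * (norm v)\<^sup>2) \<le> L (x, v')"
          using Lm[OF x, of v'] by (simp add: v' power_mult_distrib)
        moreover have "(1 + 2 * l) * (m\<^sup>2/2 * (norm v)\<^sup>2) \<le> (1 + 2 * l) * L (x, v)"
          using l Lm[OF x, of v] by (intro mult_left_mono) auto
        moreover have "\<mu> * (norm w)\<^sup>2 \<le> m\<^sup>2/2 * ((1 + l)\<^sup>2 * (norm v)\<^sup>2)"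
        proof -
          have "(norm w)\<^sup>2 = (1 + l)\<^sup>2 * (norm v)\<^sup>2" unfolding w by (simp add: power_mult_distrib)
          then show ?thesis using mult_right_mono[of \<mu> "m\<^sup>2/2" "(norm w)\<^sup>2"] by (simp add: \<mu>_def)
        qed
        ultimately show ?thesis unfolding w_def[symmetric]
          by (simp add: power2_eq_square algebra_simps)
      qed
    next
      case False
      \<comment> \<open>\<open>p\<close> vanishes at 0 together with its derivative, and its second
        derivative is nonnegative by the choice of \<open>c\<close>. The claim is
        \<open>0 \<le> p 1\<close>.\<close>
      define p where "p s = L (x, v + s *\<^sub>R w) - L (x, v) - s * (Lv (x, v) \<bullet> w) - c * (norm w)\<^sup>2 * s\<^sup>2 / 2" for s
      have d: "\<exists>y. (p has_real_derivative y) (at s) \<and> 0 \<le> y" if s: "0 \<le> s" "s \<le> 1" for s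
      proof (intro exI conjI)
        show "(p has_real_derivative (Lv (x, v + s *\<^sub>R w) \<bullet> w - Lv (x, v) \<bullet> w - c * (norm w)\<^sup>2 * s)) (at s)"
          unfolding p_def[abs_def] using False s
          by (auto intro!: derivative_eq_intros L_path[OF xU])
        have "\<exists>y. ((\<lambda>s. Lv (x, v + s *\<^sub>R w) \<bullet> w - c * (norm w)\<^sup>2 * s) has_real_derivative y) (at u) \<and> 0 \<le> y"
          if u: "0 \<le> u" "u \<le> s" for u
        proof (intro exI conjI)
          show "((\<lambda>s. Lv (x, v + s *\<^sub>R w) \<bullet> w - c * (norm w)\<^sup>2 * s) has_real_derivative
              (Hs (x, v + u *\<^sub>R w) w - c * (norm w)\<^sup>2)) (at u)"
            using False u s by (auto intro!: derivative_eq_intros Lv_path[OF xU])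
          show "0 \<le> Hs (x, v + u *\<^sub>R w) w - c * (norm w)\<^sup>2"
            using c(2)[OF x, of "v + u *\<^sub>R w" w] False u s by auto
        qed
        then have "Lv (x, v + 0 *\<^sub>R w) \<bullet> w - c * (norm w)\<^sup>2 * 0 \<le> Lv (x, v + s *\<^sub>R w) \<bullet> w - c * (norm w)\<^sup>2 * s"
          by (intro DERIV_nonneg_imp_nondecreasing[OF s(1)]) blast
        then show "0 \<le> Lv (x, v + s *\<^sub>R w) \<bullet> w - Lv (x, v) \<bullet> w - c * (norm w)\<^sup>2 * s" by simp
      qed
      have "p 0 \<le> p 1" by (rule DERIV_nonneg_imp_nondecreasing) (use d in auto)
      moreover have "\<mu> * (norm w)\<^sup>2 \<le> c/2 * (norm w)\<^sup>2" by (intro mult_right_mono) (auto simp: \<mu>_def)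
      ultimately show ?thesis unfolding w_def[symmetric] by (simp add: p_def w_def)
    qed
  qed
  moreover have "0 < \<mu>" using c(1) m(1) by (simp add: \<mu>_def)
  ultimately show ?thesis by blast
qed

text \<open>The error of the first order Taylor expansion of \<open>L\<close> at
  \<open>(x, v)\<close>.\<close>

definition remainder :: "'e \<Rightarrow> 'e \<Rightarrow> 'e \<Rightarrow> 'e \<Rightarrow> real" where
  "remainder x v y v' = L (y, v') - L (x, v) - Lx (x, v) \<bullet> (y - x) - Lv (x, v) \<bullet> (v' - v)"

end

text \<open>The powers of \<open>max (norm v) (norm v')\<close> in the Lipschitz bounds are dictated
  by homogeneity, of degree 2 for \<open>Lx\<close> and 1 for \<open>Lv\<close>; with them the
  bounds hold for all velocities, across the zero section as well. Convexity of \<open>K\<close>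
  provides segments between base points.\<close>

locale finsler_estimates = local_finsler U f for U :: "'e::euclidean_space set" and f +
  fixes K :: "'e set" and \<mu> C m :: real
  assumes K: "compact K" "convex K" "K \<subseteq> U" and const_pos: "0 < \<mu>" "0 \<le> C" "0 < m"
    and f_lower: "x \<in> K \<Longrightarrow> m * norm v \<le> f (x, v)"
    and Lx_lip: "x \<in> K \<Longrightarrow> x' \<in> K \<Longrightarrow> norm (Lx (x', v') - Lx (x, v)) \<le>
      C * ((max (norm v) (norm v'))\<^sup>2 * norm (x' - x) + max (norm v) (norm v') * norm (v' - v))"
    and Lv_lip: "x \<in> K \<Longrightarrow> x' \<in> K \<Longrightarrow> norm (Lv (x', v') - Lv (x, v)) \<le>
      C * (max (norm v) (norm v') * norm (x' - x) + norm (v' - v))"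
    and convexity: "x \<in> K \<Longrightarrow> L (x, v) + Lv (x, v) \<bullet> (v' - v) + \<mu> * (norm (v' - v))\<^sup>2 \<le> L (x, v')"

lemma (in local_finsler) estimates_exist:
  assumes K: "compact K" "convex K" "K \<subseteq> U"
  shows "\<exists>\<mu> C m. finsler_estimates U f K \<mu> C m"
proof -
  obtain \<mu> where \<mu>: "0 < \<mu>" "\<And>x v v'. x \<in> K \<Longrightarrow> L (x, v) + Lv (x, v) \<bullet> (v' - v) + \<mu> * (norm (v' - v))\<^sup>2 \<le> L (x, v')"
    using strong_convexity[OF K(1,3)] by metis
  obtain m where m: "0 < m" "\<And>x v. x \<in> K \<Longrightarrow> m * norm v \<le> f (x, v)"
    using f_bounds[OF K(1,3)] by metis
  obtain C1 where C1: "0 \<le> C1" "\<And>x x' v v'. x \<in> K \<Longrightarrow> x' \<in> K \<Longrightarrow> norm (Lx (x', v') - Lx (x, v)) \<le>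
     C1 * (max (norm v) (norm v') ^ Suc 1 * norm (x' - x) + max (norm v) (norm v') ^ 1 * norm (v' - v))"
    using homog_lipschitz[OF Lx_smooth K, of 1] Lx_homog by (metis (no_types, lifting) Suc_1)
  obtain C2 where C2: "0 \<le> C2" "\<And>x x' v v'. x \<in> K \<Longrightarrow> x' \<in> K \<Longrightarrow> norm (Lv (x', v') - Lv (x, v)) \<le>
     C2 * (max (norm v) (norm v') ^ Suc 0 * norm (x' - x) + max (norm v) (norm v') ^ 0 * norm (v' - v))"
    using homog_lipschitz[OF Lv_smooth K, of 0] Lv_homog by (metis (no_types, lifting) power_one_right One_nat_def)
  define C where "C = max C1 C2"
  have "finsler_estimates U f K \<mu> C m"
  proof unfold_locales
    fix x x' v v' assume x: "x \<in> K" "x' \<in> K"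
    have "C1 * y \<le> C * y" "C2 * y \<le> C * y" if "0 \<le> y" for y
      using that by (auto simp: C_def intro!: mult_right_mono)
    note le = this
    show "norm (Lx (x', v') - Lx (x, v)) \<le>
      C * ((max (norm v) (norm v'))\<^sup>2 * norm (x' - x) + max (norm v) (norm v') * norm (v' - v))"
      using C1(2)[OF x, of v' v] by (rule order_trans) (auto simp: power2_eq_square max_def intro!: le)
    show "norm (Lv (x', v') - Lv (x, v)) \<le>
      C * (max (norm v) (norm v') * norm (x' - x) + norm (v' - v))"
      using C2(2)[OF x, of v' v] by (rule order_trans) (auto simp: max_def intro!: le)
  qed (use K \<mu> m C1(1) in \<open>auto simp: C_def\<close>)
  then show ?thesis by blast
qed

context finsler_estimates begin

text \<open>The base point is moved first, at the velocity \<open>v'\<close>, and then the velocity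
  at the base point \<open>x\<close>. The first move costs at most \<open>B\<close> by the mean
  value theorem. The second is bounded below by strong convexity, for the minimizing property, and
  above by the Lipschitz bound on \<open>Lv\<close>, for the first variation of the energy.\<close>

lemma remainder_bounds:
  fixes x v y v' :: 'e
  assumes x: "x \<in> K" and y: "y \<in> K"
  defines "l \<equiv> max (norm v) (norm v')"
  defines "B \<equiv> C * norm (y - x) * (l\<^sup>2 * norm (y - x) + l * norm (v' - v))"
  shows "\<mu> * (norm (v' - v))\<^sup>2 - B \<le> remainder x v y v'"
    and "\<bar>remainder x v y v'\<bar> \<le> C * (norm (v' - v))\<^sup>2 + B"
proof -
  have U: "x \<in> U" "y \<in> U" using x y K by auto
  have l0: "0 \<le> l" by (simp add: l_def le_max_iff_disj)
  define h where "h = y - x"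
  have "\<exists>z. z > 0 \<and> z < 1 \<and> L (x + 1 *\<^sub>R h, v') - L (x + 0 *\<^sub>R h, v') = (1 - 0) * (Lx (x + z *\<^sub>R h, v') \<bullet> h)"
  proof (rule MVT2)
    fix s :: real assume s: "0 \<le> s" "s \<le> 1"
    have "x + s *\<^sub>R h \<in> K"
      using convexD_alt[OF K(2) x y, of s] s by (simp add: h_def algebra_simps)
    then have sU: "x + s *\<^sub>R h \<in> U" using K by auto
    have "((\<lambda>s. (x + s *\<^sub>R h, v')) has_derivative (\<lambda>t. (t *\<^sub>R h, 0))) (at s)"
      by (auto intro!: derivative_eq_intros)
    from has_derivative_compose[OF this L_derivative[OF sU, of v']]
    show "((\<lambda>s. L (x + s *\<^sub>R h, v')) has_real_derivative Lx (x + s *\<^sub>R h, v') \<bullet> h) (at s)"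
      by (simp add: has_field_derivative_def mult.commute[of _ "Lx _ \<bullet> h"] fun_eq_iff)
  qed auto
  then obtain z where z: "0 < z" "z < 1" "L (y, v') - L (x, v') = Lx (x + z *\<^sub>R h, v') \<bullet> h"
    by (auto simp: h_def)
  have zK: "x + z *\<^sub>R h \<in> K"
    using convexD_alt[OF K(2) x y, of z] z by (simp add: h_def algebra_simps)
  have "norm (Lx (x + z *\<^sub>R h, v') - Lx (x, v)) \<le> C * (l\<^sup>2 * norm (x + z *\<^sub>R h - x) + l * norm (v' - v))"
    unfolding l_def by (rule Lx_lip[OF x zK])
  also have "\<dots> \<le> C * (l\<^sup>2 * norm h + l * norm (v' - v))"
    using z const_pos l0 by (intro mult_left_mono add_mono) (auto simp: mult_left_le_one_le)
  finally have "norm (Lx (x + z *\<^sub>R h, v') - Lx (x, v)) * norm h \<le> (C * (l\<^sup>2 * norm h + l * norm (v' - v))) * norm h"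
    by (intro mult_right_mono) auto
  then have "\<bar>(Lx (x + z *\<^sub>R h, v') - Lx (x, v)) \<bullet> h\<bar> \<le> B"
    using Cauchy_Schwarz_ineq2[of "Lx (x + z *\<^sub>R h, v') - Lx (x, v)" h] by (simp add: B_def h_def mult_ac)
  then have 1: "\<bar>L (y, v') - L (x, v') - Lx (x, v) \<bullet> (y - x)\<bar> \<le> B"
    using z(3) by (simp add: inner_diff_left h_def)
  show "\<mu> * (norm (v' - v))\<^sup>2 - B \<le> remainder x v y v'"
    using 1 convexity[OF x, of v v'] by (simp add: remainder_def)
  define w where "w = v' - v"
  have "\<exists>z. z > 0 \<and> z < 1 \<and> L (x, v + 1 *\<^sub>R w) - L (x, v + 0 *\<^sub>R w) = (1 - 0) * (Lv (x, v + z *\<^sub>R w) \<bullet> w)"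
  proof (rule MVT2)
    fix s :: real
    have "((\<lambda>s. (x, v + s *\<^sub>R w)) has_derivative (\<lambda>t. (0, t *\<^sub>R w))) (at s)"
      by (auto intro!: derivative_eq_intros)
    from has_derivative_compose[OF this L_derivative[OF U(1), of "v + s *\<^sub>R w"]]
    show "((\<lambda>s. L (x, v + s *\<^sub>R w)) has_real_derivative Lv (x, v + s *\<^sub>R w) \<bullet> w) (at s)"
      by (simp add: has_field_derivative_def mult.commute[of _ "Lv _ \<bullet> w"] fun_eq_iff)
  qed auto
  then obtain \<xi> where \<xi>: "0 < \<xi>" "\<xi> < 1" "L (x, v') - L (x, v) = Lv (x, v + \<xi> *\<^sub>R w) \<bullet> w"
    by (auto simp: w_def)
  have "norm (Lv (x, v + \<xi> *\<^sub>R w) - Lv (x, v)) \<le> C * norm w"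
    using Lv_lip[OF x x, of "v + \<xi> *\<^sub>R w" v] \<xi> const_pos mult_left_mono[of "\<xi> * norm w" "norm w" C]
    by (simp add: mult_left_le_one_le)
  then have "norm (Lv (x, v + \<xi> *\<^sub>R w) - Lv (x, v)) * norm w \<le> C * norm w * norm w"
    by (intro mult_right_mono) auto
  then have "\<bar>(Lv (x, v + \<xi> *\<^sub>R w) - Lv (x, v)) \<bullet> w\<bar> \<le> C * (norm w)\<^sup>2"
    using Cauchy_Schwarz_ineq2[of "Lv (x, v + \<xi> *\<^sub>R w) - Lv (x, v)" w] by (simp add: power2_eq_square)
  then have "\<bar>L (x, v') - L (x, v) - Lv (x, v) \<bullet> w\<bar> \<le> C * (norm w)\<^sup>2"
    using \<xi>(3) by (simp add: inner_diff_left)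
  then show "\<bar>remainder x v y v'\<bar> \<le> C * (norm (v' - v))\<^sup>2 + B"
    using 1 by (simp add: remainder_def w_def)
qed

text \<open>The convexity inequality, added to itself with \<open>v\<close> and \<open>v'\<close>
  exchanged.\<close>

lemma Lv_monotone:
  assumes "x \<in> K" shows "2 * \<mu> * (norm (v' - v))\<^sup>2 \<le> (Lv (x, v') - Lv (x, v)) \<bullet> (v' - v)"
  using convexity[OF assms, of v v'] convexity[OF assms, of v' v]
  by (simp add: norm_minus_commute inner_diff_left inner_diff_right)

end

section \<open>The geodesic flow\<close>

context local_finsler begin

text \<open>Written out, the Euler-Lagrange equation says that the fibre derivative of
  \<open>Lv\<close>, applied to the acceleration, equals \<open>Lx\<close> minus the base derivative
  of \<open>Lv\<close> along the velocity. The fibre derivative is injective because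
  \<open>Hs\<close> is positive, so off the zero section this is a smooth first order
  system.\<close>

theorem geodesic_flow:
  assumes B: "open B" "B \<subseteq> U" and Z: "compact Z" "Z \<subseteq> B \<times> (UNIV - {0})"
  shows "\<exists>T>0. \<forall>z\<in>Z. \<exists>x u. Cinf_on {-T<..<T} x \<and> Cinf_on {-T<..<T} u \<and> x 0 = fst z \<and> u 0 = snd z \<and>
    (\<forall>t\<in>{-T<..<T}. x t \<in> B \<and> u t \<noteq> 0 \<and> (x has_vector_derivative u t) (at t) \<and>
      ((\<lambda>t. Lv (x t, u t)) has_vector_derivative Lx (x t, u t)) (at t) \<and> f (x t, u t) = f z)"
proof -
  define D where "D z = frechet_derivative Lv (at z)" for z
  have D: "(Lv has_derivative D z) (at z)" if "z \<in> W" for z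
    unfolding D_def by (rule Cinf_on_has_derivative[OF Lv_smooth that])
  have linD: "linear (D z)" if "z \<in> W" for z using D[OF that] has_derivative_linear by blast
  \<comment> \<open>The basis expansion makes \<open>M z\<close> linear for every \<open>z\<close>,
    also for those where \<open>Lv\<close> is not known to be differentiable.\<close>
  define M where "M z a = (\<Sum>b\<in>Basis. (a \<bullet> b) *\<^sub>R D z (0, b))" for z a
  have linM: "linear (M z)" for z
    unfolding M_def[abs_def]
    by (intro linear_compose_sum ballI bounded_linear.linear bounded_linear_scaleR_const bounded_linear_inner_left)
  have MD: "M z a = D z (0, a)" if "z \<in> W" for z a
  proof -
    have "(0, a) = (\<Sum>b\<in>Basis. (a \<bullet> b) *\<^sub>R (0::'e, b))"
      by (simp add: prod_eq_iff fst_sum snd_sum euclidean_representation)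
    then show ?thesis
      by (simp add: M_def linear_sum[OF linD[OF that]] linear_scale[OF linD[OF that]] del: scaleR_Pair)
  qed
  have M0: "a = 0" if "z \<in> W" "M z a = 0" for z a
  proof (rule ccontr)
    assume "a \<noteq> 0"
    moreover have "fst z \<in> U" "snd z \<noteq> 0" using that(1) by (auto simp: mem_Times_iff)
    ultimately show False using Hs_pos[of "fst z" "snd z" a] that MD[OF that(1), of a] by (simp add: Hs_def D_def)
  qed
  define N where "N z = (\<Sum>b\<in>Basis. (snd z \<bullet> b) *\<^sub>R D z (b, 0))" for z
  have ND: "N z = D z (snd z, 0)" if "z \<in> W" for z
  proof -
    have "(snd z, 0) = (\<Sum>b\<in>Basis. (snd z \<bullet> b) *\<^sub>R (b, 0::'e))"
      by (simp add: prod_eq_iff fst_sum snd_sum euclidean_representation)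
    then show ?thesis
      by (simp add: N_def linear_sum[OF linD[OF that]] linear_scale[OF linD[OF that]] del: scaleR_Pair)
  qed
  define G where "G z = (SOME a. M z a = Lx z - N z)" for z
  have G: "M z (G z) = Lx z - N z" if "z \<in> W" for z
  proof -
    have "inj (M z)" using M0[OF that] linM linear_injective_0 by blast
    then have "surj (M z)" using linM linear_injective_imp_surjective by blast
    then have "\<exists>a. M z a = Lx z - N z" by (metis surjD)
    then show ?thesis unfolding G_def by (rule someI_ex)
  qed
  have G_smooth: "Cinf_on W G"
  proof (rule Cinf_on_linear_solve[where M = M and b = "\<lambda>z. Lx z - N z"])
    show "Cinf_on W (\<lambda>z. M z w)" for w
      unfolding M_def D_def
      by (intro Cinf_on_sum open_W Cinf_on_bounded_linear[OF bounded_linear_scaleR_right] Cinf_on_frechet Lv_smooth)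
    show "Cinf_on W (\<lambda>z. Lx z - N z)"
      unfolding N_def D_def
      by (intro Cinf_on_minus Lx_smooth Cinf_on_sum open_W Cinf_on_bilinear[OF bounded_bilinear_scaleR] Cinf_on_frechet Lv_smooth
          Cinf_on_bounded_linear[OF bounded_linear_inner_left] Cinf_on_linear bounded_linear_snd)
  qed (use linM M0 G open_W in auto)
  define X where "X z = (snd z, G z)" for z
  let ?V = "B \<times> (UNIV - {0::'e})"
  have V: "open ?V" "?V \<subseteq> W" using B by (auto intro!: open_Times open_Diff)
  have X: "Cinf_on ?V X"
    unfolding X_def by (intro Cinf_on_subset[OF _ V(2)] Cinf_on_Pair open_W Cinf_on_linear bounded_linear_snd G_smooth)
  define P where "P T z \<longleftrightarrow> (\<exists>y. y 0 = z \<and> (\<forall>t\<in>{-T<..<T}. y t \<in> ?V \<and> (y has_vector_derivative X (y t)) (at t)))"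
    for T z
  have "\<exists>T>0. \<forall>z\<in>Z. P T z"
  proof (rule compact_uniform_pos[OF Z(1)])
    fix z assume "z \<in> Z"
    then have "z \<in> ?V" using Z by auto
    from ODE_local[OF V(1) this Cinf_on_imp_Ck_on[OF X]] obtain r T where
      rT: "0 < r" "0 < T" "\<forall>y\<in>ball z r. P T y" unfolding P_def by blast
    then show "\<exists>V T. open V \<and> z \<in> V \<and> 0 < T \<and> (\<forall>y\<in>V \<inter> Z. P T y)"
      by (intro exI[of _ "ball z r"] exI[of _ T]) auto
  next
    fix T T' :: real and z assume "P T z" "0 < T'" "T' \<le> T"
    then obtain y where "y 0 = z" "\<forall>t\<in>{-T<..<T}. y t \<in> ?V \<and> (y has_vector_derivative X (y t)) (at t)"
      unfolding P_def by (elim exE conjE)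
    then show "P T' z" unfolding P_def using \<open>T' \<le> T\<close> by (intro exI[of _ y]) auto
  qed
  then obtain T where T: "0 < T" "\<And>z. z \<in> Z \<Longrightarrow> P T z" by blast
  have "\<exists>x u. Cinf_on {-T<..<T} x \<and> Cinf_on {-T<..<T} u \<and> x 0 = fst z \<and> u 0 = snd z \<and>
    (\<forall>t\<in>{-T<..<T}. x t \<in> B \<and> u t \<noteq> 0 \<and> (x has_vector_derivative u t) (at t) \<and>
      ((\<lambda>t. Lv (x t, u t)) has_vector_derivative Lx (x t, u t)) (at t) \<and> f (x t, u t) = f z)"
    if "z \<in> Z" for z
  proof -
    obtain y where y: "y 0 = z" "\<And>t. t \<in> {-T<..<T} \<Longrightarrow> y t \<in> ?V"
      "\<And>t. t \<in> {-T<..<T} \<Longrightarrow> (y has_vector_derivative X (y t)) (at t)"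
      using T(2)[OF \<open>z \<in> Z\<close>] unfolding P_def by auto
    have "Cinf_on {-T<..<T} y"
      by (rule ODE_solution_smooth[OF _ V(1) X]) (use y in auto)
    then have s: "Cinf_on {-T<..<T} (\<lambda>t. fst (y t))" "Cinf_on {-T<..<T} (\<lambda>t. snd (y t))"
      by (auto intro: Cinf_on_bounded_linear bounded_linear_fst bounded_linear_snd)
    have d: "((\<lambda>t. fst (y t)) has_vector_derivative snd (y t)) (at t)"
      "((\<lambda>t. snd (y t)) has_vector_derivative G (y t)) (at t)" if "t \<in> {-T<..<T}" for t
      using bounded_linear.has_vector_derivative[OF bounded_linear_fst y(3)[OF that]]
        bounded_linear.has_vector_derivative[OF bounded_linear_snd y(3)[OF that]] by (simp_all add: X_def)
    have yW: "y t \<in> W" if "t \<in> {-T<..<T}" for t by (rule subsetD[OF V(2) y(2)[OF that]])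
    have Lvd: "((\<lambda>t. Lv (y t)) has_vector_derivative Lx (y t)) (at t)" if t: "t \<in> {-T<..<T}" for t
    proof -
      have "((\<lambda>t. Lv (y t)) has_derivative (\<lambda>h. D (y t) (h *\<^sub>R X (y t)))) (at t)"
        by (rule has_derivative_compose[OF y(3)[OF t, unfolded has_vector_derivative_def] D[OF yW[OF t]]])
      moreover have "D (y t) (X (y t)) = Lx (y t)"
      proof -
        have "X (y t) = (snd (y t), 0) + (0, G (y t))" by (simp add: X_def)
        then have "D (y t) (X (y t)) = N (y t) + M (y t) (G (y t))"
          using linear_add[OF linD[OF yW[OF t]]] ND[OF yW[OF t]] MD[OF yW[OF t]] by metis
        then show ?thesis using G[OF yW[OF t]] by simp
      qed
      ultimately show ?thesis
        using linear_scale[OF linD[OF yW[OF t]]] by (simp add: has_vector_derivative_def)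
    qed
    have Ld: "((\<lambda>t. L (y t)) has_real_derivative Lx (y t) \<bullet> snd (y t) + Lv (y t) \<bullet> G (y t)) (at t)"
      if t: "t \<in> {-T<..<T}" for t
    proof -
      have "((\<lambda>t. L (y t)) has_derivative (\<lambda>h. dL (y t) (h *\<^sub>R X (y t)))) (at t)"
        by (rule has_derivative_compose[OF y(3)[OF t, unfolded has_vector_derivative_def] dL_W[OF yW[OF t]]])
      then show ?thesis
        using dL_inner_W[OF yW[OF t]] by (simp add: has_real_derivative_iff_has_vector_derivative has_vector_derivative_def X_def algebra_simps)
    qed
    \<comment> \<open>Conservation of energy: by Euler's identity \<open>2 L\<close> is the product
      of momentum and velocity, and by the Euler-Lagrange equation this product has the same
      derivative as \<open>L\<close>; so the derivative of \<open>L\<close> is twice itself.\<close>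
    have "((\<lambda>t. L (y t)) has_real_derivative 0) (at t)" if t: "t \<in> {-T<..<T}" for t
    proof -
      have "((\<lambda>t. Lv (y t) \<bullet> snd (y t)) has_derivative
          (\<lambda>h. Lv (y t) \<bullet> (h *\<^sub>R G (y t)) + (h *\<^sub>R Lx (y t)) \<bullet> snd (y t))) (at t)"
        using Lvd[OF t] d(2)[OF t] unfolding has_vector_derivative_def by (rule has_derivative_inner)
      then have "((\<lambda>t. Lv (y t) \<bullet> snd (y t)) has_real_derivative Lx (y t) \<bullet> snd (y t) + Lv (y t) \<bullet> G (y t)) (at t)"
        by (simp add: has_real_derivative_iff_has_vector_derivative has_vector_derivative_def algebra_simps)
      then have "((\<lambda>t. 2 * L (y t)) has_real_derivative Lx (y t) \<bullet> snd (y t) + Lv (y t) \<bullet> G (y t)) (at t)"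
      proof (rule has_field_derivative_transform_within_open[where S = "{-T<..<T}"])
        fix s assume "s \<in> {-T<..<T}"
        then show "Lv (y s) \<bullet> snd (y s) = 2 * L (y s)" using euler[of "fst (y s)" "snd (y s)"] yW[of s] by auto
      qed (use t in auto)
      moreover have "((\<lambda>t. 2 * L (y t)) has_real_derivative 2 * (Lx (y t) \<bullet> snd (y t) + Lv (y t) \<bullet> G (y t))) (at t)"
        by (rule DERIV_cmult[OF Ld[OF t]])
      ultimately have "Lx (y t) \<bullet> snd (y t) + Lv (y t) \<bullet> G (y t) = 0" using DERIV_unique by fastforce
      then show ?thesis using Ld[OF t] by simp
    qed
    then have "\<exists>c. \<forall>t\<in>{-T<..<T}. L (y t) = c"
      by (intro has_field_derivative_zero_constant) (auto intro: has_field_derivative_at_within)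
    then have "L (y t) = L z" if "t \<in> {-T<..<T}" for t using that T(1) y(1) by force
    note L_eq = this
  have "f (y t) = f z" if "t \<in> {-T<..<T}" for t
      using power2_eq_iff_nonneg[OF nonneg[of "y t"] nonneg[of z]] using L_eq[OF that] by (simp add: L_def)
    note f_eq = this
    have V': "fst (y t) \<in> B" "snd (y t) \<noteq> 0" if "t \<in> {-T<..<T}" for t
      using y(2)[OF that] by (auto simp: mem_Times_iff)
    show ?thesis
    proof (intro exI conjI ballI)
      show "Cinf_on {-T<..<T} (\<lambda>t. fst (y t))" "Cinf_on {-T<..<T} (\<lambda>t. snd (y t))" by (fact s)+
      show "fst (y 0) = fst z" "snd (y 0) = snd z" by (simp_all add: y(1))
      fix t assume t: "t \<in> {-T<..<T}"
      show "fst (y t) \<in> B" "snd (y t) \<noteq> 0" by (fact V'[OF t])+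
      show "((\<lambda>t. fst (y t)) has_vector_derivative snd (y t)) (at t)" by (rule d[OF t])
      show "((\<lambda>t. Lv (fst (y t), snd (y t))) has_vector_derivative Lx (fst (y t), snd (y t))) (at t)"
        using Lvd[OF t] by simp
      show "f (fst (y t), snd (y t)) = f z" using f_eq[OF t] by simp
    qed
  qed
  then show ?thesis using T(1) by blast
qed

end

section \<open>Piecewise C^1 curves and their integrals\<close>

text \<open>The end points belong to the exceptional set \<open>Q\<close>, so that all derivatives
  are two-sided. Boundedness of \<open>x'\<close> does the work of one-sided limits at the break
  points.\<close>

definition piecewise_C1 :: "real set \<Rightarrow> real \<Rightarrow> real \<Rightarrow> (real \<Rightarrow> 'a::real_normed_vector) \<Rightarrow> (real \<Rightarrow> 'a) \<Rightarrow> bool" where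
  "piecewise_C1 Q a b x x' \<longleftrightarrow> finite Q \<and> a \<in> Q \<and> b \<in> Q \<and> continuous_on {a..b} x \<and>
     continuous_on ({a..b} - Q) x' \<and> bounded (x' ` ({a..b} - Q)) \<and>
     (\<forall>t\<in>{a..b} - Q. (x has_vector_derivative x' t) (at t))"

lemma integrable_bounded_continuous_off_finite:
  fixes g :: "real \<Rightarrow> 'a::euclidean_space"
  assumes "finite Q" "continuous_on ({a..b} - Q) g" "bounded (g ` ({a..b} - Q))"
  shows "g integrable_on {a..b}"
proof -
  obtain B where B: "\<And>t. t \<in> {a..b} - Q \<Longrightarrow> norm (g t) \<le> B"
    using assms(3) unfolding bounded_iff by blast
  have S: "{a..b} - Q \<in> sets lebesgue"
    by (intro sets.Diff) (auto intro: negligible_imp_sets negligible_finite assms(1))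
  have neg: "negligible Q" using assms(1) by (rule negligible_finite)
  have i: "(\<lambda>t. B) integrable_on ({a..b} - Q)"
    by (rule integrable_spike_set[OF integrable_const_ivl[of B a b]]) (auto intro: negligible_subset[OF neg])
  have "g integrable_on ({a..b} - Q)"
    by (rule measurable_bounded_by_integrable_imp_integrable[OF _ i B S])
      (use continuous_imp_measurable_on_sets_lebesgue[OF assms(2) S] in auto)
  then show ?thesis
    by (rule integrable_spike_set) (auto intro: negligible_subset[OF neg])
qed

text \<open>Integrability of \<open>\<Phi>'\<close> comes from the fundamental theorem itself: off a
  finite set it is the derivative of a continuous function.\<close>

lemma FTC_le:
  fixes \<Phi> g :: "real \<Rightarrow> real"
  assumes "a \<le> b" "finite Q" "continuous_on {a..b} \<Phi>" "g integrable_on {a..b}"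
    and d: "\<And>t. t \<in> {a..b} - Q \<Longrightarrow> (\<Phi> has_vector_derivative \<Phi>' t) (at t)"
    and le: "\<And>t. t \<in> {a..b} - Q \<Longrightarrow> \<Phi>' t \<le> g t"
  shows "\<Phi> b - \<Phi> a \<le> integral {a..b} g"
proof -
  have "(\<Phi>' has_integral \<Phi> b - \<Phi> a) {a..b}"
    by (rule fundamental_theorem_of_calculus_interior_strong[OF assms(2,1) _ assms(3)]) (use d in auto)
  then have 1: "((\<lambda>t. if t \<in> Q then 0 else \<Phi>' t) has_integral \<Phi> b - \<Phi> a) {a..b}"
    by (rule has_integral_spike_finite[OF assms(2), rotated]) auto
  have 2: "((\<lambda>t. if t \<in> Q then 0 else g t) has_integral integral {a..b} g) {a..b}"
    by (rule has_integral_spike_finite[OF assms(2) _ integrable_integral[OF assms(4)]]) auto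
  show ?thesis by (rule has_integral_le[OF 1 2]) (use le in auto)
qed

lemma piecewise_C1_compose_continuous:
  fixes \<phi> :: "'a::euclidean_space \<times> 'a \<Rightarrow> 'b::euclidean_space"
  assumes "piecewise_C1 Q a b x x'" "continuous_on (S \<times> UNIV) \<phi>" "closed S" "\<And>t. t \<in> {a..b} \<Longrightarrow> x t \<in> S"
  shows "continuous_on ({a..b} - Q) (\<lambda>t. \<phi> (x t, x' t))" "bounded ((\<lambda>t. \<phi> (x t, x' t)) ` ({a..b} - Q))"
    "(\<lambda>t. \<phi> (x t, x' t)) integrable_on {a..b}"
proof -
  have c: "continuous_on ({a..b} - Q) (\<lambda>t. (x t, x' t))"
    using assms(1) by (auto simp: piecewise_C1_def intro!: continuous_on_Pair intro: continuous_on_subset)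
  show 1: "continuous_on ({a..b} - Q) (\<lambda>t. \<phi> (x t, x' t))"
    by (rule continuous_on_compose2[OF assms(2) c]) (use assms(4) in auto)
  obtain B where B: "\<And>t. t \<in> {a..b} - Q \<Longrightarrow> norm (x' t) \<le> B"
    using assms(1) unfolding piecewise_C1_def bounded_iff by blast
  have "compact (x ` {a..b} \<times> cball (0::'a) B)"
    using assms(1) by (intro compact_Times compact_continuous_image) (auto simp: piecewise_C1_def)
  then have "compact (\<phi> ` (x ` {a..b} \<times> cball 0 B))"
    by (rule compact_continuous_image[rotated]) (rule continuous_on_subset[OF assms(2)], use assms(4) in auto)
  then have "bounded (\<phi> ` (x ` {a..b} \<times> cball 0 B))" by (rule compact_imp_bounded)
  then show 2: "bounded ((\<lambda>t. \<phi> (x t, x' t)) ` ({a..b} - Q))"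
    by (rule bounded_subset) (use B in auto)
  show "(\<lambda>t. \<phi> (x t, x' t)) integrable_on {a..b}"
    by (rule integrable_bounded_continuous_off_finite[OF _ 1 2]) (use assms(1) in \<open>simp add: piecewise_C1_def\<close>)
qed

text \<open>Here \<open>a\<close>, \<open>b\<close>, \<open>v\<close> stand for the norms of
  \<open>h'\<close>, \<open>h\<close> and the geodesic's velocity, and \<open>l\<close> for the
  larger of the two speeds. Half of \<open>\<mu> * a\<^sup>2\<close> pays for the error: a quarter
  absorbs the terms in \<open>a\<^sup>2\<close> by smallness of \<open>\<rho>\<close>, a quarter the
  mixed term \<open>C * b * v * a\<close>.\<close>

lemma quadratic_form_bound:
  fixes a b v w l :: real
  assumes nn: "0 \<le> a" "0 \<le> b" "0 \<le> v" "0 \<le> C" "0 < \<mu>" "0 \<le> \<rho>" and "b \<le> \<rho>" "0 \<le> l" "l \<le> v + a"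
    and small: "2 * C * \<rho>\<^sup>2 + C * \<rho> \<le> \<mu> / 4"
  shows "\<mu>/2 * a\<^sup>2 - (2 * C + C\<^sup>2/\<mu>) * (v\<^sup>2 * b\<^sup>2) \<le> \<mu> * a\<^sup>2 - C * b * (l\<^sup>2 * b + l * a)"
proof -
  have l2: "l\<^sup>2 \<le> (v + a)\<^sup>2" using assms by (intro power_mono) auto
  have "(v + a)\<^sup>2 \<le> 2 * v\<^sup>2 + 2 * a\<^sup>2"
    using zero_le_power2[of "v - a"] by (simp add: power2_eq_square algebra_simps)
  then have "l\<^sup>2 * b + l * a \<le> (2 * v\<^sup>2 + 2 * a\<^sup>2) * b + (v + a) * a"
    using assms order_trans[OF l2, of "2 * v\<^sup>2 + 2 * a\<^sup>2"] by (intro add_mono mult_right_mono) auto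
  then have 1: "C * b * (l\<^sup>2 * b + l * a) \<le> C * b * ((2 * v\<^sup>2 + 2 * a\<^sup>2) * b + (v + a) * a)"
    using assms by (intro mult_left_mono) auto
  have "C * b\<^sup>2 \<le> C * \<rho>\<^sup>2" "C * b \<le> C * \<rho>" using assms by (auto intro!: mult_left_mono power_mono)
  then have "2 * C * b\<^sup>2 + C * b \<le> \<mu>/4" using small by linarith
  then have 2: "(2 * C * b\<^sup>2 + C * b) * a\<^sup>2 \<le> \<mu>/4 * a\<^sup>2" by (rule mult_right_mono) simp
  \<comment> \<open>Young's inequality, weighted so that exactly \<open>\<mu>/4\<close> of the
    coefficient of \<open>a\<^sup>2\<close> is spent.\<close>
  have "0 \<le> (sqrt \<mu> / 2 * a - C / sqrt \<mu> * (v * b))\<^sup>2" by simp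
  also have "\<dots> = \<mu>/4 * a\<^sup>2 - C * b * v * a + C\<^sup>2/\<mu> * (v\<^sup>2 * b\<^sup>2)"
    using nn(5) by (simp add: power2_diff power_mult_distrib power_divide)
  finally have 3: "C * b * v * a \<le> \<mu>/4 * a\<^sup>2 + C\<^sup>2/\<mu> * (v\<^sup>2 * b\<^sup>2)" by simp
  have "C * b * ((2 * v\<^sup>2 + 2 * a\<^sup>2) * b + (v + a) * a)
      = 2 * C * (v\<^sup>2 * b\<^sup>2) + (2 * C * b\<^sup>2 + C * b) * a\<^sup>2 + C * b * v * a"
    by (simp add: power2_eq_square algebra_simps)
  then show ?thesis using 1 2 3 by (simp add: algebra_simps)
qed

section \<open>Comparison of a short normal geodesic with its competitors\<close>

context finsler_estimates begin

text \<open>The competitor \<open>y\<close> is compared with the geodesic \<open>x\<close>, reparametrized so that its speed is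
  proportional to the regularized speed \<open>w = f (y, y') + \<delta>\<close> of \<open>y\<close>. Strong convexity of \<open>L\<close> in the
  velocity makes the integrand dominate a total derivative; the term \<open>I \<bar>y - X\<bar>\<^sup>2\<close> in it
  replaces a Poincare inequality.\<close>

theorem short_geodesic_minimizes:
  assumes x: "\<And>t. t \<in> {0..\<tau>} \<Longrightarrow> x t \<in> K"
      "\<And>t. t \<in> {0..\<tau>} \<Longrightarrow> (x has_vector_derivative u t) (at t within {0..\<tau>})"
      "\<And>t. t \<in> {0..\<tau>} \<Longrightarrow> f (x t, u t) = 1"
      "\<And>t. t \<in> {0..\<tau>} \<Longrightarrow> ((\<lambda>t. Lv (x t, u t)) has_vector_derivative Lx (x t, u t)) (at t within {0..\<tau>})"
    and y: "piecewise_C1 Q a b y y'" "a < b" "\<And>s. s \<in> {a..b} \<Longrightarrow> y s \<in> K" "y b = x \<tau>"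
    and normal: "Lv (x 0, u 0) \<bullet> (y a - x 0) = 0"
    and \<tau>: "0 < \<tau>" and \<rho>: "0 < \<rho>" "2 * C * \<rho>\<^sup>2 + C * \<rho> \<le> \<mu> / 4"
    and close: "\<And>s t. s \<in> {a..b} \<Longrightarrow> t \<in> {0..\<tau>} \<Longrightarrow> norm (y s - x t) \<le> \<rho>"
    and small: "8 * (2 * C + C\<^sup>2/\<mu>) * \<tau>\<^sup>2 \<le> \<mu> * m\<^sup>2"
  shows "\<tau> \<le> integral {a..b} (\<lambda>s. f (y s, y' s))"
proof (rule ccontr)
  define g where "g s = f (y s, y' s)" for s
  define l where "l = integral {a..b} g"
  assume "\<not> ?thesis"
  then have l: "l < \<tau>" by (simp add: l_def g_def[abs_def])
  have cf: "continuous_on (K \<times> UNIV) f" by (rule continuous_on_subset[OF cont_f]) (use K in auto)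
  note g_props = piecewise_C1_compose_continuous[OF y(1) cf compact_imp_closed[OF K(1)] y(3), folded g_def]
  have Q: "finite Q" "a \<in> Q" "b \<in> Q" using y(1) by (auto simp: piecewise_C1_def)
  have openQ: "open ({a..b} - Q)"
  proof -
    have "{a..b} - Q = {a<..<b} - Q" using Q by (auto simp: less_le)
    then show ?thesis using Q by (simp add: open_Diff finite_imp_closed)
  qed
  have g0: "0 \<le> g s" for s unfolding g_def by (rule nonneg)
  have l0: "0 \<le> l" unfolding l_def by (rule Henstock_Kurzweil_Integration.integral_nonneg[OF g_props(3) g0])
  \<comment> \<open>Adding \<open>\<delta>\<close> makes \<open>w\<close> positive, so that one can
    divide by it, and this value makes the integral of \<open>w\<close> equal to
    \<open>\<tau>\<close>, so that the reparametrized geodesic and \<open>y\<close> end at the same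
    point at the same time.\<close>
  define \<delta> where "\<delta> = (\<tau> - l) / (b - a)"
  have \<delta>: "0 < \<delta>" using l y(2) by (simp add: \<delta>_def)
  define w where "w s = g s + \<delta>" for s
  have w0: "0 < w s" "g s \<le> w s" for s using \<delta> nonneg[of "(y s, y' s)"] by (auto simp: w_def g_def)
  have wc: "continuous_on ({a..b} - Q) w" unfolding w_def[abs_def] by (intro continuous_intros g_props(1))
  have wi: "w integrable_on {a..b}" unfolding w_def[abs_def]
    by (intro integrable_add g_props(3) integrable_const_ivl)
  \<comment> \<open>The time on the geodesic that belongs to the parameter \<open>s\<close> of the
    competitor.\<close>
  define I where "I s = integral {a..s} w" for s
  have Ib: "I b = \<tau>"
  proof -
    have "I b = integral {a..b} g + integral {a..b} (\<lambda>s. \<delta>)"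
      unfolding I_def w_def[abs_def] by (rule Henstock_Kurzweil_Integration.integral_add[OF g_props(3) integrable_const_ivl])
    then show ?thesis using y(2) by (simp add: l_def[symmetric] \<delta>_def)
  qed
  have Ia: "I a = 0" by (simp add: I_def)
  have I_range: "I s \<in> {0..\<tau>}" if s: "s \<in> {a..b}" for s
  proof -
    have ws: "w integrable_on {a..s}" by (rule integrable_on_subinterval[OF wi]) (use s in auto)
    have "0 \<le> I s" unfolding I_def by (rule Henstock_Kurzweil_Integration.integral_nonneg[OF ws]) (use w0 less_imp_le in blast)
    moreover have "I s \<le> I b" unfolding I_def
      by (rule integral_subset_le[OF _ ws wi]) (use s w0 less_imp_le in auto)
    ultimately show ?thesis using Ib by simp
  qed
  have I_cont: "continuous_on {a..b} I" unfolding I_def[abs_def] by (rule indefinite_integral_continuous_1[OF wi])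
  have I_deriv: "(I has_vector_derivative w s) (at s)" if s: "s \<in> {a..b} - Q" for s
  proof -
    have "continuous (at s within ({a..b} - Q)) w" using wc s by (simp add: continuous_on_eq_continuous_within)
    then have "(I has_vector_derivative w s) (at s within ({a..b} - Q))"
      unfolding I_def[abs_def] by (rule integral_has_vector_derivative_continuous_at[OF wi s Q(1)])
    then show ?thesis using at_within_open[OF s openQ] by simp
  qed
  define X where "X s = x (I s)" for s
  define p where "p s = Lv (x (I s), u (I s))" for s
  have X_deriv: "(X has_vector_derivative w s *\<^sub>R u (I s)) (at s)"
    and p_deriv: "(p has_vector_derivative w s *\<^sub>R Lx (x (I s), u (I s))) (at s)" if s: "s \<in> {a..b} - Q" for s
  proof -
    have Is: "I s \<in> {0..\<tau>}" using I_range s by auto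
    have sub: "I ` ({a..b} - Q) \<subseteq> {0..\<tau>}" using I_range by auto
    have "(x \<circ> I has_vector_derivative w s *\<^sub>R u (I s)) (at s within ({a..b} - Q))"
      by (rule vector_diff_chain_within[OF has_vector_derivative_at_within[OF I_deriv[OF s]]
            has_vector_derivative_within_subset[OF x(2)[OF Is] sub]])
    then show "(X has_vector_derivative w s *\<^sub>R u (I s)) (at s)"
      using at_within_open[OF s openQ] by (simp add: X_def[abs_def] o_def)
    have "((\<lambda>t. Lv (x t, u t)) \<circ> I has_vector_derivative w s *\<^sub>R Lx (x (I s), u (I s))) (at s within ({a..b} - Q))"
      by (rule vector_diff_chain_within[OF has_vector_derivative_at_within[OF I_deriv[OF s]]
            has_vector_derivative_within_subset[OF x(4)[OF Is] sub]])
    then show "(p has_vector_derivative w s *\<^sub>R Lx (x (I s), u (I s))) (at s)"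
      using at_within_open[OF s openQ] by (simp add: p_def[abs_def] o_def)
  qed
  have X_cont: "continuous_on {a..b} X" unfolding X_def[abs_def]
    by (rule continuous_on_compose2[OF continuous_on_vector_derivative[of "{0..\<tau>}" x u] I_cont]) (use x(2) I_range in auto)
  have p_cont: "continuous_on {a..b} p" unfolding p_def[abs_def]
    by (rule continuous_on_compose2[OF continuous_on_vector_derivative[of "{0..\<tau>}" "\<lambda>t. Lv (x t, u t)" "\<lambda>t. Lx (x t, u t)"] I_cont])
      (use x(4) I_range in auto)
  define h where "h s = y s - X s" for s
  define h' where "h' s = y' s - w s *\<^sub>R u (I s)" for s
  have h_deriv: "(h has_vector_derivative h' s) (at s)" if s: "s \<in> {a..b} - Q" for s
    unfolding h_def[abs_def] h'_def using y(1) s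
    by (intro has_vector_derivative_diff X_deriv) (auto simp: piecewise_C1_def)
  have h_cont: "continuous_on {a..b} h" unfolding h_def[abs_def]
    using y(1) by (intro continuous_on_diff X_cont) (auto simp: piecewise_C1_def)
  \<comment> \<open>Unit speed of \<open>x\<close> gives \<open>m * norm V \<le> w\<close> for the
    velocity \<open>V\<close> of \<open>X\<close>. Hence \<open>B * w\<^sup>2\<close> times the
    squared norm of \<open>h\<close> bounds the part of the error that
    \<open>quadratic_form_bound\<close> leaves over.\<close>
  define B where "B = (2 * C + C\<^sup>2/\<mu>) / m\<^sup>2"
  have B: "0 \<le> B" "8 * B * \<tau>\<^sup>2 \<le> \<mu>" using const_pos small by (auto simp: B_def field_simps)
  \<comment> \<open>\<open>p \<bullet> h\<close> arises from integration by parts, and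
    \<open>I / 2\<close> from the energy of the geodesic. The middle term has the derivative
    \<open>- 2 * B * w * (h \<bullet> h)\<close> plus a mixed term; the former pays for the error
    quadratic in \<open>h\<close>. All boundary values are known, as \<open>I\<close> vanishes at
    \<open>a\<close> and \<open>h\<close> at \<open>b\<close>.\<close>
  define \<Phi> where "\<Phi> s = p s \<bullet> h s - 2 * B * (I s * (h s \<bullet> h s)) + I s / 2" for s
  define \<Phi>' where "\<Phi>' s = (p s \<bullet> h' s + (w s *\<^sub>R Lx (x (I s), u (I s))) \<bullet> h s)
      - 2 * B * (I s * (h s \<bullet> h' s + h' s \<bullet> h s) + w s * (h s \<bullet> h s)) + w s / 2" for s
  have \<Phi>_deriv: "(\<Phi> has_vector_derivative \<Phi>' s) (at s)" if s: "s \<in> {a..b} - Q" for s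
    unfolding \<Phi>_def[abs_def] \<Phi>'_def
    by (intro has_vector_derivative_add has_vector_derivative_diff has_vector_derivative_mult_right
        bounded_bilinear.has_vector_derivative[OF bounded_bilinear_inner] has_vector_derivative_mult
        bounded_linear.has_vector_derivative[OF bounded_linear_divide]
        p_deriv h_deriv I_deriv s)
  have \<Phi>_cont: "continuous_on {a..b} \<Phi>" unfolding \<Phi>_def[abs_def]
    by (intro continuous_intros p_cont h_cont I_cont) auto
  have "\<Phi>' s \<le> g s / 2" if s: "s \<in> {a..b} - Q" for s
  proof -
    define r where "r = I s"
    have r: "r \<in> {0..\<tau>}" using I_range s by (auto simp: r_def)
    define V where "V = w s *\<^sub>R u r"
    have xK: "x r \<in> K" "y s \<in> K" using x(1)[OF r] y(3) s by auto
    have xU: "x r \<in> U" using xK K by auto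
    have w: "0 < w s" "0 \<le> w s" using w0[of s] by auto
    have fX: "L (x r, V) = (w s)\<^sup>2 / 2" unfolding V_def L_homog[OF xU w(2)] by (simp add: L_def x(3)[OF r])
    have LxV: "Lx (x r, V) = (w s)\<^sup>2 *\<^sub>R Lx (x r, u r)" and LvV: "Lv (x r, V) = w s *\<^sub>R p s"
      unfolding V_def p_def r_def[symmetric] using Lx_homog[OF xU w(2)] Lv_homog[OF xU w(2)] by auto
    have hs: "h s = y s - x r" "h' s = y' s - V" by (simp_all add: h_def h'_def X_def V_def r_def)
    define R where "R = remainder (x r) V (y s) (y' s)"
    have Ly: "L (y s, y' s) = (w s)\<^sup>2/2 + (w s)\<^sup>2 * (Lx (x r, u r) \<bullet> h s) + w s * (p s \<bullet> h' s) + R"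
      by (simp add: R_def remainder_def fX LxV LvV hs)
    \<comment> \<open>One factor of \<open>g\<^sup>2\<close> is enlarged to \<open>w\<close>, which
      cancels at the end; the estimate becomes linear in the speed \<open>g\<close>.\<close>
    have "L (y s, y' s) \<le> g s * w s / 2"
      using w0(2)[of s] nonneg[of "(y s, y' s)"] by (simp add: L_def g_def power2_eq_square mult_left_mono)
    moreover
    have "\<mu> / 2 * (norm (h' s))\<^sup>2 - (2 * C + C\<^sup>2/\<mu>) * ((norm V)\<^sup>2 * (norm (h s))\<^sup>2) \<le> R"
    proof -
      have "norm (h s) \<le> \<rho>" using close[of s r] s r by (simp add: h_def X_def r_def)
      moreover have "max (norm V) (norm (y' s)) \<le> norm V + norm (h' s)"
        using norm_triangle_sub[of "y' s" V] by (simp add: h'_def V_def r_def)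
      ultimately have "\<mu> / 2 * (norm (h' s))\<^sup>2 - (2 * C + C\<^sup>2/\<mu>) * ((norm V)\<^sup>2 * (norm (h s))\<^sup>2)
        \<le> \<mu> * (norm (h' s))\<^sup>2 - C * norm (h s) * ((max (norm V) (norm (y' s)))\<^sup>2 * norm (h s) + max (norm V) (norm (y' s)) * norm (h' s))"
        using \<rho> const_pos by (intro quadratic_form_bound[where \<rho> = \<rho>]) (auto simp: le_max_iff_disj)
      also have "\<dots> \<le> R"
        using remainder_bounds(1)[OF xK, where v = V and v' = "y' s"] by (simp add: R_def hs)
      finally show ?thesis .
    qed
    moreover have "(2 * C + C\<^sup>2/\<mu>) * ((norm V)\<^sup>2 * (norm (h s))\<^sup>2) \<le> B * (w s)\<^sup>2 * (norm (h s))\<^sup>2"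
    proof -
      have "m * norm (u r) \<le> 1" using f_lower[OF xK(1), of "u r"] x(3)[OF r] by simp
      then have "(m * norm V)\<^sup>2 \<le> (w s)\<^sup>2"
        using w const_pos by (intro power_mono) (auto simp: V_def mult_left_le mult.left_commute)
      then have "(norm V)\<^sup>2 \<le> (w s)\<^sup>2 / m\<^sup>2" using const_pos by (simp add: field_simps)
      then have "(2 * C + C\<^sup>2/\<mu>) * ((norm V)\<^sup>2 * (norm (h s))\<^sup>2) \<le> (2 * C + C\<^sup>2/\<mu>) * ((w s)\<^sup>2 / m\<^sup>2 * (norm (h s))\<^sup>2)"
        using const_pos by (intro mult_left_mono mult_right_mono) auto
      then show ?thesis by (simp add: B_def)
    qed
    \<comment> \<open>Completing the square: differentiating the middle term of
      \<open>\<Phi>\<close> leaves a product of \<open>h\<close> and \<open>h'\<close>, which is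
      absorbed because \<open>8 * B * \<tau>\<^sup>2 \<le> \<mu>\<close>.\<close>
    moreover have "- 4 * B * r * w s * (h s \<bullet> h' s) - 2 * B * (w s)\<^sup>2 * (norm (h s))\<^sup>2
        \<le> \<mu> / 2 * (norm (h' s))\<^sup>2 - B * (w s)\<^sup>2 * (norm (h s))\<^sup>2"
    proof -
      have "0 \<le> B * (w s * norm (h s) - 2 * r * norm (h' s))\<^sup>2" using B by simp
      also have "\<dots> = B * (w s)\<^sup>2 * (norm (h s))\<^sup>2 - 4 * B * r * w s * (norm (h s) * norm (h' s))
          + 4 * B * r\<^sup>2 * (norm (h' s))\<^sup>2"
        by (simp add: power2_diff power_mult_distrib right_diff_distrib distrib_left)
      finally have "0 \<le> B * (w s)\<^sup>2 * (norm (h s))\<^sup>2 - 4 * B * r * w s * (norm (h s) * norm (h' s))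
          + 4 * B * r\<^sup>2 * (norm (h' s))\<^sup>2" .
      moreover have "4 * B * r\<^sup>2 * (norm (h' s))\<^sup>2 \<le> \<mu>/2 * (norm (h' s))\<^sup>2"
      proof (rule mult_right_mono)
        have "B * r\<^sup>2 \<le> B * \<tau>\<^sup>2" using r B by (intro mult_left_mono power_mono) auto
        then show "4 * B * r\<^sup>2 \<le> \<mu>/2" using B by linarith
      qed simp
      moreover have "4 * B * r * w s * (- (h s \<bullet> h' s)) \<le> 4 * B * r * w s * (norm (h s) * norm (h' s))"
        using B r w Cauchy_Schwarz_ineq2[of "h s" "h' s"] by (intro mult_left_mono) (auto simp: abs_le_iff)
      moreover have "4 * B * r * w s * (- (h s \<bullet> h' s)) = - 4 * B * r * w s * (h s \<bullet> h' s)" by simp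
      moreover have "2 * B * (w s)\<^sup>2 * (norm (h s))\<^sup>2 = 2 * (B * (w s)\<^sup>2 * (norm (h s))\<^sup>2)" by simp
      ultimately show ?thesis by linarith
    qed
    ultimately have "(w s)\<^sup>2/2 + (w s)\<^sup>2 * (Lx (x r, u r) \<bullet> h s) + w s * (p s \<bullet> h' s)
       - 4 * B * r * w s * (h s \<bullet> h' s) - 2 * B * (w s)\<^sup>2 * (norm (h s))\<^sup>2 \<le> g s * w s / 2"
      using Ly by linarith
    also have "(w s)\<^sup>2/2 + (w s)\<^sup>2 * (Lx (x r, u r) \<bullet> h s) + w s * (p s \<bullet> h' s)
       - 4 * B * r * w s * (h s \<bullet> h' s) - 2 * B * (w s)\<^sup>2 * (norm (h s))\<^sup>2 = \<Phi>' s * w s"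
      by (simp add: \<Phi>'_def r_def[symmetric] dot_square_norm inner_commute[of "h' s" "h s"] power2_eq_square algebra_simps)
    finally show ?thesis using w(1) by (simp add: mult_le_cancel_right_pos flip: times_divide_eq_left)
  qed
  then have "\<Phi> b - \<Phi> a \<le> integral {a..b} (\<lambda>s. g s / 2)"
    using y(2) g_props(3) by (intro FTC_le[OF _ Q(1) \<Phi>_cont _ \<Phi>_deriv]) (auto intro: integrable_divide)
  moreover have "\<Phi> a = 0" using normal by (simp add: \<Phi>_def Ia h_def p_def X_def)
  moreover have "\<Phi> b = \<tau> / 2" by (simp add: \<Phi>_def Ib h_def X_def y(4))
  moreover have "integral {a..b} (\<lambda>s. g s / 2) = l / 2" by (simp add: l_def)
  ultimately show False using l by simp
qed

end

section \<open>Charts and their inverses\<close>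

abbreviation cinv :: "('m, 'e) chart \<Rightarrow> 'e \<Rightarrow> 'm" where "cinv c \<equiv> inv_into (fst c) (snd c)"

lemma
  assumes "is_chart c"
  shows chart_open: "open (fst c)" and chart_image_open: "open (snd c ` fst c)"
    and cinv_chart: "p \<in> fst c \<Longrightarrow> cinv c (snd c p) = p"
    and chart_cinv: "x \<in> snd c ` fst c \<Longrightarrow> snd c (cinv c x) = x"
    and cinv_in: "x \<in> snd c ` fst c \<Longrightarrow> cinv c x \<in> fst c"
    and chart_continuous: "continuous_on (fst c) (snd c)"
    and cinv_continuous: "continuous_on (snd c ` fst c) (cinv c)"
  using assms by (auto simp: is_chart_def homeomorphism_def f_inv_into_f inv_into_into)

lemma chart_inj: "is_chart c \<Longrightarrow> p \<in> fst c \<Longrightarrow> q \<in> fst c \<Longrightarrow> snd c p = snd c q \<Longrightarrow> p = q"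
  by (metis cinv_chart)

lemma chart_open_image:
  assumes "is_chart c" "open V" shows "open (snd c ` (fst c \<inter> V))"
proof -
  have "snd c ` (fst c \<inter> V) = snd c ` fst c \<inter> cinv c -` V"
    using cinv_chart[OF assms(1)] chart_cinv[OF assms(1)] cinv_in[OF assms(1)] by force
  then show ?thesis
    using continuous_open_preimage[OF cinv_continuous[OF assms(1)] chart_image_open[OF assms(1)] assms(2)] by simp
qed

lemma cinv_open_image:
  assumes "is_chart c" "open V" "V \<subseteq> snd c ` fst c" shows "open (cinv c ` V)"
proof -
  have "cinv c ` V = fst c \<inter> snd c -` V"
    using cinv_chart[OF assms(1)] chart_cinv[OF assms(1)] cinv_in[OF assms(1)] assms(3) by force
  then show ?thesis
    using continuous_open_preimage[OF chart_continuous[OF assms(1)] chart_open[OF assms(1)] assms(2)] by simp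
qed

section \<open>Curves and tangent vectors in charts\<close>

text \<open>The condition of \<open>smooth_into\<close> at a single point and in a prescribed chart,
  isolated so that the chart can be exchanged.\<close>

definition smooth_rep :: "('m::topological_space, 'e::euclidean_space) chart \<Rightarrow> 'a::real_normed_vector set \<Rightarrow> ('a \<Rightarrow> 'm) \<Rightarrow> 'a \<Rightarrow> bool" where
  "smooth_rep c X f x \<longleftrightarrow> (\<exists>W g. open W \<and> x \<in> W \<and> f ` (X \<inter> W) \<subseteq> fst c \<and>
     Cinf_on W g \<and> (\<forall>y\<in>X \<inter> W. snd c (f y) = g y))"

lemma smooth_into_iff_rep: "smooth_into A X f \<longleftrightarrow> (\<forall>x\<in>X. \<exists>c\<in>A. smooth_rep c X f x)"
  by (simp only: smooth_into_def smooth_rep_def)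

lemma smooth_rep_change:
  assumes c: "is_chart c" "is_chart c'" "smooth_transition c c'" and x: "x \<in> X" "f x \<in> fst c'"
    and r: "smooth_rep c X f x"
  shows "smooth_rep c' X f x"
proof -
  from r obtain W g where W: "open W" "x \<in> W" "f ` (X \<inter> W) \<subseteq> fst c" "Cinf_on W g" "\<And>y. y \<in> X \<inter> W \<Longrightarrow> snd c (f y) = g y"
    unfolding smooth_rep_def by metis
  let ?V = "snd c ` (fst c \<inter> fst c')"
  have V: "open ?V" by (rule chart_open_image[OF c(1) chart_open[OF c(2)]])
  \<comment> \<open>The extension \<open>g\<close> has values also off \<open>X\<close>; they are
    forced into the overlap of the charts, where the transition map is smooth.\<close>
  define W' where "W' = W \<inter> g -` ?V"
  have "open W'" unfolding W'_def
    by (rule continuous_open_preimage[OF Cinf_on_imp_continuous_on[OF W(4)] W(1) V])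
  moreover have "x \<in> W'" using W x by (force simp: W'_def)
  moreover have in': "f y \<in> fst c \<inter> fst c'" if "y \<in> X \<inter> W'" for y
  proof -
    have "f y \<in> fst c" "snd c (f y) \<in> ?V" using that W by (auto simp: W'_def)
    then show ?thesis using chart_inj[OF c(1)] by force
  qed
  moreover have "Cinf_on W' (\<lambda>y. (snd c' \<circ> cinv c) (g y))"
    by (rule Cinf_on_compose[OF \<open>open W'\<close> V Cinf_on_subset[OF W(4)], where g = "snd c' \<circ> cinv c"]) (use c(3) in \<open>auto simp: W'_def smooth_transition_def\<close>)
  moreover have "snd c' (f y) = (snd c' \<circ> cinv c) (g y)" if y: "y \<in> X \<inter> W'" for y
  proof -
    have "g y = snd c (f y)" using W(5) y by (simp add: W'_def)
    then show ?thesis using cinv_chart[OF c(1)] in'[OF y] by simp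
  qed
  ultimately show ?thesis unfolding smooth_rep_def by (intro exI[of _ W'] exI conjI) blast+
qed

locale finsler_manifold =
  fixes A :: "('m::{t2_space, second_countable_topology}, 'e::euclidean_space) chart set"
    and F :: "'m \<Rightarrow> 'e \<Rightarrow> real"
  assumes atlas: "smooth_atlas A" and finsler: "finsler_metric A F"
begin

abbreviation charts :: "('m, 'e) chart set" where "charts \<equiv> maximal_atlas A"

lemma A_charts: "c \<in> A \<Longrightarrow> c \<in> charts"
  using atlas by (auto simp: smooth_atlas_def maximal_atlas_def)

lemma is_chart: "c \<in> charts \<Longrightarrow> is_chart c"
  by (simp add: maximal_atlas_def)

lemma transition: "c \<in> charts \<Longrightarrow> c' \<in> A \<Longrightarrow> smooth_transition c c'" "c \<in> charts \<Longrightarrow> c' \<in> A \<Longrightarrow> smooth_transition c' c"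
  by (auto simp: maximal_atlas_def)

lemma chart_at: "chart_at A p \<in> A" "p \<in> fst (chart_at A p)"
proof -
  have "\<exists>c. c \<in> A \<and> p \<in> fst c" using atlas unfolding smooth_atlas_def by (metis UNIV_I UN_iff)
  then show "chart_at A p \<in> A" "p \<in> fst (chart_at A p)"
    unfolding chart_at_def by (metis (mono_tags, lifting) someI_ex)+
qed

lemma smooth_into_rep:
  assumes "smooth_into A X f" "x \<in> X" "c \<in> charts" "f x \<in> fst c"
  shows "smooth_rep c X f x"
proof -
  obtain c' where c': "c' \<in> A" "smooth_rep c' X f x"
    using assms(1,2) unfolding smooth_into_iff_rep by blast
  show ?thesis
    using smooth_rep_change[OF is_chart[OF A_charts[OF c'(1)]] is_chart[OF assms(3)] transition(2)[OF assms(3) c'(1)] assms(2,4) c'(2)] .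
qed

lemma smooth_intoI:
  assumes "\<And>x. x \<in> X \<Longrightarrow> \<exists>c\<in>charts. smooth_rep c X f x"
  shows "smooth_into A X f"
proof -
  have "\<exists>c'\<in>A. smooth_rep c' X f x" if x: "x \<in> X" for x
  proof -
    obtain c where c: "c \<in> charts" "smooth_rep c X f x" using assms[OF x] by blast
    show ?thesis
      using smooth_rep_change[OF is_chart[OF c(1)] is_chart[OF A_charts[OF chart_at(1)]] transition(1)[OF c(1) chart_at(1)] x chart_at(2) c(2)]
        chart_at(1) by blast
  qed
  then show ?thesis unfolding smooth_into_iff_rep by blast
qed

lemma smooth_into_continuous_on:
  assumes "smooth_into A X f" shows "continuous_on X f"
  unfolding continuous_on_eq_continuous_within
proof
  fix x assume x: "x \<in> X"
  let ?c = "chart_at A (f x)"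
  have c: "is_chart ?c" using is_chart[OF A_charts[OF chart_at(1)]] .
  obtain W g where W: "open W" "x \<in> W" "f ` (X \<inter> W) \<subseteq> fst ?c" "Cinf_on W g" "\<And>y. y \<in> X \<inter> W \<Longrightarrow> snd ?c (f y) = g y"
    using smooth_into_rep[OF assms x A_charts[OF chart_at(1)] chart_at(2)] unfolding smooth_rep_def by metis
  have "continuous_on (X \<inter> W) (\<lambda>y. cinv ?c (g y))"
    by (rule continuous_on_compose2[OF cinv_continuous[OF c] continuous_on_subset[OF Cinf_on_imp_continuous_on[OF W(4)]]])
      (use W(3) W(5)[symmetric] in auto)
  then have "continuous_on (X \<inter> W) f"
    by (rule continuous_on_eq) (use W(3,5) cinv_chart[OF c] in \<open>metis imageI subsetD\<close>)
  then have "continuous (at x within X \<inter> W) f" using x W(2) by (simp add: continuous_on_eq_continuous_within)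
  moreover have "at x within X \<inter> W = at x within X" by (rule at_within_nhd[OF W(2,1)]) auto
  ultimately show "continuous (at x within X) f" by (simp add: continuous_within)
qed

text \<open>The coordinate change from the tangent space in the chart \<open>c\<close> to the preferred chart.\<close>

definition \<tau> :: "('m, 'e) chart \<Rightarrow> 'e \<Rightarrow> 'e \<Rightarrow> 'e" where
  "\<tau> c x = frechet_derivative (snd (chart_at A (cinv c x)) \<circ> cinv c) (at x)"

lemma from_chart_\<tau>: "from_chart A c (x, u) = (cinv c x, \<tau> c x u)"
  by (simp add: from_chart_def \<tau>_def Let_def)

lemma in_chart_\<tau>: "in_chart A F c (x, u) = F (cinv c x) (\<tau> c x u)"
  by (simp add: in_chart_def from_chart_\<tau>)

lemma transition_derivative:
  assumes "smooth_transition c c'" "is_chart c" "p \<in> fst c" "p \<in> fst c'"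
  shows "((snd c' \<circ> cinv c) has_derivative frechet_derivative (snd c' \<circ> cinv c) (at (snd c p))) (at (snd c p))"
  using assms by (intro Cinf_on_has_derivative[of "snd c ` (fst c \<inter> fst c')"]) (auto simp: smooth_transition_def)

lemma transition_inverse:
  assumes c: "smooth_transition c c'" "smooth_transition c' c" "is_chart c" "is_chart c'" and p: "p \<in> fst c" "p \<in> fst c'"
  shows "frechet_derivative (snd c \<circ> cinv c') (at (snd c' p)) (frechet_derivative (snd c' \<circ> cinv c) (at (snd c p)) u) = u"
proof -
  let ?D = "frechet_derivative (snd c' \<circ> cinv c) (at (snd c p))"
  let ?E = "frechet_derivative (snd c \<circ> cinv c') (at (snd c' p))"
  let ?V = "snd c ` (fst c \<inter> fst c')"
  have e: "(snd c' \<circ> cinv c) (snd c p) = snd c' p" using cinv_chart[OF c(3) p(1)] by simp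
  have "((\<lambda>x. (snd c \<circ> cinv c') ((snd c' \<circ> cinv c) x)) has_derivative (\<lambda>u. ?E (?D u))) (at (snd c p))"
    by (rule has_derivative_compose[OF transition_derivative[OF c(1,3) p]])
      (simp only: e transition_derivative[OF c(2,4) p(2,1)])
  moreover have "((\<lambda>x. (snd c \<circ> cinv c') ((snd c' \<circ> cinv c) x)) has_derivative (\<lambda>u. u)) (at (snd c p))"
  proof (rule has_derivative_transform_within_open[OF has_derivative_ident])
    show "open ?V" by (rule chart_open_image[OF c(3) chart_open[OF c(4)]])
    show "snd c p \<in> ?V" using p by simp
    show "x = (snd c \<circ> cinv c') ((snd c' \<circ> cinv c) x)" if "x \<in> ?V" for x
      using that cinv_chart[OF c(3)] cinv_chart[OF c(4)] by auto
  qed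
  ultimately have "(\<lambda>u. ?E (?D u)) = (\<lambda>u. u)" by (rule has_derivative_unique)
  then show ?thesis by metis
qed

lemma
  assumes "c \<in> charts" "p \<in> fst c"
  shows \<tau>_derivative: "((snd (chart_at A p) \<circ> cinv c) has_derivative \<tau> c (snd c p)) (at (snd c p))"
    and \<tau>_linear: "linear (\<tau> c (snd c p))"
    and \<tau>_inj: "\<tau> c (snd c p) u = \<tau> c (snd c p) v \<Longrightarrow> u = v"
    and \<tau>_surj: "\<exists>u. \<tau> c (snd c p) u = w"
proof -
  let ?c = "chart_at A p"
  note tr = transition[OF assms(1) chart_at(1), of p]
  note ch = is_chart[OF assms(1)] is_chart[OF A_charts[OF chart_at(1)], of p]
  have e: "\<tau> c (snd c p) = frechet_derivative (snd ?c \<circ> cinv c) (at (snd c p))"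
    using cinv_chart[OF ch(1) assms(2)] by (simp add: \<tau>_def)
  show 1: "((snd ?c \<circ> cinv c) has_derivative \<tau> c (snd c p)) (at (snd c p))"
    unfolding e by (rule transition_derivative[OF tr(1) ch(1) assms(2) chart_at(2)])
  then show "linear (\<tau> c (snd c p))" by (rule has_derivative_linear)
  show "u = v" if "\<tau> c (snd c p) u = \<tau> c (snd c p) v" for u v
    using arg_cong[OF that[unfolded e], of "frechet_derivative (snd c \<circ> cinv ?c) (at (snd ?c p))"]
    by (simp only: transition_inverse[OF tr ch assms(2) chart_at(2)])
  show "\<exists>u. \<tau> c (snd c p) u = w"
    unfolding e by (rule exI, rule transition_inverse[OF tr(2,1) ch(2,1) chart_at(2) assms(2)])
qed

lemma \<tau>_nonzero: "c \<in> charts \<Longrightarrow> p \<in> fst c \<Longrightarrow> u \<noteq> 0 \<Longrightarrow> \<tau> c (snd c p) u \<noteq> 0"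
  using \<tau>_inj[of c p u 0] linear_0[OF \<tau>_linear, of c p] by force

lemma F_in_chart: "c \<in> charts \<Longrightarrow> p \<in> fst c \<Longrightarrow> F p (\<tau> c (snd c p) u) = in_chart A F c (snd c p, u)"
  by (simp add: in_chart_\<tau> cinv_chart is_chart)

text \<open>Both sides evaluate \<open>F p\<close> at the same vector: the coordinate change from
  \<open>c\<close> to the preferred chart at \<open>p\<close> factors through \<open>c'\<close>, and
  the chain rule applies.\<close>

lemma in_chart_change:
  assumes c: "c \<in> charts" "c' \<in> A" and p: "p \<in> fst c" "p \<in> fst c'"
  shows "in_chart A F c (snd c p, u) = in_chart A F c' ((snd c' \<circ> cinv c) (snd c p), frechet_derivative (snd c' \<circ> cinv c) (at (snd c p)) u)"
proof -
  let ?D = "frechet_derivative (snd c' \<circ> cinv c) (at (snd c p))"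
  let ?V = "snd c ` (fst c \<inter> fst c')"
  note ch = is_chart[OF c(1)] is_chart[OF A_charts[OF c(2)]]
  note tr = transition[OF c]
  have e: "(snd c' \<circ> cinv c) (snd c p) = snd c' p" using cinv_chart[OF ch(1) p(1)] by simp
  have "((\<lambda>x. (snd (chart_at A p) \<circ> cinv c') ((snd c' \<circ> cinv c) x)) has_derivative (\<lambda>u. \<tau> c' (snd c' p) (?D u))) (at (snd c p))"
    by (rule has_derivative_compose[OF transition_derivative[OF tr(1) ch(1) p]])
      (simp only: e \<tau>_derivative[OF A_charts[OF c(2)] p(2)])
  then have "((snd (chart_at A p) \<circ> cinv c) has_derivative (\<lambda>u. \<tau> c' (snd c' p) (?D u))) (at (snd c p))"
  proof (rule has_derivative_transform_within_open)
    show "open ?V" by (rule chart_open_image[OF ch(1) chart_open[OF ch(2)]])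
    show "snd c p \<in> ?V" using p by simp
    show "(snd (chart_at A p) \<circ> cinv c') ((snd c' \<circ> cinv c) x) = (snd (chart_at A p) \<circ> cinv c) x" if "x \<in> ?V" for x
      using that cinv_chart[OF ch(1)] cinv_chart[OF ch(2)] by auto
  qed
  then have "\<tau> c (snd c p) = (\<lambda>u. \<tau> c' (snd c' p) (?D u))"
    using \<tau>_derivative[OF c(1) p(1)] by (rule has_derivative_unique[symmetric])
  then have "in_chart A F c (snd c p, u) = F p (\<tau> c' (snd c' p) (?D u))"
    by (simp add: in_chart_\<tau> cinv_chart[OF ch(1) p(1)])
  then show ?thesis using e by (simp add: F_in_chart[OF A_charts[OF c(2)] p(2)])
qed

text \<open>Joint smoothness in base and fibre follows from that in fixed directions by expanding
  the fibre variable in a basis.\<close>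

lemma bundle_transition_smooth:
  assumes c: "c \<in> charts" "c' \<in> A"
  defines "T \<equiv> snd c' \<circ> cinv c" and "V \<equiv> snd c ` (fst c \<inter> fst c')"
  shows "Cinf_on (V \<times> UNIV) (\<lambda>z. (T (fst z), frechet_derivative T (at (fst z)) (snd z)))"
proof -
  have V: "open V" unfolding V_def
    by (rule chart_open_image[OF is_chart[OF c(1)] chart_open[OF is_chart[OF A_charts[OF c(2)]]]])
  then have VU: "open (V \<times> (UNIV :: 'e set))" by (simp add: open_Times)
  have T: "Cinf_on V T" using transition(1)[OF c] by (simp add: smooth_transition_def T_def V_def)
  have f: "Cinf_on (V \<times> (UNIV :: 'e set)) fst" by (rule Cinf_on_linear[OF bounded_linear_fst VU])
  have "Cinf_on (V \<times> UNIV) (\<lambda>z. \<Sum>b\<in>Basis. (snd z \<bullet> b) *\<^sub>R frechet_derivative T (at (fst z)) b)"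
    by (intro Cinf_on_sum VU Cinf_on_bilinear[OF bounded_bilinear_scaleR] Cinf_on_bounded_linear[OF bounded_linear_inner_left]
        Cinf_on_linear bounded_linear_snd Cinf_on_compose[OF VU V f Cinf_on_frechet[OF T]]) auto
  then have "Cinf_on (V \<times> UNIV) (\<lambda>z. frechet_derivative T (at (fst z)) (snd z))"
  proof (rule Cinf_on_cong[OF VU, rotated])
    fix z :: "'e \<times> 'e" assume "z \<in> V \<times> UNIV"
    then have "fst z \<in> V" by auto
    from Cinf_on_has_derivative[OF T this]
    have l: "linear (frechet_derivative T (at (fst z)))" by (rule has_derivative_linear)
    have "frechet_derivative T (at (fst z)) (snd z) = frechet_derivative T (at (fst z)) (\<Sum>b\<in>Basis. (snd z \<bullet> b) *\<^sub>R b)"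
      by (simp add: euclidean_representation)
    then show "(\<Sum>b\<in>Basis. (snd z \<bullet> b) *\<^sub>R frechet_derivative T (at (fst z)) b) = frechet_derivative T (at (fst z)) (snd z)"
      by (simp add: linear_sum[OF l] linear_scale[OF l])
  qed
  then show ?thesis by (intro Cinf_on_Pair VU Cinf_on_compose[OF VU V f T]) auto
qed

text \<open>\<open>finsler_metric\<close> speaks of the charts in \<open>A\<close>, whereas the
  charts that flatten \<open>N\<close> belong to the maximal atlas. Regularity is carried over by
  bundle transitions, homogeneity and positivity by the linear isomorphism
  \<open>\<tau> c x\<close>.\<close>

lemma local_finsler_chart:
  assumes c: "c \<in> charts"
  shows "local_finsler (snd c ` fst c) (in_chart A F c)"
proof
  note ch = is_chart[OF c]
  have fin: "\<And>c. c \<in> A \<Longrightarrow> continuous_on (snd c ` fst c \<times> UNIV) (in_chart A F c)"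
    "\<And>c. c \<in> A \<Longrightarrow> Cinf_on (snd c ` fst c \<times> (UNIV - {0})) (in_chart A F c)"
    "\<And>p v. 0 \<le> F p v" "\<And>p v r. 0 < r \<Longrightarrow> v \<noteq> 0 \<Longrightarrow> F p (r *\<^sub>R v) = r * F p v"
    "\<And>p v w. v \<noteq> 0 \<Longrightarrow> w \<noteq> 0 \<Longrightarrow> 0 < fundamental_tensor F p v w w"
    using finsler unfolding finsler_metric_def by auto
  show "open (snd c ` fst c)" by (rule chart_image_open[OF ch])
  show "0 \<le> in_chart A F c z" for z using fin(3) by (cases z) (simp add: in_chart_\<tau>)
  \<comment> \<open>\<open>\<Theta>\<close> is the bundle transition into the preferred chart of the
    point with coordinates \<open>x\<close>; it maps nonzero vectors to nonzero vectors.\<close>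
  have loc: "\<exists>V c' \<Theta>. open V \<and> x \<in> V \<and> V \<subseteq> snd c ` fst c \<and> c' \<in> A \<and> Cinf_on (V \<times> UNIV) \<Theta> \<and>
      (\<forall>z\<in>V \<times> UNIV. fst (\<Theta> z) \<in> snd c' ` fst c' \<and> in_chart A F c z = in_chart A F c' (\<Theta> z) \<and> (snd z \<noteq> 0 \<longrightarrow> snd (\<Theta> z) \<noteq> 0))"
    if x: "x \<in> snd c ` fst c" for x
  proof -
    obtain p where p: "p \<in> fst c" "x = snd c p" using x by blast
    define c' where "c' = chart_at A p"
    have c': "c' \<in> A" "p \<in> fst c'" using chart_at by (auto simp: c'_def)
    define T where "T = snd c' \<circ> cinv c"
    define V where "V = snd c ` (fst c \<inter> fst c')"
    define \<Theta> where "\<Theta> z = (T (fst z), frechet_derivative T (at (fst z)) (snd z))" for z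
    note ch' = is_chart[OF A_charts[OF c'(1)]]
    have "Cinf_on (V \<times> UNIV) \<Theta>"
      using bundle_transition_smooth[OF c c'(1)] unfolding \<Theta>_def[abs_def] T_def V_def .
    moreover have "open V" unfolding V_def by (rule chart_open_image[OF ch chart_open[OF ch']])
    moreover have "x \<in> V" "V \<subseteq> snd c ` fst c" using p c' by (auto simp: V_def)
    moreover have "fst (\<Theta> z) \<in> snd c' ` fst c' \<and> in_chart A F c z = in_chart A F c' (\<Theta> z) \<and> (snd z \<noteq> 0 \<longrightarrow> snd (\<Theta> z) \<noteq> 0)"
      if z: "z \<in> V \<times> UNIV" for z
    proof -
      obtain q where q: "q \<in> fst c" "q \<in> fst c'" "fst z = snd c q" using z by (auto simp: V_def)
      have "T (fst z) = snd c' q" using q cinv_chart[OF ch] by (simp add: T_def)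
      then have "fst (\<Theta> z) \<in> snd c' ` fst c'" using q by (simp add: \<Theta>_def)
      moreover have "in_chart A F c z = in_chart A F c' (\<Theta> z)"
        using in_chart_change[OF c c'(1) q(1,2), of "snd z"] unfolding \<Theta>_def T_def q(3)[symmetric] by simp
      moreover have "snd (\<Theta> z) \<noteq> 0" if "snd z \<noteq> 0"
      proof
        assume z0: "snd (\<Theta> z) = 0"
        note tr = transition[OF c c'(1)]
        have "frechet_derivative (snd c \<circ> cinv c') (at (snd c' q)) (snd (\<Theta> z)) = snd z"
          using transition_inverse[OF tr ch ch' q(1,2), of "snd z"] by (simp add: \<Theta>_def T_def q(3))
        then show False
          using z0 that linear_0[OF has_derivative_linear[OF transition_derivative[OF tr(2) ch' q(2,1)]]] by simp
      qed
      ultimately show ?thesis by blast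
    qed
    ultimately show ?thesis using c'(1) by (intro exI[of _ V] exI[of _ c'] exI[of _ \<Theta>]) blast
  qed
  show "continuous_on (snd c ` fst c \<times> UNIV) (in_chart A F c)"
  proof (rule continuous_at_imp_continuous_on, rule ballI)
    fix z :: "'e \<times> 'e" assume "z \<in> snd c ` fst c \<times> UNIV"
    then have "fst z \<in> snd c ` fst c" by auto
    from loc[OF this] obtain V c' \<Theta> where V: "open V" "fst z \<in> V" "c' \<in> A" "Cinf_on (V \<times> UNIV) \<Theta>"
      "\<forall>z\<in>V \<times> UNIV. fst (\<Theta> z) \<in> snd c' ` fst c' \<and> in_chart A F c z = in_chart A F c' (\<Theta> z) \<and> (snd z \<noteq> 0 \<longrightarrow> snd (\<Theta> z) \<noteq> 0)"
      by (elim exE conjE)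
    have "continuous_on (V \<times> UNIV) (\<lambda>z. in_chart A F c' (\<Theta> z))"
    proof (rule continuous_on_compose2[OF fin(1)[OF V(3)] Cinf_on_imp_continuous_on[OF V(4)]], rule image_subsetI)
      show "\<Theta> z \<in> snd c' ` fst c' \<times> UNIV" if "z \<in> V \<times> UNIV" for z
        using bspec[OF V(5) that] by (simp add: mem_Times_iff)
    qed
    then have "continuous_on (V \<times> UNIV) (in_chart A F c)"
      by (rule continuous_on_eq) (use bspec[OF V(5)] in simp)
    moreover have "open (V \<times> (UNIV :: 'e set))" using V(1) by (simp add: open_Times)
    moreover have "z \<in> V \<times> UNIV" using V(2) by (simp add: mem_Times_iff)
    ultimately show "isCont (in_chart A F c) z" using continuous_on_eq_continuous_at by metis
  qed
  show "Cinf_on (snd c ` fst c \<times> (UNIV - {0})) (in_chart A F c)"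
  proof (rule Cinf_on_local)
    fix z :: "'e \<times> 'e" assume z: "z \<in> snd c ` fst c \<times> (UNIV - {0})"
    then have "fst z \<in> snd c ` fst c" by auto
    from loc[OF this] obtain V c' \<Theta> where V: "open V" "fst z \<in> V" "c' \<in> A" "Cinf_on (V \<times> UNIV) \<Theta>"
      "\<forall>z\<in>V \<times> UNIV. fst (\<Theta> z) \<in> snd c' ` fst c' \<and> in_chart A F c z = in_chart A F c' (\<Theta> z) \<and> (snd z \<noteq> 0 \<longrightarrow> snd (\<Theta> z) \<noteq> 0)"
      by (elim exE conjE)
    let ?V = "V \<times> (UNIV - {0::'e})"
    have oV: "open ?V" by (intro open_Times V(1) open_Diff) auto
    have oc: "open (snd c' ` fst c' \<times> (UNIV - {0::'e}))"
      by (intro open_Times chart_image_open[OF is_chart[OF A_charts[OF V(3)]]] open_Diff) auto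
    have "Cinf_on ?V (\<lambda>z. in_chart A F c' (\<Theta> z))"
    proof (rule Cinf_on_compose[OF oV oc Cinf_on_subset[OF V(4)] fin(2)[OF V(3)]], goal_cases)
      case 2
      show ?case
      proof (rule image_subsetI)
        fix z assume z: "z \<in> ?V"
        then have "z \<in> V \<times> UNIV" by auto
        from bspec[OF V(5) this] z show "\<Theta> z \<in> snd c' ` fst c' \<times> (UNIV - {0})" by (simp add: mem_Times_iff)
      qed
    qed auto
    then have "Cinf_on ?V (in_chart A F c)"
    proof (rule Cinf_on_cong[OF oV, rotated])
      fix z assume "z \<in> ?V"
      then have "z \<in> V \<times> UNIV" by auto
      from bspec[OF V(5) this] show "in_chart A F c' (\<Theta> z) = in_chart A F c z" by simp
    qed
    then show "\<exists>W. open W \<and> z \<in> W \<and> Cinf_on W (in_chart A F c)"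
      using oV z V(2) by (intro exI[of _ ?V]) (auto simp: mem_Times_iff)
  qed
  fix x assume "x \<in> snd c ` fst c"
  then obtain p where p: "p \<in> fst c" "x = snd c p" by blast
  have l: "linear (\<tau> c x)" using \<tau>_linear[OF c p(1)] p(2) by simp
  have nz: "\<tau> c x v \<noteq> 0" if "v \<noteq> 0" for v using \<tau>_nonzero[OF c p(1) that] p(2) by simp
  show "in_chart A F c (x, r *\<^sub>R v) = r * in_chart A F c (x, v)" if "0 < r" "v \<noteq> 0" for r v
    using fin(4)[OF that(1) nz[OF that(2)]] by (simp add: in_chart_\<tau> linear_scale[OF l])
  show "0 < deriv (\<lambda>s1. deriv (\<lambda>s2. (in_chart A F c (x, v + s1 *\<^sub>R w + s2 *\<^sub>R w))\<^sup>2) 0) 0" if "v \<noteq> 0" "w \<noteq> 0" for v w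
    using fin(5)[OF nz[OF that(1)] nz[OF that(2)], of "cinv c x"]
    by (simp add: fundamental_tensor_def in_chart_\<tau> linear_add[OF l] linear_scale[OF l])
qed

end

section \<open>Piecewise smooth curves in coordinates\<close>

lemma
  fixes g :: "real \<Rightarrow> 'a::real_normed_vector"
  assumes "Cinf_on I g" "t \<in> I"
  shows Cinf_on_has_vector_derivative: "(g has_vector_derivative frechet_derivative g (at t) 1) (at t)"
proof -
  note d = Cinf_on_has_derivative[OF assms]
  have "frechet_derivative g (at t) h = h *\<^sub>R frechet_derivative g (at t) 1" for h :: real
    using linear_scale[OF has_derivative_linear[OF d], of h 1] by simp
  then have "frechet_derivative g (at t) = (\<lambda>h. h *\<^sub>R frechet_derivative g (at t) 1)" by blast
  then show ?thesis using d by (simp add: has_vector_derivative_def)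
qed

lemma piece_right:
  assumes "breaks P a b" "a \<le> t" "t < b"
  shows "\<exists>l u. piece P l u \<and> l \<le> t \<and> t < u"
proof -
  let ?L = "{p\<in>P. p \<le> t}" and ?U = "{p\<in>P. t < p}"
  have fin: "finite ?L" "finite ?U" "?L \<noteq> {}" "?U \<noteq> {}" using assms by (auto simp: breaks_def)
  have "Max ?L \<in> ?L" "Min ?U \<in> ?U" using Max_in[OF fin(1,3)] Min_in[OF fin(2,4)] by blast+
  moreover have "p \<le> Max ?L \<or> Min ?U \<le> p" if "p \<in> P" for p
    using that fin by (cases "p \<le> t") auto
  ultimately have "piece P (Max ?L) (Min ?U) \<and> Max ?L \<le> t \<and> t < Min ?U"
    unfolding piece_def by fastforce
  then show ?thesis by blast
qed

lemma piece_left: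
  assumes "breaks P a b" "a < t" "t \<le> b"
  shows "\<exists>l u. piece P l u \<and> l < t \<and> t \<le> u"
proof -
  let ?L = "{p\<in>P. p < t}" and ?U = "{p\<in>P. t \<le> p}"
  have fin: "finite ?L" "finite ?U" "?L \<noteq> {}" "?U \<noteq> {}" using assms by (auto simp: breaks_def)
  have "Max ?L \<in> ?L" "Min ?U \<in> ?U" using Max_in[OF fin(1,3)] Min_in[OF fin(2,4)] by blast+
  moreover have "p \<le> Max ?L \<or> Min ?U \<le> p" if "p \<in> P" for p
    using that fin by (cases "p < t") auto
  ultimately have "piece P (Max ?L) (Min ?U) \<and> Max ?L < t \<and> t \<le> Min ?U"
    unfolding piece_def by fastforce
  then show ?thesis by blast
qed

lemma piece_mid:
  assumes "breaks P a b" "t \<in> {a..b} - P" shows "\<exists>l u. piece P l u \<and> l < t \<and> t < u"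
proof -
  have "t < b" using assms by (auto simp: breaks_def less_le)
  moreover have "a \<le> t" using assms(2) by simp
  ultimately obtain l u where "piece P l u" "l \<le> t" "t < u" using piece_right[OF assms(1)] by metis
  moreover then have "l \<noteq> t" using assms(2) by (auto simp: piece_def)
  ultimately show ?thesis by force
qed

lemma piece_bounds: "breaks P a b \<Longrightarrow> piece P l u \<Longrightarrow> a \<le> l \<and> l < u \<and> u \<le> b"
  by (auto simp: breaks_def piece_def)

lemma smooth_rep_ball:
  fixes x :: "'a::real_normed_vector"
  assumes "smooth_rep c X f x"
  shows "\<exists>e>0. \<exists>g. Cinf_on (ball x e) g \<and> (\<forall>y\<in>X \<inter> ball x e. f y \<in> fst c \<and> snd c (f y) = g y)"
proof -
  obtain W g where W: "open W" "x \<in> W" "f ` (X \<inter> W) \<subseteq> fst c" "Cinf_on W g" "\<forall>y\<in>X \<inter> W. snd c (f y) = g y"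
    using assms unfolding smooth_rep_def by metis
  obtain e where e: "0 < e" "ball x e \<subseteq> W" using W(1,2) open_contains_ball by blast
  have "Cinf_on (ball x e) g" by (rule Cinf_on_subset[OF W(4) e(2)])
  moreover have "\<forall>y\<in>X \<inter> ball x e. f y \<in> fst c \<and> snd c (f y) = g y" using W(3,5) e(2) by blast
  ultimately show ?thesis using e(1) by blast
qed

context finsler_manifold begin

text \<open>By continuity the curve stays in \<open>c\<close> near \<open>t\<close>, so that its
  coordinates in the preferred chart come from those in \<open>c\<close> by the transition map, and
  the chain rule applies.\<close>

lemma has_velocity_chart:
  assumes c: "c \<in> charts" "\<gamma> t \<in> fst c" and cont: "continuous (at t within I) \<gamma>" and t: "t \<in> I"
    and d: "((\<lambda>s. snd c (\<gamma> s)) has_vector_derivative u) (at t within I)"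
  shows "has_velocity A \<gamma> I t (\<tau> c (snd c (\<gamma> t)) u)"
proof -
  let ?c = "chart_at A (\<gamma> t)"
  have "\<forall>\<^sub>F s in at t within I. \<gamma> s \<in> fst c"
    using cont chart_open[OF is_chart[OF c(1)]] c(2) unfolding continuous_within by (rule topological_tendstoD)
  then obtain e where e: "0 < e" "\<forall>s\<in>I. s \<noteq> t \<and> dist s t < e \<longrightarrow> \<gamma> s \<in> fst c"
    unfolding eventually_at by blast
  have "((\<lambda>s. (snd ?c \<circ> cinv c) (snd c (\<gamma> s))) has_derivative (\<lambda>h. \<tau> c (snd c (\<gamma> t)) (h *\<^sub>R u))) (at t within I)"
    by (rule has_derivative_compose[OF d[unfolded has_vector_derivative_def] \<tau>_derivative[OF c]])
  then have "((\<lambda>s. snd ?c (\<gamma> s)) has_derivative (\<lambda>h. \<tau> c (snd c (\<gamma> t)) (h *\<^sub>R u))) (at t within I)"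
  proof (rule has_derivative_transform_within[OF _ e(1) t])
    fix s assume "s \<in> I" "dist s t < e"
    then have "\<gamma> s \<in> fst c" using e(2) c(2) by (cases "s = t") auto
    then show "(snd ?c \<circ> cinv c) (snd c (\<gamma> s)) = snd ?c (\<gamma> s)" by (simp add: cinv_chart[OF is_chart[OF c(1)]])
  qed
  then show ?thesis
    by (simp add: has_velocity_def has_vector_derivative_def linear_scale[OF \<tau>_linear[OF c]])
qed

lemma has_velocity_chart_unique:
  assumes c: "c \<in> charts" "\<gamma> t \<in> fst c" and cont: "continuous (at t within I) \<gamma>" and t: "t \<in> I" "at t within I \<noteq> bot"
    and d: "((\<lambda>s. snd c (\<gamma> s)) has_vector_derivative u) (at t within I)"
    and v: "has_velocity A \<gamma> I t v"
  shows "v = \<tau> c (snd c (\<gamma> t)) u"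
  using vector_derivative_unique_within[OF t(2) v[unfolded has_velocity_def]
      has_velocity_chart[OF c cont t(1) d, unfolded has_velocity_def]] .

lemma velocity_in_chart:
  assumes c: "c \<in> charts" "\<gamma> t \<in> fst c" and cont: "continuous (at t within I) \<gamma>" and t: "t \<in> I" "at t within I \<noteq> bot"
    and d: "((\<lambda>s. snd c (\<gamma> s)) has_vector_derivative u) (at t within I)"
  shows "F (\<gamma> t) (velocity A \<gamma> I t) = in_chart A F c (snd c (\<gamma> t), u)"
proof -
  have "velocity A \<gamma> I t = \<tau> c (snd c (\<gamma> t)) u"
    unfolding velocity_def
    by (rule vector_derivative_within[OF t(2) has_velocity_chart[OF c cont t(1) d, unfolded has_velocity_def]])
  then show ?thesis by (simp add: F_in_chart[OF c])
qed

definition smooth_pieces :: "real set \<Rightarrow> real \<Rightarrow> real \<Rightarrow> (real \<Rightarrow> 'm) \<Rightarrow> bool" where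
  "smooth_pieces P a b \<gamma> \<longleftrightarrow> breaks P a b \<and> (\<forall>l u. piece P l u \<longrightarrow> smooth_into A {l..u} \<gamma>)"

lemma piecewise_smooth_iff: "piecewise_smooth A \<gamma> a b \<longleftrightarrow> a \<le> b \<and> (\<exists>P. smooth_pieces P a b \<gamma>)"
  by (simp add: piecewise_smooth_def smooth_pieces_def)

text \<open>At a break point a curve has two unrelated smooth extensions. This lemma and the next
  provide the one from the right and the one from the left, each on a full neighbourhood of
  \<open>t\<close>; \<open>mid_rep\<close> is for the other points.\<close>

lemma right_rep:
  assumes P: "smooth_pieces P a b \<gamma>" and t: "a \<le> t" "t < b" and c: "c \<in> charts" "\<gamma> t \<in> fst c"
  shows "\<exists>e>0. \<exists>g. t + e \<le> b \<and> Cinf_on {t-e<..<t+e} g \<and> (\<forall>s\<in>{t..<t+e}. \<gamma> s \<in> fst c \<and> snd c (\<gamma> s) = g s)"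
proof -
  note br = P[unfolded smooth_pieces_def, THEN conjunct1]
  obtain l u where lu: "piece P l u" "l \<le> t" "t < u" using piece_right[OF br t] by blast
  then have "smooth_into A {l..u} \<gamma>" using P by (simp add: smooth_pieces_def)
  then have "smooth_rep c {l..u} \<gamma> t" by (rule smooth_into_rep) (use lu c in auto)
  from smooth_rep_ball[OF this] obtain e g where e: "0 < e" "Cinf_on (ball t e) g"
    "\<forall>y\<in>{l..u} \<inter> ball t e. \<gamma> y \<in> fst c \<and> snd c (\<gamma> y) = g y" by metis
  have ub: "u \<le> b" using piece_bounds[OF br lu(1)] by simp
  show ?thesis
  proof (intro exI[of _ "min e (u - t)"] exI[of _ g] conjI ballI)
    show "Cinf_on {t - min e (u - t)<..<t + min e (u - t)} g"
      by (rule Cinf_on_subset[OF e(2)]) (auto simp: ball_eq_greaterThanLessThan)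
    fix s assume "s \<in> {t..<t + min e (u - t)}"
    then have "s \<in> {l..u} \<inter> ball t e" using lu by (auto simp: ball_eq_greaterThanLessThan)
    then show "\<gamma> s \<in> fst c" "snd c (\<gamma> s) = g s" using e(3) by auto
  qed (use e lu ub in auto)
qed

lemma left_rep:
  assumes P: "smooth_pieces P a b \<gamma>" and t: "a < t" "t \<le> b" and c: "c \<in> charts" "\<gamma> t \<in> fst c"
  shows "\<exists>e>0. \<exists>g. a \<le> t - e \<and> Cinf_on {t-e<..<t+e} g \<and> (\<forall>s\<in>{t-e<..t}. \<gamma> s \<in> fst c \<and> snd c (\<gamma> s) = g s)"
proof -
  note br = P[unfolded smooth_pieces_def, THEN conjunct1]
  obtain l u where lu: "piece P l u" "l < t" "t \<le> u" using piece_left[OF br t] by blast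
  then have "smooth_into A {l..u} \<gamma>" using P by (simp add: smooth_pieces_def)
  then have "smooth_rep c {l..u} \<gamma> t" by (rule smooth_into_rep) (use lu c in auto)
  from smooth_rep_ball[OF this] obtain e g where e: "0 < e" "Cinf_on (ball t e) g"
    "\<forall>y\<in>{l..u} \<inter> ball t e. \<gamma> y \<in> fst c \<and> snd c (\<gamma> y) = g y" by metis
  have ub: "a \<le> l" using piece_bounds[OF br lu(1)] by simp
  show ?thesis
  proof (intro exI[of _ "min e (t - l)"] exI[of _ g] conjI ballI)
    show "Cinf_on {t - min e (t - l)<..<t + min e (t - l)} g"
      by (rule Cinf_on_subset[OF e(2)]) (auto simp: ball_eq_greaterThanLessThan)
    fix s assume "s \<in> {t - min e (t - l)<..t}"
    then have "s \<in> {l..u} \<inter> ball t e" using lu by (auto simp: ball_eq_greaterThanLessThan)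
    then show "\<gamma> s \<in> fst c" "snd c (\<gamma> s) = g s" using e(3) by auto
  qed (use e lu ub in auto)
qed

lemma mid_rep:
  assumes P: "smooth_pieces P a b \<gamma>" and t: "t \<in> {a..b} - P" and c: "c \<in> charts" "\<gamma> t \<in> fst c"
  shows "\<exists>e>0. \<exists>g. a \<le> t - e \<and> t + e \<le> b \<and> {t-e<..<t+e} \<inter> P = {} \<and> Cinf_on {t-e<..<t+e} g \<and>
    (\<forall>s\<in>{t-e<..<t+e}. \<gamma> s \<in> fst c \<and> snd c (\<gamma> s) = g s)"
proof -
  note br = P[unfolded smooth_pieces_def, THEN conjunct1]
  obtain l u where lu: "piece P l u" "l < t" "t < u" using piece_mid[OF br t] by blast
  then have "smooth_into A {l..u} \<gamma>" using P by (simp add: smooth_pieces_def)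
  then have "smooth_rep c {l..u} \<gamma> t" by (rule smooth_into_rep) (use lu c in auto)
  from smooth_rep_ball[OF this] obtain e g where e: "0 < e" "Cinf_on (ball t e) g"
    "\<forall>y\<in>{l..u} \<inter> ball t e. \<gamma> y \<in> fst c \<and> snd c (\<gamma> y) = g y" by metis
  note ub = piece_bounds[OF br lu(1)]
  define d where "d = min e (min (t - l) (u - t))"
  have d: "0 < d" "d \<le> e" "d \<le> t - l" "d \<le> u - t" using e lu by (auto simp: d_def)
  show ?thesis
  proof (intro exI[of _ d] exI[of _ g] conjI ballI)
    show "Cinf_on {t - d<..<t + d} g"
      by (rule Cinf_on_subset[OF e(2)]) (use d in \<open>auto simp: ball_eq_greaterThanLessThan\<close>)
    show "{t - d<..<t + d} \<inter> P = {}" using lu(1) d by (auto simp: piece_def)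
    fix s assume "s \<in> {t - d<..<t + d}"
    then have "s \<in> {l..u} \<inter> ball t e" using d by (auto simp: ball_eq_greaterThanLessThan)
    then show "\<gamma> s \<in> fst c" "snd c (\<gamma> s) = g s" using e(3) by auto
  qed (use d ub in auto)
qed

lemma smooth_pieces_continuous:
  assumes P: "smooth_pieces P a b \<gamma>" and "a < b" shows "continuous_on {a..b} \<gamma>"
proof -
  note br = P[unfolded smooth_pieces_def, THEN conjunct1]
  let ?I = "{(l, u). piece P l u}"
  have "finite (P \<times> P)" using br by (simp add: breaks_def)
  then have fin: "finite ?I" by (rule finite_subset[rotated]) (auto simp: piece_def)
  have "continuous_on (\<Union>i\<in>?I. {fst i..snd i}) \<gamma>"
  proof (rule continuous_on_closed_Union[OF fin])
    fix i assume "i \<in> ?I"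
    then have "smooth_into A {fst i..snd i} \<gamma>" using P by (auto simp: smooth_pieces_def)
    then show "continuous_on {fst i..snd i} \<gamma>" by (rule smooth_into_continuous_on)
  qed auto
  moreover have "{a..b} \<subseteq> (\<Union>i\<in>?I. {fst i..snd i})"
  proof
    fix t assume t: "t \<in> {a..b}"
    have "\<exists>l u. piece P l u \<and> l \<le> t \<and> t \<le> u"
    proof (cases "t < b")
      case True then show ?thesis using piece_right[OF br, of t] t by force
    next
      case False then show ?thesis using piece_left[OF br, of t] t assms(2) by force
    qed
    then show "t \<in> (\<Union>i\<in>?I. {fst i..snd i})" by force
  qed
  ultimately show ?thesis by (rule continuous_on_subset)
qed

abbreviation speed :: "(real \<Rightarrow> 'm) \<Rightarrow> real \<Rightarrow> real \<Rightarrow> real \<Rightarrow> real" where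
  "speed \<gamma> a b t \<equiv> F (\<gamma> t) (velocity A \<gamma> {a..b} t)"

text \<open>The passage from curves on the manifold to coordinate curves, on a subinterval that
  stays in one chart. The substance is the bound on the derivative near break points, which the
  one-sided extensions supply. Off \<open>Q\<close>, the derivative within \<open>{a..b}\<close> in
  the definition of \<open>velocity\<close> is the two-sided one.\<close>

lemma smooth_pieces_coordinates:
  assumes P: "smooth_pieces P a b \<gamma>" and ab: "a \<le> \<alpha>" "\<alpha> < \<beta>" "\<beta> \<le> b"
    and c: "c \<in> charts" "\<And>t. t \<in> {\<alpha>..\<beta>} \<Longrightarrow> \<gamma> t \<in> fst c"
  defines "Q \<equiv> {\<alpha>, \<beta>} \<union> (P \<inter> {\<alpha>..\<beta>})" and "x \<equiv> \<lambda>t. snd c (\<gamma> t)"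
  defines "x' \<equiv> \<lambda>t. vector_derivative x (at t)"
  shows "piecewise_C1 Q \<alpha> \<beta> x x'" "\<And>t. t \<in> {\<alpha>..\<beta>} - Q \<Longrightarrow> speed \<gamma> a b t = in_chart A F c (x t, x' t)"
proof -
  note br = P[unfolded smooth_pieces_def, THEN conjunct1]
  have \<gamma>c: "continuous_on {a..b} \<gamma>" using smooth_pieces_continuous[OF P] ab by auto
  have xc: "continuous_on {\<alpha>..\<beta>} x" unfolding x_def
    by (rule continuous_on_compose2[OF chart_continuous[OF is_chart[OF c(1)]] continuous_on_subset[OF \<gamma>c]]) (use ab c in auto)
  have x'I: "(x has_vector_derivative frechet_derivative g (at s) 1) (at s) \<and> x' s = frechet_derivative g (at s) 1"
    if "Cinf_on J g" "open S" "S \<subseteq> J" "s \<in> S" "\<And>r. r \<in> S \<Longrightarrow> x r = g r" for g J S s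
  proof -
    have "(x has_vector_derivative frechet_derivative g (at s) 1) (at s)"
      by (rule has_vector_derivative_transform_within_open[OF Cinf_on_has_vector_derivative[OF that(1)] that(2,4)])
        (use that in auto)
    then show ?thesis by (simp add: x'_def vector_derivative_at)
  qed
  have mid: "\<exists>e>0. \<exists>g. {t-e<..<t+e} \<subseteq> {\<alpha>..\<beta>} - Q \<and> Cinf_on {t-e<..<t+e} g \<and> (\<forall>s\<in>{t-e<..<t+e}. x s = g s)"
    if t: "t \<in> {\<alpha>..\<beta>} - Q" for t
  proof -
    have tP: "t \<in> {a..b} - P" "\<alpha> < t" "t < \<beta>" using t ab by (auto simp: Q_def)
    obtain e g where e: "0 < e" "{t-e<..<t+e} \<inter> P = {}" "Cinf_on {t-e<..<t+e} g"
        "\<forall>s\<in>{t-e<..<t+e}. \<gamma> s \<in> fst c \<and> snd c (\<gamma> s) = g s"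
      using mid_rep[OF P tP(1) c(1) c(2)] t by (metis DiffD1)
    define d where "d = min e (min (t - \<alpha>) (\<beta> - t))"
    have d: "0 < d" "d \<le> e" "d \<le> t - \<alpha>" "d \<le> \<beta> - t" using e tP by (auto simp: d_def)
    show ?thesis
    proof (intro exI[of _ d] exI[of _ g] conjI ballI)
      show "{t - d<..<t + d} \<subseteq> {\<alpha>..\<beta>} - Q" using d e(2) by (auto simp: Q_def disjoint_iff)
      show "Cinf_on {t - d<..<t + d} g" by (rule Cinf_on_subset[OF e(3)]) (use d in auto)
      show "x s = g s" if "s \<in> {t - d<..<t + d}" for s using e(4) that d by (auto simp: x_def)
    qed (rule d)
  qed
  have deriv: "(x has_vector_derivative x' t) (at t)" and x'_cont: "isCont x' t" if t: "t \<in> {\<alpha>..\<beta>} - Q" for t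
  proof -
    obtain e g where e: "0 < e" "Cinf_on {t-e<..<t+e} g" "\<forall>s\<in>{t-e<..<t+e}. x s = g s" using mid[OF t] by metis
    have eq: "(x has_vector_derivative frechet_derivative g (at s) 1) (at s) \<and> x' s = frechet_derivative g (at s) 1"
      if "s \<in> {t-e<..<t+e}" for s
      by (rule x'I[OF e(2) _ _ that]) (use e in auto)
    have tt: "t \<in> {t-e<..<t+e}" using e by simp
    show "(x has_vector_derivative x' t) (at t)" using eq[OF tt] by simp
    have "continuous_on {t-e<..<t+e} x'"
      by (rule continuous_on_eq[OF Cinf_on_imp_continuous_on[OF Cinf_on_frechet[OF e(2), of 1]]]) (simp add: eq)
    then show "isCont x' t" using tt by (simp add: continuous_on_eq_continuous_at)
  qed
  have loc: "\<exists>d>0. \<exists>B. \<forall>s. \<bar>s - t\<bar> < d \<longrightarrow> norm (frechet_derivative g (at s) 1) \<le> B"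
    if "0 < e" "Cinf_on {t-e<..<t+e} g" for e t and g :: "real \<Rightarrow> 'e"
  proof -
    have "continuous_on {t-e/2..t+e/2} (\<lambda>s. frechet_derivative g (at s) 1)"
      by (rule continuous_on_subset[OF Cinf_on_imp_continuous_on[OF Cinf_on_frechet[OF that(2)]]]) (use that(1) in auto)
    then have "bounded ((\<lambda>s. frechet_derivative g (at s) 1) ` {t-e/2..t+e/2})"
      using compact_continuous_image compact_Icc compact_imp_bounded by blast
    then obtain B where B: "\<forall>s\<in>{t-e/2..t+e/2}. norm (frechet_derivative g (at s) 1) \<le> B"
      unfolding bounded_iff by blast
    show ?thesis
    proof (rule exI[of _ "e/2"], intro conjI exI[of _ B] allI impI)
      fix s assume "\<bar>s - t\<bar> < e / 2"
      then have "t - e/2 \<le> s \<and> s \<le> t + e/2" by linarith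
      then show "norm (frechet_derivative g (at s) 1) \<le> B" using B by simp
    qed (use that in simp)
  qed
  \<comment> \<open>Writing the bound as \<open>1 / T\<close> makes it hold for smaller
    \<open>T\<close>, as \<open>compact_uniform_pos\<close> demands. Every point \<open>z\<close> is
    treated from the right and from the left separately.\<close>
  have "\<exists>T>0. \<forall>s\<in>{\<alpha>..\<beta>}. s \<notin> Q \<longrightarrow> norm (x' s) \<le> 1 / T"
  proof (rule compact_uniform_pos[OF compact_Icc])
    fix z assume z: "z \<in> {\<alpha>..\<beta>}"
    have "\<exists>d>0. \<exists>B. \<forall>s\<in>{\<alpha>..\<beta>}. z < s \<and> s < z + d \<longrightarrow> norm (x' s) \<le> B"
    proof (cases "z < b")
      case True
      obtain e g where e: "0 < e" "Cinf_on {z-e<..<z+e} g" "\<forall>s\<in>{z..<z+e}. \<gamma> s \<in> fst c \<and> snd c (\<gamma> s) = g s"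
        using right_rep[OF P _ True c(1) c(2)[OF z]] z ab by auto
      obtain d B where d: "0 < d" "\<forall>s. \<bar>s - z\<bar> < d \<longrightarrow> norm (frechet_derivative g (at s) 1) \<le> B"
        using loc[OF e(1,2)] by blast
      show ?thesis
      proof (rule exI[of _ "min d e"], intro conjI exI[of _ B] ballI impI)
        fix s assume "z < s \<and> s < z + min d e"
        then have s: "z < s" "s < z + d" "s < z + e" by auto
        have "{z<..<z+e} \<subseteq> {z-e<..<z+e}" using e(1) by auto
        from x'I[OF e(2) open_greaterThanLessThan this, of s]
        have "x' s = frechet_derivative g (at s) 1" using s e(3) by (simp add: x_def)
        then show "norm (x' s) \<le> B" using d s by auto
      qed (use d e in auto)
    next
      case False then show ?thesis using ab z by (intro exI[of _ 1]) auto
    qed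
    then obtain d1 B1 where d1: "0 < d1" "\<forall>s\<in>{\<alpha>..\<beta>}. z < s \<and> s < z + d1 \<longrightarrow> norm (x' s) \<le> B1" by blast
    have "\<exists>d>0. \<exists>B. \<forall>s\<in>{\<alpha>..\<beta>}. z - d < s \<and> s < z \<longrightarrow> norm (x' s) \<le> B"
    proof (cases "a < z")
      case True
      obtain e g where e: "0 < e" "Cinf_on {z-e<..<z+e} g" "\<forall>s\<in>{z-e<..z}. \<gamma> s \<in> fst c \<and> snd c (\<gamma> s) = g s"
        using left_rep[OF P True _ c(1) c(2)[OF z]] z ab by auto
      obtain d B where d: "0 < d" "\<forall>s. \<bar>s - z\<bar> < d \<longrightarrow> norm (frechet_derivative g (at s) 1) \<le> B"
        using loc[OF e(1,2)] by blast
      show ?thesis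
      proof (rule exI[of _ "min d e"], intro conjI exI[of _ B] ballI impI)
        fix s assume "z - min d e < s \<and> s < z"
        then have s: "s < z" "z - d < s" "z - e < s" by auto
        have "{z-e<..<z} \<subseteq> {z-e<..<z+e}" using e(1) by auto
        from x'I[OF e(2) open_greaterThanLessThan this, of s]
        have "x' s = frechet_derivative g (at s) 1" using s e(3) by (simp add: x_def)
        then show "norm (x' s) \<le> B" using d s by auto
      qed (use d e in auto)
    next
      case False then show ?thesis using ab z by (intro exI[of _ 1]) auto
    qed
    then obtain d2 B2 where d2: "0 < d2" "\<forall>s\<in>{\<alpha>..\<beta>}. z - d2 < s \<and> s < z \<longrightarrow> norm (x' s) \<le> B2" by blast
    define B where "B = max 1 (max (norm (x' z)) (max B1 B2))"
    define d where "d = min d1 d2"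
    have "norm (x' s) \<le> B" if "s \<in> {z - d<..<z + d}" "s \<in> {\<alpha>..\<beta>}" for s
    proof -
      consider "s < z" | "s = z" | "z < s" by linarith
      then show ?thesis
        using that d1(2) d2(2) by cases (auto simp: d_def B_def le_max_iff_disj)
    qed
    moreover have "0 < B" "0 < d" using d1 d2 by (auto simp: B_def d_def)
    ultimately show "\<exists>V T. open V \<and> z \<in> V \<and> 0 < T \<and> (\<forall>y\<in>V \<inter> {\<alpha>..\<beta>}. y \<notin> Q \<longrightarrow> norm (x' y) \<le> 1 / T)"
      by (intro exI[of _ "{z - d<..<z + d}"] exI[of _ "1 / B"]) (simp add: open_greaterThanLessThan)
  next
    fix T T' :: real and z assume "z \<notin> Q \<longrightarrow> norm (x' z) \<le> 1 / T" "0 < T'" "T' \<le> T"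
    then show "z \<notin> Q \<longrightarrow> norm (x' z) \<le> 1 / T'"
      using divide_left_mono[of T' T 1] by fastforce
  qed
  then have "bounded (x' ` ({\<alpha>..\<beta>} - Q))" unfolding bounded_iff by blast
  moreover have "finite Q" using br by (simp add: Q_def breaks_def)
  ultimately show "piecewise_C1 Q \<alpha> \<beta> x x'"
    using xc deriv x'_cont by (auto simp: piecewise_C1_def Q_def[symmetric] intro!: continuous_at_imp_continuous_on) (auto simp: Q_def)
  show "speed \<gamma> a b t = in_chart A F c (x t, x' t)" if t: "t \<in> {\<alpha>..\<beta>} - Q" for t
  proof -
    have t': "a < t" "t < b" using t ab by (auto simp: Q_def)
    then have at: "at t within {a..b} = at t" by (rule at_within_Icc_at)
    have "isCont \<gamma> t"
      using continuous_on_subset[OF \<gamma>c, of "{a<..<b}"] t' by (simp add: continuous_on_eq_continuous_at subset_iff)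
    show ?thesis unfolding x_def
    proof (rule velocity_in_chart[OF c(1) c(2)])
      show "continuous (at t within {a..b}) \<gamma>" unfolding at by fact
      show "at t within {a..b} \<noteq> bot" unfolding at by simp
      show "((\<lambda>s. snd c (\<gamma> s)) has_vector_derivative x' t) (at t within {a..b})"
        unfolding at using deriv[OF t] by (simp add: x_def)
    qed (use t t' in auto)
  qed
qed

text \<open>The curve may cross many charts; bisection reduces the claim to short intervals, each
  within one chart. \<open>H\<close> will be the identity for lengths and the square for
  energies.\<close>

lemma speed_integrable:
  assumes "piecewise_smooth A \<gamma> a b" and H: "continuous_on UNIV (H :: real \<Rightarrow> real)"
  shows "(\<lambda>t. H (speed \<gamma> a b t)) integrable_on {a..b}"
proof (cases "a < b")
  case True
  obtain P where P: "smooth_pieces P a b \<gamma>" using assms(1) piecewise_smooth_iff by blast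
  let ?G = "\<lambda>t. H (speed \<gamma> a b t)"
  define Pr where "Pr c d \<longleftrightarrow> (a \<le> c \<and> d \<le> b \<and> c \<le> d \<longrightarrow> ?G integrable_on {c..d})" for c d
  have "Pr a b"
  proof (rule Bolzano)
    fix r s t assume "Pr r s" "Pr s t" "r \<le> s" "s \<le> t"
    then show "Pr r t"
      using Henstock_Kurzweil_Integration.integrable_combine[of r s t ?G] by (auto simp: Pr_def)
  next
    fix z assume local: "a \<le> z" "z \<le> b"
    let ?c = "chart_at A (\<gamma> z)"
    have c: "?c \<in> charts" using A_charts[OF chart_at(1)] .
    have "continuous (at z within {a..b}) \<gamma>"
      using smooth_pieces_continuous[OF P True] local by (simp add: continuous_on_eq_continuous_within)
    then have "\<forall>\<^sub>F s in at z within {a..b}. \<gamma> s \<in> fst ?c"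
      using chart_open[OF is_chart[OF c]] chart_at(2) unfolding continuous_within by (rule topological_tendstoD)
    then obtain d where d: "0 < d" "\<forall>s\<in>{a..b}. s \<noteq> z \<and> dist s z < d \<longrightarrow> \<gamma> s \<in> fst ?c"
      unfolding eventually_at by blast
    have "?G integrable_on {r..s}" if rs: "r \<le> z" "z \<le> s" "s - r < d" "a \<le> r" "s \<le> b" for r s
    proof (cases "r < s")
      case True
      have in_c: "\<gamma> t \<in> fst ?c" if "t \<in> {r..s}" for t
        using d(2) that rs chart_at(2) by (cases "t = z") (auto simp: dist_real_def)
      let ?x = "\<lambda>t. snd ?c (\<gamma> t)"
      let ?x' = "\<lambda>t. vector_derivative ?x (at t)"
      note co = smooth_pieces_coordinates[OF P rs(4) True rs(5) c in_c]
      interpret local_finsler "snd ?c ` fst ?c" "in_chart A F ?c" by (rule local_finsler_chart[OF c])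
      have "continuous_on (?x ` {r..s} \<times> UNIV) (\<lambda>z. H (in_chart A F ?c z))"
        by (rule continuous_on_compose2[OF H continuous_on_subset[OF cont_f]]) (use in_c in auto)
      moreover have "closed (?x ` {r..s})"
        using co(1) by (auto simp: piecewise_C1_def intro: compact_imp_closed compact_continuous_image)
      ultimately have "(\<lambda>t. H (in_chart A F ?c (?x t, ?x' t))) integrable_on {r..s}"
        using piecewise_C1_compose_continuous(3)[OF co(1), of "?x ` {r..s}" "\<lambda>z. H (in_chart A F ?c z)"] by auto
      moreover have "finite ({r, s} \<union> (P \<inter> {r..s}))" using co(1) by (simp add: piecewise_C1_def)
      ultimately show ?thesis
        by (rule integrable_spike_finite[rotated 2]) (simp only: co(2))
    next
      case False
      then have "r = s" using rs by simp
      then show ?thesis using integrable_on_refl[of ?G r] by simp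
    qed
    then show "\<exists>d>0. \<forall>r s. r \<le> z \<and> z \<le> s \<and> s - r < d \<longrightarrow> Pr r s" using d(1) unfolding Pr_def by blast
  qed (use True in simp)
  then show ?thesis using True by (simp add: Pr_def)
next
  case False
  then have "{a..b} = {} \<or> {a..b} = {a}" using assms(1) by (auto simp: piecewise_smooth_def)
  then show ?thesis by (metis atLeastAtMost_singleton integrable_on_refl integrable_on_empty box_real(2))
qed

text \<open>Stated for the tail from \<open>\<alpha>\<close> on, in order to cover competitors that
  leave the chart and return before they end.\<close>

lemma length_in_chart:
  assumes \<gamma>: "piecewise_smooth A \<gamma> a b" and ab: "a \<le> \<alpha>" "\<alpha> < b"
    and c: "c \<in> charts" "\<And>t. t \<in> {\<alpha>..b} \<Longrightarrow> \<gamma> t \<in> fst c"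
  shows "\<exists>Q x'. piecewise_C1 Q \<alpha> b (\<lambda>t. snd c (\<gamma> t)) x' \<and>
    integral {\<alpha>..b} (\<lambda>t. in_chart A F c (snd c (\<gamma> t), x' t)) \<le> curve_length A F \<gamma> a b"
proof -
  obtain P where P: "smooth_pieces P a b \<gamma>" using \<gamma> piecewise_smooth_iff by blast
  note co = smooth_pieces_coordinates[OF P ab order_refl c]
  have int: "speed \<gamma> a b integrable_on {a..b}" using speed_integrable[OF \<gamma>, of "\<lambda>x. x"] by simp
  have nn: "0 \<le> speed \<gamma> a b t" for t using finsler by (simp add: finsler_metric_def)
  let ?Q = "{\<alpha>, b} \<union> (P \<inter> {\<alpha>..b})"
  let ?x' = "\<lambda>t. vector_derivative (\<lambda>t. snd c (\<gamma> t)) (at t)"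
  have "integral {\<alpha>..b} (\<lambda>t. in_chart A F c (snd c (\<gamma> t), ?x' t)) = integral {\<alpha>..b} (speed \<gamma> a b)"
    by (rule integral_spike[of ?Q]) (use co in \<open>auto simp: piecewise_C1_def intro: negligible_finite\<close>)
  also have "\<dots> \<le> integral {a..b} (speed \<gamma> a b)"
    by (rule integral_subset_le[OF _ integrable_on_subinterval[OF int] int]) (use ab nn in auto)
  finally have "integral {\<alpha>..b} (\<lambda>t. in_chart A F c (snd c (\<gamma> t), ?x' t)) \<le> curve_length A F \<gamma> a b"
    by (simp add: curve_length_def)
  then show ?thesis using co(1) by blast
qed

end

section \<open>First variation of the energy in coordinates\<close>

context finsler_estimates begin

text \<open>Smoothness gives continuity off the zero section only; the weighted Lipschitz bounds
  give it across, as the weights have finite limits.\<close>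

lemma Lx_continuous: "continuous_on (K \<times> UNIV) Lx" and Lv_continuous: "continuous_on (K \<times> UNIV) Lv"
  and L_continuous: "continuous_on (K \<times> UNIV) L"
proof -
  have *: "continuous_on (K \<times> UNIV) g"
    if g: "\<And>z z0. z \<in> K \<times> UNIV \<Longrightarrow> z0 \<in> K \<times> UNIV \<Longrightarrow> norm (g z - g z0) \<le>
      C * (h (norm (snd z0)) (norm (snd z)) * norm (fst z - fst z0) + k (norm (snd z0)) (norm (snd z)) * norm (snd z - snd z0))"
      and h: "\<And>r. continuous_on UNIV (h r)" and k: "\<And>r. continuous_on UNIV (k r)"
    for g :: "'e \<times> 'e \<Rightarrow> 'e" and h k :: "real \<Rightarrow> real \<Rightarrow> real"
    unfolding continuous_on_def
  proof
    fix z0 :: "'e \<times> 'e" assume z0: "z0 \<in> K \<times> UNIV"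
    let ?F = "at z0 within K \<times> UNIV"
    have t: "((\<lambda>z. z) \<longlongrightarrow> z0) ?F" by (rule tendsto_ident_at)
    have n: "((\<lambda>z. norm (snd z)) \<longlongrightarrow> norm (snd z0)) ?F" by (intro tendsto_norm tendsto_snd t)
    have hk: "((\<lambda>z. j (norm (snd z0)) (norm (snd z))) \<longlongrightarrow> j (norm (snd z0)) (norm (snd z0))) ?F"
      if "\<And>r. continuous_on UNIV (j r)" for j :: "real \<Rightarrow> real \<Rightarrow> real"
      by (rule isCont_tendsto_compose[OF _ n]) (use that continuous_on_eq_continuous_at in blast)
    have d: "((\<lambda>z. norm (fst z - fst z0)) \<longlongrightarrow> norm (fst z0 - fst z0)) ?F"
      "((\<lambda>z. norm (snd z - snd z0)) \<longlongrightarrow> norm (snd z0 - snd z0)) ?F"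
      by (intro tendsto_norm tendsto_diff tendsto_fst tendsto_snd t tendsto_const)+
    have "((\<lambda>z. C * (h (norm (snd z0)) (norm (snd z)) * norm (fst z - fst z0)
        + k (norm (snd z0)) (norm (snd z)) * norm (snd z - snd z0))) \<longlongrightarrow>
        C * (h (norm (snd z0)) (norm (snd z0)) * norm (fst z0 - fst z0)
        + k (norm (snd z0)) (norm (snd z0)) * norm (snd z0 - snd z0))) ?F"
      by (intro tendsto_mult tendsto_add tendsto_const hk h k d)
    then have lim: "((\<lambda>z. C * (h (norm (snd z0)) (norm (snd z)) * norm (fst z - fst z0)
        + k (norm (snd z0)) (norm (snd z)) * norm (snd z - snd z0))) \<longlongrightarrow> 0) ?F" by simp
    have "((\<lambda>z. g z - g z0) \<longlongrightarrow> 0) ?F"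
      by (rule Lim_null_comparison[OF _ lim]) (use g z0 in \<open>auto simp: eventually_at_filter\<close>)
    then show "(g \<longlongrightarrow> g z0) ?F" by (simp add: LIM_zero_iff)
  qed
  show "continuous_on (K \<times> UNIV) Lx"
    by (rule *[where h = "\<lambda>r s. (max r s)\<^sup>2" and k = "\<lambda>r s. max r s"])
      (use Lx_lip in \<open>auto intro!: continuous_intros\<close>)
  show "continuous_on (K \<times> UNIV) Lv"
    by (rule *[where h = "\<lambda>r s. max r s" and k = "\<lambda>r s. 1"])
      (use Lv_lip in \<open>auto intro!: continuous_intros\<close>)
  have "continuous_on (K \<times> UNIV) f" by (rule continuous_on_subset[OF cont_f]) (use K in auto)
  then show "continuous_on (K \<times> UNIV) L" unfolding L_def[abs_def] by (intro continuous_intros) auto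
qed

text \<open>The upper bound of \<open>remainder_bounds\<close>, integrated: up to an error quadratic
  in the C^1 distance \<open>d\<close>, the energy changes by the linear term \<open>J\<close>. As
  \<open>d \<le> 1\<close>, both speeds are at most \<open>M + 1\<close>.\<close>

lemma energy_remainder:
  assumes x: "piecewise_C1 Q a b x u" "\<And>t. t \<in> {a..b} \<Longrightarrow> x t \<in> K"
    and y: "piecewise_C1 Q' a b y y'" "\<And>t. t \<in> {a..b} \<Longrightarrow> y t \<in> K" and ab: "a \<le> b"
    and d: "\<And>t. t \<in> {a..b} \<Longrightarrow> norm (y t - x t) \<le> d" "\<And>t. t \<in> {a..b} - (Q \<union> Q') \<Longrightarrow> norm (y' t - u t) \<le> d"
    and d1: "0 \<le> d" "d \<le> 1" and M: "\<And>t. t \<in> {a..b} - Q \<Longrightarrow> norm (u t) \<le> M" "0 \<le> M"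
    and J: "((\<lambda>t. Lx (x t, u t) \<bullet> (y t - x t) + Lv (x t, u t) \<bullet> (y' t - u t)) has_integral J) {a..b}"
  shows "\<bar>integral {a..b} (\<lambda>t. L (y t, y' t)) - integral {a..b} (\<lambda>t. L (x t, u t)) - J\<bar>
    \<le> C * (1 + ((M + 1)\<^sup>2 + (M + 1))) * d\<^sup>2 * (b - a)"
proof -
  have clK: "closed K" using K by (simp add: compact_imp_closed)
  note i = piecewise_C1_compose_continuous(3)[OF x(1) L_continuous clK x(2), THEN integrable_integral]
     piecewise_C1_compose_continuous(3)[OF y(1) L_continuous clK y(2), THEN integrable_integral]
  have fin: "finite (Q \<union> Q')" using x(1) y(1) by (simp add: piecewise_C1_def)
  have h: "((\<lambda>t. L (y t, y' t) - L (x t, u t) - (Lx (x t, u t) \<bullet> (y t - x t) + Lv (x t, u t) \<bullet> (y' t - u t)))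
     has_integral (integral {a..b} (\<lambda>t. L (y t, y' t)) - integral {a..b} (\<lambda>t. L (x t, u t)) - J)) (cbox a b)"
    unfolding box_real by (intro has_integral_diff i J)
  have "norm (integral {a..b} (\<lambda>t. L (y t, y' t)) - integral {a..b} (\<lambda>t. L (x t, u t)) - J)
     \<le> (C * (1 + ((M + 1)\<^sup>2 + (M + 1))) * d\<^sup>2) * measure lborel (cbox a b)"
  proof (rule has_integral_bound_spike_finite[OF _ fin h])
    show "0 \<le> C * (1 + ((M + 1)\<^sup>2 + (M + 1))) * d\<^sup>2" using const_pos M by (intro mult_nonneg_nonneg) auto
    fix t assume "t \<in> cbox a b - (Q \<union> Q')"
    then have t: "t \<in> {a..b}" "t \<in> {a..b} - Q" "t \<in> {a..b} - (Q \<union> Q')" by auto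
    define l where "l = max (norm (u t)) (norm (y' t))"
    have l: "0 \<le> l" "l \<le> M + 1"
      using M(1)[OF t(2)] d(2)[OF t(3)] d1 norm_triangle_sub[of "y' t" "u t"] by (auto simp: l_def le_max_iff_disj)
    have "\<bar>remainder (x t) (u t) (y t) (y' t)\<bar> \<le> C * (norm (y' t - u t))\<^sup>2
       + C * norm (y t - x t) * (l\<^sup>2 * norm (y t - x t) + l * norm (y' t - u t))"
      unfolding l_def by (rule remainder_bounds(2)[OF x(2)[OF t(1)] y(2)[OF t(1)]])
    also have "\<dots> \<le> C * d\<^sup>2 + C * d * ((M + 1)\<^sup>2 * d + (M + 1) * d)"
      using d(1)[OF t(1)] d(2)[OF t(3)] l const_pos d1 M(2)
      by (intro add_mono mult_mono power_mono) auto
    also have "\<dots> = C * (1 + ((M + 1)\<^sup>2 + (M + 1))) * d\<^sup>2" by (simp add: power2_eq_square algebra_simps)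
    finally show "norm (L (y t, y' t) - L (x t, u t) - (Lx (x t, u t) \<bullet> (y t - x t) + Lv (x t, u t) \<bullet> (y' t - u t)))
        \<le> C * (1 + ((M + 1)\<^sup>2 + (M + 1))) * d\<^sup>2"
      by (simp add: remainder_def algebra_simps)
  qed
  then show ?thesis using ab by simp
qed

end

lemma quadratic_remainder_derivative:
  fixes E :: "real \<Rightarrow> real"
  assumes "0 < e" and q: "\<And>s. \<bar>s\<bar> < e \<Longrightarrow> \<bar>E s - E 0 - s * J\<bar> \<le> B * s\<^sup>2"
  shows "(E has_real_derivative J) (at 0)"
  unfolding has_field_derivative_def
proof (rule has_derivativeI_sandwich[OF assms(1)])
  show "((\<lambda>s. \<bar>B\<bar> * \<bar>s\<bar>) \<longlongrightarrow> 0) (at 0)" by (rule tendsto_eq_intros refl | simp)+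
  fix s :: real assume s: "s \<noteq> 0" "dist s 0 < e"
  have "B * s\<^sup>2 \<le> \<bar>B\<bar> * s\<^sup>2" by (intro mult_right_mono) auto
  also have "\<dots> = \<bar>B\<bar> * \<bar>s\<bar> * \<bar>s\<bar>" by (simp add: power2_eq_square)
  finally have "B * s\<^sup>2 \<le> \<bar>B\<bar> * \<bar>s\<bar> * \<bar>s\<bar>" .
  moreover have "\<bar>E s - E 0 - s * J\<bar> \<le> B * s\<^sup>2" using q s(2) by simp
  ultimately show "norm (E s - E 0 - J * (s - 0)) / norm (s - 0) \<le> \<bar>B\<bar> * \<bar>s\<bar>"
    using s(1) by (simp add: divide_le_eq mult.commute)
qed (rule bounded_linear_mult_right)

section \<open>Test functions\<close>

text \<open>Affine pieces are smooth on closed intervals, so that displacing a curve by such a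
  function gives a piecewise smooth variation. The bound 2 on the slope is a convenient one for both
  kinds of test functions below.\<close>

definition piecewise_affine :: "real set \<Rightarrow> (real \<Rightarrow> real) \<Rightarrow> (real \<Rightarrow> real) \<Rightarrow> bool" where
  "piecewise_affine D \<phi> \<phi>' \<longleftrightarrow> finite D \<and> continuous_on UNIV \<phi> \<and>
     (\<forall>l u. l < u \<longrightarrow> D \<inter> {l<..<u} = {} \<longrightarrow> (\<exists>p q. \<forall>t\<in>{l..u}. \<phi> t = p + q * t)) \<and>
     (\<forall>t. t \<notin> D \<longrightarrow> (\<phi> has_real_derivative \<phi>' t) (at t)) \<and> (\<forall>t. \<bar>\<phi>' t\<bar> \<le> 2)"

definition clmp :: "real \<Rightarrow> real \<Rightarrow> real \<Rightarrow> real" where "clmp l u t = max l (min u t)"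

lemma clmp_derivative:
  fixes I :: "real \<Rightarrow> 'a::real_normed_vector"
  assumes "l < u" "t \<noteq> l" "t \<noteq> u" "l < t \<Longrightarrow> t < u \<Longrightarrow> (I has_vector_derivative g) (at t)"
  shows "((\<lambda>t. I (clmp l u t)) has_vector_derivative indicator {l<..<u} t *\<^sub>R g) (at t)"
proof -
  consider "t < l" | "l < t" "t < u" | "u < t" using assms by linarith
  then show ?thesis
  proof cases
    case 1
    have "((\<lambda>t. I (clmp l u t)) has_vector_derivative 0) (at t)"
      by (rule has_vector_derivative_transform_within_open[of "\<lambda>t. I l" 0 t "{..<l}"])
        (use 1 assms in \<open>auto simp: clmp_def\<close>)
    then show ?thesis using 1 by simp
  next
    case 2
    have "((\<lambda>t. I (clmp l u t)) has_vector_derivative g) (at t)"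
      by (rule has_vector_derivative_transform_within_open[of I g t "{l<..<u}"])
        (use 2 assms in \<open>auto simp: clmp_def\<close>)
    then show ?thesis using 2 by simp
  next
    case 3
    have "((\<lambda>t. I (clmp l u t)) has_vector_derivative 0) (at t)"
      by (rule has_vector_derivative_transform_within_open[of "\<lambda>t. I u" 0 t "{u<..}"])
        (use 3 assms in \<open>auto simp: clmp_def\<close>)
    then show ?thesis using 3 by simp
  qed
qed

text \<open>Slope 1 on one interval and slope -1 on another. If the intervals have equal length,
  \<open>k = l - l'\<close> makes the function vanish outside their convex hull.\<close>

lemma piecewise_affine_trapezoid:
  assumes "l < u" "l' < u'"
  shows "piecewise_affine {l, u, l', u'} (\<lambda>t. clmp l u t - clmp l' u' t - k)
    (\<lambda>t. indicator {l<..<u} t - indicator {l'<..<u'} t)"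
  unfolding piecewise_affine_def
proof (intro conjI allI impI)
  show "continuous_on UNIV (\<lambda>t. clmp l u t - clmp l' u' t - k)"
    unfolding clmp_def by (intro continuous_intros)
  show "\<bar>indicator {l<..<u} t - indicator {l'<..<u'} t :: real\<bar> \<le> 2" for t
    by (simp add: indicator_def)
  have aff: "\<exists>p q. \<forall>t\<in>{r..s}. clmp l u t = p + q * t" if "r < s" "{l, u} \<inter> {r<..<s} = {}" "l < u" for r s l u
  proof -
    have "l \<le> r \<or> s \<le> l" "u \<le> r \<or> s \<le> u" using that(2) by (auto simp: disjoint_iff not_less)
    then consider "s \<le> l" | "u \<le> r" | "l \<le> r" "s \<le> u" by blast
    then show ?thesis
    proof cases
      case 1 then have "\<forall>t\<in>{r..s}. clmp l u t = l + 0 * t" using that(3) by (auto simp: clmp_def)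
      then show ?thesis by blast
    next
      case 2 then have "\<forall>t\<in>{r..s}. clmp l u t = u + 0 * t" using that(3) by (auto simp: clmp_def)
      then show ?thesis by blast
    next
      case 3 then have "\<forall>t\<in>{r..s}. clmp l u t = 0 + 1 * t" using that(3) by (auto simp: clmp_def)
      then show ?thesis by blast
    qed
  qed
  fix r s :: real assume rs: "r < s" "{l, u, l', u'} \<inter> {r<..<s} = {}"
  obtain p q where pq: "\<forall>t\<in>{r..s}. clmp l u t = p + q * t" using aff[OF rs(1) _ assms(1)] rs(2) by auto
  obtain p' q' where pq': "\<forall>t\<in>{r..s}. clmp l' u' t = p' + q' * t" using aff[OF rs(1) _ assms(2)] rs(2) by auto
  have "\<forall>t\<in>{r..s}. clmp l u t - clmp l' u' t - k = (p - p' - k) + (q - q') * t"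
    using pq pq' by (simp add: algebra_simps)
  then show "\<exists>p q. \<forall>t\<in>{r..s}. clmp l u t - clmp l' u' t - k = p + q * t" by blast
next
  fix t assume t: "t \<notin> {l, u, l', u'}"
  have "((\<lambda>t. clmp l u t) has_vector_derivative indicator {l<..<u} t *\<^sub>R 1) (at t)"
    using clmp_derivative[OF assms(1), of t "\<lambda>t. t" 1] t by auto
  moreover have "((\<lambda>t. clmp l' u' t) has_vector_derivative indicator {l'<..<u'} t *\<^sub>R 1) (at t)"
    using clmp_derivative[OF assms(2), of t "\<lambda>t. t" 1] t by auto
  ultimately show "((\<lambda>t. clmp l u t - clmp l' u' t - k) has_real_derivative indicator {l<..<u} t - indicator {l'<..<u'} t) (at t)"
    by (auto simp: has_real_derivative_iff_has_vector_derivative intro!: derivative_eq_intros)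
qed simp

text \<open>The test function that displaces the initial point and fixes the point at
  \<open>b\<close>.\<close>

lemma piecewise_affine_line: "piecewise_affine {} (\<lambda>t. b - t) (\<lambda>t. -1)"
proof -
  have "\<exists>p q. \<forall>t\<in>{l..u}. b - t = p + q * t" for l u :: real by (rule exI[of _ b], rule exI[of _ "-1"]) simp
  then show ?thesis
    by (auto simp: piecewise_affine_def intro!: continuous_intros derivative_eq_intros)
qed

lemma inner_eqI: "(\<And>w. x \<bullet> w = y \<bullet> w) \<Longrightarrow> x = y" for x y :: "'a::real_inner"
  by (metis inner_commute vector_eq_ldot)

lemma piecewise_C1_interior:
  assumes "piecewise_C1 Q a b x x'" shows "open ({a..b} - Q)" "t \<in> {a..b} - Q \<Longrightarrow> a < t \<and> t < b"
proof -
  have "{a..b} - Q = {a<..<b} - Q" using assms by (auto simp: piecewise_C1_def less_le)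
  then show "open ({a..b} - Q)" using assms by (simp add: piecewise_C1_def open_Diff finite_imp_closed)
  show "t \<in> {a..b} - Q \<Longrightarrow> a < t \<and> t < b" using assms by (auto simp: piecewise_C1_def less_le)
qed

lemma integral_derivative_off_finite:
  fixes g :: "real \<Rightarrow> 'a::euclidean_space"
  assumes "finite Q" "open ({a..b} - Q)" "g integrable_on {a..b}" "continuous_on ({a..b} - Q) g" "t \<in> {a..b} - Q"
  shows "((\<lambda>u. integral {a..u} g) has_vector_derivative g t) (at t)"
proof -
  have "continuous (at t within ({a..b} - Q)) g" using assms by (simp add: continuous_on_eq_continuous_within)
  then have "((\<lambda>u. integral {a..u} g) has_vector_derivative g t) (at t within ({a..b} - Q))"
    by (rule integral_has_vector_derivative_continuous_at[OF assms(3,5,1)])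
  then show ?thesis using at_within_open[OF assms(5,2)] by simp
qed

section \<open>The integrated Euler-Lagrange equation\<close>

context finsler_estimates begin

text \<open>The lemma of du Bois-Reymond, with trapezoidal test functions.\<close>

lemma weak_euler_lagrange:
  assumes y: "piecewise_C1 Q a b y y'" "\<And>t. t \<in> {a..b} \<Longrightarrow> y t \<in> K" and ab: "a < b"
    and crit: "\<And>D \<phi> \<phi>' w J. piecewise_affine D \<phi> \<phi>' \<Longrightarrow> D \<subseteq> {a..b} \<Longrightarrow> \<phi> a = 0 \<Longrightarrow> \<phi> b = 0 \<Longrightarrow>
      ((\<lambda>t. \<phi> t * (Lx (y t, y' t) \<bullet> w) + \<phi>' t * (Lv (y t, y' t) \<bullet> w)) has_integral J) {a..b} \<Longrightarrow> J = 0"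
  shows "\<exists>p0. \<forall>t\<in>{a..b} - Q. Lv (y t, y' t) = p0 + integral {a..t} (\<lambda>t. Lx (y t, y' t))"
proof -
  have clK: "closed K" using K by (simp add: compact_imp_closed)
  note Lxp = piecewise_C1_compose_continuous[OF y(1) Lx_continuous clK y(2)]
  note Lvp = piecewise_C1_compose_continuous[OF y(1) Lv_continuous clK y(2)]
  have Q: "finite Q" using y(1) by (simp add: piecewise_C1_def)
  note oQ = piecewise_C1_interior[OF y(1)]
  define \<Lambda> where "\<Lambda> t = integral {a..t} (\<lambda>t. Lx (y t, y' t))" for t
  have \<Lambda>_cont: "continuous_on {a..b} \<Lambda>" unfolding \<Lambda>_def[abs_def] by (rule indefinite_integral_continuous_1[OF Lxp(3)])
  have \<Lambda>_deriv: "(\<Lambda> has_vector_derivative Lx (y t, y' t)) (at t)" if "t \<in> {a..b} - Q" for t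
    unfolding \<Lambda>_def[abs_def] by (rule integral_derivative_off_finite[OF Q oQ(1) Lxp(3,1) that])
  \<comment> \<open>Integration by parts turns the first variation in the direction \<open>w\<close>
    into the integral of \<open>\<phi>' * (G \<bullet> w)\<close>; the claim is that
    \<open>G\<close> is constant off \<open>Q\<close>.\<close>
  define G where "G t = Lv (y t, y' t) - \<Lambda> t" for t
  have G_int: "G integrable_on {a..b}" unfolding G_def[abs_def]
    by (intro integrable_diff Lvp(3) integrable_continuous_interval \<Lambda>_cont)
  have G_cont: "continuous_on ({a..b} - Q) G" unfolding G_def[abs_def]
    by (intro continuous_on_diff Lvp(1) continuous_on_subset[OF \<Lambda>_cont]) auto
  have key: "G r = G s" if rs: "r \<in> {a..b} - Q" "s \<in> {a..b} - Q" "r < s" for r s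
  proof (rule inner_eqI)
    fix w
    define g where "g t = G t \<bullet> w" for t
    have g_int: "g integrable_on {a..b}" unfolding g_def[abs_def]
      using integrable_linear[OF G_int bounded_linear_inner_left[of w]] by (simp add: o_def)
    have g_cont: "continuous_on ({a..b} - Q) g" unfolding g_def[abs_def] by (intro continuous_intros G_cont)
    define I where "I t = integral {a..t} g" for t
    have I_cont: "continuous_on {a..b} I" unfolding I_def[abs_def] by (rule indefinite_integral_continuous_1[OF g_int])
    have I_deriv: "(I has_vector_derivative g t) (at t)" if "t \<in> {a..b} - Q" for t
      unfolding I_def[abs_def] by (rule integral_derivative_off_finite[OF Q oQ(1) g_int g_cont that])
    have arb: "a < r" "r < b" "a < s" "s < b" using oQ(2) rs by auto
    \<comment> \<open>The trapezoid with rising side at \<open>r\<close> and falling side at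
      \<open>s\<close> compares the integrals of \<open>g\<close> over two intervals of length
      \<open>\<delta>\<close>.\<close>
    have eq: "I (r + \<delta>) - I r = I (s + \<delta>) - I s" if \<delta>: "0 < \<delta>" "\<delta> < s - r" "\<delta> < b - s" for \<delta>
    proof -
      define \<phi> where "\<phi> t = clmp r (r + \<delta>) t - clmp s (s + \<delta>) t - (r - s)" for t
      define \<phi>' :: "real \<Rightarrow> real" where "\<phi>' t = indicator {r<..<r+\<delta>} t - indicator {s<..<s+\<delta>} t" for t
      let ?D = "{r, r + \<delta>, s, s + \<delta>}"
      have pa: "piecewise_affine ?D \<phi> \<phi>'" unfolding \<phi>_def[abs_def] \<phi>'_def[abs_def]
        using \<delta> by (intro piecewise_affine_trapezoid) auto
      have ends: "\<phi> a = 0" "\<phi> b = 0" using arb \<delta> by (auto simp: \<phi>_def clmp_def)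
      \<comment> \<open>An antiderivative of the integrand of the first variation:
        \<open>\<Lambda>\<close> contributes a product, and the integral of
        \<open>\<phi>' * g\<close> is expressed by \<open>I\<close> at clamped times.\<close>
      define \<Psi> where "\<Psi> t = \<phi> t * (\<Lambda> t \<bullet> w) + (I (clmp r (r + \<delta>) t) - I (clmp s (s + \<delta>) t))" for t
      have cl: "clmp r (r + \<delta>) t \<in> {a..b}" "clmp s (s + \<delta>) t \<in> {a..b}" for t
        using arb \<delta> by (auto simp: clmp_def)
      have ccl: "continuous_on {a..b} (clmp l u)" for l u
        unfolding clmp_def[abs_def] by (intro continuous_intros)
      have \<phi>c: "continuous_on {a..b} \<phi>" using pa continuous_on_subset by (auto simp: piecewise_affine_def)
      have "continuous_on {a..b} \<Psi>" unfolding \<Psi>_def[abs_def]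
        by (intro continuous_intros \<phi>c \<Lambda>_cont continuous_on_compose2[OF I_cont ccl]) (use cl in auto)
      moreover have "(\<Psi> has_vector_derivative \<phi> t * (Lx (y t, y' t) \<bullet> w) + \<phi>' t * (Lv (y t, y' t) \<bullet> w)) (at t)"
        if t: "t \<in> {a<..<b} - (Q \<union> ?D)" for t
      proof -
        have tQ: "t \<in> {a..b} - Q" using t by auto
        have "(\<phi> has_vector_derivative \<phi>' t) (at t)"
          using pa t by (simp add: piecewise_affine_def has_real_derivative_iff_has_vector_derivative)
        moreover have "((\<lambda>t. \<Lambda> t \<bullet> w) has_vector_derivative Lx (y t, y' t) \<bullet> w) (at t)"
          by (rule bounded_linear.has_vector_derivative[OF bounded_linear_inner_left \<Lambda>_deriv[OF tQ]])
        ultimately have "((\<lambda>t. \<phi> t * (\<Lambda> t \<bullet> w)) has_vector_derivative \<phi> t * (Lx (y t, y' t) \<bullet> w) + \<phi>' t * (\<Lambda> t \<bullet> w)) (at t)"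
          by (rule has_vector_derivative_mult)
        moreover have "((\<lambda>t. I (clmp r (r + \<delta>) t)) has_vector_derivative indicator {r<..<r+\<delta>} t *\<^sub>R g t) (at t)"
          by (rule clmp_derivative) (use t \<delta> I_deriv[OF tQ] in auto)
        moreover have "((\<lambda>t. I (clmp s (s + \<delta>) t)) has_vector_derivative indicator {s<..<s+\<delta>} t *\<^sub>R g t) (at t)"
          by (rule clmp_derivative) (use t \<delta> I_deriv[OF tQ] in auto)
        ultimately have D: "(\<Psi> has_vector_derivative \<phi> t * (Lx (y t, y' t) \<bullet> w) + \<phi>' t * (\<Lambda> t \<bullet> w)
           + (indicator {r<..<r+\<delta>} t *\<^sub>R g t - indicator {s<..<s+\<delta>} t *\<^sub>R g t)) (at t)"
          unfolding \<Psi>_def[abs_def] by (intro has_vector_derivative_add has_vector_derivative_diff)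
        have e1: "indicator {r<..<r+\<delta>} t *\<^sub>R g t - indicator {s<..<s+\<delta>} t *\<^sub>R g t = \<phi>' t * g t"
          by (simp add: \<phi>'_def left_diff_distrib)
        have e2: "\<phi>' t * (Lv (y t, y' t) \<bullet> w) = \<phi>' t * (\<Lambda> t \<bullet> w) + \<phi>' t * g t"
          by (simp add: g_def G_def inner_diff_left right_diff_distrib)
        show ?thesis using D unfolding e1 e2 by (simp only: add.assoc)
      qed
      ultimately have "((\<lambda>t. \<phi> t * (Lx (y t, y' t) \<bullet> w) + \<phi>' t * (Lv (y t, y' t) \<bullet> w)) has_integral \<Psi> b - \<Psi> a) {a..b}"
        using ab Q by (intro fundamental_theorem_of_calculus_interior_strong[of "Q \<union> ?D"]) auto
      note hi = this
      have "\<Psi> b - \<Psi> a = 0"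
        by (rule crit[OF pa _ ends hi]) (use arb \<delta> in auto)
      then show ?thesis using arb \<delta> by (simp add: \<Psi>_def ends clmp_def)
    qed
    define d where "d = min (s - r) (b - s)"
    have d: "0 < d" using rs arb by (simp add: d_def)
    \<comment> \<open>The right derivative at \<open>\<delta> = 0\<close> turns equal increments of
      \<open>I\<close> at \<open>r\<close> and at \<open>s\<close> into
      \<open>g r = g s\<close>.\<close>
    have sh: "((\<lambda>\<delta>. I (v + \<delta>) - I v) has_vector_derivative g v) (at 0 within {0..<d})" if "v \<in> {a..b} - Q" for v
    proof -
      have "((\<lambda>\<delta>. v + \<delta>) has_vector_derivative 1) (at 0)" by (auto intro!: derivative_eq_intros)
      moreover have "(I has_vector_derivative g v) (at (v + 0))" using I_deriv[OF that] by simp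
      ultimately have "(I \<circ> (\<lambda>\<delta>. v + \<delta>) has_vector_derivative 1 *\<^sub>R g v) (at 0)" by (rule vector_diff_chain_at)
      then have "((\<lambda>\<delta>. I (v + \<delta>) - I v) has_vector_derivative g v) (at 0)"
        by (auto simp: o_def intro!: derivative_eq_intros)
      then show ?thesis by (rule has_vector_derivative_at_within)
    qed
    have "((\<lambda>\<delta>. I (s + \<delta>) - I s) has_vector_derivative g r) (at 0 within {0..<d})"
    proof (rule has_vector_derivative_transform[OF _ _ sh[OF rs(1)]])
      show "I (s + \<delta>) - I s = I (r + \<delta>) - I r" if "\<delta> \<in> {0..<d}" for \<delta>
        using eq[of \<delta>] that by (cases "\<delta> = 0") (auto simp: d_def)
    qed (use d in auto)
    moreover have "at 0 within {0..<d} \<noteq> bot"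
    proof -
      have "(0::real) islimpt {0..<d}" by (rule islimpt_subset[of 0 "{0<..<d}"]) (use d in \<open>auto simp: islimpt_greaterThanLessThan1\<close>)
      then show ?thesis by (simp add: trivial_limit_within)
    qed
    ultimately have "g r = g s" using sh[OF rs(2)] vector_derivative_unique_within by blast
    then show "G r \<bullet> w = G s \<bullet> w" by (simp add: g_def)
  qed
  have "G r = G s" if "r \<in> {a..b} - Q" "s \<in> {a..b} - Q" for r s
    using key[of r s] key[of s r] that by (cases r s rule: linorder_cases) auto
  note const = this
  have "\<exists>p0. \<forall>t\<in>{a..b} - Q. G t = p0"
  proof (cases "\<exists>r. r \<in> {a..b} - Q")
    case True
    then obtain r where r: "r \<in> {a..b} - Q" by (elim exE)
    show ?thesis by (rule exI[of _ "G r"], rule ballI, rule const[OF _ r])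
  qed blast
  then obtain p0 where p0: "\<forall>t\<in>{a..b} - Q. G t = p0" by (elim exE)
  have "\<forall>t\<in>{a..b} - Q. Lv (y t, y' t) = p0 + integral {a..t} (\<lambda>t. Lx (y t, y' t))"
  proof
    fix t assume "t \<in> {a..b} - Q"
    then have "G t = p0" by (rule bspec[OF p0])
    then show "Lv (y t, y' t) = p0 + integral {a..t} (\<lambda>t. Lx (y t, y' t))"
      by (simp add: G_def \<Lambda>_def algebra_simps)
  qed
  then show ?thesis by blast
qed

text \<open>Integration by parts leaves just the boundary term at \<open>a\<close>, which exposes
  the initial momentum \<open>p0\<close>. This is how normality will be read off from
  criticality.\<close>

lemma linear_test_function:
  assumes y: "piecewise_C1 Q a b y y'" "\<And>t. t \<in> {a..b} \<Longrightarrow> y t \<in> K" and ab: "a < b"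
    and p0: "\<forall>t\<in>{a..b} - Q. Lv (y t, y' t) = p0 + integral {a..t} (\<lambda>t. Lx (y t, y' t))"
  shows "((\<lambda>t. (b - t) * (Lx (y t, y' t) \<bullet> w) + (-1) * (Lv (y t, y' t) \<bullet> w)) has_integral - (b - a) * (p0 \<bullet> w)) {a..b}"
proof -
  have clK: "closed K" using K by (simp add: compact_imp_closed)
  note Lxp = piecewise_C1_compose_continuous[OF y(1) Lx_continuous clK y(2)]
  have Q: "finite Q" using y(1) by (simp add: piecewise_C1_def)
  note oQ = piecewise_C1_interior[OF y(1)]
  define \<Lambda> where "\<Lambda> t = integral {a..t} (\<lambda>t. Lx (y t, y' t))" for t
  have \<Lambda>_cont: "continuous_on {a..b} \<Lambda>" unfolding \<Lambda>_def[abs_def] by (rule indefinite_integral_continuous_1[OF Lxp(3)])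
  have \<Lambda>_deriv: "(\<Lambda> has_vector_derivative Lx (y t, y' t)) (at t)" if "t \<in> {a..b} - Q" for t
    unfolding \<Lambda>_def[abs_def] by (rule integral_derivative_off_finite[OF Q oQ(1) Lxp(3,1) that])
  define \<Psi> where "\<Psi> t = (b - t) * ((p0 + \<Lambda> t) \<bullet> w)" for t
  have "((\<lambda>t. (b - t) * (Lx (y t, y' t) \<bullet> w) + (-1) * (Lv (y t, y' t) \<bullet> w)) has_integral \<Psi> b - \<Psi> a) {a..b}"
  proof (rule fundamental_theorem_of_calculus_interior_strong[OF Q])
    show "continuous_on {a..b} \<Psi>" unfolding \<Psi>_def[abs_def] by (intro continuous_intros \<Lambda>_cont)
    fix t assume "t \<in> {a<..<b} - Q"
    then have tQ: "t \<in> {a..b} - Q" by auto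
    have "((\<lambda>t. b - t) has_vector_derivative -1) (at t)" by (auto intro!: derivative_eq_intros)
    moreover have "((\<lambda>t. p0 + \<Lambda> t) has_vector_derivative 0 + Lx (y t, y' t)) (at t)"
      by (rule has_vector_derivative_add[OF has_vector_derivative_const \<Lambda>_deriv[OF tQ]])
    then have "((\<lambda>t. (p0 + \<Lambda> t) \<bullet> w) has_vector_derivative Lx (y t, y' t) \<bullet> w) (at t)"
      using bounded_linear.has_vector_derivative[OF bounded_linear_inner_left] by fastforce
    ultimately have "(\<Psi> has_vector_derivative (b - t) * (Lx (y t, y' t) \<bullet> w) + (-1) * ((p0 + \<Lambda> t) \<bullet> w)) (at t)"
      unfolding \<Psi>_def[abs_def] by (rule has_vector_derivative_mult)
    then show "(\<Psi> has_vector_derivative (b - t) * (Lx (y t, y' t) \<bullet> w) + (-1) * (Lv (y t, y' t) \<bullet> w)) (at t)"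
      using p0 tQ by (simp add: \<Lambda>_def)
  qed (use ab in simp)
  moreover have "\<Psi> b - \<Psi> a = - (b - a) * (p0 \<bullet> w)" by (simp add: \<Psi>_def \<Lambda>_def algebra_simps)
  ultimately show ?thesis by simp
qed

text \<open>Two solutions of the integrated Euler-Lagrange equation agree on a short interval: by
  monotonicity of \<open>Lv\<close> the velocity difference is bounded by its own integral.\<close>

lemma weak_solution_unique:
  assumes x: "piecewise_C1 Q1 a b x u" "\<And>t. t \<in> {a..b} \<Longrightarrow> x t \<in> K"
    and y: "piecewise_C1 Q2 a b y y'" "\<And>t. t \<in> {a..b} \<Longrightarrow> y t \<in> K"
    and ab: "a \<le> \<sigma>" "\<sigma> < b" and eq: "\<And>t. t \<in> {a..\<sigma>} \<Longrightarrow> y t = x t"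
    and xp: "\<forall>t\<in>{a..b} - Q1. Lv (x t, u t) = p0 + integral {a..t} (\<lambda>t. Lx (x t, u t))"
    and yp: "\<forall>t\<in>{a..b} - Q2. Lv (y t, y' t) = p0 + integral {a..t} (\<lambda>t. Lx (y t, y' t))"
  shows "\<exists>\<beta>. \<sigma> < \<beta> \<and> \<beta> \<le> b \<and> (\<forall>t\<in>{\<sigma>..\<beta>}. y t = x t)"
proof -
  have clK: "closed K" using K by (simp add: compact_imp_closed)
  note xi = piecewise_C1_compose_continuous(3)[OF x(1) Lx_continuous clK x(2)]
  note yi = piecewise_C1_compose_continuous(3)[OF y(1) Lx_continuous clK y(2)]
  define Q where "Q = Q1 \<union> Q2"
  have Q: "finite Q" using x(1) y(1) by (simp add: piecewise_C1_def Q_def)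
  have bd: "bounded (u ` ({a..b} - Q1))" "bounded (y' ` ({a..b} - Q2))" using x(1) y(1) by (simp_all add: piecewise_C1_def)
  obtain M1 where M1: "\<forall>v\<in>u ` ({a..b} - Q1). norm v \<le> M1" using bd(1) unfolding bounded_iff by (elim exE)
  obtain M2 where M2: "\<forall>v\<in>y' ` ({a..b} - Q2). norm v \<le> M2" using bd(2) unfolding bounded_iff by (elim exE)
  have M12: "norm (u t) \<le> M1" if "t \<in> {a..b} - Q1" for t using bspec[OF M1 imageI[OF that]] .
  have M12': "norm (y' t) \<le> M2" if "t \<in> {a..b} - Q2" for t using bspec[OF M2 imageI[OF that]] .
  define M where "M = max 1 (max M1 M2)"
  have M: "1 \<le> M" "\<And>t. t \<in> {a..b} - Q \<Longrightarrow> norm (u t) \<le> M" "\<And>t. t \<in> {a..b} - Q \<Longrightarrow> norm (y' t) \<le> M"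
    using M12 M12' by (auto simp: M_def Q_def le_max_iff_disj)
  define h where "h t = y t - x t" for t
  define k where "k t = y' t - u t" for t
  have h_deriv: "(h has_vector_derivative k t) (at t)" if "t \<in> {a..b} - Q" for t
    unfolding h_def[abs_def] k_def using x(1) y(1) that
    by (intro has_vector_derivative_diff) (auto simp: piecewise_C1_def Q_def)
  have h_cont: "continuous_on {a..b} h" unfolding h_def[abs_def]
    using x(1) y(1) by (intro continuous_on_diff) (auto simp: piecewise_C1_def)
  \<comment> \<open>\<open>M\<^sup>2 + M\<close> comes from the Lipschitz bound on
    \<open>Lx\<close>, the last \<open>M\<close> from changing the base point in \<open>Lv\<close>;
    \<open>\<eta>\<close> makes the total momentum difference at most
    \<open>\<mu> * B\<close>.\<close>
  define \<eta> where "\<eta> = min (b - \<sigma>) (min 1 (\<mu> / (C * (M\<^sup>2 + M + M) + 1)))"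
  have den: "0 < C * (M\<^sup>2 + M + M) + 1"
    using const_pos M(1) by (intro add_nonneg_pos mult_nonneg_nonneg) auto
  have \<eta>: "0 < \<eta>" "\<eta> \<le> b - \<sigma>" "\<eta> \<le> 1" using ab const_pos den by (auto simp: \<eta>_def)
  have \<eta>\<mu>: "\<eta> * (C * (M\<^sup>2 + M + M)) \<le> \<mu>"
  proof -
    have "\<eta> * (C * (M\<^sup>2 + M + M)) \<le> \<eta> * (C * (M\<^sup>2 + M + M) + 1)" using \<eta> by (intro mult_left_mono) auto
    also have "\<dots> \<le> \<mu> / (C * (M\<^sup>2 + M + M) + 1) * (C * (M\<^sup>2 + M + M) + 1)"
      using den by (intro mult_right_mono) (auto simp: \<eta>_def)
    finally show ?thesis using den by simp
  qed
  define \<beta> where "\<beta> = \<sigma> + \<eta>"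
  have sub: "{\<sigma>..\<beta>} \<subseteq> {a..b}" using ab \<eta> by (auto simp: \<beta>_def)
  have hb: "norm (h t) \<le> B * (t - \<sigma>)"
    if B: "0 \<le> B" "\<And>t. t \<in> {\<sigma>..\<beta>} - Q \<Longrightarrow> norm (k t) \<le> B" and t: "t \<in> {\<sigma>..\<beta>}" for B t
  proof -
    have "(k has_integral h t - h \<sigma>) {\<sigma>..t}"
    proof (rule fundamental_theorem_of_calculus_interior_strong[OF Q])
      show "continuous_on {\<sigma>..t} h" by (rule continuous_on_subset[OF h_cont]) (use t sub in auto)
      fix r assume "r \<in> {\<sigma><..<t} - Q"
      then have "r \<in> {a..b} - Q" using t sub by auto
      then show "(h has_vector_derivative k r) (at r)" by (rule h_deriv)
    qed (use t in auto)
    then have i: "(k has_integral h t - h \<sigma>) (cbox \<sigma> t)" by (simp add: box_real)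
    have "norm (h t - h \<sigma>) \<le> B * measure lborel (cbox \<sigma> t)"
      by (rule has_integral_bound_spike_finite[OF B(1) Q i]) (use B(2) t in auto)
    moreover have "h \<sigma> = 0" using eq ab by (simp add: h_def)
    ultimately show ?thesis using t by simp
  qed
  \<comment> \<open>A bound \<open>B\<close> on the velocity difference improves to
    \<open>B / 2\<close>: integration bounds the momentum difference by \<open>\<mu> * B\<close>,
    and monotonicity of \<open>Lv\<close> with constant \<open>2 * \<mu>\<close> converts this
    back.\<close>
  have step: "norm (k t) \<le> B / 2"
    if B: "0 \<le> B" "\<And>t. t \<in> {\<sigma>..\<beta>} - Q \<Longrightarrow> norm (k t) \<le> B" and t: "t \<in> {\<sigma>..\<beta>} - Q" for B t
  proof -
    have tab: "t \<in> {a..b}" "t \<in> {a..b} - Q" "t \<in> {a..b} - Q1" "t \<in> {a..b} - Q2" using t sub by (auto simp: Q_def)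
    have hB: "norm (h r) \<le> B * \<eta>" if "r \<in> {\<sigma>..\<beta>}" for r
      using hb[OF B that] that mult_left_mono[of "r - \<sigma>" \<eta> B] B(1) by (auto simp: \<beta>_def)
    have LxB: "norm (Lx (y r, y' r) - Lx (x r, u r)) \<le> C * ((M\<^sup>2 + M) * B)" if r: "r \<in> {\<sigma>..\<beta>} - Q" for r
    proof -
      have rab: "r \<in> {a..b}" "r \<in> {a..b} - Q" using r sub by auto
      define l where "l = max (norm (u r)) (norm (y' r))"
      have l: "0 \<le> l" "l \<le> M" using M(2,3)[OF rab(2)] by (auto simp: l_def le_max_iff_disj)
      have "norm (Lx (y r, y' r) - Lx (x r, u r)) \<le> C * (l\<^sup>2 * norm (h r) + l * norm (k r))"
        unfolding l_def h_def k_def by (rule Lx_lip[OF x(2)[OF rab(1)] y(2)[OF rab(1)]])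
      also have "\<dots> \<le> C * (M\<^sup>2 * B + M * B)"
      proof -
        have "norm (h r) \<le> B * 1" using hB[of r] r \<eta> mult_left_mono[of \<eta> 1 B] B(1) by auto
        then show ?thesis using l B(1) B(2)[OF r] const_pos by (intro mult_left_mono add_mono mult_mono power_mono) auto
      qed
      finally show ?thesis by (simp add: algebra_simps)
    qed
    have "((\<lambda>r. Lx (y r, y' r) - Lx (x r, u r)) has_integral
        (integral {a..t} (\<lambda>t. Lx (y t, y' t)) - integral {a..t} (\<lambda>t. Lx (x t, u t)))) {a..t}"
      using tab by (intro has_integral_diff integrable_integral integrable_on_subinterval[OF yi] integrable_on_subinterval[OF xi]) auto
    \<comment> \<open>Up to \<open>\<sigma>\<close> the curves agree, so the integrals from
      \<open>a\<close> differ only by their parts after \<open>\<sigma>\<close>.\<close>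
    moreover have "(Lx (y r, y' r) - Lx (x r, u r)) = 0" if r: "r \<in> {a<..<\<sigma>} - Q" for r
    proof -
      have rab: "r \<in> {a..b}" "r \<in> {a..b} - Q1" "r \<in> {a..b} - Q2" using r ab by (auto simp: Q_def)
      have "(y has_vector_derivative u r) (at r)"
        by (rule has_vector_derivative_transform_within_open[of x "u r" r "{a<..<\<sigma>}"])
          (use x(1) rab r eq in \<open>auto simp: piecewise_C1_def\<close>)
      moreover have "(y has_vector_derivative y' r) (at r)" using y(1) rab by (auto simp: piecewise_C1_def)
      ultimately have "u r = y' r" by (rule vector_derivative_unique_at)
      then show ?thesis using eq r by simp
    qed
    ultimately have "norm (integral {a..t} (\<lambda>t. Lx (y t, y' t)) - integral {a..t} (\<lambda>t. Lx (x t, u t))) \<le> C * ((M\<^sup>2 + M) * B) * \<eta>"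
    proof -
      let ?q = "\<lambda>r. Lx (y r, y' r) - Lx (x r, u r)"
      assume 1: "(?q has_integral (integral {a..t} (\<lambda>t. Lx (y t, y' t)) - integral {a..t} (\<lambda>t. Lx (x t, u t)))) {a..t}"
        and 0: "\<And>r. r \<in> {a<..<\<sigma>} - Q \<Longrightarrow> ?q r = 0"
      have qi: "?q integrable_on {a..t}" using 1 by blast
      have "integral {a..t} ?q = integral {a..\<sigma>} ?q + integral {\<sigma>..t} ?q"
        by (rule Henstock_Kurzweil_Integration.integral_combine[symmetric]) (use ab t qi in auto)
      moreover have "integral {a..\<sigma>} ?q = integral {a..\<sigma>} (\<lambda>r. 0)"
        by (rule integral_spike[of "Q \<union> {a, \<sigma>}"]) (use 0 Q in \<open>auto intro: negligible_finite\<close>)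
      ultimately have e: "integral {a..t} ?q = integral {\<sigma>..t} ?q" by simp
      have q2: "(?q has_integral integral {\<sigma>..t} ?q) (cbox \<sigma> t)"
        unfolding box_real by (rule integrable_integral[OF integrable_on_subinterval[OF qi]]) (use ab in auto)
      have "norm (integral {\<sigma>..t} ?q) \<le> C * ((M\<^sup>2 + M) * B) * measure lborel (cbox \<sigma> t)"
        by (rule has_integral_bound_spike_finite[OF _ Q q2]) (use LxB t B(1) M(1) const_pos in auto)
      also have "\<dots> \<le> C * ((M\<^sup>2 + M) * B) * \<eta>"
        using t B(1) M(1) const_pos by (intro mult_left_mono) (auto simp: \<beta>_def)
      finally show ?thesis by (simp only: trans[OF integral_unique[OF 1, symmetric] e])
    qed
    then have 1: "norm (Lv (y t, y' t) - Lv (x t, u t)) \<le> C * ((M\<^sup>2 + M) * B) * \<eta>"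
      using xp yp tab by simp
    have "norm (Lv (y t, y' t) - Lv (x t, y' t)) \<le> C * (max (norm (y' t)) (norm (y' t)) * norm (y t - x t) + norm (y' t - y' t))"
      by (rule Lv_lip[OF x(2)[OF tab(1)] y(2)[OF tab(1)]])
    also have "\<dots> \<le> C * (M * (B * \<eta>))"
      using hB[of t] t M(3)[OF tab(2)] const_pos M(1) by (auto simp: h_def intro!: mult_left_mono mult_mono)
    finally have 2: "norm (Lv (y t, y' t) - Lv (x t, y' t)) \<le> C * (M * (B * \<eta>))" .
    have "norm (Lv (x t, y' t) - Lv (x t, u t)) \<le> norm (Lv (y t, y' t) - Lv (x t, u t)) + norm (Lv (y t, y' t) - Lv (x t, y' t))"
      using norm_triangle_ineq4[of "Lv (y t, y' t) - Lv (x t, u t)" "Lv (y t, y' t) - Lv (x t, y' t)"] by simp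
    also have "\<dots> \<le> C * ((M\<^sup>2 + M) * B) * \<eta> + C * (M * (B * \<eta>))" using 1 2 by linarith
    also have "\<dots> = \<eta> * (C * (M\<^sup>2 + M + M)) * B" by (simp add: algebra_simps)
    also have "\<dots> \<le> \<mu> * B" using \<eta>\<mu> B(1) by (rule mult_right_mono)
    finally have 3: "norm (Lv (x t, y' t) - Lv (x t, u t)) \<le> \<mu> * B" .
    have "2 * \<mu> * (norm (k t))\<^sup>2 \<le> (Lv (x t, y' t) - Lv (x t, u t)) \<bullet> k t"
      unfolding k_def by (rule Lv_monotone[OF x(2)[OF tab(1)]])
    also have "\<dots> \<le> \<mu> * B * norm (k t)"
      using norm_cauchy_schwarz[of "Lv (x t, y' t) - Lv (x t, u t)" "k t"] mult_right_mono[OF 3, of "norm (k t)"] by simp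
    finally have "\<mu> * norm (k t) * (2 * norm (k t)) \<le> \<mu> * norm (k t) * B" by (simp add: power2_eq_square mult_ac)
    then show ?thesis
      using const_pos B(1) by (cases "norm (k t) = 0") (auto simp: mult_le_cancel_left_pos)
  qed
  have k2: "norm (k t) \<le> 2 * M" if "t \<in> {\<sigma>..\<beta>} - Q" for t
    using M(2,3)[of t] that sub norm_triangle_ineq4[of "y' t" "u t"] by (fastforce simp: k_def)
  \<comment> \<open>Iterating the improvement replaces Gronwall's inequality and forces the velocity
    difference to vanish.\<close>
  have kn: "norm (k t) \<le> 2 * M / 2 ^ n" if "t \<in> {\<sigma>..\<beta>} - Q" for t n
    using that
  proof (induction n arbitrary: t)
    case 0 then show ?case using k2 by simp
  next
    case (Suc n)
    have "norm (k t) \<le> (2 * M / 2 ^ n) / 2"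
      by (rule step[OF _ Suc.IH Suc.prems]) (use M(1) in auto)
    then show ?case by simp
  qed
  have "norm (k t) \<le> 0" if "t \<in> {\<sigma>..\<beta>} - Q" for t
  proof (rule LIMSEQ_le_const[of "\<lambda>n. 2 * M / 2 ^ n"])
    show "(\<lambda>n. 2 * M / 2 ^ n) \<longlonglongrightarrow> 0"
      using tendsto_mult_right[OF LIMSEQ_realpow_zero[of "1/2"], of "2 * M"] by (simp add: power_divide)
  qed (use kn that in auto)
  then have "norm (h t) \<le> 0 * (t - \<sigma>)" if "t \<in> {\<sigma>..\<beta>}" for t
    by (rule hb[OF order_refl _ that]) auto
  then have "y t = x t" if "t \<in> {\<sigma>..\<beta>}" for t using that by (simp add: h_def)
  then show ?thesis using \<eta> by (intro exI[of _ \<beta>]) (auto simp: \<beta>_def)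
qed

end

lemma smooth_into_slice:
  fixes \<Gamma> :: "real \<times> real \<Rightarrow> 'm::topological_space"
  assumes "smooth_into A ({-e<..<e} \<times> T) \<Gamma>" "s \<in> {-e<..<e}"
  shows "smooth_into A T (\<lambda>t. \<Gamma> (s, t))"
  unfolding smooth_into_iff_rep
proof
  fix t assume t: "t \<in> T"
  then obtain c where c: "c \<in> A" "smooth_rep c ({-e<..<e} \<times> T) \<Gamma> (s, t)"
    using assms unfolding smooth_into_iff_rep by blast
  obtain r g where r: "0 < r" "Cinf_on (ball (s, t) r) g"
    "\<forall>y\<in>{-e<..<e} \<times> T \<inter> ball (s, t) r. \<Gamma> y \<in> fst c \<and> snd c (\<Gamma> y) = g y"
    using smooth_rep_ball[OF c(2)] by (elim exE conjE)
  have sub: "(\<lambda>t. (s, t)) ` ball t r \<subseteq> ball (s, t) r" by (auto simp: dist_Pair_Pair)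
  have "Cinf_on (ball t r) (\<lambda>t. g (s, t))"
    by (rule Cinf_on_compose[OF open_ball open_ball Cinf_on_Pair[OF open_ball Cinf_on_const[OF open_ball] Cinf_on_id[OF open_ball]] r(2) sub])
  moreover have "\<Gamma> (s, y) \<in> fst c \<and> snd c (\<Gamma> (s, y)) = g (s, y)" if "y \<in> T \<inter> ball t r" for y
  proof -
    have "(s, y) \<in> {-e<..<e} \<times> T \<inter> ball (s, t) r" using that assms(2) sub by blast
    from bspec[OF r(3) this] show ?thesis .
  qed
  ultimately have "smooth_rep c T (\<lambda>t. \<Gamma> (s, t)) t"
    unfolding smooth_rep_def using r(1)
    by (intro exI[of _ "ball t r"] exI[of _ "\<lambda>t. g (s, t)"]) auto
  then show "\<exists>c\<in>A. smooth_rep c T (\<lambda>t. \<Gamma> (s, t)) t" using c(1) by blast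
qed

lemma smooth_rep_subset: "smooth_rep c X f x \<Longrightarrow> Y \<subseteq> X \<Longrightarrow> smooth_rep c Y f x"
  unfolding smooth_rep_def by (elim exE, intro exI conjI) auto

lemma smooth_into_subset: "smooth_into A X f \<Longrightarrow> Y \<subseteq> X \<Longrightarrow> smooth_into A Y f"
  unfolding smooth_into_iff_rep using smooth_rep_subset by (metis subsetD)

lemma finite_uniform_pos:
  assumes "finite S" "\<And>p. p \<in> S \<Longrightarrow> \<exists>T>0. P T p" and mono: "\<And>T T' p. P T p \<Longrightarrow> 0 < T' \<Longrightarrow> T' \<le> T \<Longrightarrow> P T' p"
  shows "\<exists>T>0::real. \<forall>p\<in>S. P T p"
  using assms(1,2)
proof (induction S rule: finite_induct)
  case empty then show ?case by (intro exI[of _ 1]) simp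
next
  case (insert p S)
  then obtain T1 T2 where "0 < T1" "P T1 p" "0 < T2" "\<forall>q\<in>S. P T2 q" by (metis insertCI)
  then show ?case using mono by (intro exI[of _ "min T1 T2"]) (auto simp: min_def not_le intro: less_imp_le)
qed

section \<open>Geodesics in a chart\<close>

locale chart_estimates = finsler_manifold A F
  for A :: "('m::{t2_space, second_countable_topology}, 'e::euclidean_space) chart set" and F +
  fixes c :: "('m, 'e) chart" and K :: "'e set" and \<mu> C m :: real
  assumes c: "c \<in> charts" and est: "finsler_estimates (snd c ` fst c) (in_chart A F c) K \<mu> C m"
begin

sublocale finsler_estimates "snd c ` fst c" "in_chart A F c" K \<mu> C m by (rule est)

lemma ch: "is_chart c" by (rule is_chart[OF c])

lemma interior_K: "x \<in> interior K \<Longrightarrow> x \<in> K" "x \<in> interior K \<Longrightarrow> x \<in> snd c ` fst c" "x \<in> K \<Longrightarrow> x \<in> snd c ` fst c"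
  using K(3) interior_subset by blast+

text \<open>The speed refers to the whole interval \<open>{a..b}\<close>, while the curve has to
  stay in the chart only up to \<open>\<beta>\<close>.\<close>

lemma speed_square_integral:
  assumes P: "smooth_pieces P a b \<zeta>" and ab: "a < \<beta>" "\<beta> \<le> b"
    and in_c: "\<And>t. t \<in> {a..\<beta>} \<Longrightarrow> \<zeta> t \<in> fst c"
  shows "integral {a..\<beta>} (\<lambda>t. (speed \<zeta> a b t)\<^sup>2) =
    2 * integral {a..\<beta>} (\<lambda>t. L (snd c (\<zeta> t), vector_derivative (\<lambda>t. snd c (\<zeta> t)) (at t)))"
proof -
  note co = smooth_pieces_coordinates[OF P order_refl ab c in_c]
  have fin: "finite ({a, \<beta>} \<union> (P \<inter> {a..\<beta>}))" using co(1) by (simp add: piecewise_C1_def)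
  have "integral {a..\<beta>} (\<lambda>t. (speed \<zeta> a b t)\<^sup>2) =
    integral {a..\<beta>} (\<lambda>t. 2 * L (snd c (\<zeta> t), vector_derivative (\<lambda>t. snd c (\<zeta> t)) (at t)))"
  proof (rule integral_spike[OF negligible_finite[OF fin]])
    fix t assume t: "t \<in> {a..\<beta>} - ({a, \<beta>} \<union> (P \<inter> {a..\<beta>}))"
    have "speed \<zeta> a b t = in_chart A F c (snd c (\<zeta> t), vector_derivative (\<lambda>t. snd c (\<zeta> t)) (at t))"
      by (rule co(2)[OF _ t])
    then show "2 * L (snd c (\<zeta> t), vector_derivative (\<lambda>t. snd c (\<zeta> t)) (at t)) = (speed \<zeta> a b t)\<^sup>2" by (simp add: L_def)
  qed
  then show ?thesis by simp
qed

lemma energy_in_chart: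
  assumes P: "smooth_pieces P a b \<zeta>" and ab: "a < b" and in_c: "\<And>t. t \<in> {a..b} \<Longrightarrow> \<zeta> t \<in> fst c"
  shows "energy A F \<zeta> a b = integral {a..b} (\<lambda>t. L (snd c (\<zeta> t), vector_derivative (\<lambda>t. snd c (\<zeta> t)) (at t)))"
  using speed_square_integral[OF P ab order_refl in_c] by (simp add: energy_def)

text \<open>\<open>I\<close> is open so that derivatives are two-sided on closed subintervals, and
  the curve runs in the interior of \<open>K\<close> so that small variations stay in
  \<open>K\<close>. The speed is left free, to allow rescaling.\<close>

definition EL_curve :: "real set \<Rightarrow> (real \<Rightarrow> 'e) \<Rightarrow> (real \<Rightarrow> 'e) \<Rightarrow> bool" where
  "EL_curve I x u \<longleftrightarrow> open I \<and> Cinf_on I x \<and> Cinf_on I u \<and>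
     (\<forall>t\<in>I. x t \<in> interior K \<and> (x has_vector_derivative u t) (at t) \<and>
        ((\<lambda>t. Lv (x t, u t)) has_vector_derivative Lx (x t, u t)) (at t))"

lemma EL_smooth_into: 
  assumes "EL_curve I x u" "T \<subseteq> I" shows "smooth_into A T (\<lambda>t. cinv c (x t))"
proof (rule smooth_intoI)
  fix t assume t: "t \<in> T"
  have I: "open I" "Cinf_on I x" using assms(1) by (simp_all add: EL_curve_def)
  have tI: "t \<in> I" using assms(2) t by blast
  have U: "x y \<in> snd c ` fst c" if "y \<in> I" for y
    using assms(1) that by (intro interior_K(2)) (simp add: EL_curve_def)
  have 1: "(\<lambda>t. cinv c (x t)) ` (T \<inter> I) \<subseteq> fst c" using cinv_in[OF ch] U by blast
  have 2: "\<forall>y\<in>T \<inter> I. snd c (cinv c (x y)) = x y" using chart_cinv[OF ch] U by blast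
  have "smooth_rep c T (\<lambda>t. cinv c (x t)) t"
    unfolding smooth_rep_def using I tI 1 2 by (intro exI[of _ I] exI[of _ x] conjI)
  then show "\<exists>d\<in>charts. smooth_rep d T (\<lambda>t. cinv c (x t)) t" using c by blast
qed

lemma EL_piecewise_C1:
  assumes "EL_curve I x u" "{a..b} \<subseteq> I"
  shows "piecewise_C1 {a, b} a b x u"
proof -
  have cu: "continuous_on {a..b} u" "continuous_on {a..b} x"
    using assms Cinf_on_imp_continuous_on continuous_on_subset unfolding EL_curve_def by blast+
  have "bounded (u ` {a..b})" by (intro compact_imp_bounded compact_continuous_image cu compact_Icc)
  then have "bounded (u ` ({a..b} - {a, b}))" by (rule bounded_subset) auto
  then show ?thesis unfolding piecewise_C1_def
    using cu assms by (auto simp: EL_curve_def intro: continuous_on_subset)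
qed

text \<open>The first variation formula: by the Euler-Lagrange equation the linear term consists of
  boundary terms, and \<open>bdry\<close> makes them cancel, so that the energy changes only
  quadratically in \<open>s\<close>. The labour is to show that a piecewise smooth variation is C^1
  close to the curve, uniformly in time and linearly in \<open>s\<close>.\<close>

lemma EL_variation:
  assumes EL: "EL_curve I x u" and ab: "a < b" "{a..b} \<subseteq> I"
    and var: "variation A (\<lambda>t. cinv c (x t)) a b e \<Gamma>"
    and bdry: "\<And>s. s \<in> {-e<..<e} \<Longrightarrow> \<Gamma> (s, a) \<in> fst c \<Longrightarrow> \<Gamma> (s, b) \<in> fst c \<Longrightarrow>
      Lv (x b, u b) \<bullet> (snd c (\<Gamma> (s, b)) - x b) - Lv (x a, u a) \<bullet> (snd c (\<Gamma> (s, a)) - x a) = 0"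
  shows "((\<lambda>s. energy A F (\<lambda>t. \<Gamma> (s, t)) a b) has_real_derivative 0) (at 0)"
proof -
  obtain P where e: "0 < e" and \<Gamma>0: "\<forall>t\<in>{a..b}. \<Gamma> (0, t) = cinv c (x t)" and P: "breaks P a b"
    "\<forall>l r. piece P l r \<longrightarrow> smooth_into A ({-e<..<e} \<times> {l..r}) \<Gamma>"
    using var unfolding variation_def by (elim exE conjE)
  have ELt: "x t \<in> interior K" "x t \<in> K" "x t \<in> snd c ` fst c" "(x has_vector_derivative u t) (at t)"
    "((\<lambda>t. Lv (x t, u t)) has_vector_derivative Lx (x t, u t)) (at t)" if "t \<in> {a..b}" for t
    using EL ab(2) that interior_K by (auto simp: EL_curve_def subset_iff)
  define y where "y s t = snd c (\<Gamma> (s, t))" for s t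
  \<comment> \<open>Lipschitz constants are again written as \<open>1 / T\<close>, so that one small
    \<open>T\<close> serves both as range of \<open>s\<close> and as bound. \<open>good\<close>
    holds at break points as well, \<open>good'\<close> only inside the pieces, where derivatives
    are two-sided.\<close>
  define good where "good T s t \<longleftrightarrow> \<Gamma> (s, t) \<in> fst c \<and> y s t \<in> K \<and> norm (y s t - x t) \<le> \<bar>s\<bar> / T" for T s t
  define good' where "good' T s t \<longleftrightarrow> (\<exists>v. (y s has_vector_derivative v) (at t) \<and> norm (v - u t) \<le> \<bar>s\<bar> / T)" for T s t
  have y0: "y 0 t = x t" if "t \<in> {a..b}" for t
    using \<Gamma>0 that chart_cinv[OF ch ELt(3)[OF that]] by (simp add: y_def)
  have mono: "\<bar>s\<bar> / T \<le> \<bar>s\<bar> / T'" if "0 < T'" "T' \<le> T" for s T T' :: real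
    using that by (intro divide_left_mono) auto
  have piece_loc: "\<exists>T>0. \<forall>t\<in>{l..r}. \<forall>s. \<bar>s\<bar> < T \<longrightarrow> \<bar>s\<bar> < e \<longrightarrow> good T s t \<and> (l < t \<and> t < r \<longrightarrow> good' T s t)"
    if lr: "piece P l r" for l r
  proof (rule compact_uniform_pos[OF compact_Icc])
    fix t0 assume t0: "t0 \<in> {l..r}"
    note lrab = piece_bounds[OF P(1) lr]
    have t0ab: "t0 \<in> {a..b}" using t0 lrab by auto
    have sm: "smooth_into A ({-e<..<e} \<times> {l..r}) \<Gamma>" using P(2) lr by blast
    have in0: "(0, t0) \<in> {-e<..<e} \<times> {l..r}" using e t0 by simp
    have "\<Gamma> (0, t0) \<in> fst c" using \<Gamma>0 t0ab cinv_in[OF ch ELt(3)[OF t0ab]] by simp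
    from smooth_rep_ball[OF smooth_into_rep[OF sm in0 c this]] obtain r0 g where
      g: "0 < r0" "Cinf_on (ball (0, t0) r0) g"
        "\<forall>z\<in>{-e<..<e} \<times> {l..r} \<inter> ball (0, t0) r0. \<Gamma> z \<in> fst c \<and> snd c (\<Gamma> z) = g z"
      by (elim exE conjE)
    have g0: "g (0, t0) = x t0"
      using bspec[OF g(3), of "(0, t0)"] g(1) in0 y0[OF t0ab] by (auto simp: y_def)
    have "open (ball (0, t0) r0 \<inter> g -` interior K)"
      by (rule continuous_open_preimage[OF Cinf_on_imp_continuous_on[OF g(2)]]) auto
    moreover have "(0, t0) \<in> ball (0, t0) r0 \<inter> g -` interior K" using g(1) g0 ELt(1)[OF t0ab] by simp
    ultimately obtain r1 where r1: "0 < r1" "cball (0, t0) r1 \<subseteq> ball (0, t0) r0 \<inter> g -` interior K"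
      by (meson open_contains_cball)
    have r1b: "cball (0::real, t0) r1 \<subseteq> ball (0, t0) r0" by (rule subset_trans[OF r1(2) Int_lower1])
    define gt where "gt z = frechet_derivative g (at z) (0, 1)" for z
    have gts: "Cinf_on (ball (0, t0) r0) gt" unfolding gt_def[abs_def] by (rule Cinf_on_frechet[OF g(2)])
    obtain D1 where D1: "0 \<le> D1" "\<forall>z\<in>cball (0, t0) r1. \<forall>z'\<in>cball (0, t0) r1. norm (g z - g z') \<le> D1 * norm (z - z')"
      using C1_lipschitz_on_compact_convex[OF Cinf_on_imp_Ck_on[OF g(2)] compact_cball convex_cball r1b] by (elim exE conjE)
    obtain D2 where D2: "0 \<le> D2" "\<forall>z\<in>cball (0, t0) r1. \<forall>z'\<in>cball (0, t0) r1. norm (gt z - gt z') \<le> D2 * norm (z - z')"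
      using C1_lipschitz_on_compact_convex[OF Cinf_on_imp_Ck_on[OF gts] compact_cball convex_cball r1b] by (elim exE conjE)
    \<comment> \<open>\<open>r1 / 2\<close> keeps \<open>(s, t)\<close> in the ball for
      \<open>t\<close> within \<open>r1 / 2\<close> of \<open>t0\<close>; the other bound makes
      \<open>1 / T\<close> larger than both Lipschitz constants.\<close>
    define T where "T = min (r1 / 2) (1 / (D1 + D2 + 1))"
    have T: "0 < T" "T \<le> r1 / 2" using r1 D1 D2 by (auto simp: T_def)
    have Tb: "D1 * \<bar>s\<bar> \<le> \<bar>s\<bar> / T" "D2 * \<bar>s\<bar> \<le> \<bar>s\<bar> / T" for s
    proof -
      have D: "0 < D1 + D2 + 1" using D1(1) D2(1) by simp
      have "T \<le> 1 / (D1 + D2 + 1)" by (simp add: T_def)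
      then have "(D1 + D2 + 1) * T \<le> 1" unfolding pos_le_divide_eq[OF D] by (simp only: mult.commute)
      then have "D1 + D2 + 1 \<le> 1 / T" unfolding pos_le_divide_eq[OF T(1)] .
      then have "D1 \<le> 1 / T" "D2 \<le> 1 / T" using D1(1) D2(1) by auto
      from mult_right_mono[OF this(1), of "\<bar>s\<bar>"] mult_right_mono[OF this(2), of "\<bar>s\<bar>"]
      show "D1 * \<bar>s\<bar> \<le> \<bar>s\<bar> / T" "D2 * \<bar>s\<bar> \<le> \<bar>s\<bar> / T" by auto
    qed
    have "good T s t \<and> (l < t \<and> t < r \<longrightarrow> good' T s t)"
      if t: "t \<in> ball t0 (r1 / 2) \<inter> {l..r}" and s: "\<bar>s\<bar> < T" "\<bar>s\<bar> < e" for s t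
    proof -
      have in_ball: "(s', t') \<in> cball (0, t0) r1" if "\<bar>s'\<bar> < T" "t' \<in> ball t0 (r1 / 2)" for s' t'
      proof -
        have "norm (- s', t0 - t') \<le> norm (- s') + norm (t0 - t')" by (rule norm_Pair_le)
        then show ?thesis using that T by (simp add: dist_norm)
      qed
      have rep: "\<Gamma> (s', t') \<in> fst c \<and> y s' t' = g (s', t')"
        if "\<bar>s'\<bar> < T" "\<bar>s'\<bar> < e" "t' \<in> ball t0 (r1 / 2) \<inter> {l..r}" for s' t'
      proof -
        have "(s', t') \<in> ball (0, t0) r0" using subsetD[OF r1b in_ball] that by blast
        moreover have "s' \<in> {-e<..<e}" using that by (auto simp: abs_less_iff)
        ultimately have "(s', t') \<in> {-e<..<e} \<times> {l..r} \<inter> ball (0, t0) r0" using that by blast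
        from bspec[OF g(3) this] show ?thesis by (simp add: y_def)
      qed
      have st: "(s, t) \<in> cball (0, t0) r1" "(0::real, t) \<in> cball (0, t0) r1" using in_ball[of s t] in_ball[of 0 t] s t T by auto
      have tab: "t \<in> {a..b}" using t lrab by auto
      have xt: "x t' = g (0, t')" if "t' \<in> ball t0 (r1 / 2) \<inter> {l..r}" for t'
        using rep[of 0 t'] y0[of t'] that lrab e T by auto
      have nrm: "norm ((s, t) - (0::real, t)) = \<bar>s\<bar>" by (simp add: norm_Pair)
      have "norm (y s t - x t) \<le> D1 * \<bar>s\<bar>"
        using bspec[OF bspec[OF D1(2) st(1)] st(2)] rep[OF s t] xt[OF t] nrm by simp
      then have gd: "good T s t"
        using rep[OF s t] Tb(1)[of s] r1(2) st(1) interior_K(1) by (auto simp: good_def)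
      have "good' T s t" if lt: "l < t" "t < r"
      proof -
        have op: "open (ball t0 (r1 / 2) \<inter> {l<..<r})" "t \<in> ball t0 (r1 / 2) \<inter> {l<..<r}" using t lt by auto
        have dg: "((\<lambda>t. g (s', t)) has_vector_derivative gt (s', t)) (at t)" if "\<bar>s'\<bar> < T" for s'
        proof -
          have z: "(s', t) \<in> ball (0, t0) r0" using in_ball[OF that, of t] t r1b by blast
          note dgz = Cinf_on_has_derivative[OF g(2) z]
          have "((\<lambda>t. (s', t)) has_derivative (\<lambda>h. (0, h))) (at t)" by (auto intro!: derivative_eq_intros)
          from has_derivative_compose[OF this dgz]
          have "((\<lambda>t. g (s', t)) has_derivative (\<lambda>h. frechet_derivative g (at (s', t)) (0, h))) (at t)" .
          moreover have "frechet_derivative g (at (s', t)) (0, h) = h *\<^sub>R gt (s', t)" for h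
            using linear_scale[OF has_derivative_linear[OF dgz], of h "(0, 1)"] by (simp add: gt_def)
          ultimately show ?thesis by (simp add: has_vector_derivative_def)
        qed
        have d1: "(y s has_vector_derivative gt (s, t)) (at t)"
          by (rule has_vector_derivative_transform_within_open[OF dg[OF s(1)] op]) (use rep[OF s] in auto)
        have "(x has_vector_derivative gt (0, t)) (at t)"
          by (rule has_vector_derivative_transform_within_open[OF dg op]) (use xt T in auto)
        then have "u t = gt (0, t)" using ELt(4)[OF tab] vector_derivative_unique_at by blast
        then have "norm (gt (s, t) - u t) \<le> D2 * \<bar>s\<bar>"
          using bspec[OF bspec[OF D2(2) st(1)] st(2)] nrm by simp
        then show ?thesis unfolding good'_def using d1 Tb(2)[of s] by (meson order_trans)
      qed
      then show ?thesis using gd by blast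
    qed
    then have "\<forall>t\<in>ball t0 (r1 / 2) \<inter> {l..r}. \<forall>s. \<bar>s\<bar> < T \<longrightarrow> \<bar>s\<bar> < e \<longrightarrow> good T s t \<and> (l < t \<and> t < r \<longrightarrow> good' T s t)"
      by (intro ballI allI impI)
    then show "\<exists>V T. open V \<and> t0 \<in> V \<and> 0 < T \<and> (\<forall>t\<in>V \<inter> {l..r}. \<forall>s. \<bar>s\<bar> < T \<longrightarrow> \<bar>s\<bar> < e \<longrightarrow> good T s t \<and> (l < t \<and> t < r \<longrightarrow> good' T s t))"
      using T(1) r1(1) by (intro exI[of _ "ball t0 (r1 / 2)"] exI[of _ T] conjI) auto
  next
    fix T T' :: real and t
    assume h: "\<forall>s. \<bar>s\<bar> < T \<longrightarrow> \<bar>s\<bar> < e \<longrightarrow> good T s t \<and> (l < t \<and> t < r \<longrightarrow> good' T s t)" "0 < T'" "T' \<le> T"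
    show "\<forall>s. \<bar>s\<bar> < T' \<longrightarrow> \<bar>s\<bar> < e \<longrightarrow> good T' s t \<and> (l < t \<and> t < r \<longrightarrow> good' T' s t)"
    proof (intro allI impI)
      fix s assume "\<bar>s\<bar> < T'" "\<bar>s\<bar> < e"
      then have "good T s t \<and> (l < t \<and> t < r \<longrightarrow> good' T s t)" using h by auto
      then show "good T' s t \<and> (l < t \<and> t < r \<longrightarrow> good' T' s t)"
        using mono[OF h(2,3), of s] unfolding good_def good'_def by (meson order_trans)
    qed
  qed
  have "\<exists>T>0. \<forall>p\<in>{(l, r). piece P l r}. \<forall>t\<in>{fst p..snd p}. \<forall>s. \<bar>s\<bar> < T \<longrightarrow> \<bar>s\<bar> < e \<longrightarrow>
      good T s t \<and> (fst p < t \<and> t < snd p \<longrightarrow> good' T s t)"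
  proof (rule finite_uniform_pos)
    have "finite (P \<times> P)" using P(1) by (simp add: breaks_def)
    then show "finite {(l, r). piece P l r}" by (rule finite_subset[rotated]) (auto simp: piece_def)
    show "\<exists>T>0. \<forall>t\<in>{fst p..snd p}. \<forall>s. \<bar>s\<bar> < T \<longrightarrow> \<bar>s\<bar> < e \<longrightarrow> good T s t \<and> (fst p < t \<and> t < snd p \<longrightarrow> good' T s t)"
      if "p \<in> {(l, r). piece P l r}" for p
      using piece_loc[of "fst p" "snd p"] that by (simp add: case_prod_beta)
    fix T T' :: real and p :: "real \<times> real"
    assume h: "\<forall>t\<in>{fst p..snd p}. \<forall>s. \<bar>s\<bar> < T \<longrightarrow> \<bar>s\<bar> < e \<longrightarrow> good T s t \<and> (fst p < t \<and> t < snd p \<longrightarrow> good' T s t)" "0 < T'" "T' \<le> T"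
    show "\<forall>t\<in>{fst p..snd p}. \<forall>s. \<bar>s\<bar> < T' \<longrightarrow> \<bar>s\<bar> < e \<longrightarrow> good T' s t \<and> (fst p < t \<and> t < snd p \<longrightarrow> good' T' s t)"
    proof (intro ballI allI impI)
      fix t s assume "t \<in> {fst p..snd p}" "\<bar>s\<bar> < T'" "\<bar>s\<bar> < e"
      then have "good T s t \<and> (fst p < t \<and> t < snd p \<longrightarrow> good' T s t)" using h by auto
      then show "good T' s t \<and> (fst p < t \<and> t < snd p \<longrightarrow> good' T' s t)"
        using mono[OF h(2,3), of s] unfolding good_def good'_def by (meson order_trans)
    qed
  qed
  then obtain T where T: "0 < T" "\<forall>p\<in>{(l, r). piece P l r}. \<forall>t\<in>{fst p..snd p}. \<forall>s. \<bar>s\<bar> < T \<longrightarrow> \<bar>s\<bar> < e \<longrightarrow>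
      good T s t \<and> (fst p < t \<and> t < snd p \<longrightarrow> good' T s t)" by (elim exE conjE)
  have G: "good T s t" if "\<bar>s\<bar> < T" "\<bar>s\<bar> < e" "t \<in> {a..b}" for s t
  proof -
    have "\<exists>l r. piece P l r \<and> l \<le> t \<and> t \<le> r"
    proof (cases "t < b")
      case True then show ?thesis using piece_right[OF P(1), of t] that by force
    next
      case False then show ?thesis using piece_left[OF P(1), of t] that ab by force
    qed
    then obtain l r where "piece P l r" "l \<le> t" "t \<le> r" by blast
    then show ?thesis using bspec[OF T(2), of "(l, r)"] that by auto
  qed
  have G': "good' T s t" if "\<bar>s\<bar> < T" "\<bar>s\<bar> < e" "t \<in> {a..b} - P" for s t
  proof -
    from piece_mid[OF P(1) that(3)] obtain l r where "piece P l r" "l < t" "t < r" by (elim exE conjE)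
    then show ?thesis using bspec[OF T(2), of "(l, r)"] that by auto
  qed
  have sp: "smooth_pieces P a b (\<lambda>t. \<Gamma> (s, t))" if "\<bar>s\<bar> < e" for s
    unfolding smooth_pieces_def using P that smooth_into_slice[of A e _ \<Gamma> s] by (auto simp: abs_less_iff)
  define y' where "y' s t = vector_derivative (y s) (at t)" for s t
  define Q where "Q = {a, b} \<union> (P \<inter> {a..b})"
  note xC = EL_piecewise_C1[OF EL ab(2)]
  have "bounded (u ` {a..b})"
    using EL ab(2) Cinf_on_imp_continuous_on continuous_on_subset unfolding EL_curve_def
    by (intro compact_imp_bounded compact_continuous_image compact_Icc) blast
  then obtain M where M: "0 < M" "\<forall>v\<in>u ` {a..b}. norm v \<le> M" unfolding bounded_pos by (elim exE conjE)
  have rem: "\<bar>energy A F (\<lambda>t. \<Gamma> (s, t)) a b - integral {a..b} (\<lambda>t. L (x t, u t)) - 0\<bar>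
      \<le> C * (1 + ((M + 1)\<^sup>2 + (M + 1))) * (\<bar>s\<bar> / T)\<^sup>2 * (b - a)" if s: "\<bar>s\<bar> < min T e" for s
  proof -
    have s': "\<bar>s\<bar> < T" "\<bar>s\<bar> < e" using s by auto
    have in_c: "\<Gamma> (s, t) \<in> fst c" and inK: "y s t \<in> K" and cl: "norm (y s t - x t) \<le> \<bar>s\<bar> / T" if "t \<in> {a..b}" for t
      using G[OF s' that] by (simp_all add: good_def)
    note co = smooth_pieces_coordinates(1)[OF sp[OF s'(2)] order_refl ab(1) order_refl c in_c, folded y_def Q_def, folded y'_def]
    have en: "energy A F (\<lambda>t. \<Gamma> (s, t)) a b = integral {a..b} (\<lambda>t. L (y s t, y' s t))"
      using energy_in_chart[OF sp[OF s'(2)] ab(1) in_c] by (simp add: y_def[abs_def] y'_def)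
    have d': "norm (y' s t - u t) \<le> \<bar>s\<bar> / T" if t: "t \<in> {a..b} - ({a, b} \<union> Q)" for t
    proof -
      have "t \<in> {a..b} - P" using t by (auto simp: Q_def)
      from G'[OF s' this] obtain v where "(y s has_vector_derivative v) (at t)" "norm (v - u t) \<le> \<bar>s\<bar> / T"
        unfolding good'_def by (elim exE conjE)
      then show ?thesis by (simp add: y'_def vector_derivative_at)
    qed
    \<comment> \<open>An antiderivative of the linear term, by the Euler-Lagrange equation; its
      boundary values are the expression in \<open>bdry\<close>.\<close>
    define \<Phi> where "\<Phi> t = Lv (x t, u t) \<bullet> (y s t - x t)" for t
    have "((\<lambda>t. Lv (x t, u t) \<bullet> (y' s t - u t) + Lx (x t, u t) \<bullet> (y s t - x t)) has_integral \<Phi> b - \<Phi> a) {a..b}"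
    proof (rule fundamental_theorem_of_calculus_interior_strong[of "{a, b} \<union> Q"])
      show "finite ({a, b} \<union> Q)" using co by (simp add: piecewise_C1_def)
      have "continuous_on {a..b} (\<lambda>t. Lv (x t, u t))"
        by (rule continuous_on_vector_derivative[where f' = "\<lambda>t. Lx (x t, u t)"]) (use ELt(5) has_vector_derivative_at_within in blast)
      then show "continuous_on {a..b} \<Phi>" unfolding \<Phi>_def[abs_def]
        using co xC by (intro continuous_on_inner continuous_on_diff) (auto simp: piecewise_C1_def)
      fix t assume "t \<in> {a<..<b} - ({a, b} \<union> Q)"
      then have t: "t \<in> {a..b}" "t \<in> {a..b} - Q" by auto
      have "(y s has_vector_derivative y' s t) (at t)" using co t by (simp add: piecewise_C1_def)
      from has_vector_derivative_diff[OF this ELt(4)[OF t(1)]]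
      show "(\<Phi> has_vector_derivative Lv (x t, u t) \<bullet> (y' s t - u t) + Lx (x t, u t) \<bullet> (y s t - x t)) (at t)"
        unfolding \<Phi>_def[abs_def] by (rule bounded_bilinear.has_vector_derivative[OF bounded_bilinear_inner ELt(5)[OF t(1)]])
    qed (use ab in simp)
    moreover have "\<Phi> b - \<Phi> a = 0"
      using bdry[of s] in_c[of a] in_c[of b] s'(2) ab by (simp add: \<Phi>_def y_def abs_less_iff)
    ultimately have J: "((\<lambda>t. Lx (x t, u t) \<bullet> (y s t - x t) + Lv (x t, u t) \<bullet> (y' s t - u t)) has_integral 0) {a..b}"
      by (simp add: add.commute)
    show ?thesis unfolding en
      by (rule energy_remainder[OF xC ELt(2) co inK _ cl d' _ _ _ _ J]) (use M s' T ab in auto)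
  qed
  have E0: "energy A F (\<lambda>t. \<Gamma> (0, t)) a b = integral {a..b} (\<lambda>t. L (x t, u t))"
    using rem[of 0] T(1) e by simp
  show ?thesis
  proof (rule quadratic_remainder_derivative)
    show "0 < min T e" using T(1) e by simp
    show "\<bar>energy A F (\<lambda>t. \<Gamma> (s, t)) a b - energy A F (\<lambda>t. \<Gamma> (0, t)) a b - s * 0\<bar>
       \<le> (C * (1 + ((M + 1)\<^sup>2 + (M + 1))) * (b - a) / T\<^sup>2) * s\<^sup>2" if "\<bar>s\<bar> < min T e" for s
      using rem[OF that] unfolding E0 by (simp add: power_divide field_simps)
  qed
qed

lemma EL_piecewise_smooth:
  assumes "EL_curve I x u" "{a..b} \<subseteq> I" "a \<le> b"
  shows "piecewise_smooth A (\<lambda>t. cinv c (x t)) a b"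
proof -
  have "breaks {a, b} a b" using assms(3) by (simp add: breaks_def)
  moreover have "smooth_into A {s..t} (\<lambda>t. cinv c (x t))" if "piece {a, b} s t" for s t
    using that assms by (intro EL_smooth_into[OF assms(1)]) (auto simp: piece_def)
  ultimately show ?thesis using assms(3) by (auto simp: piecewise_smooth_def)
qed

lemma EL_geodesic:
  assumes EL: "EL_curve I x u" and ab: "a < b" "{a..b} \<subseteq> I"
  shows "geodesic A F (\<lambda>t. cinv c (x t)) a b"
  unfolding geodesic_def
proof (intro conjI allI impI)
  show "piecewise_smooth A (\<lambda>t. cinv c (x t)) a b" using EL_piecewise_smooth[OF EL ab(2)] ab(1) by simp
  have xU: "x t \<in> snd c ` fst c" if "t \<in> {a..b}" for t
    using EL ab(2) that interior_K(2) by (auto simp: EL_curve_def subset_iff)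
  fix e \<Gamma> assume h: "variation A (\<lambda>t. cinv c (x t)) a b e \<Gamma> \<and> (\<forall>s\<in>{-e<..<e}. \<Gamma> (s, a) = cinv c (x a) \<and> \<Gamma> (s, b) = cinv c (x b))"
  show "((\<lambda>s. energy A F (\<lambda>t. \<Gamma> (s, t)) a b) has_real_derivative 0) (at 0)"
    by (rule EL_variation[OF EL ab]) (use h chart_cinv[OF ch] xU ab(1) in auto)
qed (rule ab)

text \<open>As \<open>N\<close> is the subspace \<open>S\<close> in the chart, the displacement of
  the initial point along \<open>N\<close> lies in \<open>S\<close>, and the momentum annihilates
  it.\<close>

lemma EL_N_geodesic:
  assumes EL: "EL_curve I x u" and ab: "a < b" "{a..b} \<subseteq> I"
    and N: "\<And>p. p \<in> fst c \<Longrightarrow> p \<in> N \<longleftrightarrow> snd c p \<in> S" "subspace S" "x a \<in> S"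
    and normal: "\<And>w. w \<in> S \<Longrightarrow> Lv (x a, u a) \<bullet> w = 0"
  shows "N_geodesic A F N (\<lambda>t. cinv c (x t)) a b"
  unfolding N_geodesic_def
proof (intro conjI allI impI)
  show "piecewise_smooth A (\<lambda>t. cinv c (x t)) a b" using EL_piecewise_smooth[OF EL ab(2)] ab(1) by simp
  have xU: "x t \<in> snd c ` fst c" if "t \<in> {a..b}" for t
    using EL ab(2) that interior_K(2) by (auto simp: EL_curve_def subset_iff)
  then show "cinv c (x a) \<in> N" using N ab(1) cinv_in[OF ch] chart_cinv[OF ch] by simp
  fix e \<Gamma> assume h: "variation A (\<lambda>t. cinv c (x t)) a b e \<Gamma> \<and> (\<forall>s\<in>{-e<..<e}. \<Gamma> (s, a) \<in> N \<and> \<Gamma> (s, b) = cinv c (x b))"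
  show "((\<lambda>s. energy A F (\<lambda>t. \<Gamma> (s, t)) a b) has_real_derivative 0) (at 0)"
  proof (rule EL_variation[OF EL ab])
    fix s assume s: "s \<in> {-e<..<e}" "\<Gamma> (s, a) \<in> fst c"
    have "snd c (\<Gamma> (s, a)) \<in> S" using N(1)[OF s(2)] h s(1) by blast
    then have "snd c (\<Gamma> (s, a)) - x a \<in> S" using N(2,3) by (intro subspace_diff)
    from normal[OF this] show "Lv (x b, u b) \<bullet> (snd c (\<Gamma> (s, b)) - x b) - Lv (x a, u a) \<bullet> (snd c (\<Gamma> (s, a)) - x a) = 0"
      using h s chart_cinv[OF ch xU] ab(1) by auto
  qed (use h in blast)
qed (rule ab)

section \<open>From critical curves to the Euler-Lagrange equation\<close>

text \<open>Realizes the coordinate displacement \<open>\<phi> w\<close> by a variation of the whole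
  curve, although the curve need stay in the chart only up to \<open>\<beta>\<close>: as
  \<open>\<phi>\<close> vanishes at \<open>\<beta>\<close>, the displaced part can be glued to the
  rest of \<open>\<gamma>\<close>.\<close>

lemma affine_variation:
  assumes P: "smooth_pieces P a b \<gamma>" and ab: "a < \<beta>" "\<beta> \<le> b"
    and in_cK: "\<forall>t\<in>{a..\<beta>}. \<gamma> t \<in> fst c \<and> snd c (\<gamma> t) \<in> interior K"
    and pa: "piecewise_affine D \<phi> \<phi>'" "D \<subseteq> {a..\<beta>}" "\<phi> \<beta> = 0"
  defines "y \<equiv> \<lambda>t. snd c (\<gamma> t)" and "y' \<equiv> \<lambda>t. vector_derivative (\<lambda>t. snd c (\<gamma> t)) (at t)"
  assumes J: "((\<lambda>t. \<phi> t * (Lx (y t, y' t) \<bullet> w) + \<phi>' t * (Lv (y t, y' t) \<bullet> w)) has_integral J) {a..\<beta>}"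
  shows "\<exists>e \<Gamma>. variation A \<gamma> a b e \<Gamma> \<and>
    (\<forall>s\<in>{-e<..<e}. y a + (s * \<phi> a) *\<^sub>R w \<in> snd c ` fst c \<and> \<Gamma> (s, a) = cinv c (y a + (s * \<phi> a) *\<^sub>R w) \<and> \<Gamma> (s, b) = \<gamma> b) \<and>
    ((\<lambda>s. energy A F (\<lambda>t. \<Gamma> (s, t)) a b) has_real_derivative J) (at 0)"
proof -
  have in_c: "\<gamma> t \<in> fst c" and in_K: "snd c (\<gamma> t) \<in> interior K" if "t \<in> {a..\<beta>}" for t
    using bspec[OF in_cK that] by auto
  note br = P[unfolded smooth_pieces_def, THEN conjunct1]
  define Q where "Q = {a, \<beta>} \<union> (P \<inter> {a..\<beta>})"
  have co: "piecewise_C1 Q a \<beta> y y'"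
    using smooth_pieces_coordinates(1)[OF P order_refl ab c in_c] by (simp add: y_def[abs_def] y'_def[abs_def] Q_def)
  have y_cont: "continuous_on {a..\<beta>} y" using co by (simp add: piecewise_C1_def)
  have yK: "y t \<in> interior K" "y t \<in> K" if "t \<in> {a..\<beta>}" for t using in_K[OF that] interior_K(1) by (auto simp: y_def)
  have "compact (y ` {a..\<beta>})" "y ` {a..\<beta>} \<subseteq> interior K" using y_cont yK by (auto intro: compact_continuous_image)
  then obtain \<rho> where \<rho>: "\<rho> > 0" "(\<Union>x\<in>y ` {a..\<beta>}. ball x \<rho>) \<subseteq> interior K"
    using compact_subset_open_imp_ball_epsilon_subset[OF _ open_interior] by metis
  have "bounded (\<phi> ` {a..\<beta>})"
    using pa(1) continuous_on_subset[of UNIV \<phi> "{a..\<beta>}"] unfolding piecewise_affine_def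
    by (intro compact_imp_bounded compact_continuous_image compact_Icc) auto
  then obtain H where H0: "0 < H" "\<forall>r\<in>\<phi> ` {a..\<beta>}. norm r \<le> H" unfolding bounded_pos by (elim exE conjE)
  have H: "\<bar>\<phi> t\<bar> \<le> H" if "t \<in> {a..\<beta>}" for t using bspec[OF H0(2) imageI[OF that]] by simp
  \<comment> \<open>\<open>H\<close> bounds \<open>\<phi>\<close>, 2 bounds \<open>\<phi>'\<close>,
    and the 1 makes \<open>D0\<close> positive when \<open>w\<close> is zero. So
    \<open>\<bar>s\<bar> * D0\<close> bounds the displacement in C^1.\<close>
  define D0 where "D0 = (H + 2) * norm w + 1"
  have D0: "1 \<le> D0" "H * norm w \<le> D0" "2 * norm w \<le> D0" using H0(1) by (auto simp: D0_def algebra_simps)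
  \<comment> \<open>Below \<open>\<rho>\<close> the displaced curve stays in the interior of
    \<open>K\<close>; the bound 1 is the one required by \<open>energy_remainder\<close>.\<close>
  define e where "e = min \<rho> 1 / D0"
  have e: "0 < e" using \<rho> D0 by (simp add: e_def)
  have sD: "\<bar>s\<bar> * D0 < \<rho>" "\<bar>s\<bar> * D0 \<le> 1" if "s \<in> {-e<..<e}" for s
  proof -
    have "\<bar>s\<bar> < min \<rho> 1 / D0" using that by (auto simp: e_def abs_less_iff)
    then have "\<bar>s\<bar> * D0 < min \<rho> 1" using D0(1) by (simp add: pos_less_divide_eq)
    then show "\<bar>s\<bar> * D0 < \<rho>" "\<bar>s\<bar> * D0 \<le> 1" by auto
  qed
  have sw: "norm ((s * \<phi> t) *\<^sub>R w) \<le> \<bar>s\<bar> * D0" if "t \<in> {a..\<beta>}" for s t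
  proof -
    have "\<bar>\<phi> t\<bar> * norm w \<le> D0" using mult_right_mono[OF H[OF that], of "norm w"] D0(2) by simp
    from mult_left_mono[OF this, of "\<bar>s\<bar>"] show ?thesis by (simp add: abs_mult mult.assoc)
  qed
  have inK: "y t + (s * \<phi> t) *\<^sub>R w \<in> interior K" if "s \<in> {-e<..<e}" "t \<in> {a..\<beta>}" for s t
  proof -
    have "y t + (s * \<phi> t) *\<^sub>R w \<in> ball (y t) \<rho>"
      using sw[OF that(2), of s] sD(1)[OF that(1)] by (simp add: dist_norm)
    then show ?thesis using \<rho>(2) that(2) by blast
  qed
  define \<Gamma> where "\<Gamma> z = (if snd z \<le> \<beta> then cinv c (y (snd z) + (fst z * \<phi> (snd z)) *\<^sub>R w) else \<gamma> (snd z))" for z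
  have \<Gamma>_in: "\<Gamma> (s, t) \<in> fst c" "snd c (\<Gamma> (s, t)) = y t + (s * \<phi> t) *\<^sub>R w" if "s \<in> {-e<..<e}" "t \<in> {a..\<beta>}" for s t
    using cinv_in[OF ch interior_K(2)[OF inK[OF that]]] chart_cinv[OF ch interior_K(2)[OF inK[OF that]]] that(2)
    by (simp_all add: \<Gamma>_def)
  have \<Gamma>_out: "\<Gamma> (s, t) = \<gamma> t" if "\<beta> \<le> t" for s t
    using that pa(3) cinv_chart[OF ch in_c[of \<beta>]] ab by (auto simp: \<Gamma>_def y_def)
  have \<Gamma>0: "\<Gamma> (0, t) = \<gamma> t" if "t \<in> {a..b}" for t
    using that cinv_chart[OF ch in_c[of t]] by (auto simp: \<Gamma>_def y_def)
  \<comment> \<open>The variation can break where the curve does, at the kinks of the test function,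
    and at the gluing point.\<close>
  define P' where "P' = P \<union> D \<union> {\<beta>}"
  have br': "breaks P' a b"
    using br pa ab by (auto simp: breaks_def P'_def piecewise_affine_def)
  have smooth: "smooth_into A ({-e<..<e} \<times> {l..u}) \<Gamma>" if lu: "piece P' l u" for l u
  proof -
    note lub = piece_bounds[OF br' lu]
    from piece_right[OF br, of l] lub obtain l0 u0 where l0: "piece P l0 u0" "l0 \<le> l" "l < u0" by auto
    have "u \<le> u0"
    proof (rule ccontr)
      assume "\<not> u \<le> u0"
      then have "u0 \<in> P' \<inter> {l<..<u}" using l0 by (auto simp: P'_def piece_def)
      then show False using lu by (auto simp: piece_def)
    qed
    then have sub: "{l..u} \<subseteq> {l0..u0}" using l0(2) by auto
    have "smooth_into A {l0..u0} \<gamma>" using P l0(1) unfolding smooth_pieces_def by blast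
    then have \<gamma>s: "smooth_into A {l..u} \<gamma>" by (rule smooth_into_subset[OF _ sub])
    have "\<beta> \<notin> {l<..<u}" using lu by (auto simp: piece_def P'_def)
    then consider "u \<le> \<beta>" | "\<beta> \<le> l" by force
    then show ?thesis
    proof cases
      case 1
      have "D \<inter> {l<..<u} = {}" using lu by (auto simp: piece_def P'_def)
      then obtain p q where pq: "\<forall>t\<in>{l..u}. \<phi> t = p + q * t"
        using pa(1) lub unfolding piecewise_affine_def by metis
      show ?thesis
      proof (rule smooth_intoI)
        fix z assume z: "z \<in> {-e<..<e} \<times> {l..u}"
        have t: "snd z \<in> {l..u}" "snd z \<in> {a..\<beta>}" using z 1 lub by auto
        from smooth_rep_ball[OF smooth_into_rep[OF \<gamma>s t(1) c in_c[OF t(2)]]] obtain r g0 where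
          g0: "0 < r" "Cinf_on (ball (snd z) r) g0" "\<forall>t\<in>{l..u} \<inter> ball (snd z) r. \<gamma> t \<in> fst c \<and> snd c (\<gamma> t) = g0 t"
          by (elim exE conjE)
        let ?W = "(UNIV :: real set) \<times> ball (snd z) r"
        have oW: "open ?W" by (intro open_Times) auto
        define g where "g v = g0 (snd v) + (fst v * (p + q * snd v)) *\<^sub>R w" for v
        have "Cinf_on ?W g" unfolding g_def[abs_def]
        proof (intro Cinf_on_add[OF oW])
          show "Cinf_on ?W (\<lambda>v. g0 (snd v))"
            by (rule Cinf_on_compose[OF oW open_ball Cinf_on_linear[OF bounded_linear_snd oW] g0(2)]) auto
          show "Cinf_on ?W (\<lambda>v. (fst v * (p + q * snd v)) *\<^sub>R w)"
            by (intro Cinf_on_bounded_linear[OF bounded_linear_scaleR_left oW] Cinf_on_bilinear[OF bounded_bilinear_mult oW]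
                Cinf_on_add[OF oW] Cinf_on_const[OF oW] Cinf_on_bounded_linear[OF bounded_linear_mult_right oW]
                Cinf_on_linear[OF bounded_linear_snd oW] Cinf_on_linear[OF bounded_linear_fst oW])
        qed
        moreover have "\<Gamma> v \<in> fst c \<and> snd c (\<Gamma> v) = g v" if v: "v \<in> {-e<..<e} \<times> {l..u} \<inter> ?W" for v
        proof -
          have v': "fst v \<in> {-e<..<e}" "snd v \<in> {a..\<beta>}" "snd v \<in> {l..u}" "snd v \<in> {l..u} \<inter> ball (snd z) r"
            using v 1 lub by auto
          have "y (snd v) = g0 (snd v)" using bspec[OF g0(3) v'(4)] by (simp add: y_def)
          then show ?thesis using \<Gamma>_in[OF v'(1,2)] bspec[OF pq v'(3)] by (simp add: g_def)
        qed
        then have "\<Gamma> ` ({-e<..<e} \<times> {l..u} \<inter> ?W) \<subseteq> fst c" "\<forall>v\<in>{-e<..<e} \<times> {l..u} \<inter> ?W. snd c (\<Gamma> v) = g v"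
          by blast+
        ultimately have "smooth_rep c ({-e<..<e} \<times> {l..u}) \<Gamma> z"
          unfolding smooth_rep_def using oW g0(1) by (intro exI[of _ ?W] exI[of _ g] conjI) (auto simp: mem_Times_iff)
        then show "\<exists>d\<in>charts. smooth_rep d ({-e<..<e} \<times> {l..u}) \<Gamma> z" using c by blast
      qed
    next
      case 2
      show ?thesis
      proof (rule smooth_intoI)
        fix z assume z: "z \<in> {-e<..<e} \<times> {l..u}"
        have t: "snd z \<in> {l..u}" using z by auto
        let ?d = "chart_at A (\<gamma> (snd z))"
        have d: "?d \<in> charts" by (rule A_charts[OF chart_at(1)])
        from smooth_rep_ball[OF smooth_into_rep[OF \<gamma>s t d chart_at(2)]] obtain r g0 where
          g0: "0 < r" "Cinf_on (ball (snd z) r) g0" "\<forall>t\<in>{l..u} \<inter> ball (snd z) r. \<gamma> t \<in> fst ?d \<and> snd ?d (\<gamma> t) = g0 t"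
          by (elim exE conjE)
        let ?W = "(UNIV :: real set) \<times> ball (snd z) r"
        have oW: "open ?W" by (intro open_Times) auto
        have "Cinf_on ?W (\<lambda>v. g0 (snd v))"
          by (rule Cinf_on_compose[OF oW open_ball Cinf_on_linear[OF bounded_linear_snd oW] g0(2)]) auto
        moreover have "\<Gamma> v \<in> fst ?d \<and> snd ?d (\<Gamma> v) = g0 (snd v)" if v: "v \<in> {-e<..<e} \<times> {l..u} \<inter> ?W" for v
        proof -
          have v': "snd v \<in> {l..u} \<inter> ball (snd z) r" "\<beta> \<le> snd v" using v 2 by auto
          have "\<Gamma> v = \<gamma> (snd v)" using \<Gamma>_out[OF v'(2), of "fst v"] by simp
          then show ?thesis using bspec[OF g0(3) v'(1)] by simp
        qed
        then have "\<Gamma> ` ({-e<..<e} \<times> {l..u} \<inter> ?W) \<subseteq> fst ?d" "\<forall>v\<in>{-e<..<e} \<times> {l..u} \<inter> ?W. snd ?d (\<Gamma> v) = g0 (snd v)"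
          by blast+
        ultimately have "smooth_rep ?d ({-e<..<e} \<times> {l..u}) \<Gamma> z"
          unfolding smooth_rep_def using oW g0(1) by (intro exI[of _ ?W] exI[of _ "\<lambda>v. g0 (snd v)"] conjI) (auto simp: mem_Times_iff)
        then show "\<exists>d\<in>charts. smooth_rep d ({-e<..<e} \<times> {l..u}) \<Gamma> z" using d by blast
      qed
    qed
  qed
  have var: "variation A \<gamma> a b e \<Gamma>"
    unfolding variation_def using e \<Gamma>0 br' smooth by (intro conjI exI[of _ P'] allI impI ballI) auto
  have sp: "smooth_pieces P' a b (\<lambda>t. \<Gamma> (s, t))" if "s \<in> {-e<..<e}" for s
    unfolding smooth_pieces_def using br' smooth_into_slice[OF smooth that] by blast
  \<comment> \<open>After \<open>\<beta>\<close> the variation coincides with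
    \<open>\<gamma>\<close>, so this share of the energy does not depend on
    \<open>s\<close>.\<close>
  define R where "R = integral {\<beta>..b} (\<lambda>t. (speed \<gamma> a b t)\<^sup>2)"
  define Y' where "Y' s t = vector_derivative (\<lambda>t. snd c (\<Gamma> (s, t))) (at t)" for s t
  have en: "energy A F (\<lambda>t. \<Gamma> (s, t)) a b = integral {a..\<beta>} (\<lambda>t. L (y t + (s * \<phi> t) *\<^sub>R w, Y' s t)) + R / 2"
    if s: "s \<in> {-e<..<e}" for s
  proof -
    let ?\<zeta> = "\<lambda>t. \<Gamma> (s, t)"
    have "piecewise_smooth A ?\<zeta> a b" using piecewise_smooth_iff sp[OF s] ab by auto
    from speed_integrable[OF this, of "\<lambda>r. r\<^sup>2"] have int: "(\<lambda>t. (speed ?\<zeta> a b t)\<^sup>2) integrable_on {a..b}"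
      by (simp add: continuous_intros)
    have "integral {a..\<beta>} (\<lambda>t. (speed ?\<zeta> a b t)\<^sup>2) + integral {\<beta>..b} (\<lambda>t. (speed ?\<zeta> a b t)\<^sup>2)
       = integral {a..b} (\<lambda>t. (speed ?\<zeta> a b t)\<^sup>2)"
      by (rule Henstock_Kurzweil_Integration.integral_combine[OF _ ab(2) int]) (use ab in simp)
    moreover have "integral {\<beta>..b} (\<lambda>t. (speed ?\<zeta> a b t)\<^sup>2) = R"
      unfolding R_def
    proof (rule integral_spike[of "{\<beta>, b}"])
      fix t assume t: "t \<in> {\<beta>..b} - {\<beta>, b}"
      have z: "?\<zeta> t = \<gamma> t" using \<Gamma>_out t by simp
      have "velocity A ?\<zeta> {a..b} t = velocity A \<gamma> {a..b} t"
        unfolding velocity_def z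
      proof (rule vector_derivative_cong_eq)
        have "\<forall>\<^sub>F r in nhds t. r \<in> {\<beta><..}" using t by (intro eventually_nhds_in_open) auto
        then show "\<forall>\<^sub>F r in nhds t. r \<in> {a..b} \<longrightarrow> snd (chart_at A (\<gamma> t)) (\<Gamma> (s, r)) = snd (chart_at A (\<gamma> t)) (\<gamma> r)"
          by (rule eventually_mono) (simp add: \<Gamma>_out)
      qed (use t ab in auto)
      then show "(speed \<gamma> a b t)\<^sup>2 = (speed ?\<zeta> a b t)\<^sup>2" using z by simp
    qed simp
    moreover have "integral {a..\<beta>} (\<lambda>t. (speed ?\<zeta> a b t)\<^sup>2) = 2 * integral {a..\<beta>} (\<lambda>t. L (snd c (\<Gamma> (s, t)), Y' s t))"
      unfolding Y'_def by (rule speed_square_integral[OF sp[OF s] ab \<Gamma>_in(1)[OF s]])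
    moreover have "integral {a..\<beta>} (\<lambda>t. L (snd c (\<Gamma> (s, t)), Y' s t)) = integral {a..\<beta>} (\<lambda>t. L (y t + (s * \<phi> t) *\<^sub>R w, Y' s t))"
      by (rule Henstock_Kurzweil_Integration.integral_cong) (simp add: \<Gamma>_in(2)[OF s])
    ultimately show ?thesis by (simp add: energy_def)
  qed
  have "bounded (y' ` ({a..\<beta>} - Q))" using co by (simp add: piecewise_C1_def)
  then obtain M where M: "0 < M" "\<forall>v\<in>y' ` ({a..\<beta>} - Q). norm v \<le> M" unfolding bounded_pos by (elim exE conjE)
  define Q' where "Q' = {a, \<beta>} \<union> (P' \<inter> {a..\<beta>})"
  have rem: "\<bar>integral {a..\<beta>} (\<lambda>t. L (y t + (s * \<phi> t) *\<^sub>R w, Y' s t)) - integral {a..\<beta>} (\<lambda>t. L (y t, y' t)) - s * J\<bar>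
      \<le> C * (1 + ((M + 1)\<^sup>2 + (M + 1))) * (\<bar>s\<bar> * D0)\<^sup>2 * (\<beta> - a)" if s: "s \<in> {-e<..<e}" for s
  proof -
    have "piecewise_C1 Q' a \<beta> (\<lambda>t. snd c (\<Gamma> (s, t))) (Y' s)"
      using smooth_pieces_coordinates(1)[OF sp[OF s] order_refl ab c \<Gamma>_in(1)[OF s]] by (simp add: Y'_def[abs_def] Q'_def)
    moreover have tr: "(snd c (\<Gamma> (s, t))) = y t + (s * \<phi> t) *\<^sub>R w" if "t \<in> {a..\<beta>}" for t using \<Gamma>_in(2)[OF s that] .
    ultimately have coY: "piecewise_C1 Q' a \<beta> (\<lambda>t. y t + (s * \<phi> t) *\<^sub>R w) (Y' s)"
      unfolding piecewise_C1_def
    proof (elim conjE, intro conjI ballI)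
      assume h: "continuous_on {a..\<beta>} (\<lambda>t. snd c (\<Gamma> (s, t)))" "a \<in> Q'" "\<beta> \<in> Q'"
        "\<forall>t\<in>{a..\<beta>} - Q'. ((\<lambda>t. snd c (\<Gamma> (s, t))) has_vector_derivative Y' s t) (at t)"
      show "continuous_on {a..\<beta>} (\<lambda>t. y t + (s * \<phi> t) *\<^sub>R w)" by (rule continuous_on_eq[OF h(1) tr])
      fix t assume t: "t \<in> {a..\<beta>} - Q'"
      show "((\<lambda>t. y t + (s * \<phi> t) *\<^sub>R w) has_vector_derivative Y' s t) (at t)"
        by (rule has_vector_derivative_transform_within_open[OF bspec[OF h(4) t], of "{a<..<\<beta>}"])
          (use t h tr in \<open>auto simp: less_le\<close>)
    qed auto
    have Y'_eq: "Y' s t - y' t = (s * \<phi>' t) *\<^sub>R w" if t: "t \<in> {a..\<beta>} - (Q \<union> Q')" for t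
    proof -
      have "t \<notin> D" using t pa(2) by (auto simp: Q'_def P'_def)
      then have "(\<phi> has_vector_derivative \<phi>' t) (at t)"
        using pa(1) by (simp add: piecewise_affine_def has_real_derivative_iff_has_vector_derivative)
      from bounded_linear.has_vector_derivative[OF bounded_linear_scaleR_left has_vector_derivative_mult_right[OF this]]
      have "((\<lambda>t. (s * \<phi> t) *\<^sub>R w) has_vector_derivative (s * \<phi>' t) *\<^sub>R w) (at t)" .
      moreover have "(y has_vector_derivative y' t) (at t)" using co t by (simp add: piecewise_C1_def)
      ultimately have "((\<lambda>t. y t + (s * \<phi> t) *\<^sub>R w) has_vector_derivative y' t + (s * \<phi>' t) *\<^sub>R w) (at t)"
        by (intro has_vector_derivative_add)
      moreover have "((\<lambda>t. y t + (s * \<phi> t) *\<^sub>R w) has_vector_derivative Y' s t) (at t)"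
        using coY t by (simp add: piecewise_C1_def)
      ultimately have "Y' s t = y' t + (s * \<phi>' t) *\<^sub>R w" by (rule vector_derivative_unique_at[rotated])
      then show ?thesis by simp
    qed
    have fin: "finite (Q \<union> Q')" using co coY by (simp add: piecewise_C1_def)
    have "((\<lambda>t. s * (\<phi> t * (Lx (y t, y' t) \<bullet> w) + \<phi>' t * (Lv (y t, y' t) \<bullet> w))) has_integral s * J) {a..\<beta>}"
      by (rule has_integral_mult_right[OF J])
    then have Js: "((\<lambda>t. Lx (y t, y' t) \<bullet> (y t + (s * \<phi> t) *\<^sub>R w - y t) + Lv (y t, y' t) \<bullet> (Y' s t - y' t)) has_integral s * J) {a..\<beta>}"
      by (rule has_integral_spike_finite[OF fin, rotated]) (simp add: Y'_eq algebra_simps)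
    show ?thesis
    proof (rule energy_remainder[OF co yK(2) coY _ _ _ _ _ _ _ _ Js])
      show "y t + (s * \<phi> t) *\<^sub>R w \<in> K" if "t \<in> {a..\<beta>}" for t using interior_K(1)[OF inK[OF s that]] .
      show "norm (y t + (s * \<phi> t) *\<^sub>R w - y t) \<le> \<bar>s\<bar> * D0" if "t \<in> {a..\<beta>}" for t using sw[OF that, of s] by simp
      show "norm (Y' s t - y' t) \<le> \<bar>s\<bar> * D0" if t: "t \<in> {a..\<beta>} - (Q \<union> Q')" for t
      proof -
        have "\<bar>\<phi>' t\<bar> \<le> 2" using pa(1) by (simp add: piecewise_affine_def)
        then have "\<bar>\<phi>' t\<bar> * norm w \<le> D0" using mult_right_mono[of "\<bar>\<phi>' t\<bar>" 2 "norm w"] D0(3) by simp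
        from mult_left_mono[OF this, of "\<bar>s\<bar>"] show ?thesis by (simp add: Y'_eq[OF t] abs_mult mult.assoc)
      qed
      show "norm (y' t) \<le> M" if "t \<in> {a..\<beta>} - Q" for t using bspec[OF M(2) imageI[OF that]] .
    qed (use ab M(1) sD(2)[OF s] D0(1) in auto)
  qed
  have s0: "0 \<in> {-e<..<e}" using e by simp
  have E0: "energy A F (\<lambda>t. \<Gamma> (0, t)) a b = integral {a..\<beta>} (\<lambda>t. L (y t, y' t)) + R / 2"
    using rem[OF s0] en[OF s0] by simp
  have "((\<lambda>s. energy A F (\<lambda>t. \<Gamma> (s, t)) a b) has_real_derivative J) (at 0)"
  proof (rule quadratic_remainder_derivative[OF e])
    fix s assume "\<bar>s\<bar> < e"
    then have s: "s \<in> {-e<..<e}" by (auto simp: abs_less_iff)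
    show "\<bar>energy A F (\<lambda>t. \<Gamma> (s, t)) a b - energy A F (\<lambda>t. \<Gamma> (0, t)) a b - s * J\<bar>
       \<le> (C * (1 + ((M + 1)\<^sup>2 + (M + 1))) * D0\<^sup>2 * (\<beta> - a)) * s\<^sup>2"
      using rem[OF s] unfolding E0 en[OF s] by (simp add: power_mult_distrib mult_ac)
  qed
  moreover have "y a + (s * \<phi> a) *\<^sub>R w \<in> snd c ` fst c \<and> \<Gamma> (s, a) = cinv c (y a + (s * \<phi> a) *\<^sub>R w) \<and> \<Gamma> (s, b) = \<gamma> b"
    if "s \<in> {-e<..<e}" for s
    using interior_K(2)[OF inK[OF that, of a]] \<Gamma>_out[OF ab(2)] ab(1) by (simp add: \<Gamma>_def)
  ultimately show ?thesis using var by blast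
qed

text \<open>A test function that vanishes at \<open>a\<close> and \<open>\<beta>\<close> yields a
  variation with fixed end points, so criticality makes the linear term \<open>J\<close>
  zero.\<close>

lemma critical_weak_EL:
  assumes P: "smooth_pieces P a b \<gamma>" and ab: "a < \<beta>" "\<beta> \<le> b"
    and in_cK: "\<forall>t\<in>{a..\<beta>}. \<gamma> t \<in> fst c \<and> snd c (\<gamma> t) \<in> interior K"
    and geo: "geodesic A F \<gamma> a b"
  defines "y \<equiv> \<lambda>t. snd c (\<gamma> t)" and "y' \<equiv> \<lambda>t. vector_derivative (\<lambda>t. snd c (\<gamma> t)) (at t)"
  shows "\<exists>p0. \<forall>t\<in>{a..\<beta>} - ({a, \<beta>} \<union> (P \<inter> {a..\<beta>})). Lv (y t, y' t) = p0 + integral {a..t} (\<lambda>t. Lx (y t, y' t))"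
proof -
  have in_c: "\<gamma> t \<in> fst c" and in_K: "snd c (\<gamma> t) \<in> interior K" if "t \<in> {a..\<beta>}" for t
    using bspec[OF in_cK that] by auto
  show ?thesis
  proof (rule weak_euler_lagrange)
  show "piecewise_C1 ({a, \<beta>} \<union> (P \<inter> {a..\<beta>})) a \<beta> y y'"
    using smooth_pieces_coordinates(1)[OF P order_refl ab c in_c] by (simp add: y_def[abs_def] y'_def[abs_def])
  show "y t \<in> K" if "t \<in> {a..\<beta>}" for t using interior_K(1)[OF in_K[OF that]] by (simp add: y_def)
  fix D \<phi> \<phi>' w J
  assume h: "piecewise_affine D \<phi> \<phi>'" "D \<subseteq> {a..\<beta>}" "\<phi> a = 0" "\<phi> \<beta> = 0"
    "((\<lambda>t. \<phi> t * (Lx (y t, y' t) \<bullet> w) + \<phi>' t * (Lv (y t, y' t) \<bullet> w)) has_integral J) {a..\<beta>}"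
  from affine_variation[OF P ab in_cK h(1,2,4) h(5)[unfolded y_def y'_def]] obtain e \<Gamma> where
    G: "variation A \<gamma> a b e \<Gamma>" "\<forall>s\<in>{-e<..<e}. snd c (\<gamma> a) + (s * \<phi> a) *\<^sub>R w \<in> snd c ` fst c \<and>
      \<Gamma> (s, a) = cinv c (snd c (\<gamma> a) + (s * \<phi> a) *\<^sub>R w) \<and> \<Gamma> (s, b) = \<gamma> b"
    "((\<lambda>s. energy A F (\<lambda>t. \<Gamma> (s, t)) a b) has_real_derivative J) (at 0)"
    by (elim exE conjE)
  have "\<forall>s\<in>{-e<..<e}. \<Gamma> (s, a) = \<gamma> a \<and> \<Gamma> (s, b) = \<gamma> b"
    using G(2) h(3) cinv_chart[OF ch in_c[of a]] ab by simp
  then have "((\<lambda>s. energy A F (\<lambda>t. \<Gamma> (s, t)) a b) has_real_derivative 0) (at 0)"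
    using geo G(1) unfolding geodesic_def by blast
  then show "J = 0" using G(3) by (rule DERIV_unique[rotated])
  qed (rule ab)
qed

text \<open>The weak equation holds off a finite set that contains \<open>a\<close>. The smooth
  extension from the right gives velocities that are continuous up to \<open>a\<close>, and the
  limit identifies the constant \<open>p0\<close> with the momentum there.\<close>

lemma initial_momentum:
  assumes P: "smooth_pieces P a b \<gamma>" and ab: "a < \<beta>" "\<beta> \<le> b"
    and in_cK: "\<forall>t\<in>{a..\<beta>}. \<gamma> t \<in> fst c \<and> snd c (\<gamma> t) \<in> interior K"
  defines "y \<equiv> \<lambda>t. snd c (\<gamma> t)" and "y' \<equiv> \<lambda>t. vector_derivative (\<lambda>t. snd c (\<gamma> t)) (at t)"
  assumes p0: "\<forall>t\<in>{a..\<beta>} - ({a, \<beta>} \<union> (P \<inter> {a..\<beta>})). Lv (y t, y' t) = p0 + integral {a..t} (\<lambda>t. Lx (y t, y' t))"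
  shows "\<exists>v. ((\<lambda>t. snd c (\<gamma> t)) has_vector_derivative v) (at a within {a..b}) \<and> p0 = Lv (snd c (\<gamma> a), v)"
proof -
  have in_c: "\<gamma> t \<in> fst c" and in_K: "snd c (\<gamma> t) \<in> interior K" if "t \<in> {a..\<beta>}" for t
    using bspec[OF in_cK that] by auto
  define Q where "Q = {a, \<beta>} \<union> (P \<inter> {a..\<beta>})"
  have co: "piecewise_C1 Q a \<beta> y y'"
    using smooth_pieces_coordinates(1)[OF P order_refl ab c in_c] by (simp add: y_def[abs_def] y'_def[abs_def] Q_def)
  have yK: "y t \<in> K" if "t \<in> {a..\<beta>}" for t using interior_K(1)[OF in_K[OF that]] by (simp add: y_def)
  have "\<gamma> a \<in> fst c" "a < b" using in_c ab by auto
  from right_rep[OF P order_refl this(2) c this(1)] obtain e g where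
    g: "0 < e" "a + e \<le> b" "Cinf_on {a-e<..<a+e} g" "\<forall>s\<in>{a..<a+e}. \<gamma> s \<in> fst c \<and> snd c (\<gamma> s) = g s"
    by (elim exE conjE)
  have yg: "y s = g s" if "s \<in> {a..<a+e}" for s using bspec[OF g(4) that] by (simp add: y_def)
  define v where "v t = frechet_derivative g (at t) 1" for t
  have gd: "(g has_vector_derivative v t) (at t)" if "t \<in> {a-e<..<a+e}" for t
    unfolding v_def by (rule Cinf_on_has_vector_derivative[OF g(3) that])
  have "(y has_vector_derivative v a) (at a within {a..b})"
    by (rule has_vector_derivative_transform_within[OF has_vector_derivative_at_within[OF gd] g(1)])
      (use g(1) yg ab in \<open>auto simp: dist_real_def\<close>)
  moreover have "p0 = Lv (y a, v a)"
  proof -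
    define d where "d = min (e/2) (\<beta> - a)"
    have d: "0 < d" "d < e" "a + d \<le> \<beta>" using g(1) ab by (auto simp: d_def)
    let ?S = "{a..a+d}"
    have y'v: "y' t = v t" if "t \<in> {a<..<a+d}" for t
    proof -
      have "(y has_vector_derivative v t) (at t)"
        by (rule has_vector_derivative_transform_within_open[OF gd, of _ "{a<..<a+d}"]) (use that yg d g(1) in auto)
      then show ?thesis unfolding y'_def y_def by (simp add: vector_derivative_at)
    qed
    have c1: "continuous_on ?S (\<lambda>t. Lv (y t, v t))"
    proof (rule continuous_on_compose2[OF Lv_continuous])
      have "continuous_on {a-e<..<a+e} v" unfolding v_def[abs_def]
        by (rule Cinf_on_imp_continuous_on[OF Cinf_on_frechet[OF g(3)]])
      then have "continuous_on ?S v" by (rule continuous_on_subset) (use d g(1) in auto)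
      moreover have "continuous_on ?S y" by (rule continuous_on_subset[of "{a..\<beta>}"]) (use co d in \<open>auto simp: piecewise_C1_def\<close>)
      ultimately show "continuous_on ?S (\<lambda>t. (y t, v t))" by (intro continuous_on_Pair)
      show "(\<lambda>t. (y t, v t)) ` ?S \<subseteq> K \<times> UNIV" using yK d by auto
    qed
    have clK: "closed K" using K by (simp add: compact_imp_closed)
    have "continuous_on {a..\<beta>} (\<lambda>t. integral {a..t} (\<lambda>t. Lx (y t, y' t)))"
      by (rule indefinite_integral_continuous_1[OF piecewise_C1_compose_continuous(3)[OF co Lx_continuous clK yK]])
    then have ct: "continuous_on ?S (\<lambda>t. p0 + integral {a..t} (\<lambda>t. Lx (y t, y' t)))"
      by (intro continuous_on_add continuous_on_const) (rule continuous_on_subset, use d in auto)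
    have t1: "((\<lambda>t. p0 + integral {a..t} (\<lambda>t. Lx (y t, y' t))) \<longlongrightarrow> p0) (at a within ?S)"
      using bspec[OF ct[unfolded continuous_on_def], of a] d(1) by simp
    have t2: "((\<lambda>t. Lv (y t, v t)) \<longlongrightarrow> Lv (y a, v a)) (at a within ?S)"
      using c1 d(1) by (simp add: continuous_on_def)
    have nb: "at a within ?S \<noteq> bot"
      using d(1) by (simp add: trivial_limit_within islimpt_Icc)
    have "open (- (Q - {a}))" using co by (intro open_Compl finite_imp_closed) (simp add: piecewise_C1_def)
    then have "\<forall>\<^sub>F t in at a within ?S. t \<in> - (Q - {a})"
      by (rule topological_tendstoD[OF tendsto_ident_at]) simp
    moreover have "\<forall>\<^sub>F t in at a within ?S. t \<in> {..<a+d}"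
      by (rule topological_tendstoD[OF tendsto_ident_at]) (use d in auto)
    ultimately have "\<forall>\<^sub>F t in at a within ?S. Lv (y t, v t) = p0 + integral {a..t} (\<lambda>t. Lx (y t, y' t))"
      unfolding eventually_at_filter
    proof (eventually_elim, intro impI)
      fix t assume h: "t \<noteq> a \<longrightarrow> t \<in> ?S \<longrightarrow> t \<in> - (Q - {a})" "t \<noteq> a \<longrightarrow> t \<in> ?S \<longrightarrow> t \<in> {..<a+d}" "t \<noteq> a" "t \<in> ?S"
      then have tt: "t \<in> {a<..<a+d}" "t \<in> {a..\<beta>} - Q" using d by auto
      then show "Lv (y t, v t) = p0 + integral {a..t} (\<lambda>t. Lx (y t, y' t))"
        using bspec[OF p0[folded Q_def] tt(2)] by (simp only: y'v[OF tt(1)])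
    qed
    then have "((\<lambda>t. Lv (y t, v t)) \<longlongrightarrow> p0) (at a within ?S)" using t1 by (simp only: tendsto_cong)
    then show ?thesis using t2 tendsto_unique[OF nb] by blast
  qed
  ultimately show ?thesis unfolding y_def by blast
qed

lemma EL_weak:
  assumes EL: "EL_curve I x u" and "{a..b} \<subseteq> I" and t: "t \<in> {a..b}"
  shows "Lv (x t, u t) = Lv (x a, u a) + integral {a..t} (\<lambda>t. Lx (x t, u t))"
proof -
  have "((\<lambda>t. Lx (x t, u t)) has_integral Lv (x t, u t) - Lv (x a, u a)) {a..t}"
    using assms by (intro fundamental_theorem_of_calculus) (auto simp: EL_curve_def subset_iff intro: has_vector_derivative_at_within)
  then show ?thesis by (simp add: integral_unique)
qed

text \<open>A continuation argument for a curve \<open>\<gamma>\<close> that is not known to stay in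
  the chart. As long as it agrees with \<open>x\<close> it does, and by continuity slightly longer;
  there \<open>weak_solution_unique\<close> extends the agreement.\<close>

lemma geodesic_unique:
  assumes EL: "EL_curve I x u" and ab: "a < b" "{a..b} \<subseteq> I"
    and geo: "geodesic A F \<gamma> a b" and init: "\<gamma> a = cinv c (x a)"
    and vel: "((\<lambda>t. snd c (\<gamma> t)) has_vector_derivative u a) (at a within {a..b})"
  shows "\<forall>t\<in>{a..b}. \<gamma> t = cinv c (x t)"
proof -
  obtain P where P: "smooth_pieces P a b \<gamma>" using geo piecewise_smooth_iff unfolding geodesic_def by blast
  have \<gamma>c: "continuous_on {a..b} \<gamma>" by (rule smooth_pieces_continuous[OF P ab(1)])
  have xI: "x t \<in> interior K" "x t \<in> K" "x t \<in> snd c ` fst c" if "t \<in> {a..b}" for t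
    using EL ab(2) that interior_K by (auto simp: EL_curve_def subset_iff)
  have xc: "continuous_on {a..b} (\<lambda>t. cinv c (x t))"
    by (rule smooth_into_continuous_on[OF EL_smooth_into[OF EL ab(2)]])
  define S where "S = {\<sigma> \<in> {a..b}. \<forall>t\<in>{a..\<sigma>}. \<gamma> t = cinv c (x t)}"
  have aS: "a \<in> S" using ab init by (simp add: S_def)
  define \<sigma> where "\<sigma> = Sup S"
  have bdd: "bdd_above S" unfolding S_def by (rule bdd_aboveI[of _ b]) auto
  have \<sigma>ab: "a \<le> \<sigma>" "\<sigma> \<le> b" 
  proof -
    show "a \<le> \<sigma>" unfolding \<sigma>_def by (rule cSup_upper[OF aS bdd])
    have "s \<le> b" if "s \<in> S" for s using that by (simp add: S_def)
    then show "\<sigma> \<le> b" unfolding \<sigma>_def using aS by (intro cSup_least) auto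
  qed
  have lt: "\<gamma> t = cinv c (x t)" if "a \<le> t" "t < \<sigma>" for t
  proof -
    have "S \<noteq> {}" using aS by blast
    from less_cSupE[OF that(2)[unfolded \<sigma>_def] this] obtain s where s: "s \<in> S" "t < s" by metis
    then show ?thesis using that(1) by (simp add: S_def)
  qed
  have \<sigma>_eq: "\<gamma> \<sigma> = cinv c (x \<sigma>)"
  proof (cases "\<sigma> = a")
    case False
    then have a\<sigma>: "a < \<sigma>" using \<sigma>ab by simp
    have sub: "{a..<\<sigma>} \<subseteq> {a..b}" using \<sigma>ab by auto
    have \<sigma>in: "\<sigma> \<in> {a..b}" using \<sigma>ab by simp
    note l1 = tendsto_within_subset[OF bspec[OF \<gamma>c[unfolded continuous_on_def] \<sigma>in] sub]
    note l2 = tendsto_within_subset[OF bspec[OF xc[unfolded continuous_on_def] \<sigma>in] sub]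
    have ev: "\<forall>\<^sub>F t in at \<sigma> within {a..<\<sigma>}. \<gamma> t = cinv c (x t)"
      unfolding eventually_at_filter by (rule always_eventually) (simp add: lt)
    have "\<sigma> islimpt {a..<\<sigma>}"
      by (rule islimpt_subset[of \<sigma> "{a<..<\<sigma>}"]) (use a\<sigma> in \<open>auto simp: islimpt_greaterThanLessThan2\<close>)
    then have "at \<sigma> within {a..<\<sigma>} \<noteq> bot" by (simp add: trivial_limit_within)
    then show ?thesis by (rule tendsto_unique[OF _ l1[unfolded tendsto_cong[OF ev]] l2])
  qed (use init in simp)
  have all: "\<gamma> t = cinv c (x t)" if "t \<in> {a..\<sigma>}" for t
    using lt[of t] \<sigma>_eq that by (cases "t = \<sigma>") auto
  have "\<sigma> = b"
  proof (rule ccontr)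
    assume "\<sigma> \<noteq> b"
    then have \<sigma>b: "\<sigma> < b" using \<sigma>ab by simp
    let ?V = "cinv c ` interior K"
    have V: "open ?V" by (rule cinv_open_image[OF ch open_interior]) (use interior_K(2) in blast)
    have "\<gamma> \<sigma> \<in> ?V" using \<sigma>_eq xI(1) \<sigma>ab by auto
    moreover have "(\<gamma> \<longlongrightarrow> \<gamma> \<sigma>) (at \<sigma> within {a..b})" using \<gamma>c \<sigma>ab by (simp add: continuous_on_def)
    ultimately have "\<forall>\<^sub>F t in at \<sigma> within {a..b}. \<gamma> t \<in> ?V" using topological_tendstoD[OF _ V] by blast
    then obtain d where d: "0 < d" "\<forall>t\<in>{a..b}. t \<noteq> \<sigma> \<and> dist t \<sigma> < d \<longrightarrow> \<gamma> t \<in> ?V" unfolding eventually_at by blast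
    define \<beta> where "\<beta> = min (\<sigma> + d / 2) b"
    have \<beta>: "\<sigma> < \<beta>" "\<beta> \<le> b" "\<beta> < \<sigma> + d" "a < \<beta>" using d(1) \<sigma>b \<sigma>ab by (auto simp: \<beta>_def)
    have inV: "\<gamma> t \<in> ?V" if t: "t \<in> {a..\<beta>}" for t
    proof (cases "t \<le> \<sigma>")
      case True
      then have "\<gamma> t = cinv c (x t)" "x t \<in> interior K" using all xI(1) t \<beta> by auto
      then show ?thesis by blast
    next
      case False then show ?thesis using d(2) t \<beta> by (auto simp: dist_real_def)
    qed
    have in_c: "\<gamma> t \<in> fst c" and in_K: "snd c (\<gamma> t) \<in> interior K" if "t \<in> {a..\<beta>}" for t
    proof -
      obtain z where z: "z \<in> interior K" "\<gamma> t = cinv c z" using inV[OF \<open>t \<in> {a..\<beta>}\<close>] by blast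
      show "\<gamma> t \<in> fst c" "snd c (\<gamma> t) \<in> interior K"
        using z cinv_in[OF ch interior_K(2)[OF z(1)]] chart_cinv[OF ch interior_K(2)[OF z(1)]] by simp_all
    qed
    have in_cK: "\<forall>t\<in>{a..\<beta>}. \<gamma> t \<in> fst c \<and> snd c (\<gamma> t) \<in> interior K" using in_c in_K by blast
    \<comment> \<open>The weak equation is used from \<open>a\<close> on and not from
      \<open>\<sigma>\<close>: so both curves share the constant \<open>p0\<close>, which the
      initial velocity determines, and the momenta at \<open>\<sigma>\<close> need no separate
      comparison.\<close>
    from critical_weak_EL[OF P \<beta>(4,2) in_cK geo] obtain p0 where
      p0: "\<forall>t\<in>{a..\<beta>} - ({a, \<beta>} \<union> (P \<inter> {a..\<beta>})). Lv (snd c (\<gamma> t), vector_derivative (\<lambda>t. snd c (\<gamma> t)) (at t)) =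
        p0 + integral {a..t} (\<lambda>t. Lx (snd c (\<gamma> t), vector_derivative (\<lambda>t. snd c (\<gamma> t)) (at t)))" by (elim exE)
    from initial_momentum[OF P \<beta>(4,2) in_cK p0] obtain v where
      v: "((\<lambda>t. snd c (\<gamma> t)) has_vector_derivative v) (at a within {a..b})" "p0 = Lv (snd c (\<gamma> a), v)"
      by (elim exE conjE)
    have "at a within {a..b} \<noteq> bot" using ab(1) by (simp add: trivial_limit_within islimpt_Icc)
    then have "v = u a" using vector_derivative_unique_within v(1) vel by blast
    moreover have ya: "snd c (\<gamma> a) = x a" using init chart_cinv[OF ch xI(3)[of a]] ab(1) by simp
    ultimately have p0': "p0 = Lv (x a, u a)" using v(2) by simp
    have sub: "{a..\<beta>} \<subseteq> I" using ab(2) \<beta> by auto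
    have "\<exists>\<beta>'. \<sigma> < \<beta>' \<and> \<beta>' \<le> \<beta> \<and> (\<forall>t\<in>{\<sigma>..\<beta>'}. snd c (\<gamma> t) = x t)"
    proof (rule weak_solution_unique[OF EL_piecewise_C1[OF EL sub] _ smooth_pieces_coordinates(1)[OF P order_refl \<beta>(4,2) c in_c]])
      show "x t \<in> K" if "t \<in> {a..\<beta>}" for t using xI(2)[of t] that \<beta> by auto
      show "snd c (\<gamma> t) \<in> K" if "t \<in> {a..\<beta>}" for t using interior_K(1)[OF in_K[OF that]] .
      show "snd c (\<gamma> t) = x t" if "t \<in> {a..\<sigma>}" for t
        using all[OF that] chart_cinv[OF ch xI(3)[of t]] that \<sigma>ab by auto
      show "\<forall>t\<in>{a..\<beta>} - {a, \<beta>}. Lv (x t, u t) = p0 + integral {a..t} (\<lambda>t. Lx (x t, u t))"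
      proof
        fix t assume "t \<in> {a..\<beta>} - {a, \<beta>}"
        then have "t \<in> {a..\<beta>}" by simp
        from EL_weak[OF EL sub this] show "Lv (x t, u t) = p0 + integral {a..t} (\<lambda>t. Lx (x t, u t))"
          by (simp only: p0')
      qed
      show "a \<le> \<sigma>" "\<sigma> < \<beta>" by (fact \<sigma>ab \<beta>)+
    qed (assumption | rule p0)+
    then obtain \<beta>' where b': "\<sigma> < \<beta>'" "\<beta>' \<le> \<beta>" "\<forall>t\<in>{\<sigma>..\<beta>'}. snd c (\<gamma> t) = x t" by (elim exE conjE)
    have "\<gamma> t = cinv c (x t)" if t: "t \<in> {a..\<beta>'}" for t
    proof (cases "t \<le> \<sigma>")
      case True then show ?thesis using all t by simp
    next
      case False
      then have "snd c (\<gamma> t) = x t" using b'(3) t by simp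
      moreover have "\<gamma> t \<in> fst c" using in_c t b'(2) by auto
      ultimately show ?thesis using cinv_chart[OF ch] by metis
    qed
    then have "\<beta>' \<in> S" using b' \<beta> \<sigma>ab by (simp add: S_def)
    then have "\<beta>' \<le> \<sigma>" unfolding \<sigma>_def by (rule cSup_upper[OF _ bdd])
    then show False using b'(1) by simp
  qed
  then show ?thesis using all by simp
qed

text \<open>The linear test function moves the initial point in a direction \<open>w\<close> of
  \<open>S\<close>, thus inside \<open>N\<close>. Its first variation
  \<open>- (\<beta> - a) * (p0 \<bullet> w)\<close> must vanish.\<close>

lemma N_geodesic_normal:
  assumes geo: "N_geodesic A F N \<gamma> a b" and N: "\<And>p. p \<in> fst c \<Longrightarrow> p \<in> N \<longleftrightarrow> snd c p \<in> S" "subspace S"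
    and init: "\<gamma> a \<in> fst c" "snd c (\<gamma> a) \<in> interior K"
  shows "\<exists>v. ((\<lambda>t. snd c (\<gamma> t)) has_vector_derivative v) (at a within {a..b}) \<and> (\<forall>w\<in>S. Lv (snd c (\<gamma> a), v) \<bullet> w = 0)"
proof -
  have ab: "a < b" and aN: "\<gamma> a \<in> N" using geo by (auto simp: N_geodesic_def)
  obtain P where P: "smooth_pieces P a b \<gamma>" using geo piecewise_smooth_iff unfolding N_geodesic_def by blast
  \<comment> \<open>Variations that fix the initial point are among those that move it in
    \<open>N\<close>.\<close>
  have geo': "geodesic A F \<gamma> a b"
    unfolding geodesic_def
  proof (intro conjI allI impI)
    show "a < b" "piecewise_smooth A \<gamma> a b" using geo by (auto simp: N_geodesic_def)
    fix e \<Gamma> assume h: "variation A \<gamma> a b e \<Gamma> \<and> (\<forall>s\<in>{-e<..<e}. \<Gamma> (s, a) = \<gamma> a \<and> \<Gamma> (s, b) = \<gamma> b)"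
    then have "\<forall>s\<in>{-e<..<e}. \<Gamma> (s, a) \<in> N \<and> \<Gamma> (s, b) = \<gamma> b" using aN by simp
    then show "((\<lambda>s. energy A F (\<lambda>t. \<Gamma> (s, t)) a b) has_real_derivative 0) (at 0)"
      using geo h unfolding N_geodesic_def by blast
  qed
  have \<gamma>c: "continuous_on {a..b} \<gamma>" by (rule smooth_pieces_continuous[OF P ab(1)])
  let ?V = "cinv c ` interior K"
  have V: "open ?V" by (rule cinv_open_image[OF ch open_interior]) (use interior_K(2) in blast)
  have aV: "\<gamma> a \<in> ?V" using init cinv_chart[OF ch init(1)] by (metis imageI)
  moreover have "(\<gamma> \<longlongrightarrow> \<gamma> a) (at a within {a..b})" using \<gamma>c ab by (simp add: continuous_on_def)
  ultimately have "\<forall>\<^sub>F t in at a within {a..b}. \<gamma> t \<in> ?V" using topological_tendstoD[OF _ V] by blast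
  then obtain d where d: "0 < d" "\<forall>t\<in>{a..b}. t \<noteq> a \<and> dist t a < d \<longrightarrow> \<gamma> t \<in> ?V" unfolding eventually_at by blast
  define \<beta> where "\<beta> = min (a + d / 2) b"
  have \<beta>: "a < \<beta>" "\<beta> \<le> b" "\<beta> < a + d" using d(1) ab by (auto simp: \<beta>_def)
  have in_c: "\<gamma> t \<in> fst c" and in_K: "snd c (\<gamma> t) \<in> interior K" if t: "t \<in> {a..\<beta>}" for t
  proof -
    have "\<gamma> t \<in> ?V" using d(2) aV t \<beta> by (cases "t = a") (auto simp: dist_real_def)
    then obtain z where z: "z \<in> interior K" "\<gamma> t = cinv c z" by blast
    show "\<gamma> t \<in> fst c" "snd c (\<gamma> t) \<in> interior K"
      using z cinv_in[OF ch interior_K(2)[OF z(1)]] chart_cinv[OF ch interior_K(2)[OF z(1)]] by simp_all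
  qed
  have in_cK: "\<forall>t\<in>{a..\<beta>}. \<gamma> t \<in> fst c \<and> snd c (\<gamma> t) \<in> interior K" using in_c in_K by blast
  from critical_weak_EL[OF P \<beta>(1,2) in_cK geo'] obtain p0 where
    p0: "\<forall>t\<in>{a..\<beta>} - ({a, \<beta>} \<union> (P \<inter> {a..\<beta>})). Lv (snd c (\<gamma> t), vector_derivative (\<lambda>t. snd c (\<gamma> t)) (at t)) =
      p0 + integral {a..t} (\<lambda>t. Lx (snd c (\<gamma> t), vector_derivative (\<lambda>t. snd c (\<gamma> t)) (at t)))" by (elim exE)
  from initial_momentum[OF P \<beta>(1,2) in_cK p0] obtain v where
    v: "((\<lambda>t. snd c (\<gamma> t)) has_vector_derivative v) (at a within {a..b})" "p0 = Lv (snd c (\<gamma> a), v)"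
    by (elim exE conjE)
  have "p0 \<bullet> w = 0" if w: "w \<in> S" for w
  proof -
    have lin: "((\<lambda>t. (\<beta> - t) * (Lx (snd c (\<gamma> t), vector_derivative (\<lambda>t. snd c (\<gamma> t)) (at t)) \<bullet> w)
        + (-1) * (Lv (snd c (\<gamma> t), vector_derivative (\<lambda>t. snd c (\<gamma> t)) (at t)) \<bullet> w)) has_integral - (\<beta> - a) * (p0 \<bullet> w)) {a..\<beta>}"
      by (rule linear_test_function[OF smooth_pieces_coordinates(1)[OF P order_refl \<beta>(1,2) c in_c] interior_K(1)[OF in_K] \<beta>(1) p0])
    have b0: "(\<lambda>t. \<beta> - t) \<beta> = 0" by simp
    from affine_variation[OF P \<beta>(1,2) in_cK piecewise_affine_line empty_subsetI b0 lin] obtain e \<Gamma> where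
      G: "variation A \<gamma> a b e \<Gamma>" "\<forall>s\<in>{-e<..<e}. snd c (\<gamma> a) + (s * (\<beta> - a)) *\<^sub>R w \<in> snd c ` fst c \<and>
        \<Gamma> (s, a) = cinv c (snd c (\<gamma> a) + (s * (\<beta> - a)) *\<^sub>R w) \<and> \<Gamma> (s, b) = \<gamma> b"
      "((\<lambda>s. energy A F (\<lambda>t. \<Gamma> (s, t)) a b) has_real_derivative - (\<beta> - a) * (p0 \<bullet> w)) (at 0)"
      by (elim exE conjE)
    have "\<Gamma> (s, a) \<in> N \<and> \<Gamma> (s, b) = \<gamma> b" if s: "s \<in> {-e<..<e}" for s
    proof -
      note Gs = bspec[OF G(2) s]
      have "snd c (\<gamma> a) + (s * (\<beta> - a)) *\<^sub>R w \<in> S"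
        using N init aN w by (intro subspace_add subspace_scale) auto
      then show ?thesis using Gs N(1)[OF cinv_in[OF ch]] chart_cinv[OF ch] by metis
    qed
    then have "((\<lambda>s. energy A F (\<lambda>t. \<Gamma> (s, t)) a b) has_real_derivative 0) (at 0)"
      using geo G(1) unfolding N_geodesic_def by blast
    then have "- (\<beta> - a) * (p0 \<bullet> w) = 0" using G(3) DERIV_unique by blast
    then show ?thesis using \<beta>(1) by simp
  qed
  then show ?thesis using v by blast
qed

section \<open>Rescaling, lengths, normal vectors and the exponential map\<close>

text \<open>Since \<open>Lv\<close> has degree 1 and \<open>Lx\<close> has degree 2, both sides of
  the Euler-Lagrange equation acquire the factor \<open>k\<^sup>2\<close> under the time change. The
  case \<open>k = 1\<close> is a shift by \<open>a\<close>.\<close>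

lemma EL_scale:
  assumes EL: "EL_curve I x u" and k: "0 < k"
  shows "EL_curve {t. k * (t - a) \<in> I} (\<lambda>t. x (k * (t - a))) (\<lambda>t. k *\<^sub>R u (k * (t - a)))"
proof -
  let ?I = "{t. k * (t - a) \<in> I}"
  have I: "open I" "Cinf_on I x" "Cinf_on I u" using EL by (simp_all add: EL_curve_def)
  have "open ((\<lambda>t. k * (t - a)) -` I)" by (intro open_vimage I(1) continuous_intros)
  then have oI: "open ?I" by (simp add: vimage_def)
  have lin: "Cinf_on ?I (\<lambda>t. k * (t - a))"
    by (intro Cinf_on_bounded_linear[OF bounded_linear_mult_right oI] Cinf_on_minus[OF oI] Cinf_on_id[OF oI] Cinf_on_const[OF oI])
  have s: "Cinf_on ?I (\<lambda>t. x (k * (t - a)))" "Cinf_on ?I (\<lambda>t. u (k * (t - a)))"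
    by (rule Cinf_on_compose[OF oI I(1) lin I(2)], force) (rule Cinf_on_compose[OF oI I(1) lin I(3)], force)
  have ch: "((\<lambda>t. g (k * (t - a))) has_vector_derivative k *\<^sub>R g') (at t)"
    if "(g has_vector_derivative g') (at (k * (t - a)))" for g :: "real \<Rightarrow> 'e" and g' t
  proof -
    have "((\<lambda>t. k * (t - a)) has_vector_derivative k) (at t)" by (auto intro!: derivative_eq_intros)
    from vector_diff_chain_at[OF this that] show ?thesis by (simp add: o_def)
  qed
  show ?thesis unfolding EL_curve_def
  proof (intro conjI ballI)
    show "Cinf_on ?I (\<lambda>t. k *\<^sub>R u (k * (t - a)))" by (rule Cinf_on_bounded_linear[OF bounded_linear_scaleR_right oI s(2)])
    fix t assume "t \<in> ?I"
    then have t: "k * (t - a) \<in> I" by simp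
    have E: "x (k * (t - a)) \<in> interior K" "(x has_vector_derivative u (k * (t - a))) (at (k * (t - a)))"
      "((\<lambda>t. Lv (x t, u t)) has_vector_derivative Lx (x (k * (t - a)), u (k * (t - a)))) (at (k * (t - a)))"
      using EL t by (simp_all add: EL_curve_def)
    show "x (k * (t - a)) \<in> interior K" by fact
    show "((\<lambda>t. x (k * (t - a))) has_vector_derivative k *\<^sub>R u (k * (t - a))) (at t)" by (rule ch[OF E(2)])
    have d: "((\<lambda>t. k *\<^sub>R Lv (x (k * (t - a)), u (k * (t - a)))) has_vector_derivative
        k *\<^sub>R k *\<^sub>R Lx (x (k * (t - a)), u (k * (t - a)))) (at t)"
      by (rule bounded_linear.has_vector_derivative[OF bounded_linear_scaleR_right ch[OF E(3)]])
    have e: "k *\<^sub>R k *\<^sub>R Lx (x (k * (t - a)), u (k * (t - a))) = Lx (x (k * (t - a)), k *\<^sub>R u (k * (t - a)))"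
      using Lx_homog[OF interior_K(2)[OF E(1)], of k] k by (simp add: power2_eq_square)
    show "((\<lambda>t. Lv (x (k * (t - a)), k *\<^sub>R u (k * (t - a)))) has_vector_derivative
        Lx (x (k * (t - a)), k *\<^sub>R u (k * (t - a)))) (at t)"
    proof (rule has_vector_derivative_transform_within_open[OF d[unfolded e] oI])
      fix s assume "s \<in> ?I"
      then have "x (k * (s - a)) \<in> snd c ` fst c" using EL interior_K(2) by (auto simp: EL_curve_def)
      then show "k *\<^sub>R Lv (x (k * (s - a)), u (k * (s - a))) = Lv (x (k * (s - a)), k *\<^sub>R u (k * (s - a)))"
        using Lv_homog k by simp
    qed (use t in simp)
  qed (use oI s in auto)
qed

text \<open>A calibration: \<open>m\<close> times the coordinate in the direction \<open>n\<close>
  of the total displacement grows no faster than the length.\<close>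

lemma length_ge_distance:
  assumes y: "piecewise_C1 Q a b y y'" "\<And>t. t \<in> {a..b} \<Longrightarrow> y t \<in> K" and ab: "a \<le> b"
  shows "m * norm (y b - y a) \<le> integral {a..b} (\<lambda>t. in_chart A F c (y t, y' t))"
proof -
  have cf: "continuous_on (K \<times> UNIV) (in_chart A F c)" by (rule continuous_on_subset[OF cont_f]) (use K in auto)
  note i = piecewise_C1_compose_continuous(3)[OF y(1) cf compact_imp_closed[OF K(1)] y(2)]
  define n where "n = sgn (y b - y a)"
  define \<Phi> where "\<Phi> t = m * (y t \<bullet> n)" for t
  have "\<Phi> b - \<Phi> a \<le> integral {a..b} (\<lambda>t. in_chart A F c (y t, y' t))"
  proof (rule FTC_le[OF ab _ _ i])
    show "finite Q" using y(1) by (simp add: piecewise_C1_def)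
    show "continuous_on {a..b} \<Phi>" unfolding \<Phi>_def[abs_def] using y(1) by (intro continuous_intros) (simp add: piecewise_C1_def)
    fix t assume t: "t \<in> {a..b} - Q"
    have "(y has_vector_derivative y' t) (at t)" using y(1) t by (simp add: piecewise_C1_def)
    from has_vector_derivative_mult_right[OF bounded_linear.has_vector_derivative[OF bounded_linear_inner_left this]]
    show "(\<Phi> has_vector_derivative m * (y' t \<bullet> n)) (at t)" unfolding \<Phi>_def[abs_def] .
    have "y' t \<bullet> n \<le> norm (y' t) * norm n" by (rule norm_cauchy_schwarz)
    also have "\<dots> \<le> norm (y' t)" using mult_left_mono[of "norm n" 1 "norm (y' t)"] by (simp add: n_def norm_sgn)
    finally have "m * (y' t \<bullet> n) \<le> m * norm (y' t)" using const_pos by (intro mult_left_mono) auto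
    also have "\<dots> \<le> in_chart A F c (y t, y' t)" using f_lower[OF y(2)] t by simp
    finally show "m * (y' t \<bullet> n) \<le> in_chart A F c (y t, y' t)" .
  qed
  moreover have "\<Phi> b - \<Phi> a = m * norm (y b - y a)"
  proof -
    have "\<Phi> b - \<Phi> a = m * ((y b - y a) \<bullet> n)" by (simp add: \<Phi>_def inner_diff_left right_diff_distrib)
    also have "(y b - y a) \<bullet> n = norm (y b - y a)"
      by (cases "y b - y a = 0") (simp_all add: n_def sgn_div_norm dot_square_norm power2_eq_square)
    finally show ?thesis .
  qed
  ultimately show ?thesis by simp
qed

lemma EL_velocity:
  assumes EL: "EL_curve I x u" and T: "T \<subseteq> I" "t \<in> T"
  shows "has_velocity A (\<lambda>t. cinv c (x t)) T t (\<tau> c (x t) (u t))"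
    "F (cinv c (x t)) (\<tau> c (x t) (u t)) = in_chart A F c (x t, u t)"
    "((\<lambda>t. snd c (cinv c (x t))) has_vector_derivative u t) (at t within T)"
proof -
  have U: "x s \<in> snd c ` fst c" if "s \<in> I" for s using EL that interior_K(2) by (simp add: EL_curve_def)
  have tI: "t \<in> I" using T by blast
  have e: "snd c (cinv c (x s)) = x s" if "s \<in> I" for s using chart_cinv[OF ch U[OF that]] .
  have d: "(x has_vector_derivative u t) (at t)" "open I" using EL tI by (simp_all add: EL_curve_def)
  have "((\<lambda>t. snd c (cinv c (x t))) has_vector_derivative u t) (at t)"
    by (rule has_vector_derivative_transform_within_open[OF d tI]) (simp add: e)
  then show d': "((\<lambda>t. snd c (cinv c (x t))) has_vector_derivative u t) (at t within T)"
    by (rule has_vector_derivative_at_within)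
  have "continuous (at t within T) (\<lambda>t. cinv c (x t))"
    using smooth_into_continuous_on[OF EL_smooth_into[OF EL T(1)]] T(2) by (simp add: continuous_on_eq_continuous_within)
  from has_velocity_chart[where \<gamma> = "\<lambda>t. cinv c (x t)", OF c cinv_in[OF ch U[OF tI]] this T(2) d']
  show "has_velocity A (\<lambda>t. cinv c (x t)) T t (\<tau> c (x t) (u t))" by (simp only: e[OF tI])
  show "F (cinv c (x t)) (\<tau> c (x t) (u t)) = in_chart A F c (x t, u t)" by (simp add: in_chart_\<tau>)
qed

lemma EL_length:
  assumes EL: "EL_curve I x u" and ab: "a < b" "{a..b} \<subseteq> I" and unit: "\<And>t. t \<in> {a..b} \<Longrightarrow> in_chart A F c (x t, u t) = 1"
  shows "curve_length A F (\<lambda>t. cinv c (x t)) a b = b - a"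
proof -
  have "integral {a..b} (speed (\<lambda>t. cinv c (x t)) a b) = integral {a..b} (\<lambda>t. 1)"
  proof (rule Henstock_Kurzweil_Integration.integral_cong)
    fix t assume t: "t \<in> {a..b}"
    have nb: "at t within {a..b} \<noteq> bot" using ab(1) t by (simp add: trivial_limit_within islimpt_Icc)
    have "velocity A (\<lambda>t. cinv c (x t)) {a..b} t = \<tau> c (x t) (u t)"
      unfolding velocity_def
      by (rule vector_derivative_within[OF nb EL_velocity(1)[OF EL ab(2) t, unfolded has_velocity_def]])
    then show "speed (\<lambda>t. cinv c (x t)) a b t = 1" using EL_velocity(2)[OF EL ab(2) t] unit[OF t] by simp
  qed
  then show ?thesis using ab(1) by (simp add: curve_length_def)
qed

text \<open>\<open>Lv\<close> is homogeneous of degree 1, so differentiating it along the vector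
  itself returns it. Normality thus becomes a linear condition on the momentum.\<close>

lemma fundamental_tensor_chart:
  assumes p: "p \<in> fst c" and u: "u \<noteq> 0"
  defines "v \<equiv> \<tau> c (snd c p) u"
  shows "fundamental_tensor F p v v (\<tau> c (snd c p) w) = Lv (snd c p, u) \<bullet> w"
proof -
  have xU: "snd c p \<in> snd c ` fst c" using p by simp
  note l = \<tau>_linear[OF c p]
  have F: "(F p (v + s1 *\<^sub>R v + s2 *\<^sub>R \<tau> c (snd c p) w))\<^sup>2 = 2 * L (snd c p, (u + s1 *\<^sub>R u) + s2 *\<^sub>R w)" for s1 s2
    using F_in_chart[OF c p, of "u + s1 *\<^sub>R u + s2 *\<^sub>R w"] by (simp add: v_def L_def linear_add[OF l] linear_scale[OF l])
  have 1: "deriv (\<lambda>s2. 2 * L (snd c p, (u + s1 *\<^sub>R u) + s2 *\<^sub>R w)) 0 = 2 * ((1 + s1) * (Lv (snd c p, u) \<bullet> w))"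
    if "s1 \<in> {-1<..<1}" for s1
  proof -
    have e: "u + s1 *\<^sub>R u = (1 + s1) *\<^sub>R u" by (simp add: algebra_simps)
    have "((\<lambda>s2. 2 * L (snd c p, (u + s1 *\<^sub>R u) + s2 *\<^sub>R w)) has_real_derivative 2 * (Lv (snd c p, (u + s1 *\<^sub>R u) + 0 *\<^sub>R w) \<bullet> w)) (at 0)"
      by (intro DERIV_cmult L_path[OF xU]) (use u that in \<open>simp add: e\<close>)
    moreover have "Lv (snd c p, (u + s1 *\<^sub>R u) + 0 *\<^sub>R w) = (1 + s1) *\<^sub>R Lv (snd c p, u)"
      using Lv_homog[OF xU, of "1 + s1" u] that by (simp add: e)
    ultimately show ?thesis by (simp add: DERIV_imp_deriv)
  qed
  have "((\<lambda>s1. 2 * ((1 + s1) * (Lv (snd c p, u) \<bullet> w))) has_real_derivative 2 * (Lv (snd c p, u) \<bullet> w)) (at 0)"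
    by (auto intro!: derivative_eq_intros)
  then have "((\<lambda>s1. deriv (\<lambda>s2. 2 * L (snd c p, (u + s1 *\<^sub>R u) + s2 *\<^sub>R w)) 0) has_real_derivative 2 * (Lv (snd c p, u) \<bullet> w)) (at 0)"
    by (rule has_field_derivative_transform_within_open[of _ _ _ "{-1<..<1}"]) (simp_all only: 1 open_greaterThanLessThan, auto)
  then show ?thesis unfolding fundamental_tensor_def F by (simp add: DERIV_imp_deriv)
qed

text \<open>Each \<open>w\<close> in \<open>S\<close> is the velocity of a straight coordinate
  segment inside \<open>N\<close>, hence a tangent vector in the sense of
  \<open>tangent_space\<close>; the momentum therefore annihilates it.\<close>

lemma unit_normal_coordinates:
  assumes p: "p \<in> fst c" and N: "\<And>p. p \<in> fst c \<Longrightarrow> p \<in> N \<longleftrightarrow> snd c p \<in> S" "subspace S"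
    and v: "(p, v) \<in> unit_normal_cone A F N"
  shows "\<exists>u. v = \<tau> c (snd c p) u \<and> in_chart A F c (snd c p, u) = 1 \<and> (\<forall>w\<in>S. Lv (snd c p, u) \<bullet> w = 0)"
proof -
  have xU: "snd c p \<in> snd c ` fst c" using p by simp
  obtain u where u: "v = \<tau> c (snd c p) u" using \<tau>_surj[OF c p] by metis
  have F1: "F p v = 1" and pN: "p \<in> N" using v by (auto simp: unit_normal_cone_def normal_cone_def)
  then have f1: "in_chart A F c (snd c p, u) = 1" using F_in_chart[OF c p, of u] u by simp
  then have u0: "u \<noteq> 0" using f_zero[OF xU] by auto
  have v0: "v \<noteq> 0" unfolding u by (rule \<tau>_nonzero[OF c p u0])
  have "Lv (snd c p, u) \<bullet> w = 0" if w: "w \<in> S" for w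
  proof -
    obtain r where r: "0 < r" "ball (snd c p) r \<subseteq> snd c ` fst c" using open_U xU open_contains_ball by blast
    define e where "e = r / (norm w + 1)"
    have e: "0 < e" using r(1) by (simp add: e_def add_nonneg_pos)
    define g where "g s = snd c p + s *\<^sub>R w" for s
    have gU: "g s \<in> snd c ` fst c" if "s \<in> {-e<..<e}" for s
    proof -
      have "\<bar>s\<bar> < r / (norm w + 1)" using that by (auto simp: e_def abs_less_iff)
      then have "\<bar>s\<bar> * (norm w + 1) < r" by (simp add: pos_less_divide_eq add_nonneg_pos)
      moreover have "\<bar>s\<bar> * norm w \<le> \<bar>s\<bar> * (norm w + 1)" by (intro mult_left_mono) auto
      ultimately have "g s \<in> ball (snd c p) r" by (simp add: g_def dist_norm)
      then show ?thesis using r(2) by blast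
    qed
    let ?\<delta> = "\<lambda>s. cinv c (g s)"
    let ?J = "{-e<..<e}"
    have g_smooth: "Cinf_on ?J g" unfolding g_def[abs_def]
      by (intro Cinf_on_add Cinf_on_const Cinf_on_bounded_linear[OF bounded_linear_scaleR_left] Cinf_on_id open_greaterThanLessThan)
    have e1: "snd c (?\<delta> s) = g s" "?\<delta> s \<in> fst c" if "s \<in> ?J" for s
      using chart_cinv[OF ch gU[OF that]] cinv_in[OF ch gU[OF that]] by auto
    have sm: "smooth_into A ?J ?\<delta>"
    proof (rule smooth_intoI)
      fix s assume s: "s \<in> ?J"
      have "?\<delta> ` (?J \<inter> ?J) \<subseteq> fst c" "\<forall>y\<in>?J \<inter> ?J. snd c (?\<delta> y) = g y" using e1 by auto
      then have "smooth_rep c ?J ?\<delta> s"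
        unfolding smooth_rep_def using g_smooth s by (intro exI[of _ ?J] exI[of _ g] conjI) auto
      then show "\<exists>d\<in>charts. smooth_rep d ?J ?\<delta> s" using c by blast
    qed
    have z: "0 \<in> ?J" using e by simp
    have \<delta>0: "?\<delta> 0 = p" using cinv_chart[OF ch p] by (simp add: g_def)
    have "(g has_vector_derivative w) (at 0)" unfolding g_def[abs_def] by (auto intro!: derivative_eq_intros)
    then have "((\<lambda>s. snd c (?\<delta> s)) has_vector_derivative w) (at 0)"
      by (rule has_vector_derivative_transform_within_open[OF _ open_greaterThanLessThan z]) (simp add: e1)
    then have d: "((\<lambda>s. snd c (?\<delta> s)) has_vector_derivative w) (at 0 within ?J)" by (rule has_vector_derivative_at_within)
    have ct: "continuous (at 0 within ?J) ?\<delta>"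
      using smooth_into_continuous_on[OF sm] z by (simp add: continuous_on_eq_continuous_within)
    have "has_velocity A ?\<delta> ?J 0 (\<tau> c (snd c p) w)"
      using has_velocity_chart[where \<gamma> = ?\<delta>, OF c e1(2)[OF z] ct z d] by (simp add: \<delta>0)
    moreover have "?\<delta> ` ?J \<subseteq> N"
    proof (rule image_subsetI)
      fix s assume s: "s \<in> ?J"
      have "g s \<in> S" unfolding g_def using N p pN w by (intro subspace_add subspace_scale) auto
      then show "?\<delta> s \<in> N" using N(1)[OF e1(2)[OF s]] e1(1)[OF s] by simp
    qed
    ultimately have "\<tau> c (snd c p) w \<in> tangent_space A N p"
      unfolding tangent_space_def using e sm \<delta>0 by (intro CollectI exI[of _ e] exI[of _ ?\<delta>] conjI) auto
    then have "fundamental_tensor F p v v (\<tau> c (snd c p) w) = 0"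
      using v v0 by (auto simp: unit_normal_cone_def normal_cone_def)
    then show ?thesis using fundamental_tensor_chart[OF p u0, of w] by (simp add: u)
  qed
  then show ?thesis using u f1 by blast
qed

text \<open>\<open>exp_map\<close> can be evaluated only if every critical curve with the given
  initial velocity ends at the same point; \<open>geodesic_unique\<close> guarantees this, applied
  to \<open>x\<close> run through at \<open>k\<close> times its speed.\<close>

lemma exp_map_EL:
  assumes EL: "EL_curve I x u" and k: "0 < k" "{0..k} \<subseteq> I"
  shows "(cinv c (x 0), k *\<^sub>R \<tau> c (x 0) (u 0)) \<in> exp_dom A F"
    "exp_map A F (cinv c (x 0), k *\<^sub>R \<tau> c (x 0) (u 0)) = cinv c (x k)"
proof -
  let ?I = "{t. k * (t - 0) \<in> I}" and ?x = "\<lambda>t. x (k * (t - 0))" and ?u = "\<lambda>t. k *\<^sub>R u (k * (t - 0))"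
  note EL' = EL_scale[OF EL k(1), of 0]
  have sub: "{0..1} \<subseteq> ?I" using k by (auto simp: subset_iff mult_left_le)
  have x0: "x 0 \<in> snd c ` fst c" using EL k interior_K(2) by (auto simp: EL_curve_def subset_iff)
  have p: "cinv c (x 0) \<in> fst c" "snd c (cinv c (x 0)) = x 0" using cinv_in[OF ch x0] chart_cinv[OF ch x0] by auto
  have \<tau>k: "\<tau> c (x 0) (k *\<^sub>R u 0) = k *\<^sub>R \<tau> c (x 0) (u 0)" using linear_scale[OF \<tau>_linear[OF c p(1)]] p(2) by simp
  have geo: "geodesic_from A F (cinv c (x 0), k *\<^sub>R \<tau> c (x 0) (u 0)) (\<lambda>t. cinv c (?x t))"
    unfolding geodesic_from_def
    using EL_geodesic[OF EL' zero_less_one sub] EL_velocity(1)[OF EL' sub, of 0] by (simp add: \<tau>k)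
  then show "(cinv c (x 0), k *\<^sub>R \<tau> c (x 0) (u 0)) \<in> exp_dom A F" unfolding exp_dom_def by blast
  show "exp_map A F (cinv c (x 0), k *\<^sub>R \<tau> c (x 0) (u 0)) = cinv c (x k)"
    unfolding exp_map_def
  proof (rule the_equality)
    show "\<exists>\<gamma>. geodesic_from A F (cinv c (x 0), k *\<^sub>R \<tau> c (x 0) (u 0)) \<gamma> \<and> \<gamma> 1 = cinv c (x k)"
      using geo by (intro exI[of _ "\<lambda>t. cinv c (?x t)"]) simp
    fix q assume "\<exists>\<gamma>. geodesic_from A F (cinv c (x 0), k *\<^sub>R \<tau> c (x 0) (u 0)) \<gamma> \<and> \<gamma> 1 = q"
    then obtain \<gamma> where \<gamma>: "geodesic A F \<gamma> 0 1" "\<gamma> 0 = cinv c (x 0)"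
      "has_velocity A \<gamma> {0..1} 0 (k *\<^sub>R \<tau> c (x 0) (u 0))" "\<gamma> 1 = q"
      unfolding geodesic_from_def by auto
    obtain P where P: "smooth_pieces P 0 1 \<gamma>" using \<gamma>(1) piecewise_smooth_iff unfolding geodesic_def by blast
    have \<gamma>0: "\<gamma> 0 \<in> fst c" using p \<gamma>(2) by simp
    \<comment> \<open>The velocity of \<open>\<gamma>\<close> is prescribed in the preferred chart.
      The right-hand extension shows that it also exists in \<open>c\<close>, and injectivity of
      \<open>\<tau>\<close> identifies it.\<close>
    from right_rep[OF P order_refl zero_less_one c \<gamma>0] obtain e g where
      g: "0 < e" "0 + e \<le> 1" "Cinf_on {0-e<..<0+e} g" "\<forall>s\<in>{0..<0+e}. \<gamma> s \<in> fst c \<and> snd c (\<gamma> s) = g s"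
      by (elim exE conjE)
    have z: "0 \<in> {0-e<..<0+e}" "(0::real) \<in> {0..1}" using g(1) by auto
    define v where "v = frechet_derivative g (at 0) 1"
    have vd: "((\<lambda>t. snd c (\<gamma> t)) has_vector_derivative v) (at 0 within {0..1})"
      unfolding v_def
      by (rule has_vector_derivative_transform_within[OF has_vector_derivative_at_within[OF Cinf_on_has_vector_derivative[OF g(3) z(1)]] g(1) z(2)])
        (use g(4) in \<open>auto simp: dist_real_def\<close>)
    have ct: "continuous (at 0 within {0..1}) \<gamma>"
      using smooth_pieces_continuous[OF P zero_less_one] z(2) by (simp add: continuous_on_eq_continuous_within)
    have nb: "at (0::real) within {0..1} \<noteq> bot" by (simp add: trivial_limit_within islimpt_Icc)
    from has_velocity_chart_unique[OF c \<gamma>0 ct z(2) nb vd \<gamma>(3)]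
    have "\<tau> c (snd c (\<gamma> 0)) (k *\<^sub>R u 0) = \<tau> c (snd c (\<gamma> 0)) v" using p(2) \<gamma>(2) \<tau>k by simp
    then have "v = k *\<^sub>R u 0" using \<tau>_inj[OF c \<gamma>0] by metis
    then have "\<forall>t\<in>{0..1}. \<gamma> t = cinv c (?x t)"
      using vd \<gamma>(2) by (intro geodesic_unique[OF EL' zero_less_one sub \<gamma>(1)]) simp_all
    then show "q = cinv c (x k)" using \<gamma>(4) by force
  qed
qed

section \<open>Short normal geodesics realize the distance from N\<close>

text \<open>The geodesic itself gives the upper bound. A competitor that stays in the ball of radius
  \<open>r\<close> is covered by \<open>short_geodesic_minimizes\<close>; for any other one, the
  part after its last stay outside covers a coordinate distance of at least \<open>r / 4\<close> and
  so has length at least \<open>m * r / 4 \<ge> l0\<close>.\<close>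

lemma dist_from_short_geodesic:
  assumes N: "\<And>p. p \<in> fst c \<Longrightarrow> p \<in> N \<longleftrightarrow> snd c p \<in> S" "subspace S"
    and r: "0 < r" "cball x0 r \<subseteq> K" and \<rho>: "0 < \<rho>" "2 * r \<le> \<rho>" "2 * C * \<rho>\<^sup>2 + C * \<rho> \<le> \<mu> / 4"
    and EL: "EL_curve I x u" and I: "{0..l0} \<subseteq> I" and xr: "\<And>t. t \<in> {0..l0} \<Longrightarrow> x t \<in> ball x0 r"
    and unit: "\<And>t. t \<in> {0..l0} \<Longrightarrow> in_chart A F c (x t, u t) = 1"
    and init: "x 0 \<in> S" "x 0 \<in> ball x0 (r / 2)" and normal: "\<And>w. w \<in> S \<Longrightarrow> Lv (x 0, u 0) \<bullet> w = 0"
    and l0: "0 < l0" "l0 \<le> m * r / 4" "8 * (2 * C + C\<^sup>2/\<mu>) * l0\<^sup>2 \<le> \<mu> * m\<^sup>2"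
  shows "dist_from A F N (cinv c (x l0)) = ereal l0"
proof (rule antisym)
  have U: "z \<in> snd c ` fst c" if "z \<in> cball x0 r" for z using interior_K(3) r(2) that by blast
  have xl0: "x l0 \<in> ball x0 r" using xr l0(1) by simp
  have xU: "x 0 \<in> snd c ` fst c" "x l0 \<in> snd c ` fst c" using U init(2) xl0 r(1) by auto
  have "curve_length A F (\<lambda>t. cinv c (x t)) 0 l0 = l0" using EL_length[OF EL l0(1) I unit] by simp
  moreover have "piecewise_smooth A (\<lambda>t. cinv c (x t)) 0 l0" using EL_piecewise_smooth[OF EL I] l0(1) by simp
  moreover have "cinv c (x 0) \<in> N" using N(1)[OF cinv_in[OF ch xU(1)]] chart_cinv[OF ch xU(1)] init(1) by simp
  ultimately show "dist_from A F N (cinv c (x l0)) \<le> ereal l0"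
    unfolding dist_from_def
    by (intro Inf_lower CollectI exI[of _ "\<lambda>t. cinv c (x t)"] exI[of _ "0::real"] exI[of _ l0]) auto
  \<comment> \<open>Any two points of the ball are at most \<open>2 * r \<le> \<rho>\<close> apart,
    which is the closeness that the comparison requires.\<close>
  have min: "l0 \<le> integral {a..b} (\<lambda>s. in_chart A F c (y s, y' s))"
    if y: "piecewise_C1 Q a b y y'" "a < b" "\<And>s. s \<in> {a..b} \<Longrightarrow> y s \<in> cball x0 r" "y b = x l0" "y a \<in> S"
    for Q a b y y'
  proof (rule short_geodesic_minimizes[where x = x and u = u and \<rho> = \<rho>, OF _ _ unit _ y(1,2) _ y(4)])
    fix t assume t: "t \<in> {0..l0}"
    then have tI: "t \<in> I" using I by blast
    show "x t \<in> K" using xr[OF t] r(2) by auto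
    show "(x has_vector_derivative u t) (at t within {0..l0})"
      "((\<lambda>t. Lv (x t, u t)) has_vector_derivative Lx (x t, u t)) (at t within {0..l0})"
      using EL tI by (auto simp: EL_curve_def intro: has_vector_derivative_at_within)
  next
    show "y s \<in> K" if "s \<in> {a..b}" for s using y(3)[OF that] r(2) by blast
    show "Lv (x 0, u 0) \<bullet> (y a - x 0) = 0" using normal subspace_diff[OF N(2) y(5) init(1)] by blast
    show "norm (y s - x t) \<le> \<rho>" if "s \<in> {a..b}" "t \<in> {0..l0}" for s t
      using y(3)[OF that(1)] xr[OF that(2)] \<rho>(2) dist_triangle3[of "y s" "x t" x0] by (simp add: dist_norm)
  qed (use l0 \<rho> in auto)
  show "ereal l0 \<le> dist_from A F N (cinv c (x l0))"
    unfolding dist_from_def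
  proof (rule Inf_greatest)
    fix l assume "l \<in> {ereal (curve_length A F \<gamma> a b) | \<gamma> a b. piecewise_smooth A \<gamma> a b \<and> \<gamma> a \<in> N \<and> \<gamma> b = cinv c (x l0)}"
    then obtain \<zeta> a b where \<zeta>: "l = ereal (curve_length A F \<zeta> a b)" "piecewise_smooth A \<zeta> a b" "\<zeta> a \<in> N" "\<zeta> b = cinv c (x l0)"
      by blast
    have ab: "a \<le> b" using \<zeta>(2) by (simp add: piecewise_smooth_def)
    have \<zeta>b: "\<zeta> b \<in> fst c" "snd c (\<zeta> b) = x l0" using \<zeta>(4) cinv_in[OF ch xU(2)] chart_cinv[OF ch xU(2)] by auto
    have "l0 \<le> curve_length A F \<zeta> a b"
    proof (cases "a < b")
      \<comment> \<open>A one-point competitor would put the end point on \<open>N\<close>. The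
        comparison with the constant curve on \<open>{0..1}\<close>, whose length is 0, then
        contradicts \<open>0 < l0\<close>.\<close>
      case False
      then have "\<zeta> b \<in> N" using ab \<zeta>(3) by simp
      then have xS: "x l0 \<in> S" using N(1)[OF \<zeta>b(1)] \<zeta>b(2) by simp
      have "piecewise_C1 {0, 1} 0 1 (\<lambda>t. x l0) (\<lambda>t. 0)"
      proof -
        have "bounded ((\<lambda>t. 0::'e) ` ({0..1} - {0, 1::real}))" by (rule bounded_subset[of "{0}"]) auto
        then show ?thesis by (simp add: piecewise_C1_def)
      qed
      from min[OF this zero_less_one _ refl xS] have "l0 \<le> integral {0..1::real} (\<lambda>s. in_chart A F c (x l0, 0))"
        using xl0 by simp
      then show ?thesis using l0(1) f_zero[OF xU(2)] by simp
    next
      case True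
      obtain P where P: "smooth_pieces P a b \<zeta>" using \<zeta>(2) piecewise_smooth_iff by blast
      have \<zeta>c: "continuous_on {a..b} \<zeta>" by (rule smooth_pieces_continuous[OF P True])
      let ?O = "cinv c ` ball x0 r" and ?K = "cinv c ` cball x0 r"
      have O: "open ?O" by (rule cinv_open_image[OF ch open_ball]) (use U in auto)
      have inK: "p \<in> fst c \<and> snd c p \<in> cball x0 r" if pK: "p \<in> ?K" for p
      proof -
        obtain z where z: "z \<in> cball x0 r" "p = cinv c z" using pK by blast
        show ?thesis using z cinv_in[OF ch U[OF z(1)]] chart_cinv[OF ch U[OF z(1)]] by simp
      qed
      have O_K: "?O \<subseteq> ?K" by auto
      show ?thesis
      proof (cases "\<forall>s\<in>{a..b}. \<zeta> s \<in> ?O")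
        case all: True
        have in_c: "\<zeta> s \<in> fst c" "snd c (\<zeta> s) \<in> cball x0 r" if "s \<in> {a..b}" for s
          using inK all that O_K by blast+
        from length_in_chart[OF \<zeta>(2) order_refl True c in_c(1)] obtain Q y' where
          Q: "piecewise_C1 Q a b (\<lambda>t. snd c (\<zeta> t)) y'"
            "integral {a..b} (\<lambda>t. in_chart A F c (snd c (\<zeta> t), y' t)) \<le> curve_length A F \<zeta> a b" by auto
        have "snd c (\<zeta> a) \<in> S" using N(1)[OF in_c(1)] \<zeta>(3) True by simp
        from min[OF Q(1) True in_c(2) \<zeta>b(2) this] show ?thesis using Q(2) by linarith
      next
        case False
        let ?X = "{a..b} \<inter> \<zeta> -` (- ?O)"
        have "closed ?X" by (rule continuous_closed_preimage[OF \<zeta>c closed_atLeastAtMost closed_Compl[OF O]])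
        moreover have "bounded ?X" by (rule bounded_subset[OF bounded_closed_interval[of a b]]) auto
        ultimately have "compact ?X" by (simp add: compact_eq_bounded_closed)
        moreover have "?X \<noteq> {}" using False by blast
        \<comment> \<open>The last time outside the open ball exists by compactness; afterwards the
          competitor stays inside until its end.\<close>
        ultimately obtain \<sigma> where \<sigma>: "\<sigma> \<in> ?X" "\<forall>t\<in>?X. t \<le> \<sigma>" using compact_attains_sup[of ?X] by metis
        have "\<zeta> b \<in> ?O" using \<zeta>(4) xl0 by blast
        then have \<sigma>b: "a \<le> \<sigma>" "\<sigma> < b" using \<sigma>(1) by (auto simp: less_le)
        have after: "\<zeta> s \<in> ?K" if "s \<in> {\<sigma><..b}" for s
        proof -
          have "s \<notin> ?X" using \<sigma>(2) that by (meson greaterThanAtMost_iff not_le)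
          moreover have "s \<in> {a..b}" using that \<sigma>b(1) by simp
          ultimately have "\<zeta> s \<in> ?O" by (simp only: Int_iff vimage_eq Compl_iff) simp
          then show ?thesis using O_K by (rule rev_subsetD)
        qed
        \<comment> \<open>Compact sets of a Hausdorff space are closed; so by continuity
          \<open>\<zeta> \<sigma>\<close> itself lies over the closed ball and hence in the
          chart.\<close>
        have clK: "closed ?K"
        proof (rule compact_imp_closed, rule compact_continuous_image)
          show "continuous_on (cball x0 r) (cinv c)" by (rule continuous_on_subset[OF cinv_continuous[OF ch]]) (use U in blast)
        qed simp
        have "\<zeta> ` closure {\<sigma><..b} \<subseteq> ?K"
        proof (rule image_closure_subset[OF _ clK])
          show "continuous_on (closure {\<sigma><..b}) \<zeta>" by (rule continuous_on_subset[OF \<zeta>c]) (use \<sigma>b in auto)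
        qed (use after in blast)
        then have in_K': "\<zeta> s \<in> ?K" if "s \<in> {\<sigma>..b}" for s using that \<sigma>b by auto
        have in_c: "\<zeta> s \<in> fst c" "snd c (\<zeta> s) \<in> cball x0 r" if "s \<in> {\<sigma>..b}" for s
          using inK[OF in_K'[OF that]] by auto
        have \<sigma>in: "\<sigma> \<in> {\<sigma>..b}" using \<sigma>b by simp
        have far: "r \<le> dist x0 (snd c (\<zeta> \<sigma>))"
        proof (rule ccontr)
          assume "\<not> ?thesis"
          then have "snd c (\<zeta> \<sigma>) \<in> ball x0 r" by simp
          then have "cinv c (snd c (\<zeta> \<sigma>)) \<in> ?O" by (rule imageI)
          then show False using \<sigma>(1) cinv_chart[OF ch in_c(1)[OF \<sigma>in]] by simp
        qed
        have xK: "x t \<in> K" if "t \<in> {0..l0}" for t using xr[OF that] r(2) by auto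
        \<comment> \<open>With unit speed \<open>x\<close> moves by at most
          \<open>l0 / m \<le> r / 4\<close>, and it starts within \<open>r / 2\<close> of
          \<open>x0\<close>; its end point keeps the distance \<open>r / 4\<close> from the sphere
          of radius \<open>r\<close>.\<close>
        have "m * norm (x l0 - x 0) \<le> integral {0..l0} (\<lambda>t. in_chart A F c (x t, u t))"
          by (rule length_ge_distance[OF EL_piecewise_C1[OF EL I]]) (use xK l0(1) in auto)
        also have "\<dots> = integral {0..l0} (\<lambda>t. 1)" by (rule Henstock_Kurzweil_Integration.integral_cong) (simp add: unit)
        also have "\<dots> \<le> m * (r / 4)" using l0 by simp
        finally have "norm (x l0 - x 0) \<le> r / 4" using const_pos by (simp add: mult_le_cancel_left_pos)
        then have "dist x0 (x l0) \<le> 3 * r / 4"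
          using init(2) dist_triangle[of x0 "x l0" "x 0"] by (simp add: dist_norm norm_minus_commute)
        then have "r / 4 \<le> norm (x l0 - snd c (\<zeta> \<sigma>))"
          using far dist_triangle[of x0 "snd c (\<zeta> \<sigma>)" "x l0"] by (simp add: dist_norm)
        then have 1: "m * (r / 4) \<le> m * norm (snd c (\<zeta> b) - snd c (\<zeta> \<sigma>))"
          using const_pos \<zeta>b(2) by (intro mult_left_mono) auto
        from length_in_chart[OF \<zeta>(2) \<sigma>b c in_c(1)] obtain Q y' where
          Q: "piecewise_C1 Q \<sigma> b (\<lambda>t. snd c (\<zeta> t)) y'"
            "integral {\<sigma>..b} (\<lambda>t. in_chart A F c (snd c (\<zeta> t), y' t)) \<le> curve_length A F \<zeta> a b" by auto
        have "m * norm (snd c (\<zeta> b) - snd c (\<zeta> \<sigma>)) \<le> integral {\<sigma>..b} (\<lambda>t. in_chart A F c (snd c (\<zeta> t), y' t))"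
          by (rule length_ge_distance[OF Q(1)]) (use in_c(2) r(2) \<sigma>b in auto)
        then show ?thesis using 1 Q(2) l0(2) by simp
      qed
    qed
    then show "ereal l0 \<le> l" using \<zeta>(1) by simp
  qed
qed

end

section \<open>A length scale valid near a point of N\<close>

context finsler_manifold begin

text \<open>One \<open>\<epsilon>\<close> for both conclusions. The injectivity radius is read off
  from cut times, but the cut locus is defined by segments without extension, so extendability is
  recorded separately; \<open>a = b\<close> is included there.\<close>

definition short_segments_minimize :: "'m set \<Rightarrow> real \<Rightarrow> 'm \<Rightarrow> bool" where
  "short_segments_minimize N \<epsilon> p \<longleftrightarrow>
    (\<forall>v. (p, v) \<in> unit_normal_cone A F N \<longrightarrow> ereal \<epsilon> \<le> cut_time A F N (p, v)) \<and>
    (\<forall>\<gamma> a b. N_segment A F N \<gamma> a b \<longrightarrow> \<gamma> a = p \<longrightarrow> b - a < \<epsilon> \<longrightarrow>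
       (\<exists>\<gamma>' b'. b < b' \<and> (\<forall>t\<in>{a..b}. \<gamma>' t = \<gamma> t) \<and> N_segment A F N \<gamma>' a b'))"

text \<open>Base points \<open>p\<close> range over the coordinate ball of radius
  \<open>r / 2\<close>, and the flow is started at all their unit vectors at once, so that every
  constant is independent of \<open>p\<close>.\<close>

lemma short_segments_minimize_near:
  assumes c: "c \<in> charts" and p0: "p0 \<in> fst c"
    and N: "\<And>p. p \<in> fst c \<Longrightarrow> p \<in> N \<longleftrightarrow> snd c p \<in> S" "subspace S"
  shows "\<exists>V \<epsilon>. open V \<and> p0 \<in> V \<and> 0 < \<epsilon> \<and> (\<forall>p\<in>V \<inter> N. short_segments_minimize N \<epsilon> p)"
proof -
  note ch = is_chart[OF c]
  define x0 where "x0 = snd c p0"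
  have "x0 \<in> snd c ` fst c" using p0 by (simp add: x0_def)
  then obtain r0 where r0: "0 < r0" "cball x0 r0 \<subseteq> snd c ` fst c"
    using chart_image_open[OF ch] open_contains_cball by blast
  from local_finsler.estimates_exist[OF local_finsler_chart[OF c] compact_cball convex_cball r0(2)]
  obtain \<mu> C m where est: "finsler_estimates (snd c ` fst c) (in_chart A F c) (cball x0 r0) \<mu> C m" by (elim exE)
  interpret chart_estimates A F c "cball x0 r0" \<mu> C m
    by (intro chart_estimates.intro chart_estimates_axioms.intro finsler_manifold_axioms c est)
  \<comment> \<open>For \<open>\<rho> \<le> 1\<close> the quantity to be made small is at most
    \<open>3 * C * \<rho>\<close>; the additional 1 protects the denominator when \<open>C\<close>
    is zero.\<close>
  define \<rho> where "\<rho> = min 1 (\<mu> / (4 * (3 * C + 1)))"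
  have \<rho>: "0 < \<rho>" "\<rho> \<le> 1" using const_pos by (auto simp: \<rho>_def)
  have \<rho>_small: "2 * C * \<rho>\<^sup>2 + C * \<rho> \<le> \<mu> / 4"
  proof -
    have "\<rho>\<^sup>2 \<le> \<rho>" using \<rho> by (simp add: power2_eq_square mult_left_le)
    then have "2 * C * \<rho>\<^sup>2 \<le> 2 * C * \<rho>" using const_pos by (intro mult_left_mono) auto
    then have "2 * C * \<rho>\<^sup>2 + C * \<rho> \<le> \<rho> * (3 * C + 1)" using \<rho> by (simp add: algebra_simps)
    also have "\<dots> \<le> \<mu> / (4 * (3 * C + 1)) * (3 * C + 1)" using const_pos by (intro mult_right_mono) (auto simp: \<rho>_def)
    also have "\<dots> = \<mu> / 4" using const_pos by (simp add: field_simps)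
    finally show ?thesis .
  qed
  \<comment> \<open>\<open>2 * r \<le> \<rho>\<close> bounds distances between points of the ball,
    and \<open>r < r0\<close> keeps the ball in the interior of \<open>cball x0 r0\<close>.\<close>
  define r where "r = min (r0 / 2) (\<rho> / 2)"
  have r: "0 < r" "r < r0" "2 * r \<le> \<rho>" using r0 \<rho> by (auto simp: r_def)
  have rK: "cball x0 r \<subseteq> cball x0 r0" using r by auto
  have rint: "ball x0 r \<subseteq> interior (cball x0 r0)" using r by (auto simp: interior_cball)
  have rU: "ball x0 r \<subseteq> snd c ` fst c" using rint interior_K(2) by blast
  \<comment> \<open>Vectors with \<open>in_chart A F c\<close> equal to 1 have norm at most
    \<open>1 / m\<close>, so \<open>Z\<close> contains all unit vectors over the smaller
    ball.\<close>
  let ?A = "cball x0 (r / 2) \<times> cball (0::'e) (1 / m)"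
  define Z where "Z = ?A \<inter> in_chart A F c -` {1}"
  have hU: "cball x0 (r / 2) \<subseteq> ball x0 r" using r(1) by auto
  have cA: "continuous_on ?A (in_chart A F c)"
    by (rule continuous_on_subset[OF cont_f]) (use hU rU in blast)
  have compA: "compact ?A" by (intro compact_Times compact_cball)
  have "closed Z" unfolding Z_def
    by (rule continuous_closed_preimage[OF cA compact_imp_closed[OF compA] closed_singleton])
  moreover have "bounded Z" unfolding Z_def by (rule bounded_subset[OF compact_imp_bounded[OF compA]]) auto
  ultimately have Z: "compact Z" by (simp add: compact_eq_bounded_closed)
  have Z_sub: "Z \<subseteq> ball x0 r \<times> (UNIV - {0})"
  proof
    fix z assume "z \<in> Z"
    then have z: "fst z \<in> cball x0 (r / 2)" "in_chart A F c (fst z, snd z) = 1" by (auto simp: Z_def)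
    have b: "fst z \<in> ball x0 r" using z(1) hU by blast
    have "in_chart A F c (fst z, 0) = 0" by (rule f_zero) (use b rU in auto)
    then have "snd z \<noteq> 0" using z(2) by (cases z) auto
    then show "z \<in> ball x0 r \<times> (UNIV - {0})" using b by (simp add: mem_Times_iff)
  qed
  from geodesic_flow[OF open_ball rU Z Z_sub] obtain T where T: "0 < T"
    "\<forall>z\<in>Z. \<exists>x u. Cinf_on {-T<..<T} x \<and> Cinf_on {-T<..<T} u \<and> x 0 = fst z \<and> u 0 = snd z \<and>
      (\<forall>t\<in>{-T<..<T}. x t \<in> ball x0 r \<and> u t \<noteq> 0 \<and> (x has_vector_derivative u t) (at t) \<and>
      ((\<lambda>t. Lv (x t, u t)) has_vector_derivative Lx (x t, u t)) (at t) \<and> in_chart A F c (x t, u t) = in_chart A F c z)"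
    by (elim exE conjE)
  define C2 where "C2 = 2 * C + C\<^sup>2/\<mu>"
  have C2: "0 \<le> C2" using const_pos by (simp add: C2_def)
  \<comment> \<open>In this order: the flow exists beyond \<open>\<epsilon>\<close>; a competitor
    that leaves the ball is too long; \<open>\<epsilon>\<^sup>2 \<le> \<epsilon>\<close>; and the
    error of the comparison can be absorbed.\<close>
  define \<epsilon> where "\<epsilon> = min (min (T / 2) (m * r / 4)) (min 1 (\<mu> * m\<^sup>2 / (8 * C2 + 1)))"
  have den: "0 < 8 * C2 + 1" using C2 by simp
  have "\<epsilon> \<le> T / 2" and \<epsilon>_r: "\<epsilon> \<le> m * r / 4" and \<epsilon>_1: "\<epsilon> \<le> 1"
    unfolding \<epsilon>_def by (meson min.cobounded1 min.cobounded2 order_trans)+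
  then have \<epsilon>_T: "\<epsilon> < T" using T(1) by simp
  have "0 < \<epsilon>" using T(1) const_pos r(1) den by (auto simp: \<epsilon>_def)
  note \<epsilon> = this \<epsilon>_T \<epsilon>_r \<epsilon>_1
  have \<epsilon>_small: "8 * C2 * t\<^sup>2 \<le> \<mu> * m\<^sup>2" if t: "0 < t" "t \<le> \<epsilon>" for t
  proof -
    have "t\<^sup>2 \<le> \<epsilon>\<^sup>2" using t by (intro power_mono) auto
    also have "\<dots> \<le> \<epsilon>" using \<epsilon> by (simp add: power2_eq_square mult_left_le)
    finally have "8 * C2 * t\<^sup>2 \<le> 8 * C2 * \<epsilon>" using C2 by (intro mult_left_mono) auto
    also have "\<dots> \<le> \<epsilon> * (8 * C2 + 1)" using \<epsilon>(1) by (simp add: algebra_simps)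
    also have "\<dots> \<le> \<mu> * m\<^sup>2 / (8 * C2 + 1) * (8 * C2 + 1)" using den by (intro mult_right_mono) (auto simp: \<epsilon>_def)
    also have "\<dots> = \<mu> * m\<^sup>2" using den by simp
    finally show ?thesis .
  qed
  let ?I = "{-T<..<T}"
  have flow: "\<exists>x u. EL_curve ?I x u \<and> x 0 = snd c p \<and> u 0 = w \<and> (\<forall>t\<in>?I. in_chart A F c (x t, u t) = 1) \<and>
      (\<forall>t. 0 < t \<longrightarrow> t \<le> \<epsilon> \<longrightarrow> dist_from A F N (cinv c (x t)) = ereal t)"
    if p: "p \<in> fst c" "snd c p \<in> ball x0 (r / 2)" "p \<in> N" and w: "in_chart A F c (snd c p, w) = 1"
      and normal: "\<forall>z\<in>S. Lv (snd c p, w) \<bullet> z = 0" for p w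
  proof -
    have pK: "snd c p \<in> cball x0 r0" using p(2) r by simp
    have "m * norm w \<le> 1" using f_lower[OF pK, of w] w by simp
    then have "norm w \<le> 1 / m" using const_pos by (simp add: field_simps)
    then have "(snd c p, w) \<in> Z" using p(2) w by (simp add: Z_def)
    from bspec[OF T(2) this] obtain x u where xu: "Cinf_on ?I x" "Cinf_on ?I u" "x 0 = snd c p" "u 0 = w"
      "\<forall>t\<in>?I. x t \<in> ball x0 r \<and> u t \<noteq> 0 \<and> (x has_vector_derivative u t) (at t) \<and>
      ((\<lambda>t. Lv (x t, u t)) has_vector_derivative Lx (x t, u t)) (at t) \<and> in_chart A F c (x t, u t) = in_chart A F c (snd c p, w)"
      by (elim exE conjE) simp
    have EL: "EL_curve ?I x u"
      unfolding EL_curve_def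
    proof (intro conjI ballI)
      fix t assume t: "t \<in> ?I"
      show "x t \<in> interior (cball x0 r0)" using bspec[OF xu(5) t] rint by blast
      show "(x has_vector_derivative u t) (at t)"
        "((\<lambda>t. Lv (x t, u t)) has_vector_derivative Lx (x t, u t)) (at t)" using bspec[OF xu(5) t] by blast+
    qed (use xu in auto)
    have unit: "in_chart A F c (x t, u t) = 1" and xr: "x t \<in> ball x0 r" if "t \<in> ?I" for t
      using bspec[OF xu(5) that] w by auto
    have "dist_from A F N (cinv c (x t)) = ereal t" if t: "0 < t" "t \<le> \<epsilon>" for t
    proof (rule dist_from_short_geodesic[OF N r(1) rK \<rho>(1) r(3) \<rho>_small EL])
      show sub: "{0..t} \<subseteq> ?I" using t \<epsilon>(2) T(1) by auto
      show "x s \<in> ball x0 r" "in_chart A F c (x s, u s) = 1" if "s \<in> {0..t}" for s using xr unit sub that by blast+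
      show "x 0 \<in> S" using N(1)[OF p(1)] p(3) xu(3) by simp
      show "x 0 \<in> ball x0 (r / 2)" using p(2) xu(3) by simp
      show "Lv (x 0, u 0) \<bullet> z = 0" if "z \<in> S" for z using bspec[OF normal that] xu(3,4) by simp
      show "8 * (2 * C + C\<^sup>2 / \<mu>) * t\<^sup>2 \<le> \<mu> * m\<^sup>2" using \<epsilon>_small[OF t] by (simp add: C2_def)
    qed (use t \<epsilon> in auto)
    then show ?thesis using EL xu(3,4) unit by (intro exI[of _ x] exI[of _ u]) blast
  qed
  \<comment> \<open>The segment of full length \<open>\<epsilon>\<close>, started at time
    \<open>a\<close>; it will serve as the extension of shorter segments with the same initial
    velocity.\<close>
  have seg: "N_segment A F N (\<lambda>t. cinv c (x (t - a))) a (a + \<epsilon>)"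
    if EL: "EL_curve ?I x u" and x0: "x 0 \<in> S" and normal: "\<forall>z\<in>S. Lv (x 0, u 0) \<bullet> z = 0"
      and unit: "\<forall>t\<in>?I. in_chart A F c (x t, u t) = 1"
      and dist: "dist_from A F N (cinv c (x \<epsilon>)) = ereal \<epsilon>" for x u a
  proof -
    let ?J = "{t. t - a \<in> ?I}" and ?x = "\<lambda>t. x (t - a)" and ?u = "\<lambda>t. u (t - a)"
    have EL': "EL_curve ?J ?x ?u" using EL_scale[OF EL zero_less_one, of a] by simp
    have sub: "{a..a + \<epsilon>} \<subseteq> ?J" using \<epsilon> T(1) by auto
    have ab: "a < a + \<epsilon>" using \<epsilon> by simp
    have unit': "in_chart A F c (?x t, ?u t) = 1" if "t \<in> {a..a + \<epsilon>}" for t using unit sub that by blast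
    have "N_geodesic A F N (\<lambda>t. cinv c (?x t)) a (a + \<epsilon>)"
      by (rule EL_N_geodesic[OF EL' ab sub N]) (use x0 normal in auto)
    moreover have "\<forall>t\<in>{a..a + \<epsilon>}. \<exists>v. has_velocity A (\<lambda>t. cinv c (?x t)) {a..a + \<epsilon>} t v \<and> F (cinv c (?x t)) v = 1"
    proof
      fix t assume t: "t \<in> {a..a + \<epsilon>}"
      show "\<exists>v. has_velocity A (\<lambda>t. cinv c (?x t)) {a..a + \<epsilon>} t v \<and> F (cinv c (?x t)) v = 1"
        using EL_velocity(1,2)[OF EL' sub t] unit'[OF t] by (intro exI[of _ "\<tau> c (?x t) (?u t)"]) simp
    qed
    moreover have "curve_length A F (\<lambda>t. cinv c (?x t)) a (a + \<epsilon>) = a + \<epsilon> - a" by (rule EL_length[OF EL' ab sub unit'])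
    ultimately show ?thesis using dist by (simp add: N_segment_def unit_speed_N_geodesic_def)
  qed
  define V where "V = cinv c ` ball x0 (r / 2)"
  have half: "ball x0 (r / 2) \<subseteq> snd c ` fst c" using rU hU ball_subset_cball by blast
  have V: "open V" "p0 \<in> V"
  proof -
    show "open V" unfolding V_def by (rule cinv_open_image[OF ch open_ball half])
    have "x0 \<in> ball x0 (r / 2)" using r(1) by simp
    then show "p0 \<in> V" unfolding V_def using cinv_chart[OF ch p0] by (metis imageI x0_def)
  qed
  have "short_segments_minimize N \<epsilon> p" if p: "p \<in> V \<inter> N" for p
  proof -
    obtain z where z: "z \<in> ball x0 (r / 2)" "p = cinv c z" using p unfolding V_def by blast
    have zU: "z \<in> snd c ` fst c" using z(1) half by blast
    have pc: "p \<in> fst c" "snd c p \<in> ball x0 (r / 2)" "p \<in> N"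
      using z cinv_in[OF ch zU] chart_cinv[OF ch zU] p by auto
    have pS: "snd c p \<in> S" using N(1) pc by blast
    have pint: "snd c p \<in> interior (cball x0 r0)" using pc(2) hU rint ball_subset_cball by blast
    have "ereal \<epsilon> \<le> cut_time A F N (p, v)" if v: "(p, v) \<in> unit_normal_cone A F N" for v
    proof -
      have "\<exists>u. v = \<tau> c (snd c p) u \<and> in_chart A F c (snd c p, u) = 1 \<and> (\<forall>w\<in>S. Lv (snd c p, u) \<bullet> w = 0)"
        by (rule unit_normal_coordinates[OF pc(1) N v])
      then obtain w where
        w: "v = \<tau> c (snd c p) w" "in_chart A F c (snd c p, w) = 1" "\<forall>z\<in>S. Lv (snd c p, w) \<bullet> z = 0" by (elim exE conjE)
      from flow[OF pc w(2,3)] obtain x u where x: "EL_curve ?I x u" "x 0 = snd c p" "u 0 = w"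
        "\<forall>t. 0 < t \<longrightarrow> t \<le> \<epsilon> \<longrightarrow> dist_from A F N (cinv c (x t)) = ereal t" by (elim exE conjE)
      have sub: "{0..\<epsilon>} \<subseteq> ?I" using \<epsilon> T(1) by auto
      have e: "cinv c (x 0) = p" "\<tau> c (x 0) (u 0) = v" using x w cinv_chart[OF ch pc(1)] by auto
      note ex = exp_map_EL[OF x(1) \<epsilon>(1) sub, unfolded e]
      show ?thesis
        unfolding cut_time_def using ex x(4) \<epsilon>(1) by (auto intro!: Sup_upper exI[of _ \<epsilon>])
    qed
    moreover have "\<exists>\<gamma>' b'. b < b' \<and> (\<forall>t\<in>{a..b}. \<gamma>' t = \<gamma> t) \<and> N_segment A F N \<gamma>' a b'"
      if s: "N_segment A F N \<gamma> a b" "\<gamma> a = p" "b - a < \<epsilon>" for \<gamma> a b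
    proof -
      \<comment> \<open>A degenerate segment comes with some unit normal vector, and any such vector
        can start an extension. A proper segment has its own initial velocity, which criticality
        makes normal and which its unit speed normalizes.\<close>
      have "\<exists>w. in_chart A F c (snd c p, w) = 1 \<and> (\<forall>z\<in>S. Lv (snd c p, w) \<bullet> z = 0) \<and>
         (a < b \<and> geodesic A F \<gamma> a b \<and> ((\<lambda>t. snd c (\<gamma> t)) has_vector_derivative w) (at a within {a..b}) \<or> a = b)"
      proof (cases "a = b")
        case True
        then obtain v where "(p, v) \<in> unit_normal_cone A F N"
          using s(1,2) unfolding N_segment_def unit_speed_N_geodesic_def N_geodesic_def by blast
        from unit_normal_coordinates[OF pc(1) N this] show ?thesis using True by blast
      next
        case False
        then have geo: "N_geodesic A F N \<gamma> a b" and us: "\<forall>t\<in>{a..b}. \<exists>v. has_velocity A \<gamma> {a..b} t v \<and> F (\<gamma> t) v = 1"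
          using s(1) unfolding N_segment_def unit_speed_N_geodesic_def by blast+
        have ab: "a < b" using geo by (simp add: N_geodesic_def)
        have \<gamma>a: "\<gamma> a \<in> fst c" "snd c (\<gamma> a) \<in> interior (cball x0 r0)" using s(2) pc(1) pint by auto
        have "\<exists>v. ((\<lambda>t. snd c (\<gamma> t)) has_vector_derivative v) (at a within {a..b}) \<and> (\<forall>w\<in>S. Lv (snd c (\<gamma> a), v) \<bullet> w = 0)"
          by (rule N_geodesic_normal[OF geo N \<gamma>a])
        then obtain w where
          w: "((\<lambda>t. snd c (\<gamma> t)) has_vector_derivative w) (at a within {a..b})" "\<forall>z\<in>S. Lv (snd c (\<gamma> a), w) \<bullet> z = 0"
          by (elim exE conjE)
        have ain: "a \<in> {a..b}" using ab by simp
        obtain v where v: "has_velocity A \<gamma> {a..b} a v" "F (\<gamma> a) v = 1" using us ain by blast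
        obtain P where P: "smooth_pieces P a b \<gamma>" using geo piecewise_smooth_iff unfolding N_geodesic_def by blast
        have ct: "continuous (at a within {a..b}) \<gamma>"
          using smooth_pieces_continuous[OF P ab] ain by (simp add: continuous_on_eq_continuous_within)
        have nb: "at a within {a..b} \<noteq> bot" using ab by (simp add: trivial_limit_within islimpt_Icc)
        have "v = \<tau> c (snd c (\<gamma> a)) w" by (rule has_velocity_chart_unique[OF c \<gamma>a(1) ct ain nb w(1) v(1)])
        then have "in_chart A F c (snd c p, w) = 1" using v(2) F_in_chart[OF c \<gamma>a(1), of w] s(2) by simp
        moreover have "geodesic A F \<gamma> a b"
          unfolding geodesic_def
        proof (intro conjI allI impI)
          show "a < b" "piecewise_smooth A \<gamma> a b" using geo by (auto simp: N_geodesic_def)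
          fix e \<Gamma> assume h: "variation A \<gamma> a b e \<Gamma> \<and> (\<forall>s\<in>{-e<..<e}. \<Gamma> (s, a) = \<gamma> a \<and> \<Gamma> (s, b) = \<gamma> b)"
          then have "\<forall>s\<in>{-e<..<e}. \<Gamma> (s, a) \<in> N \<and> \<Gamma> (s, b) = \<gamma> b" using pc(3) s(2) by simp
          then show "((\<lambda>s. energy A F (\<lambda>t. \<Gamma> (s, t)) a b) has_real_derivative 0) (at 0)"
            using geo h unfolding N_geodesic_def by blast
        qed
        ultimately show ?thesis using w s(2) ab by (intro exI[of _ w]) simp
      qed
      then obtain w where w: "in_chart A F c (snd c p, w) = 1" "\<forall>z\<in>S. Lv (snd c p, w) \<bullet> z = 0"
        "a < b \<and> geodesic A F \<gamma> a b \<and> ((\<lambda>t. snd c (\<gamma> t)) has_vector_derivative w) (at a within {a..b}) \<or> a = b"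
        by (elim exE conjE)
      from flow[OF pc w(1,2)] obtain x u where x: "EL_curve ?I x u" "x 0 = snd c p" "u 0 = w" "\<forall>t\<in>?I. in_chart A F c (x t, u t) = 1"
        "\<forall>t. 0 < t \<longrightarrow> t \<le> \<epsilon> \<longrightarrow> dist_from A F N (cinv c (x t)) = ereal t" by (elim exE conjE)
      have x0: "cinv c (x 0) = p" using x(2) cinv_chart[OF ch pc(1)] by simp
      have "N_segment A F N (\<lambda>t. cinv c (x (t - a))) a (a + \<epsilon>)"
        by (rule seg[OF x(1) _ _ x(4)]) (use x pS w \<epsilon>(1) in auto)
      moreover have "cinv c (x (t - a)) = \<gamma> t" if t: "t \<in> {a..b}" for t
        using w(3)
      proof
        assume "a = b"
        then show ?thesis using t s(2) x0 by simp
      next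
        assume h: "a < b \<and> geodesic A F \<gamma> a b \<and> ((\<lambda>t. snd c (\<gamma> t)) has_vector_derivative w) (at a within {a..b})"
        have EL': "EL_curve {t. t - a \<in> ?I} (\<lambda>t. x (t - a)) (\<lambda>t. u (t - a))"
          using EL_scale[OF x(1) zero_less_one, of a] by simp
        have sub: "{a..b} \<subseteq> {t. t - a \<in> ?I}" using s(3) \<epsilon> T(1) by auto
        have "\<forall>t\<in>{a..b}. \<gamma> t = cinv c (x (t - a))"
          by (rule geodesic_unique[OF EL' _ sub]) (use h s(2) x0 x(3) in auto)
        then show ?thesis using t by simp
      qed
      ultimately show ?thesis using s(3)
        by (intro exI[of _ "\<lambda>t. cinv c (x (t - a))"] exI[of _ "a + \<epsilon>"] conjI ballI) auto
    qed
    ultimately show ?thesis unfolding short_segments_minimize_def by blast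
  qed
  then show ?thesis using V \<epsilon>(1) by blast
qed

end

theorem corollary3p13:
  fixes A :: "('m::{t2_space, second_countable_topology}, 'e::euclidean_space) chart set"
    and F :: "'m \<Rightarrow> 'e \<Rightarrow> real"
    and N :: "'m set"
  assumes "smooth_manifold A"
    and "finsler_metric A F"
    and "compact_submanifold A N"
  shows "0 < forward_inj_radius A F N \<and> 0 < dist_from_set A F N (cut_locus A F N)"
proof -
  interpret finsler_manifold A F
    using assms(1,2) by unfold_locales (simp_all add: smooth_manifold_def)
  have "\<exists>\<epsilon>>0. \<forall>p\<in>N. short_segments_minimize N \<epsilon> p"
  proof (rule compact_uniform_pos)
    show "compact N" using assms(3) by (simp add: compact_submanifold_def)
    fix p0 assume p0: "p0 \<in> N"
    obtain k where k: "\<forall>p\<in>N. \<exists>c\<in>maximal_atlas A. \<exists>S. subspace S \<and> dim S = k \<and> p \<in> fst c \<and>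
        snd c ` (fst c \<inter> N) = snd c ` fst c \<inter> S"
      using assms(3) unfolding compact_submanifold_def by (elim exE conjE)
    from bspec[OF k p0] obtain c S where c: "c \<in> maximal_atlas A" "subspace S" "p0 \<in> fst c"
      "snd c ` (fst c \<inter> N) = snd c ` fst c \<inter> S" by (elim bexE exE conjE)
    \<comment> \<open>The chart condition concerns images; injectivity of the chart turns it into a
      criterion for points.\<close>
    have flat: "p \<in> N \<longleftrightarrow> snd c p \<in> S" if p: "p \<in> fst c" for p
    proof
      assume "p \<in> N"
      then have "snd c p \<in> snd c ` (fst c \<inter> N)" using p by blast
      then show "snd c p \<in> S" unfolding c(4) by blast
    next
      assume "snd c p \<in> S"
      then have "snd c p \<in> snd c ` (fst c \<inter> N)" unfolding c(4) using p by blast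
      then obtain q where "q \<in> fst c" "q \<in> N" "snd c p = snd c q" by blast
      then show "p \<in> N" using chart_inj[OF is_chart[OF c(1)] p] by blast
    qed
    show "\<exists>V \<epsilon>. open V \<and> p0 \<in> V \<and> 0 < \<epsilon> \<and> (\<forall>p\<in>V \<inter> N. short_segments_minimize N \<epsilon> p)"
      by (rule short_segments_minimize_near[OF c(1,3) flat c(2)])
  next
    fix \<epsilon> \<epsilon>' p assume h: "short_segments_minimize N \<epsilon> p" "0 < \<epsilon>'" "\<epsilon>' \<le> \<epsilon>"
    have "ereal \<epsilon>' \<le> ereal \<epsilon>" using h(3) by simp
    then show "short_segments_minimize N \<epsilon>' p"
      unfolding short_segments_minimize_def
    proof (intro conjI allI impI)
      fix v assume "(p, v) \<in> unit_normal_cone A F N"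
      then have "ereal \<epsilon> \<le> cut_time A F N (p, v)"
        using h(1) unfolding short_segments_minimize_def by (elim conjE) (drule spec, erule (1) mp)
      then show "ereal \<epsilon>' \<le> cut_time A F N (p, v)" using \<open>ereal \<epsilon>' \<le> ereal \<epsilon>\<close> by (rule order_trans[rotated])
    next
      fix \<gamma> :: "real \<Rightarrow> 'm" and a b :: real
      assume seg: "N_segment A F N \<gamma> a b" "\<gamma> a = p" "b - a < \<epsilon>'"
      have "b - a < \<epsilon>" using seg(3) h(3) by simp
      with h(1) seg(1,2) show "\<exists>\<gamma>' b'. b < b' \<and> (\<forall>t\<in>{a..b}. \<gamma>' t = \<gamma> t) \<and> N_segment A F N \<gamma>' a b'"
        unfolding short_segments_minimize_def by simp
    qed
  qed
  then obtain \<epsilon> where \<epsilon>: "0 < \<epsilon>" "\<forall>p\<in>N. short_segments_minimize N \<epsilon> p" by (elim exE conjE)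
  have \<epsilon>0: "0 < ereal \<epsilon>" using \<epsilon>(1) by simp
  have "ereal \<epsilon> \<le> cut_time A F N z" if z: "z \<in> unit_normal_cone A F N" for z
  proof -
    obtain p v where pv: "z = (p, v)" by (cases z)
    then have "p \<in> N" using z by (simp add: unit_normal_cone_def normal_cone_def)
    from bspec[OF \<epsilon>(2) this] show ?thesis using z pv unfolding short_segments_minimize_def by blast
  qed
  \<comment> \<open>\<open>INF_greatest\<close> also covers an empty unit normal cone, as for
    \<open>N\<close> the whole manifold; likewise an empty cut locus below.\<close>
  then have "ereal \<epsilon> \<le> forward_inj_radius A F N"
    unfolding forward_inj_radius_def by (rule INF_greatest)
  moreover have "ereal \<epsilon> \<le> dist_from A F N q" if q: "q \<in> cut_locus A F N" for q
  proof -
    obtain \<gamma> a b where s: "N_segment A F N \<gamma> a b" "\<gamma> b = q"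
      "\<forall>\<gamma>' a' b'. {a..b} \<subset> {a'..b'} \<and> (\<forall>t\<in>{a..b}. \<gamma>' t = \<gamma> t) \<longrightarrow> \<not> N_segment A F N \<gamma>' a' b'"
      using q unfolding cut_locus_def mem_Collect_eq by (elim exE conjE)
    have "\<gamma> a \<in> N \<and> a \<le> b"
      using s(1) by (auto simp: N_segment_def unit_speed_N_geodesic_def N_geodesic_def unit_normal_cone_def normal_cone_def)
    then have aN: "\<gamma> a \<in> N" and ab: "a \<le> b" by auto
    \<comment> \<open>A shorter segment would extend beyond \<open>b\<close> with the same starting
      time, against the choice of \<open>\<gamma>\<close>; and the length of the segment is the
      distance of \<open>q\<close>.\<close>
    have "\<epsilon> \<le> b - a"
    proof (rule ccontr)
      assume "\<not> \<epsilon> \<le> b - a"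
      then have "b - a < \<epsilon>" by simp
      then obtain \<gamma>' b' where e: "b < b'" "\<forall>t\<in>{a..b}. \<gamma>' t = \<gamma> t" "N_segment A F N \<gamma>' a b'"
        using bspec[OF \<epsilon>(2) aN] s(1) unfolding short_segments_minimize_def by blast
      have "b' \<in> {a..b'}" "b' \<notin> {a..b}" "{a..b} \<subseteq> {a..b'}" using e(1) ab by auto
      then have "{a..b} \<subset> {a..b'}" by blast
      then show False using s(3) e(2,3) by blast
    qed
    moreover have "dist_from A F N q = ereal (b - a)" using s(1,2) by (simp add: N_segment_def)
    ultimately show ?thesis by simp
  qed
  then have "ereal \<epsilon> \<le> dist_from_set A F N (cut_locus A F N)"
    unfolding dist_from_set_def by (rule INF_greatest)
  ultimately show ?thesis using \<epsilon>0 less_le_trans by blast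
qed

end
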